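(* Let $G$ be a group with neutral element $e$, let $(\{\alpha_g\}_{g\in G},\{D_g\}_{g\in G})$ be a partial action of $G$ on a nonzero $s$-unital ring $R$, and let $R\star_\alpha G$ be the associated $s$-unital partial skew group ring. Then $R\star_\alpha G$ is not prime if and only if there are: (i) subgroups $N\lhd H\subseteq G$ with $N$ finite, (ii) an ideal $I$ of $R$ such that $\alpha_h(ID_{h^{-1}})=ID_h$ for every $h\in H$, and $ID_g\cdot\alpha_g(ID_{g^{-1}})=\{0\}$ for every $g\in G\setminus H$, and (iii) nonzero ideals $\tilde A,\tilde B$ of $R\star_\alpha N$ such that $\tilde A,\tilde B\subseteq I\delta_e(R\star_\alpha N)$ and $\tilde A\cdot D_h\delta_h\cdot\tilde B=\{0\}$ for every $h\in H$.
   Context: Rings are associative but not necessarily unital; ideals are two-sided. For subsets $U,V$ of a ring, $UV$ denotes the set of finite sums of elements $uv$ with $u\in U$, $v\in V$. A ring $R$ is $s$-unital if $r\in rR\cap Rr$ for every $r\in R$. A ring $T$ is prime if $\{0\}$ is a proper ideal and for all ideals $A,B$ of $T$, $AB=\{0\}$ implies $A=\{0\}$ or $B=\{0\}$. A partial action of a group $G$ on an $s$-unital ring $R$ is a pair $(\{\alpha_g\}_{g\in G},\{D_g\}_{g\in G})$ where for each $g\in G$, $D_g$ is a (possibly zero) $s$-unital ideal of $R$ and $\alpha_g:D_{g^{-1}}\to D_g$ is a ring isomorphism, such that for all $g,h\in G$: (P1) $\alpha_e=\mathrm{id}_R$ (so $D_e=R$); (P2) $\alpha_g(D_{g^{-1}}D_h)=D_gD_{gh}$;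 (P3) if $r\in D_{h^{-1}}D_{(gh)^{-1}}$, then $\alpha_g(\alpha_h(r))=\alpha_{gh}(r)$. The $s$-unital partial skew group ring is $R\star_\alpha G:=\bigoplus_{g\in G}D_g\delta_g$, where the $\delta_g$ are formal symbols, with multiplication determined by $(r\delta_g)(r'\delta_h)=\alpha_g(\alpha_{g^{-1}}(r)r')\delta_{gh}$ for $r\in D_g$, $r'\in D_h$; it is an associative ring. For a subgroup $N$ of $G$, $R\star_\alpha N=\bigoplus_{n\in N}D_n\delta_n$, a subring of $R\star_\alpha G$. *)

theory Defs
  imports "HOL-Algebra.Ideal_Product"
begin

text \<open>
  Associative, not necessarily unital rings are represented by the ring records of the library,
  whose field \<^term>\<open>one\<close> is ignored throughout.  The library locales \<^locale>\<open>ring\<close> and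
  \<^locale>\<open>ideal\<close> require a unit, hence the non-unital variants below.

  The set \<open>UV\<close> of finite sums of products is \<^const>\<open>ideal_prod\<close> of the library, written
  \<open>U \<cdot>\<^bsub>T\<^esub> V\<close>: it consists of the non-empty finite sums of elements \<open>uv\<close>.  The empty sum makes no
  difference here, as it is used for sets containing zero only.
\<close>

locale nonunital_ring = abelian_group R for R (structure) +
  assumes m_closed: "\<lbrakk>x \<in> carrier R; y \<in> carrier R\<rbrakk> \<Longrightarrow> x \<otimes> y \<in> carrier R"
    and m_assoc: "\<lbrakk>x \<in> carrier R; y \<in> carrier R; z \<in> carrier R\<rbrakk>
      \<Longrightarrow> (x \<otimes> y) \<otimes> z = x \<otimes> (y \<otimes> z)"
    and l_distr: "\<lbrakk>x \<in> carrier R; y \<in> carrier R; z \<in> carrier R\<rbrakk>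
      \<Longrightarrow> (x \<oplus> y) \<otimes> z = x \<otimes> z \<oplus> y \<otimes> z"
    and r_distr: "\<lbrakk>x \<in> carrier R; y \<in> carrier R; z \<in> carrier R\<rbrakk>
      \<Longrightarrow> z \<otimes> (x \<oplus> y) = z \<otimes> x \<oplus> z \<otimes> y"

definition rng_ideal :: "'a set \<Rightarrow> ('a, 'm) ring_scheme \<Rightarrow> bool" where
  "rng_ideal I R \<longleftrightarrow> additive_subgroup I R \<and>
     (\<forall>a\<in>I. \<forall>x\<in>carrier R. x \<otimes>\<^bsub>R\<^esub> a \<in> I \<and> a \<otimes>\<^bsub>R\<^esub> x \<in> I)"

definition s_unital :: "('a, 'm) ring_scheme \<Rightarrow> bool" where
  "s_unital R \<longleftrightarrow> (\<forall>r\<in>carrier R.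
     (\<exists>x\<in>carrier R. r = r \<otimes>\<^bsub>R\<^esub> x) \<and> (\<exists>x\<in>carrier R. r = x \<otimes>\<^bsub>R\<^esub> r))"

definition prime_rng :: "('a, 'm) ring_scheme \<Rightarrow> bool" where
  "prime_rng T \<longleftrightarrow> {\<zero>\<^bsub>T\<^esub>} \<noteq> carrier T \<and>
     (\<forall>A B. rng_ideal A T \<longrightarrow> rng_ideal B T \<longrightarrow>
        A \<cdot>\<^bsub>T\<^esub> B = {\<zero>\<^bsub>T\<^esub>} \<longrightarrow> A = {\<zero>\<^bsub>T\<^esub>} \<or> B = {\<zero>\<^bsub>T\<^esub>})"

definition rng_iso :: "('a, 'm) ring_scheme \<Rightarrow> ('b, 'n) ring_scheme \<Rightarrow> ('a \<Rightarrow> 'b) set" where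
  "rng_iso R S = hom R S \<inter> iso (add_monoid R) (add_monoid S)"

text \<open>
  The values of \<open>\<alpha> g\<close> outside \<open>D (inv g)\<close> are irrelevant.
\<close>

locale partial_action = group G + R: nonunital_ring R
  for G (structure) and R (structure) +
  fixes \<alpha> :: "'a \<Rightarrow> 'c \<Rightarrow> 'c" and D :: "'a \<Rightarrow> 'c set"
  assumes s_unital: "s_unital R"
    and D_ideal: "g \<in> carrier G \<Longrightarrow> rng_ideal (D g) R"
    and D_s_unital: "g \<in> carrier G \<Longrightarrow> s_unital (R\<lparr>carrier := D g\<rparr>)"
    and \<alpha>_iso: "g \<in> carrier G \<Longrightarrow>
      \<alpha> g \<in> rng_iso (R\<lparr>carrier := D (inv\<^bsub>G\<^esub> g)\<rparr>) (R\<lparr>carrier := D g\<rparr>)"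
    and D_one: "D \<one>\<^bsub>G\<^esub> = carrier R"
    and \<alpha>_one: "r \<in> carrier R \<Longrightarrow> \<alpha> \<one>\<^bsub>G\<^esub> r = r"
    and \<alpha>_image: "\<lbrakk>g \<in> carrier G; h \<in> carrier G\<rbrakk> \<Longrightarrow>
      \<alpha> g ` (D (inv\<^bsub>G\<^esub> g) \<cdot>\<^bsub>R\<^esub> D h) = D g \<cdot>\<^bsub>R\<^esub> D (g \<otimes>\<^bsub>G\<^esub> h)"
    and \<alpha>_comp: "\<lbrakk>g \<in> carrier G; h \<in> carrier G;
      r \<in> D (inv\<^bsub>G\<^esub> h) \<cdot>\<^bsub>R\<^esub> D (inv\<^bsub>G\<^esub> (g \<otimes>\<^bsub>G\<^esub> h))\<rbrakk> \<Longrightarrow>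
      \<alpha> g (\<alpha> h r) = \<alpha> (g \<otimes>\<^bsub>G\<^esub> h) r"

text \<open>
  The formal sum of the \<open>f g \<delta>\<^sub>g\<close> is represented by its coefficient function \<open>f\<close>, set to
  zero outside \<^term>\<open>carrier G\<close>.  The product is the biadditive extension of
  \<open>(r \<delta>\<^sub>g) (s \<delta>\<^sub>h) = \<alpha> g (\<alpha> (inv g) r \<otimes> s) \<delta>\<^sub>g\<^sub>h\<close>, see lemma \<open>delta_mult\<close> below: the coefficient at
  \<open>x\<close> collects the pairs \<open>(g, h)\<close> with \<open>h = g\<^sup>-\<^sup>1 x\<close>.
\<close>

definition partial_skew_group_ring ::
  "('g, 'k) monoid_scheme \<Rightarrow> ('r, 'm) ring_scheme \<Rightarrow> ('g \<Rightarrow> 'r \<Rightarrow> 'r) \<Rightarrow> ('g \<Rightarrow> 'r set)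
    \<Rightarrow> ('g \<Rightarrow> 'r) ring" where
  "partial_skew_group_ring G R \<alpha> D =
    \<lparr>carrier = {f. (\<forall>g\<in>carrier G. f g \<in> D g) \<and> (\<forall>g. g \<notin> carrier G \<longrightarrow> f g = \<zero>\<^bsub>R\<^esub>) \<and>
        finite {g \<in> carrier G. f g \<noteq> \<zero>\<^bsub>R\<^esub>}},
     mult = (\<lambda>f k x. if x \<in> carrier G
        then \<Oplus>\<^bsub>R\<^esub> g \<in> {g \<in> carrier G. f g \<noteq> \<zero>\<^bsub>R\<^esub>}.
          \<alpha> g (\<alpha> (inv\<^bsub>G\<^esub> g) (f g) \<otimes>\<^bsub>R\<^esub> k (inv\<^bsub>G\<^esub> g \<otimes>\<^bsub>G\<^esub> x))
        else \<zero>\<^bsub>R\<^esub>),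
     one = undefined,
     zero = (\<lambda>x. \<zero>\<^bsub>R\<^esub>),
     add = (\<lambda>f k x. f x \<oplus>\<^bsub>R\<^esub> k x)\<rparr>"

definition partial_skew_subring ::
  "('g, 'k) monoid_scheme \<Rightarrow> ('r, 'm) ring_scheme \<Rightarrow> ('g \<Rightarrow> 'r \<Rightarrow> 'r) \<Rightarrow> ('g \<Rightarrow> 'r set)
    \<Rightarrow> 'g set \<Rightarrow> ('g \<Rightarrow> 'r) ring" where
  "partial_skew_subring G R \<alpha> D N = (partial_skew_group_ring G R \<alpha> D)
    \<lparr>carrier := {f \<in> carrier (partial_skew_group_ring G R \<alpha> D). \<forall>g. g \<notin> N \<longrightarrow> f g = \<zero>\<^bsub>R\<^esub>}\<rparr>"

definition delta :: "('r, 'm) ring_scheme \<Rightarrow> 'r \<Rightarrow> 'g \<Rightarrow> 'g \<Rightarrow> 'r" where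
  "delta R r g = (\<lambda>x. if x = g then r else \<zero>\<^bsub>R\<^esub>)"

definition delta_set :: "('r, 'm) ring_scheme \<Rightarrow> 'r set \<Rightarrow> 'g \<Rightarrow> ('g \<Rightarrow> 'r) set" where
  "delta_set R U g = (\<lambda>r. delta R r g) ` U"

context partial_action
begin

lemma D_subset: "g \<in> carrier G \<Longrightarrow> D g \<subseteq> carrier R"
  using D_ideal[of g] additive_subgroup.a_subset[of "D g" R] by (simp add: rng_ideal_def)

lemma D_zero: "g \<in> carrier G \<Longrightarrow> \<zero>\<^bsub>R\<^esub> \<in> D g"
  using D_ideal[of g] additive_subgroup.zero_closed[of "D g" R] by (simp add: rng_ideal_def)

lemma \<alpha>_closed: "\<lbrakk>g \<in> carrier G; r \<in> D (inv g)\<rbrakk> \<Longrightarrow> \<alpha> g r \<in> D g"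
  using \<alpha>_iso[of g] by (auto simp: rng_iso_def hom_def)

lemma \<alpha>_zero:
  assumes "g \<in> carrier G"
  shows "\<alpha> g \<zero>\<^bsub>R\<^esub> = \<zero>\<^bsub>R\<^esub>"
proof -
  have z: "\<zero>\<^bsub>R\<^esub> \<in> D (inv g)" using D_zero assms by simp
  have "\<alpha> g (\<zero>\<^bsub>R\<^esub> \<oplus>\<^bsub>R\<^esub> \<zero>\<^bsub>R\<^esub>) = \<alpha> g \<zero>\<^bsub>R\<^esub> \<oplus>\<^bsub>R\<^esub> \<alpha> g \<zero>\<^bsub>R\<^esub>"
    using \<alpha>_iso[OF assms] z by (simp add: rng_iso_def iso_def hom_def del: R.r_zero R.l_zero)
  moreover have "\<alpha> g \<zero>\<^bsub>R\<^esub> \<in> carrier R"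
    using \<alpha>_closed[OF assms z] D_subset[OF assms] by blast
  ultimately show ?thesis by simp
qed

lemma R_zero_mult:
  assumes "r \<in> carrier R"
  shows "\<zero>\<^bsub>R\<^esub> \<otimes>\<^bsub>R\<^esub> r = \<zero>\<^bsub>R\<^esub>" and "r \<otimes>\<^bsub>R\<^esub> \<zero>\<^bsub>R\<^esub> = \<zero>\<^bsub>R\<^esub>"
  using R.l_distr[of "\<zero>\<^bsub>R\<^esub>" "\<zero>\<^bsub>R\<^esub>" r] R.r_distr[of "\<zero>\<^bsub>R\<^esub>" "\<zero>\<^bsub>R\<^esub>" r]
    R.m_closed[of "\<zero>\<^bsub>R\<^esub>" r] R.m_closed[of r "\<zero>\<^bsub>R\<^esub>"] assms
  by simp_all

lemma delta_mult:
  assumes g: "g \<in> carrier G" and h: "h \<in> carrier G" and r: "r \<in> D g" and s: "s \<in> D h"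
  shows "delta R r g \<otimes>\<^bsub>partial_skew_group_ring G R \<alpha> D\<^esub> delta R s h
    = delta R (\<alpha> g (\<alpha> (inv g) r \<otimes>\<^bsub>R\<^esub> s)) (g \<otimes> h)"
proof
  fix x
  have ar: "\<alpha> (inv g) r \<in> D (inv g)"
    using \<alpha>_closed[of "inv g" r] g r by simp
  then have arR: "\<alpha> (inv g) r \<in> carrier R" using D_subset[of "inv g"] g by auto
  have sR: "s \<in> carrier R" using s D_subset[OF h] by auto
  have p: "\<alpha> (inv g) r \<otimes>\<^bsub>R\<^esub> s \<in> D (inv g)"
    using D_ideal[of "inv g"] g ar sR by (auto simp: rng_ideal_def)
  have pR: "\<alpha> g (\<alpha> (inv g) r \<otimes>\<^bsub>R\<^esub> s) \<in> carrier R"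
    using \<alpha>_closed[OF g p] D_subset[OF g] by auto
  have eq: "inv g \<otimes> x = h \<longleftrightarrow> x = g \<otimes> h" if "x \<in> carrier G"
    using that g h by (metis inv_solve_left)
  show "(delta R r g \<otimes>\<^bsub>partial_skew_group_ring G R \<alpha> D\<^esub> delta R s h) x
    = delta R (\<alpha> g (\<alpha> (inv g) r \<otimes>\<^bsub>R\<^esub> s)) (g \<otimes> h) x"
  proof (cases "x \<in> carrier G")
    case False
    then show ?thesis
      using g h by (auto simp: partial_skew_group_ring_def delta_def)
  next
    case x: True
    show ?thesis
    proof (cases "r = \<zero>\<^bsub>R\<^esub>")
      case True
      have "{k \<in> carrier G. delta R r g k \<noteq> \<zero>\<^bsub>R\<^esub>} = {}"
        using True by (auto simp: delta_def)
      then show ?thesis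
        using x True g h sR
        by (simp add: partial_skew_group_ring_def) (simp add: delta_def \<alpha>_zero R_zero_mult)
    next
      case False
      have S: "{k \<in> carrier G. delta R r g k \<noteq> \<zero>\<^bsub>R\<^esub>} = {g}"
        using False g by (auto simp: delta_def)
      have t: "\<alpha> g (\<alpha> (inv g) (delta R r g g) \<otimes>\<^bsub>R\<^esub> delta R s h (inv g \<otimes> x))
          = delta R (\<alpha> g (\<alpha> (inv g) r \<otimes>\<^bsub>R\<^esub> s)) (g \<otimes> h) x"
        using eq[OF x] arR g by (auto simp: delta_def \<alpha>_zero R_zero_mult)
      have c: "delta R (\<alpha> g (\<alpha> (inv g) r \<otimes>\<^bsub>R\<^esub> s)) (g \<otimes> h) x \<in> carrier R"
        using pR by (simp add: delta_def)
      have "(\<Oplus>\<^bsub>R\<^esub> k \<in> {g}. \<alpha> k (\<alpha> (inv k) (delta R r g k) \<otimes>\<^bsub>R\<^esub> delta R s h (inv k \<otimes> x)))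
          = delta R (\<alpha> g (\<alpha> (inv g) r \<otimes>\<^bsub>R\<^esub> s)) (g \<otimes> h) x"
        using R.finsum_insert[of "{}" g
            "\<lambda>k. \<alpha> k (\<alpha> (inv k) (delta R r g k) \<otimes>\<^bsub>R\<^esub> delta R s h (inv k \<otimes> x))"] t c
        by simp
      then show ?thesis
        using x S by (simp add: partial_skew_group_ring_def)
    qed
  qed
qed

end

end

theory Submission
  imports Defs "HOL-Library.Multiset" "HOL-Algebra.Generated_Groups"
begin

text \<open>
  The proof uses Passman's \<open>\<Delta>\<close>-method for a \<open>G\<close>-graded ring \<open>S\<close> such that every homogeneous \<open>z\<close>
  of degree \<open>g\<close> lies in \<open>z S\<^bsub>g\<inverse>\<^esub> S\<^sub>g \<inter> S\<^sub>g S\<^bsub>g\<inverse>\<^esub> z\<close>. A datum gives \<open>A S B = 0\<close>, and two-sided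
  annihilators turn this into nonzero ideals with product zero.

  Conversely let \<open>A B = 0\<close>. If \<open>a S b = 0\<close> for some nonzero homogeneous \<open>a, b\<close>, take \<open>H = G\<close> and
  \<open>N = 1\<close>. Otherwise choose \<open>H\<close>, \<open>I\<close> and \<open>\<alpha> \<in> A \<inter> I S\<^sub>H\<close> such that the support of \<open>\<alpha>\<close> meets the least
  number of cosets of the FC-centre \<open>D\<close> of \<open>H\<close>, and let \<open>\<alpha>\<^sub>0\<close> be the part of \<open>\<alpha>\<close> in \<open>D\<close>. Then
  \<open>\<alpha>\<^sub>0 S\<^sub>t B = 0\<close> unless \<open>t\<close> lies in finitely many cosets of centralizers of elements \<open>y \<notin> D\<close> that
  share a coset of \<open>D\<close> with the support of \<open>\<alpha>\<close>. Were it nonzero for some \<open>t\<close>, a nonzero \<open>k \<in> I\<close> would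
  exist for which \<open>H' = {x. k S\<^sub>x k \<noteq> 0}\<close> generates, up to finite index, a subgroup of such a
  centralizer; over \<open>H'\<close> the element \<open>y\<close> becomes an FC-element, two cosets merge and \<open>\<alpha>\<close> was not
  minimal. So \<open>\<alpha>\<^sub>0 S\<^sub>h B = 0\<close> for all \<open>h \<in> H\<close>, and an order on the torsion-free abelian quotient of an
  FC-group cuts \<open>\<alpha>\<^sub>0\<close> and \<open>B\<close> down to a finite normal subgroup.
\<close>

section \<open>Finite conjugacy classes and coset coverings\<close>

context group
begin

text \<open>The obstacle is that homogeneous components contain no units in general:
  \<open>S_g\<close> may be zero, and vanishing of \<open>x S_t y\<close> outside finitely many
  cosets says nothing by itself about the remaining \<open>t\<close>. Degrees that act by zero have
  to be removed from the group, which is why subgroup, ideal and element are varied together and why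
  the ideal \<open>J\<close> carries the condition \<open>J S_g J = 0\<close> for \<open>g\<close>
  outside \<open>H\<close>. Multiplication by \<open>s\<close>, \<open>t\<close> with
  \<open>x = x s t\<close> replaces translation by group elements. The new subgroup is found as a
  stabilizer: the set of degrees \<open>t\<close> with \<open>\<omega> S_t k\<close> nonzero shrinks
  when \<open>k\<close> is multiplied on both sides in degree \<open>\<one>\<close>, a chain
  condition for finite unions of cosets makes its hull \<open>Z\<close> stable, and then every
  \<open>x\<close> with \<open>k S_x k\<close> nonzero satisfies \<open>Z x = Z\<close>. The ideal
  \<open>B\<close> is not closed under restriction to the FC-centre; it is replaced by the larger
  set of elements annihilated outside few cosets, in which an element of least support can, after
  multiplication by \<open>\<alpha>0\<close>, be exchanged with its own components.\<close>

lemma inv_cancel_left [simp]: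
  assumes "x \<in> carrier G" "y \<in> carrier G"
  shows "inv x \<otimes> (x \<otimes> y) = y" and "x \<otimes> (inv x \<otimes> y) = y"
  using assms by (simp_all flip: m_assoc)

text \<open>The element \<open>g\<close> need not lie in \<open>H\<close>: the notion is applied
  later to conjugates not known to belong to the subgroup acting on them.\<close>

definition fin_conj :: "'a set \<Rightarrow> 'a \<Rightarrow> bool" where
  "fin_conj H g \<longleftrightarrow> finite ((\<lambda>h. h \<otimes> g \<otimes> inv h) ` H)"

definition fc_center :: "'a set \<Rightarrow> 'a set" where
  "fc_center H = {g \<in> H. fin_conj H g}"

definition cent :: "'a set \<Rightarrow> 'a set \<Rightarrow> 'a set" where
  "cent H Q = {h \<in> H. \<forall>q\<in>Q. h \<otimes> q = q \<otimes> h}"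

text \<open>For a subgroup \<open>W\<close> of \<open>H\<close> this is finite index, stated through
  right cosets \<open>W f\<close>. Left cosets \<open>h W\<close> are reached by inverting the
  argument.\<close>

definition fin_cover :: "'a set \<Rightarrow> 'a set \<Rightarrow> bool" where
  "fin_cover W H \<longleftrightarrow> (\<exists>F. finite F \<and> F \<subseteq> H \<and> (\<forall>h\<in>H. \<exists>f\<in>F. h \<otimes> inv f \<in> W))"

lemma fin_conj_mono: "fin_conj H g \<Longrightarrow> K \<subseteq> H \<Longrightarrow> fin_conj K g"
  unfolding fin_conj_def by (meson finite_subset image_mono)

lemma fin_conj_mult:
  assumes "H \<subseteq> carrier G" "a \<in> carrier G" "b \<in> carrier G" "fin_conj H a" "fin_conj H b"
  shows "fin_conj H (a \<otimes> b)"
proof -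
  let ?c = "\<lambda>g h. h \<otimes> g \<otimes> inv h"
  have "?c (a \<otimes> b) ` H \<subseteq> (\<lambda>(x, y). x \<otimes> y) ` ((?c a ` H) \<times> (?c b ` H))"
  proof
    fix z assume "z \<in> ?c (a \<otimes> b) ` H"
    then obtain h where h: "h \<in> H" and z: "z = h \<otimes> (a \<otimes> b) \<otimes> inv h" by auto
    have hc: "h \<in> carrier G" using h assms(1) by auto
    have "z = ?c a h \<otimes> ?c b h" using z hc assms(2,3) by (simp add: m_assoc)
    then show "z \<in> (\<lambda>(x, y). x \<otimes> y) ` ((?c a ` H) \<times> (?c b ` H))"
      using h by (intro image_eqI[of _ _ "(?c a h, ?c b h)"]) auto
  qed
  then show ?thesis
    using assms(4,5) unfolding fin_conj_def by (meson finite_SigmaI finite_imageI finite_subset)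
qed

lemma fin_conj_inv:
  assumes "H \<subseteq> carrier G" "a \<in> carrier G" "fin_conj H a"
  shows "fin_conj H (inv a)"
proof -
  have "(\<lambda>h. h \<otimes> inv a \<otimes> inv h) ` H = (\<lambda>x. inv x) ` (\<lambda>h. h \<otimes> a \<otimes> inv h) ` H"
    unfolding image_image
    using assms(1,2) by (intro image_cong) (auto simp: inv_mult_group m_assoc subset_eq)
  then show ?thesis using assms(3) unfolding fin_conj_def by simp
qed

lemma fin_conj_conj:
  assumes "subgroup H G" "a \<in> carrier G" "fin_conj H a" "k \<in> H"
  shows "fin_conj H (k \<otimes> a \<otimes> inv k)"
proof -
  have H: "H \<subseteq> carrier G" using assms(1) by (rule subgroup.subset)
  have "(\<lambda>h. h \<otimes> (k \<otimes> a \<otimes> inv k) \<otimes> inv h) ` H \<subseteq> (\<lambda>h. h \<otimes> a \<otimes> inv h) ` H"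
  proof
    fix z assume "z \<in> (\<lambda>h. h \<otimes> (k \<otimes> a \<otimes> inv k) \<otimes> inv h) ` H"
    then obtain h where h: "h \<in> H" and z: "z = h \<otimes> (k \<otimes> a \<otimes> inv k) \<otimes> inv h" by auto
    have "z = (h \<otimes> k) \<otimes> a \<otimes> inv (h \<otimes> k)"
      using z h assms H by (simp add: m_assoc inv_mult_group subset_eq)
    then show "z \<in> (\<lambda>h. h \<otimes> a \<otimes> inv h) ` H"
      using h assms(1,4) by (auto simp: subgroup.m_closed)
  qed
  then show ?thesis using assms(3) unfolding fin_conj_def by (meson finite_subset)
qed

lemma fc_center_subgroup:
  assumes "subgroup H G"
  shows "subgroup (fc_center H) G"
proof -
  interpret H: subgroup H G by fact
  have 1: "fin_conj H \<one>"
  proof -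
    have "(\<lambda>h. h \<otimes> \<one> \<otimes> inv h) ` H \<subseteq> {\<one>}" by auto
    then show ?thesis unfolding fin_conj_def by (meson finite.simps finite_subset)
  qed
  have "\<one> \<in> fc_center H" using 1 H.one_closed by (simp add: fc_center_def)
  then have "fc_center H \<noteq> {}" by blast
  then show ?thesis
    by (intro subgroupI)
      (use H.one_closed in \<open>auto simp: fc_center_def fin_conj_mult fin_conj_inv H.subset\<close>)
qed

lemma fc_center_conj:
  assumes "subgroup H G" "d \<in> fc_center H" "h \<in> H"
  shows "h \<otimes> d \<otimes> inv h \<in> fc_center H"
  using assms fin_conj_conj[OF assms(1), of d h] subgroup.subset[OF assms(1)]
  by (auto simp: fc_center_def subgroup.m_closed subgroup.m_inv_closed)

lemma cent_subgroup:
  assumes "subgroup H G" "Q \<subseteq> carrier G"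
  shows "subgroup (cent H Q) G"
proof -
  interpret H: subgroup H G by fact
  have "\<one> \<in> cent H Q" using assms(2) H.one_closed by (auto simp: cent_def)
  then have "cent H Q \<noteq> {}" by blast
  then show ?thesis
  proof (intro subgroupI)
    fix a b assume a: "a \<in> cent H Q" and b: "b \<in> cent H Q"
    have "a \<otimes> b \<otimes> q = q \<otimes> (a \<otimes> b)" if q: "q \<in> Q" for q
    proof -
      have c: "a \<in> carrier G" "b \<in> carrier G" "q \<in> carrier G"
        using a b q assms(2) H.subset by (auto simp: cent_def)
      have "a \<otimes> b \<otimes> q = a \<otimes> (q \<otimes> b)" using a b q c by (simp add: m_assoc cent_def)
      also have "\<dots> = q \<otimes> a \<otimes> b" using a q c by (simp add: cent_def flip: m_assoc)
      finally show ?thesis using c by (simp add: m_assoc)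
    qed
    then show "a \<otimes> b \<in> cent H Q" using a b by (auto simp: cent_def)
  next
    fix a assume a: "a \<in> cent H Q"
    have "inv a \<otimes> q = q \<otimes> inv a" if q: "q \<in> Q" for q
    proof -
      have c: "a \<in> carrier G" "q \<in> carrier G"
        using a q assms(2) H.subset by (auto simp: cent_def)
      have "inv a \<otimes> (a \<otimes> q) \<otimes> inv a = inv a \<otimes> (q \<otimes> a) \<otimes> inv a"
        using a q by (simp add: cent_def)
      then show ?thesis using c by (simp add: m_assoc)
    qed
    then show "inv a \<in> cent H Q" using a by (auto simp: cent_def)
  qed (use H.subset in \<open>auto simp: cent_def\<close>)
qed

text \<open>Orbit-stabilizer for simultaneous conjugation of the elements of \<open>Q\<close>: the
  tuple \<open>\<theta> h\<close> of conjugates takes finitely many values, and two elements with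
  the same tuple differ by an element of the centralizer.\<close>

lemma cent_fin_cover:
  assumes "subgroup H G" "finite Q" "Q \<subseteq> carrier G" "\<And>q. q \<in> Q \<Longrightarrow> fin_conj H q"
  shows "fin_cover (cent H Q) H"
proof -
  interpret H: subgroup H G by fact
  \<comment> \<open>Conjugation by the inverse is used so that equal tuples for \<open>h\<close> and
    \<open>f\<close> say that \<open>h f^-1\<close> centralizes \<open>Q\<close>, in agreement with
    right cosets.\<close>
  define \<theta> where "\<theta> h = restrict (\<lambda>q. inv h \<otimes> q \<otimes> h) Q" for h
  have "\<theta> ` H \<subseteq> PiE Q (\<lambda>q. (\<lambda>h. h \<otimes> q \<otimes> inv h) ` H)"
  proof
    fix z assume "z \<in> \<theta> ` H"
    then obtain h where h: "h \<in> H" and z: "z = \<theta> h" by auto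
    show "z \<in> PiE Q (\<lambda>q. (\<lambda>h. h \<otimes> q \<otimes> inv h) ` H)"
      using h z by (auto simp: \<theta>_def intro!: image_eqI[of _ _ "inv h"])
  qed
  moreover have "finite (PiE Q (\<lambda>q. (\<lambda>h. h \<otimes> q \<otimes> inv h) ` H))"
    using assms(2,4) by (intro finite_PiE) (auto simp: fin_conj_def)
  ultimately have "finite (\<theta> ` H)" by (rule finite_subset)
  from finite_subset_image[OF this order.refl]
  obtain F where F: "F \<subseteq> H" "finite F" "\<theta> ` H = \<theta> ` F" by auto
  have "\<exists>f\<in>F. h \<otimes> inv f \<in> cent H Q" if h: "h \<in> H" for h
  proof -
    obtain f where f: "f \<in> F" "\<theta> h = \<theta> f" using F(3) h by (metis imageE imageI)
    have fH: "f \<in> H" using f F by auto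
    have "(h \<otimes> inv f) \<otimes> q = q \<otimes> (h \<otimes> inv f)" if q: "q \<in> Q" for q
    proof -
      have c: "h \<in> carrier G" "f \<in> carrier G" "q \<in> carrier G"
        using h fH q assms(3) H.subset by auto
      have "inv h \<otimes> q \<otimes> h = inv f \<otimes> q \<otimes> f"
        using fun_cong[OF f(2), of q] q by (simp add: \<theta>_def)
      then have "h \<otimes> (inv h \<otimes> q \<otimes> h) \<otimes> inv f = h \<otimes> (inv f \<otimes> q \<otimes> f) \<otimes> inv f" by simp
      then show ?thesis using c by (simp add: m_assoc)
    qed
    then show ?thesis using f h fH by (auto simp: cent_def)
  qed
  then show ?thesis unfolding fin_cover_def using F by blast
qed

lemma fin_conj_of_fin_cover:
  assumes "subgroup H G" "y \<in> carrier G" "fin_cover (cent H {y}) H"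
  shows "fin_conj H y"
proof -
  interpret H: subgroup H G by fact
  obtain F where F: "finite F" "F \<subseteq> H" "\<And>h. h \<in> H \<Longrightarrow> \<exists>f\<in>F. h \<otimes> inv f \<in> cent H {y}"
    using assms(3) unfolding fin_cover_def by blast
  have "(\<lambda>h. h \<otimes> y \<otimes> inv h) ` H \<subseteq> (\<lambda>f. inv f \<otimes> y \<otimes> f) ` F"
  proof
    fix z assume "z \<in> (\<lambda>h. h \<otimes> y \<otimes> inv h) ` H"
    then obtain h where h: "h \<in> H" and z: "z = h \<otimes> y \<otimes> inv h" by auto
    \<comment> \<open>The conjugate \<open>h y h^-1\<close> depends on the left coset of
      \<open>h\<close> modulo the centralizer, so the covering by right cosets is applied to
      \<open>inv h\<close>.\<close>
    obtain f where f: "f \<in> F" "inv h \<otimes> inv f \<in> cent H {y}" using F(3)[of "inv h"] h by auto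
    have c: "h \<in> carrier G" "f \<in> carrier G" using h f F(2) H.subset by auto
    have "inv h \<otimes> inv f \<otimes> y = y \<otimes> (inv h \<otimes> inv f)" using f(2) by (simp add: cent_def)
    then have "h \<otimes> (inv h \<otimes> inv f \<otimes> y) \<otimes> f = h \<otimes> (y \<otimes> (inv h \<otimes> inv f)) \<otimes> f" by simp
    then have "inv f \<otimes> y \<otimes> f = z" using c assms(2) z by (simp add: m_assoc)
    then show "z \<in> (\<lambda>f. inv f \<otimes> y \<otimes> f) ` F" using f(1) by auto
  qed
  then show ?thesis unfolding fin_conj_def using F(1) by (meson finite_imageI finite_subset)
qed

text \<open>B. H. Neumann's covering lemma. If some coset of \<open>C\<close> is missing from the list, it is
  covered by the cosets of the other subgroups, and so are all its translates.\<close>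

lemma neumann_aux:
  assumes "subgroup H G" "finite \<C>" "\<And>C. C \<in> \<C> \<Longrightarrow> subgroup C G"
    "finite T" "T \<subseteq> H" "\<And>h. h \<in> H \<Longrightarrow> \<exists>C\<in>\<C>. \<exists>t\<in>T. h \<otimes> inv t \<in> C"
  shows "\<exists>C\<in>\<C>. fin_cover C H"
  using assms(2-)
proof (induction \<C> arbitrary: T rule: finite_induct)
  case empty
  then show ?case using subgroup.one_closed[OF assms(1)] by blast
next
  case (insert C \<C>)
  interpret H: subgroup H G by fact
  interpret C: subgroup C G using insert.prems(1) by simp
  show ?case
  proof (cases "\<forall>h\<in>H. \<exists>t\<in>T. h \<otimes> inv t \<in> C")
    case True
    then show ?thesis unfolding fin_cover_def using insert.prems by blast
  next
    case False
    then obtain x where x: "x \<in> H" "\<And>t. t \<in> T \<Longrightarrow> x \<otimes> inv t \<notin> C" by blast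
    \<comment> \<open>If \<open>h\<close> lies in \<open>C t\<close>, then \<open>h t^-1 x\<close>
      lies in \<open>C x\<close>, which is none of the listed cosets of \<open>C\<close>; so it lies
      in some \<open>C'' s\<close> with another subgroup, and \<open>h\<close> lies in
      \<open>C'' s x^-1 t\<close>.\<close>
    define T' where "T' = T \<union> (\<lambda>(s, t). s \<otimes> inv x \<otimes> t) ` (T \<times> T)"
    have T': "finite T'" "T' \<subseteq> H"
      using insert.prems x by (auto simp: T'_def)
    have "\<exists>C'\<in>\<C>. \<exists>t\<in>T'. h \<otimes> inv t \<in> C'" if h: "h \<in> H" for h
    proof -
      obtain C' t where Ct: "C' \<in> insert C \<C>" "t \<in> T" "h \<otimes> inv t \<in> C'"
        using insert.prems(4)[OF h] by blast
      have tH: "t \<in> H" using Ct insert.prems by auto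
      have c: "h \<in> carrier G" "t \<in> carrier G" "x \<in> carrier G"
        using h tH x H.subset by auto
      show ?thesis
      proof (cases "C' = C")
        case False
        then show ?thesis using Ct by (auto simp: T'_def)
      next
        case True
        define g where "g = h \<otimes> inv t \<otimes> x"
        have gH: "g \<in> H" using h tH x by (simp add: g_def)
        obtain C'' s where Cs: "C'' \<in> insert C \<C>" "s \<in> T" "g \<otimes> inv s \<in> C''"
          using insert.prems(4)[OF gH] by blast
        have sc: "s \<in> carrier G" using Cs insert.prems H.subset by auto
        have "C'' \<noteq> C"
        proof
          assume "C'' = C"
          then have "inv (h \<otimes> inv t) \<otimes> (g \<otimes> inv s) \<in> C" using Cs Ct True by simp
          moreover have "inv (h \<otimes> inv t) \<otimes> (g \<otimes> inv s) = x \<otimes> inv s"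
            using c sc by (simp add: g_def m_assoc inv_mult_group)
          ultimately show False using x(2) Cs by simp
        qed
        moreover have "h \<otimes> inv (s \<otimes> inv x \<otimes> t) = g \<otimes> inv s"
          using c sc by (simp add: g_def m_assoc inv_mult_group)
        moreover have "s \<otimes> inv x \<otimes> t \<in> T'" using Cs Ct by (auto simp: T'_def)
        ultimately show ?thesis using Cs by (metis insertE)
      qed
    qed
    from insert.IH[OF _ T' this] insert.prems show ?thesis by auto
  qed
qed

text \<open>Form of the covering lemma for arbitrary pieces: each \<open>E i\<close> meets
  \<open>H\<close> inside a single right coset of \<open>C i\<close>, without a representative being
  given in advance.\<close>

lemma neumann:
  assumes "subgroup H G" "finite I" "\<And>i. i \<in> I \<Longrightarrow> subgroup (C i) G"
    "H \<subseteq> (\<Union>i\<in>I. E i)"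
    "\<And>i p q. i \<in> I \<Longrightarrow> p \<in> E i \<Longrightarrow> q \<in> E i \<Longrightarrow> p \<in> H \<Longrightarrow> q \<in> H \<Longrightarrow> p \<otimes> inv q \<in> C i"
  shows "\<exists>i\<in>I. fin_cover (C i) H"
proof -
  \<comment> \<open>For a piece that misses \<open>H\<close> the value \<open>\<one>\<close> is a
    placeholder that keeps all representatives in \<open>H\<close>.\<close>
  define t where "t i = (if E i \<inter> H = {} then \<one> else SOME x. x \<in> E i \<inter> H)" for i
  have t: "t i \<in> E i \<inter> H" if "E i \<inter> H \<noteq> {}" for i
    using that some_in_eq[of "E i \<inter> H"] by (simp add: t_def)
  have tH: "t ` I \<subseteq> H" using t subgroup.one_closed[OF assms(1)] by (auto simp: t_def)
  have "\<exists>C'\<in>C ` I. \<exists>s\<in>t ` I. h \<otimes> inv s \<in> C'" if h: "h \<in> H" for h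
  proof -
    obtain i where i: "i \<in> I" "h \<in> E i" using h assms(4) by auto
    then show ?thesis using assms(5)[of i h "t i"] t[of i] h by blast
  qed
  from neumann_aux[OF assms(1) _ _ _ tH this] assms(2,3) show ?thesis by auto
qed

text \<open>A pair \<open>(Q, t)\<close> stands for the right coset through \<open>t\<close> of the
  intersection of the members of \<open>Q\<close>, inside \<open>H\<close>; the empty
  \<open>Q\<close> gives \<open>H\<close> itself. Keeping \<open>Q\<close> instead of the
  intersection makes \<open>card Q\<close> available as a rank.\<close>

definition coset_inter :: "'a set \<Rightarrow> 'a set set \<times> 'a \<Rightarrow> 'a set" where
  "coset_inter H = (\<lambda>(Q, t). {x \<in> H. \<forall>C\<in>Q. x \<otimes> inv t \<in> C})"

definition coset_union :: "'a set \<Rightarrow> 'a set set \<Rightarrow> 'a set \<Rightarrow> bool" where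
  "coset_union H \<C> Z \<longleftrightarrow>
     (\<exists>F. finite F \<and> F \<subseteq> Pow \<C> \<times> H \<and> Z = (\<Union>p\<in>F. coset_inter H p))"

text \<open>Right translation moves the representatives and leaves the subgroups alone, so a
  translate of a minimal union may be compared with it by minimality.\<close>

lemma coset_union_translate:
  assumes "subgroup H G" "coset_union H \<C> Z" "x \<in> H" "\<And>C. C \<in> \<C> \<Longrightarrow> subgroup C G"
  shows "coset_union H \<C> ((\<lambda>z. z \<otimes> x) ` Z)"
proof -
  interpret H: subgroup H G by fact
  obtain F where F: "finite F" "F \<subseteq> Pow \<C> \<times> H" "Z = (\<Union>p\<in>F. coset_inter H p)"
    using assms(2) unfolding coset_union_def by blast
  have "(\<lambda>z. z \<otimes> x) ` coset_inter H (Q, t) = coset_inter H (Q, t \<otimes> x)" if "(Q, t) \<in> F" for Q t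
  proof -
    have t: "t \<in> H" using that F by auto
    have "y \<in> (\<lambda>z. z \<otimes> x) ` coset_inter H (Q, t)" if y: "y \<in> coset_inter H (Q, t \<otimes> x)" for y
    proof (rule image_eqI[of _ _ "y \<otimes> inv x"])
      have yH: "y \<in> H" using y by (auto simp: coset_inter_def)
      show "y = y \<otimes> inv x \<otimes> x" using yH assms(3) H.subset by (simp add: m_assoc subset_eq)
      have "y \<otimes> inv (t \<otimes> x) = y \<otimes> inv x \<otimes> inv t"
        using yH assms(3) t H.subset by (simp add: m_assoc subset_eq inv_mult_group)
      then show "y \<otimes> inv x \<in> coset_inter H (Q, t)"
        using y assms(3) by (auto simp: coset_inter_def)
    qed
    moreover have "z \<otimes> x \<in> coset_inter H (Q, t \<otimes> x)" if z: "z \<in> coset_inter H (Q, t)" for z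
    proof -
      have zH: "z \<in> H" using z by (auto simp: coset_inter_def)
      have "z \<otimes> x \<otimes> inv (t \<otimes> x) = z \<otimes> inv t"
        using zH assms(3) t H.subset by (simp add: m_assoc subset_eq inv_mult_group)
      then show ?thesis using z assms(3) by (auto simp: coset_inter_def)
    qed
    ultimately show ?thesis by blast
  qed
  then have "(\<lambda>z. z \<otimes> x) ` Z = (\<Union>p\<in>(\<lambda>(Q, t). (Q, t \<otimes> x)) ` F. coset_inter H p)"
    unfolding F(3) image_UN by (force simp: split_beta)
  moreover have "(\<lambda>(Q, t). (Q, t \<otimes> x)) ` F \<subseteq> Pow \<C> \<times> H"
    using F(2) assms(3) by auto
  ultimately show ?thesis unfolding coset_union_def using F(1) by blast
qed

text \<open>The finite unions of cosets of intersections of members of \<open>\<C>\<close> satisfy the descending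
  chain condition: replacing a coset by its proper intersections with others lowers the multiset
  of coranks.\<close>

lemma stable_coset_union:
  assumes "subgroup H G" "finite \<C>" "\<And>C. C \<in> \<C> \<Longrightarrow> subgroup C G"
    "X0 \<in> \<X>" "\<And>X. X \<in> \<X> \<Longrightarrow> X \<subseteq> H"
  obtains X Z where "X \<in> \<X>" "X \<subseteq> Z" "coset_union H \<C> Z"
    "\<And>X' Z'. X' \<in> \<X> \<Longrightarrow> X' \<subseteq> X \<Longrightarrow> coset_union H \<C> Z' \<Longrightarrow> X' \<subseteq> Z' \<Longrightarrow> Z \<subseteq> Z'"
proof -
  interpret H: subgroup H G by fact
  define ok :: "('a set set \<times> 'a) multiset \<Rightarrow> bool" where "ok M \<longleftrightarrow> set_mset M \<subseteq> Pow \<C> \<times> H" for M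
  define U where "U M = (\<Union>p\<in>set_mset M. coset_inter H p)" for M
  define \<mu> :: "('a set set \<times> 'a) multiset \<Rightarrow> nat multiset"
    where "\<mu> M = image_mset (\<lambda>(Q, t). card \<C> - card Q) M" for M
  \<comment> \<open>Membership asks only that some member of the family lies inside the union, so
    that a minimal multiset stays minimal when this member is replaced by a smaller one.\<close>
  define \<P> where "\<P> = {M. ok M \<and> (\<exists>X\<in>\<X>. X \<subseteq> U M)}"
  have "{#({}, \<one>)#} \<in> \<P>"
    using assms(4,5) by (auto simp: \<P>_def ok_def U_def coset_inter_def)
  moreover have "wf (inv_image (mult less_than) \<mu>)" by (intro wf_inv_image wf_mult wf_less_than)
  ultimately obtain M where M: "M \<in> \<P>"
    and min: "\<And>M'. M' \<in> \<P> \<Longrightarrow> (\<mu> M', \<mu> M) \<notin> mult less_than"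
    by (metis (no_types, lifting) in_inv_image wfE_min)
  obtain X where X: "X \<in> \<X>" "X \<subseteq> U M" using M by (auto simp: \<P>_def)
  have "coset_union H \<C> (U M)"
    unfolding coset_union_def U_def
    by (rule exI[of _ "set_mset M"]) (use M in \<open>auto simp: \<P>_def ok_def\<close>)
  moreover have "U M \<subseteq> Z'" if X': "X' \<in> \<X>" "X' \<subseteq> X" "coset_union H \<C> Z'" "X' \<subseteq> Z'" for X' Z'
  proof (rule ccontr)
    assume "\<not> U M \<subseteq> Z'"
    then obtain z c where z: "z \<notin> Z'" "c \<in># M" "z \<in> coset_inter H c" by (auto simp: U_def)
    obtain Q t where c: "c = (Q, t)" by (cases c)
    have Qt: "Q \<subseteq> \<C>" "t \<in> H" using M z(2) by (auto simp: c \<P>_def ok_def)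
    obtain F where F: "finite F" "F \<subseteq> Pow \<C> \<times> H" "Z' = (\<Union>p\<in>F. coset_inter H p)"
      using X'(3) unfolding coset_union_def by blast
    \<comment> \<open>Two cosets that meet in \<open>s p\<close> intersect in the coset through
      \<open>s p\<close> of the intersection of both groups; \<open>c\<close> is replaced by its
      intersections with the cosets that make up \<open>Z'\<close>.\<close>
    define F' where "F' = {p \<in> F. coset_inter H c \<inter> coset_inter H p \<noteq> {}}"
    define s where "s p = (SOME s. s \<in> coset_inter H c \<inter> coset_inter H p)" for p
    have s: "s p \<in> coset_inter H c \<inter> coset_inter H p" if "p \<in> F'" for p
      using that some_in_eq[of "coset_inter H c \<inter> coset_inter H p"] by (simp add: F'_def s_def)
    define N where "N = image_mset (\<lambda>p. (Q \<union> fst p, s p)) (mset_set F')"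
    define M'' where "M'' = (M - {#c#}) + N"
    have finF': "finite F'" using F(1) by (simp add: F'_def)
    have combine: "x \<otimes> inv r \<in> C"
      if "C \<in> \<C>" "x \<otimes> inv u \<in> C" "r \<otimes> inv u \<in> C" "x \<in> H" "r \<in> H" "u \<in> H" for C x r u
    proof -
      interpret C: subgroup C G using assms(3) that(1) .
      have "(x \<otimes> inv u) \<otimes> inv (r \<otimes> inv u) \<in> C" using that by simp
      moreover have "(x \<otimes> inv u) \<otimes> inv (r \<otimes> inv u) = x \<otimes> inv r"
        using that(4-6) H.subset by (simp add: m_assoc inv_mult_group subset_eq)
      ultimately show ?thesis by simp
    qed
    have F'p: "fst p \<subseteq> \<C>" "snd p \<in> H" "s p \<in> H" if "p \<in> F'" for p
    proof -
      have "p \<in> Pow \<C> \<times> H" using that F(2) by (auto simp: F'_def)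
      then show "fst p \<subseteq> \<C>" "snd p \<in> H" by auto
      show "s p \<in> H" using s[OF that] by (auto simp: coset_inter_def split_beta)
    qed
    \<comment> \<open>Otherwise the coset of \<open>p\<close> would contain all of \<open>c\<close>,
      in particular the point \<open>z\<close>, which lies outside \<open>Z'\<close>. This
      strictness makes the corank drop.\<close>
    have notsub: "\<not> fst p \<subseteq> Q" if p: "p \<in> F'" for p
    proof
      assume sub: "fst p \<subseteq> Q"
      have "z \<in> coset_inter H p"
      proof -
        have "z \<otimes> inv (snd p) \<in> C" if C: "C \<in> fst p" for C
        proof -
          interpret C: subgroup C G using assms(3) F'p(1)[OF p] C by blast
          have "C \<in> \<C>" "C \<in> Q" using C sub Qt by auto
          then have "z \<otimes> inv (s p) \<in> C"
            using combine[of C z t "s p"] C sub Qt z(3) s[OF p] F'p[OF p]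
            by (auto simp: c coset_inter_def)
          moreover have "s p \<otimes> inv (snd p) \<in> C"
            using s[OF p] C by (auto simp: coset_inter_def split_beta)
          ultimately have "(z \<otimes> inv (s p)) \<otimes> (s p \<otimes> inv (snd p)) \<in> C" by simp
          moreover have "z \<in> carrier G" "s p \<in> carrier G" "snd p \<in> carrier G"
            using z(3) F'p[OF p] H.subset by (auto simp: c coset_inter_def)
          ultimately show ?thesis by (simp add: m_assoc)
        qed
        then show ?thesis using z(3) by (auto simp: c coset_inter_def split_beta)
      qed
      then show False using z(1) p F(3) by (auto simp: F'_def)
    qed
    have "M'' \<in> \<P>"
    proof -
      have "ok M''"
        using M Qt F'p finF' by (auto simp: ok_def M''_def N_def \<P>_def dest: in_diffD)
      moreover have "X' \<subseteq> U M''"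
      proof
        fix x assume x: "x \<in> X'"
        then obtain b where b: "b \<in># M" "x \<in> coset_inter H b" using X'(2) X(2) by (auto simp: U_def)
        show "x \<in> U M''"
        proof (cases "b = c")
          case False
          then have "b \<in># M''" using b by (auto simp: M''_def in_diff_count)
          then show ?thesis using b by (auto simp: U_def)
        next
          case True
          obtain p where p: "p \<in> F" "x \<in> coset_inter H p" using x X'(4) F(3) by auto
          have p': "p \<in> F'" using p b True by (auto simp: F'_def)
          have xH: "x \<in> H" using x X'(1) assms(5) by blast
          have "x \<in> coset_inter H (Q \<union> fst p, s p)"
            using combine[of _ x t "s p"] combine[of _ x "snd p" "s p"] s[OF p'] p(2) b(2) True
              xH F'p[OF p'] Qt
            by (auto simp: coset_inter_def c split_beta subset_eq)
          moreover have "(Q \<union> fst p, s p) \<in># M''" using p' finF' by (auto simp: M''_def N_def)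
          ultimately show ?thesis by (auto simp: U_def)
        qed
      qed
      ultimately show ?thesis using X'(1) by (auto simp: \<P>_def)
    qed
    moreover have "(\<mu> M'', \<mu> M) \<in> mult less_than"
    proof -
      have "\<mu> M'' = \<mu> (M - {#c#}) + \<mu> N" by (simp add: M''_def \<mu>_def)
      moreover have "\<mu> M = \<mu> (M - {#c#}) + {#card \<C> - card Q#}"
      proof -
        have "M = (M - {#c#}) + {#c#}" using z(2) by simp
        then have "\<mu> M = \<mu> ((M - {#c#}) + {#c#})" by simp
        then show ?thesis by (simp add: \<mu>_def c)
      qed
      moreover have "card \<C> - card (Q \<union> fst p) < card \<C> - card Q" if p: "p \<in> F'" for p
      proof -
        have "Q \<subset> Q \<union> fst p" "Q \<union> fst p \<subseteq> \<C>" using notsub[OF p] F'p[OF p] Qt by auto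
        then have "card Q < card (Q \<union> fst p)" "card (Q \<union> fst p) \<le> card \<C>"
          using assms(2) by (meson psubset_card_mono card_mono finite_subset)+
        then show ?thesis by simp
      qed
      moreover from calculation(3)
      have "\<forall>k\<in>set_mset (\<mu> N). \<exists>j\<in>set_mset {#card \<C> - card Q#}. (k, j) \<in> less_than"
        using finF' by (auto simp: \<mu>_def N_def)
      ultimately show ?thesis by (simp only:) (rule one_step_implies_mult, auto)
    qed
    ultimately show False using min by blast
  qed
  ultimately show ?thesis using that X by blast
qed

end

section \<open>Dietzmann's lemma and orders on abelian groups\<close>

context group
begin

text \<open>This is only the submonoid generated by \<open>X\<close>; for letters of finite order
  inverses are powers, which turns it into a subgroup in Dietzmann's lemma.\<close>

definition words :: "'a set \<Rightarrow> 'a set" where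
  "words X = (\<lambda>ws. foldr (\<otimes>) ws \<one>) ` lists X"

lemma foldr_closed [simp]: "set ws \<subseteq> carrier G \<Longrightarrow> foldr (\<otimes>) ws \<one> \<in> carrier G"
  by (induction ws) auto

lemma foldr_append:
  "set us \<subseteq> carrier G \<Longrightarrow> set vs \<subseteq> carrier G \<Longrightarrow>
    foldr (\<otimes>) (us @ vs) \<one> = foldr (\<otimes>) us \<one> \<otimes> foldr (\<otimes>) vs \<one>"
  by (induction us) (auto simp: m_assoc simp del: foldr_append)

lemma foldr_conj:
  assumes "h \<in> carrier G"
  shows "set ws \<subseteq> carrier G \<Longrightarrow>
    foldr (\<otimes>) (map (\<lambda>u. h \<otimes> u \<otimes> inv h) ws) \<one> = h \<otimes> foldr (\<otimes>) ws \<one> \<otimes> inv h"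
  by (induction ws) (use assms in \<open>auto simp: m_assoc\<close>)

lemma lists_carrier: "ws \<in> lists X \<Longrightarrow> X \<subseteq> carrier G \<Longrightarrow> set ws \<subseteq> carrier G"
  by auto

lemma words_mult:
  assumes "X \<subseteq> carrier G" "a \<in> words X" "b \<in> words X"
  shows "a \<otimes> b \<in> words X"
proof -
  obtain us vs where "us \<in> lists X" "vs \<in> lists X" "a = foldr (\<otimes>) us \<one>" "b = foldr (\<otimes>) vs \<one>"
    using assms(2,3) unfolding words_def by auto
  then show ?thesis unfolding words_def
    using foldr_append[of us vs] lists_carrier[OF _ assms(1)]
    by (intro image_eqI[of _ _ "us @ vs"]) (simp_all del: List.foldr_append)
qed

lemma words_base: "X \<subseteq> carrier G \<Longrightarrow> x \<in> X \<Longrightarrow> x \<in> words X"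
  unfolding words_def by (intro image_eqI[of _ _ "[x]"]) auto

lemma words_subset: "subgroup K G \<Longrightarrow> X \<subseteq> K \<Longrightarrow> words X \<subseteq> K"
proof -
  assume K: "subgroup K G" "X \<subseteq> K"
  have "foldr (\<otimes>) ws \<one> \<in> K" if "ws \<in> lists X" for ws
    using that by induction (use K in \<open>auto simp: subgroup.m_closed subgroup.one_closed\<close>)
  then show ?thesis by (auto simp: words_def)
qed

text \<open>Since \<open>u x = x (x^-1 u x)\<close>, a letter moved to the front conjugates the
  letters it passes, which stay in \<open>X\<close>; the length does not change.\<close>

lemma words_pull:
  assumes X: "X \<subseteq> carrier G" "x \<in> X" "\<And>y. y \<in> X \<Longrightarrow> inv x \<otimes> y \<otimes> x \<in> X"
  shows "ws \<in> lists X \<Longrightarrow> count_list ws x \<ge> j \<Longrightarrow>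
    \<exists>ws'\<in>lists X. length ws = length ws' + j \<and> foldr (\<otimes>) ws \<one> = x [^] j \<otimes> foldr (\<otimes>) ws' \<one>"
proof (induction j arbitrary: ws)
  case 0
  then show ?case using X lists_carrier[OF 0(1) X(1)] by (intro bexI[of _ ws]) auto
next
  case (Suc j)
  have xc: "x \<in> carrier G" using X by auto
  have "x \<in> set ws" using Suc.prems(2) by (metis count_notin not_less_eq_eq zero_le)
  from split_list_first[OF this] obtain us vs where ws: "ws = us @ x # vs" "x \<notin> set us" by blast
  define us' where "us' = map (\<lambda>u. inv x \<otimes> u \<otimes> inv (inv x)) us"
  have us: "us \<in> lists X" "vs \<in> lists X" using Suc.prems(1) ws by auto
  then have c: "set us \<subseteq> carrier G" "set vs \<subseteq> carrier G" using X by auto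
  have us': "us' \<in> lists X" using us X xc by (auto simp: us'_def)
  have c': "set us' \<subseteq> carrier G" using us' X by auto
  have "count_list vs x \<ge> j" using Suc.prems(2) ws by (simp add: count_notin)
  then have "count_list (us' @ vs) x \<ge> j" by simp
  from Suc.IH[OF _ this] us us' obtain ws' where ws':
    "ws' \<in> lists X" "length (us' @ vs) = length ws' + j"
    "foldr (\<otimes>) (us' @ vs) \<one> = x [^] j \<otimes> foldr (\<otimes>) ws' \<one>" by auto
  have wc: "set ws' \<subseteq> carrier G" using ws' X by auto
  have "foldr (\<otimes>) ws \<one> = foldr (\<otimes>) us \<one> \<otimes> (x \<otimes> foldr (\<otimes>) vs \<one>)"
    using ws c xc by (simp add: foldr_append del: List.foldr_append)
  also have "\<dots> = x \<otimes> (foldr (\<otimes>) us' \<one> \<otimes> foldr (\<otimes>) vs \<one>)"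
    using foldr_conj[of "inv x" us] c xc by (simp add: us'_def m_assoc)
  also have "\<dots> = x \<otimes> (x [^] j \<otimes> foldr (\<otimes>) ws' \<one>)"
    using ws'(3) foldr_append[OF c' c(2)] by (simp del: List.foldr_append)
  also have "\<dots> = x [^] Suc j \<otimes> foldr (\<otimes>) ws' \<one>"
    using xc wc by (metis foldr_closed m_assoc nat_pow_Suc2 nat_pow_closed)
  finally show ?case using ws' ws by (intro bexI[of _ ws']) (auto simp: us'_def)
qed

text \<open>Dietzmann's lemma. In a shortest word no letter occurs as often as its exponent: the
  occurrences could be moved to the front and cancelled.\<close>

lemma dietzmann:
  assumes X: "finite X" "X \<subseteq> carrier G" "\<And>x y. x \<in> X \<Longrightarrow> y \<in> X \<Longrightarrow> x \<otimes> y \<otimes> inv x \<in> X"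
    and tor: "\<And>x. x \<in> X \<Longrightarrow> \<exists>m::nat. m > 0 \<and> x [^] m = \<one>"
  shows "finite (words X)" and "subgroup (words X) G"
proof -
  obtain e where e: "\<And>x. x \<in> X \<Longrightarrow> e x > (0::nat) \<and> x [^] e x = \<one>" using tor by metis
  define m where "m = (\<Prod>x\<in>X. e x)"
  have m0: "m > 0" using e by (simp add: m_def prod_pos)
  have m: "x [^] m = \<one>" if x: "x \<in> X" for x
  proof -
    have "m = e x * (\<Prod>y\<in>X - {x}. e y)" using X(1) x by (simp add: m_def prod.remove)
    then show ?thesis using e[OF x] x X(2) by (simp add: subset_eq flip: nat_pow_pow)
  qed
  have invX: "inv x = x [^] (m - 1)" if x: "x \<in> X" for x
  proof -
    have xc: "x \<in> carrier G" using x X by auto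
    have "x [^] (m - 1) \<otimes> x = \<one>" using m[OF x] m0 by (simp flip: nat_pow_Suc)
    then show ?thesis using xc by (simp add: inv_equality)
  qed
  have powX: "x [^] n \<in> words X" if x: "x \<in> X" for x and n :: nat
  proof (induction n)
    case 0
    show ?case unfolding words_def by (rule image_eqI[of _ _ "[]"]) auto
  next
    case (Suc n)
    then show ?case using words_mult[OF X(2)] words_base[OF X(2) x] by simp
  qed
  \<comment> \<open>The hypothesis closes \<open>X\<close> under conjugation by \<open>x\<close>
    only; conjugation by \<open>inv x\<close> is conjugation by the power
    \<open>x^(m - 1)\<close>.\<close>
  have conj': "inv x \<otimes> y \<otimes> x \<in> X" if x: "x \<in> X" and y: "y \<in> X" for x y
  proof -
    have c: "x \<in> carrier G" "y \<in> carrier G" using x y X(2) by auto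
    have step: "x [^] n \<otimes> y \<otimes> inv (x [^] n) \<in> X" for n :: nat
    proof (induction n)
      case 0
      then show ?case using y c by simp
    next
      case (Suc n)
      have "x [^] Suc n \<otimes> y \<otimes> inv (x [^] Suc n) = x \<otimes> (x [^] n \<otimes> y \<otimes> inv (x [^] n)) \<otimes> inv x"
        using c unfolding nat_pow_Suc2[OF c(1)] by (simp add: inv_mult_group m_assoc)
      then show ?case using X(3)[OF x Suc] by simp
    qed
    show ?thesis using step[of "m - 1"] c invX[OF x, symmetric] by simp
  qed
  have short: "\<exists>ws\<in>lists X. foldr (\<otimes>) ws \<one> = p \<and> length ws \<le> card X * m" if p: "p \<in> words X" for p
  proof -
    define P where "P n \<longleftrightarrow> (\<exists>ws\<in>lists X. foldr (\<otimes>) ws \<one> = p \<and> length ws = n)" for n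
    have "\<exists>n. P n" using p by (auto simp: P_def words_def)
    then have "P (LEAST n. P n)" by (rule LeastI_ex)
    then obtain ws where ws: "ws \<in> lists X" "foldr (\<otimes>) ws \<one> = p" "length ws = (LEAST n. P n)"
      by (auto simp: P_def)
    have "count_list ws x \<le> m" if x: "x \<in> X" for x
    proof (rule ccontr)
      assume "\<not> count_list ws x \<le> m"
      then have "m \<le> count_list ws x" by simp
      from words_pull[OF X(2) x conj'[OF x] ws(1) this]
      obtain ws' where ws': "ws' \<in> lists X" "length ws = length ws' + m"
        "foldr (\<otimes>) ws \<one> = x [^] m \<otimes> foldr (\<otimes>) ws' \<one>" by blast
      have "set ws' \<subseteq> carrier G" using ws'(1) X(2) by auto
      then have "foldr (\<otimes>) ws' \<one> = p" using ws' ws m[OF x] by simp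
      then have "P (length ws')" using ws' by (auto simp: P_def)
      then have "(LEAST n. P n) \<le> length ws'" by (rule Least_le)
      then show False using ws(3) ws'(2) m0 by simp
    qed
    then have "sum (count_list ws) X \<le> card X * m" using sum_bounded_above[of X "count_list ws" m] by simp
    moreover have "sum (count_list ws) X = length ws"
      using sum_count_set[of ws X] ws(1) X(1) by auto
    ultimately show ?thesis using ws by auto
  qed
  have "words X \<subseteq> (\<lambda>ws. foldr (\<otimes>) ws \<one>) ` {ws. set ws \<subseteq> X \<and> length ws \<le> card X * m}"
    using short by fastforce
  then show "finite (words X)"
    using finite_lists_length_le[OF X(1)] by (meson finite_imageI finite_subset)
  have inv: "inv (foldr (\<otimes>) ws \<one>) \<in> words X" if "ws \<in> lists X" for ws
    using that
  proof induction
    case Nil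
    show ?case unfolding words_def by (rule image_eqI[of _ _ "[]"]) auto
  next
    case (Cons x ws)
    have "set ws \<subseteq> carrier G" "x \<in> carrier G" using Cons X by auto
    then show ?case using Cons words_mult[OF X(2)] powX invX by (simp add: inv_mult_group)
  qed
  show "subgroup (words X) G"
  proof (rule subgroupI)
    show "words X \<subseteq> carrier G" using X(2) by (auto simp: words_def subset_eq)
    show "words X \<noteq> {}" by (auto simp: words_def)
  qed (use inv words_mult[OF X(2)] in \<open>auto simp: words_def\<close>)
qed

lemma words_conj:
  assumes "X \<subseteq> carrier G" "h \<in> carrier G" "\<And>x. x \<in> X \<Longrightarrow> h \<otimes> x \<otimes> inv h \<in> X" "n \<in> words X"
  shows "h \<otimes> n \<otimes> inv h \<in> words X"
proof -
  obtain ws where ws: "ws \<in> lists X" "n = foldr (\<otimes>) ws \<one>" using assms(4) by (auto simp: words_def)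
  then have "h \<otimes> n \<otimes> inv h = foldr (\<otimes>) (map (\<lambda>u. h \<otimes> u \<otimes> inv h) ws) \<one>"
    using foldr_conj[OF assms(2) lists_carrier[OF _ assms(1)]] by simp
  then show ?thesis using ws assms(3) by (auto simp: words_def intro!: imageI)
qed

text \<open>Only a set: in a general group the elements of finite order need not form a subgroup.
  For the FC-groups below this is obtained from the transfer.\<close>

definition torsion :: "'a set \<Rightarrow> 'a set" where
  "torsion E = {x \<in> E. \<exists>n::nat. n > 0 \<and> x [^] n = \<one>}"

end

text \<open>A maximal submonoid \<open>P\<close> with \<open>P \<inter> P\<inverse>\<close> torsion is total: the orderability of torsion-free
  abelian groups, without passing to the quotient.\<close>

lemma (in comm_group) exists_cone:
  obtains P where "P \<subseteq> carrier G" "torsion (carrier G) \<subseteq> P"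
    "\<And>x y. x \<in> P \<Longrightarrow> y \<in> P \<Longrightarrow> x \<otimes> y \<in> P"
    "\<And>x. x \<in> P \<Longrightarrow> inv x \<in> P \<Longrightarrow> x \<in> torsion (carrier G)"
    "\<And>x. x \<in> carrier G \<Longrightarrow> x \<in> P \<or> inv x \<in> P"
proof -
  define T where "T = torsion (carrier G)"
  have Tc: "T \<subseteq> carrier G" by (auto simp: T_def torsion_def)
  have T1: "\<one> \<in> T" by (auto simp: T_def torsion_def intro!: exI[of _ "1::nat"])
  have Tm: "x \<otimes> y \<in> T" if xy: "x \<in> T" "y \<in> T" for x y
  proof -
    obtain n k where nk: "n > (0::nat)" "k > (0::nat)" "x [^] n = \<one>" "y [^] k = \<one>"
      using xy by (auto simp: T_def torsion_def)
    have c: "x \<in> carrier G" "y \<in> carrier G" using xy Tc by auto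
    have "(x \<otimes> y) [^] (n * k) = (x [^] n) [^] k \<otimes> (y [^] k) [^] n"
      using c by (simp add: nat_pow_distrib nat_pow_pow mult.commute)
    then show ?thesis using nk c by (auto simp: T_def torsion_def intro!: exI[of _ "n * k"])
  qed
  have Ti: "inv x \<in> T" if "x \<in> T" for x
    using that by (auto simp: T_def torsion_def nat_pow_inv)
  have Troot: "x \<in> T" if xk: "x \<in> carrier G" "x [^] k \<in> T" "k > 0" for x and k :: nat
  proof -
    obtain n where "n > (0::nat)" "(x [^] k) [^] n = \<one>" using xk(2) by (auto simp: T_def torsion_def)
    then show ?thesis
      using xk(1,3) by (auto simp: T_def torsion_def nat_pow_pow intro!: exI[of _ "k * n"])
  qed
  define \<P> where "\<P> = {P. P \<subseteq> carrier G \<and> T \<subseteq> P \<and> (\<forall>x\<in>P. \<forall>y\<in>P. x \<otimes> y \<in> P) \<and>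
    (\<forall>x\<in>P. inv x \<in> P \<longrightarrow> x \<in> T)}"
  have "T \<in> \<P>" using Tc Tm by (auto simp: \<P>_def)
  moreover have "\<Union>\<K> \<in> \<P>" if K: "subset.chain \<P> \<K>" "\<K> \<noteq> {}" for \<K>
  proof -
    have comp: "\<exists>P\<in>\<K>. x \<in> P \<and> y \<in> P" if xy: "x \<in> \<Union>\<K>" "y \<in> \<Union>\<K>" for x y
      proof -
      obtain P Q where "P \<in> \<K>" "x \<in> P" "Q \<in> \<K>" "y \<in> Q" using xy by auto
      moreover have "P \<subseteq> Q \<or> Q \<subseteq> P" using calculation K(1) by (auto simp: subset_chain_def)
      ultimately show ?thesis by blast
    qed
    have sub: "\<K> \<subseteq> \<P>" using K(1) by (simp add: subset.chain_def)
    have "x \<otimes> y \<in> \<Union>\<K>" if xy: "x \<in> \<Union>\<K>" "y \<in> \<Union>\<K>" for x y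
    proof -
      obtain P where "P \<in> \<K>" "x \<in> P" "y \<in> P" using comp[OF xy] by blast
      then show ?thesis using sub by (auto simp: \<P>_def)
    qed
    moreover have "x \<in> T" if xy: "x \<in> \<Union>\<K>" "inv x \<in> \<Union>\<K>" for x
    proof -
      obtain P where "P \<in> \<K>" "x \<in> P" "inv x \<in> P" using comp[OF xy] by blast
      then show ?thesis using sub by (auto simp: \<P>_def)
    qed
    moreover have "\<Union>\<K> \<subseteq> carrier G" "T \<subseteq> \<Union>\<K>" using sub K(2) unfolding \<P>_def by blast+
    ultimately show ?thesis by (auto simp: \<P>_def)
  qed
  ultimately obtain P where P: "P \<in> \<P>" and max: "\<And>Q. Q \<in> \<P> \<Longrightarrow> P \<subseteq> Q \<Longrightarrow> Q = P"
    using subset_Zorn_nonempty[of \<P>] by blast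
  have Pc: "P \<subseteq> carrier G" and PT: "T \<subseteq> P" and Pm: "\<And>x y. x \<in> P \<Longrightarrow> y \<in> P \<Longrightarrow> x \<otimes> y \<in> P"
    and Pi: "\<And>x. x \<in> P \<Longrightarrow> inv x \<in> P \<Longrightarrow> x \<in> T" using P by (auto simp: \<P>_def)
  have Ppow: "x [^] n \<in> P" if "x \<in> P" for x and n :: nat
    by (induction n) (use that T1 PT Pm in auto)
  \<comment> \<open>By maximality the monoid generated by \<open>P\<close> and \<open>x\<close>
    violates the torsion condition; writing the offending \<open>a\<close> and \<open>inv a\<close>
    as \<open>p x^n\<close> and \<open>q x^m\<close> gives a relation with a positive power of
    \<open>x\<close>.\<close>
  have key: "\<exists>k c. k > (0::nat) \<and> c \<in> P \<and> x [^] k \<otimes> c = \<one>" if x: "x \<in> carrier G" "x \<notin> P" for x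
  proof -
    define Q where "Q = {p \<otimes> x [^] n | p n. p \<in> P \<and> n \<in> (UNIV::nat set)}"
    have PQ: "P \<subseteq> Q"
    proof
      fix p assume "p \<in> P"
      then show "p \<in> Q" using Pc unfolding Q_def by (auto intro!: exI[of _ p] exI[of _ "0::nat"])
    qed
    have "x \<in> Q" unfolding Q_def using T1 PT x by (auto intro!: exI[of _ \<one>] exI[of _ "1::nat"])
    then have "Q \<notin> \<P>" using max[of Q] PQ x by blast
    moreover have "Q \<subseteq> carrier G" using Pc x by (auto simp: Q_def)
    moreover have "a \<otimes> b \<in> Q" if ab: "a \<in> Q" "b \<in> Q" for a b
    proof -
      obtain p n q m where *: "p \<in> P" "q \<in> P" "a = p \<otimes> x [^] (n::nat)" "b = q \<otimes> x [^] (m::nat)"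
        using ab by (auto simp: Q_def)
      have "p \<in> carrier G" "q \<in> carrier G" using * Pc by auto
      then have "a \<otimes> b = (p \<otimes> q) \<otimes> x [^] (n + m)"
        using * x by (simp add: m_ac flip: nat_pow_mult)
      then show ?thesis using Pm * unfolding Q_def by blast
    qed
    ultimately obtain a where a: "a \<in> Q" "inv a \<in> Q" "a \<notin> T" using PQ PT by (auto simp: \<P>_def)
    obtain p n q m where *: "p \<in> P" "q \<in> P" "a = p \<otimes> x [^] (n::nat)" "inv a = q \<otimes> x [^] (m::nat)"
      using a(1,2) unfolding Q_def by blast
    have c: "p \<in> carrier G" "q \<in> carrier G" "a \<in> carrier G" using * Pc x by auto
    have "(p \<otimes> x [^] n) \<otimes> (q \<otimes> x [^] m) = \<one>" using r_inv[OF c(3)] by (simp only: *(4)[symmetric] *(3)[symmetric])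
    then have eq: "x [^] (n + m) \<otimes> (p \<otimes> q) = \<one>"
      using c x by (simp add: m_ac flip: nat_pow_mult)
    \<comment> \<open>For \<open>n = m = 0\<close> the offending element and its inverse would both
      lie in \<open>P\<close> already.\<close>
    have "n + m > 0"
    proof (rule ccontr)
      assume "\<not> n + m > 0"
      then have "a = p" "inv a = q" using * c by auto
      then show False using Pi[of a] * a(3) by simp
    qed
    then show ?thesis using eq Pm * by blast
  qed
  have "x \<in> P \<or> inv x \<in> P" if x: "x \<in> carrier G" for x
  proof (rule ccontr)
    assume n: "\<not> (x \<in> P \<or> inv x \<in> P)"
    obtain k c where k: "k > (0::nat)" "c \<in> P" "x [^] k \<otimes> c = \<one>" using key x n by blast
    obtain l d where l: "l > (0::nat)" "d \<in> P" "inv x [^] l \<otimes> d = \<one>" using key[of "inv x"] x n by auto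
    have cd: "c \<in> carrier G" "d \<in> carrier G" using k l Pc by auto
    have ck: "c = inv (x [^] k)"
      using inv_equality[of c "x [^] k"] k(3) cd x by (simp add: m_comm)
    have dl: "d = x [^] l"
      using inv_equality[of d "inv x [^] l"] l(3) cd x by (simp add: m_comm nat_pow_inv)
    \<comment> \<open>Here \<open>c = x^-k\<close> and \<open>d = x^l\<close>, so \<open>c^l\<close>
      and \<open>d^k\<close> are mutually inverse members of \<open>P\<close>. Hence
      \<open>c^l\<close> is torsion, so is \<open>x\<close>, and \<open>P\<close> contains all
      torsion elements.\<close>
    have "inv (c [^] l) = d [^] k"
      using x by (simp add: ck dl nat_pow_inv nat_pow_pow mult.commute)
    then have "c [^] l \<in> T" using Pi[of "c [^] l"] Ppow k(2) l(2) by simp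
    then have "c \<in> T" using Troot cd l(1) by blast
    then have "x [^] k \<in> T" using Ti[of c] x by (simp add: ck)
    then show False using Troot[OF x] k(1) PT n by blast
  qed
  then show ?thesis using that[of P] Pc PT Pm Pi by (auto simp: T_def)
qed

section \<open>FC-groups modulo torsion\<close>

context group
begin

text \<open>\<open>V\<close> is the transfer from \<open>E\<close> to a central subgroup of finite
  index \<open>m\<close>; centrality makes it the \<open>m\<close>-th power map on \<open>Z\<close>.
  A positive power of every element lies in \<open>Z\<close> because two powers must share a
  coset.\<close>

lemma exists_transfer:
  assumes E: "subgroup E G" and Z: "subgroup Z G" "Z \<subseteq> E" "fin_cover Z E"
    and central: "\<And>z x. z \<in> Z \<Longrightarrow> x \<in> E \<Longrightarrow> z \<otimes> x = x \<otimes> z"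
  obtains V and m :: nat where "m > 0" "\<And>x. x \<in> E \<Longrightarrow> V x \<in> Z"
    "\<And>x y. x \<in> E \<Longrightarrow> y \<in> E \<Longrightarrow> V (x \<otimes> y) = V x \<otimes> V y"
    "\<And>z. z \<in> Z \<Longrightarrow> V z = z [^] m" "\<And>x. x \<in> E \<Longrightarrow> \<exists>k::nat. k > 0 \<and> x [^] k \<in> Z"
proof -
  interpret E: subgroup E G by fact
  interpret Z: subgroup Z G by fact
  have Ec: "E \<subseteq> carrier G" by (rule E.subset)
  let ?Z = "G\<lparr>carrier := Z\<rparr>"
  interpret ZG: group ?Z by (rule subgroup_imp_group) fact
  interpret ZC: comm_group ?Z
    by (rule ZG.group_comm_groupI) (use central Z(2) in auto)
  obtain F where F: "finite F" "F \<subseteq> E" "\<And>x. x \<in> E \<Longrightarrow> \<exists>f\<in>F. x \<otimes> inv f \<in> Z"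
    using Z(3) unfolding fin_cover_def by blast
  \<comment> \<open>The choice depends only on the coset \<open>Z x\<close>, since its defining
    predicate does; elements of one coset get literally the same representative.\<close>
  define \<rho> where "\<rho> x = (SOME f. f \<in> F \<and> x \<otimes> inv f \<in> Z)" for x
  have \<rho>: "\<rho> x \<in> F" "x \<otimes> inv (\<rho> x) \<in> Z" if "x \<in> E" for x
  proof -
    have "\<exists>f. f \<in> F \<and> x \<otimes> inv f \<in> Z" using F(3)[OF that] by blast
    from someI_ex[OF this] show "\<rho> x \<in> F" "x \<otimes> inv (\<rho> x) \<in> Z" by (simp_all add: \<rho>_def)
  qed
  have shift: "x \<otimes> inv f \<in> Z \<longleftrightarrow> y \<otimes> inv f \<in> Z"
    if "x \<otimes> inv y \<in> Z" "x \<in> E" "y \<in> E" "f \<in> E" for x y f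
  proof -
    have c: "x \<in> carrier G" "y \<in> carrier G" "f \<in> carrier G" using that Ec by auto
    have "x \<otimes> inv f = (x \<otimes> inv y) \<otimes> (y \<otimes> inv f)"
      and "y \<otimes> inv f = inv (x \<otimes> inv y) \<otimes> (x \<otimes> inv f)"
      using c by (simp_all add: m_assoc inv_mult_group)
    then show ?thesis using that(1) by (metis Z.m_closed Z.m_inv_closed)
  qed
  have \<rho>_eq: "\<rho> x = \<rho> y" if "x \<otimes> inv y \<in> Z" "x \<in> E" "y \<in> E" for x y
  proof -
    have "(f \<in> F \<and> x \<otimes> inv f \<in> Z) \<longleftrightarrow>
        (f \<in> F \<and> y \<otimes> inv f \<in> Z)" for f
      using shift[OF that, of f] F(2) by auto
    then show ?thesis unfolding \<rho>_def by simp
  qed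
  define R where "R = \<rho> ` E"
  have R: "finite R" "R \<subseteq> E" using \<rho> F by (auto simp: R_def intro: finite_subset)
  have RE: "r \<in> E" "r \<in> carrier G" if "r \<in> R" for r using that R(2) Ec by auto
  have \<rho>R: "\<rho> x \<in> R" if "x \<in> E" for x using that by (simp add: R_def)
  have \<rho>\<rho>: "\<rho> r = r" if r: "r \<in> R" for r
  proof -
    obtain x where x: "x \<in> E" "r = \<rho> x" using r by (auto simp: R_def)
    then show ?thesis using \<rho>_eq[OF \<rho>(2)[OF x(1)] x(1)] RE[OF r] by simp
  qed
  have Rinj: "r = s" if "r \<in> R" "s \<in> R" "r \<otimes> inv s \<in> Z" for r s
    using \<rho>_eq[of r s] that \<rho>\<rho> RE by metis
  have Rne: "R \<noteq> {}" using E.one_closed unfolding R_def by blast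
  define v where "v r x = r \<otimes> x \<otimes> inv (\<rho> (r \<otimes> x))" for r x
  have vZ: "v r x \<in> Z" if "r \<in> R" "x \<in> E" for r x
    using \<rho>(2)[of "r \<otimes> x"] that RE by (simp add: v_def)
  define V where "V x = finprod ?Z (\<lambda>r. v r x) R" for x
  define m where "m = card R"
  have VZ: "V x \<in> Z" if "x \<in> E" for x
    using ZC.finprod_closed[of "\<lambda>r. v r x" R] vZ that by (auto simp: V_def)
  have Vm: "V (x \<otimes> y) = V x \<otimes> V y" if x: "x \<in> E" and y: "y \<in> E" for x y
  proof -
    have xc: "x \<in> carrier G" "y \<in> carrier G" using x y Ec by auto
    \<comment> \<open>Cocycle identity: \<open>r x\<close> is \<open>v r x\<close> times its
      representative, so the factor of \<open>x y\<close> at \<open>r\<close> splits into the factor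
      of \<open>x\<close> at \<open>r\<close> and the factor of \<open>y\<close> at the next
      representative.\<close>
    have vv: "v r (x \<otimes> y) = v r x \<otimes> v (\<rho> (r \<otimes> x)) y" if r: "r \<in> R" for r
    proof -
      let ?s = "\<rho> (r \<otimes> x)"
      have rx: "r \<otimes> x \<in> E" using RE r x by simp
      have s: "?s \<in> E" "?s \<in> carrier G" using RE \<rho>R[OF rx] by auto
      have rc: "r \<in> carrier G" using RE r by auto
      have "r \<otimes> (x \<otimes> y) \<otimes> inv (?s \<otimes> y) = r \<otimes> x \<otimes> inv ?s"
        using rc xc s by (simp add: m_assoc inv_mult_group)
      then have eq: "\<rho> (r \<otimes> (x \<otimes> y)) = \<rho> (?s \<otimes> y)"
        using \<rho>_eq[of "r \<otimes> (x \<otimes> y)" "?s \<otimes> y"] \<rho>(2)[OF rx] s x y RE r by simp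
      have t: "\<rho> (?s \<otimes> y) \<in> carrier G" using RE \<rho>R s y by simp
      show ?thesis unfolding v_def eq using rc xc s t by (simp add: m_assoc)
    qed
    have inj: "inj_on (\<lambda>r. \<rho> (r \<otimes> x)) R"
    proof (rule inj_onI)
      fix r s assume rs: "r \<in> R" "s \<in> R" "\<rho> (r \<otimes> x) = \<rho> (s \<otimes> x)"
      have c: "r \<in> carrier G" "s \<in> carrier G" "r \<otimes> x \<in> E" "s \<otimes> x \<in> E" using RE rs x by auto
      have p: "\<rho> (s \<otimes> x) \<in> carrier G" using RE \<rho>R c by blast
      have "(r \<otimes> x \<otimes> inv (\<rho> (r \<otimes> x))) \<otimes> inv (s \<otimes> x \<otimes> inv (\<rho> (s \<otimes> x))) \<in> Z"
        using \<rho>(2) c by blast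
      moreover have "(r \<otimes> x \<otimes> inv (\<rho> (r \<otimes> x))) \<otimes> inv (s \<otimes> x \<otimes> inv (\<rho> (s \<otimes> x))) = r \<otimes> inv s"
        using rs(3) c xc p by (simp add: m_assoc inv_mult_group)
      ultimately show "r = s" using Rinj rs by simp
    qed
    \<comment> \<open>Right multiplication by \<open>x\<close> permutes the representatives, which
      allows the product over \<open>\<rho> (r x)\<close> to be reindexed over
      \<open>R\<close>.\<close>
    have img: "(\<lambda>r. \<rho> (r \<otimes> x)) ` R = R"
      by (rule card_subset_eq[OF R(1)]) (use \<rho>R RE x inj in \<open>auto simp: card_image\<close>)
    have "V (x \<otimes> y) = finprod ?Z (\<lambda>r. v r x \<otimes>\<^bsub>?Z\<^esub> v (\<rho> (r \<otimes> x)) y) R"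
      unfolding V_def by (rule ZC.finprod_cong') (use vv vZ \<rho>R RE x y in auto)
    also have "\<dots> = V x \<otimes>\<^bsub>?Z\<^esub> finprod ?Z (\<lambda>r. v (\<rho> (r \<otimes> x)) y) R"
      unfolding V_def by (rule ZC.finprod_multf) (use vZ \<rho>R RE x y in auto)
    also have "finprod ?Z (\<lambda>r. v (\<rho> (r \<otimes> x)) y) R = finprod ?Z (\<lambda>r. v r y) ((\<lambda>r. \<rho> (r \<otimes> x)) ` R)"
      by (rule ZC.finprod_reindex[symmetric]) (use vZ img y inj in auto)
    finally show ?thesis by (simp add: img V_def)
  qed
  have Vz: "V z = z [^] m" if z: "z \<in> Z" for z
  proof -
    have zc: "z \<in> carrier G" "z \<in> E" using z Z(2) Ec by auto
    have "v r z = z" if r: "r \<in> R" for r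
    proof -
      have rc: "r \<in> carrier G" "r \<in> E" using RE r by auto
      have "z \<otimes> r \<otimes> inv r = z" using zc rc by (simp add: m_assoc)
      then have "\<rho> (z \<otimes> r) = \<rho> r" using \<rho>_eq[of "z \<otimes> r" r] z zc rc by simp
      then show ?thesis
        using \<rho>\<rho>[OF r] rc zc unfolding v_def central[OF z rc(2), symmetric] by (simp add: m_assoc)
    qed
    then have "V z = finprod ?Z (\<lambda>r. z) R"
      unfolding V_def by (intro ZC.finprod_cong') (use z in auto)
    also have "\<dots> = z [^]\<^bsub>?Z\<^esub> m" unfolding m_def by (rule ZC.finprod_const) (use z in simp)
    finally show ?thesis by (simp flip: nat_pow_consistent)
  qed
  have root: "\<exists>k::nat. k > 0 \<and> x [^] k \<in> Z" if x: "x \<in> E" for x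
  proof -
    have pE: "x [^] n \<in> E" for n :: nat by (induction n) (use x in auto)
    have "\<not> inj_on (\<lambda>n::nat. \<rho> (x [^] n)) UNIV"
      using R(1) \<rho>R pE by (meson finite_imageD finite_subset image_subsetI infinite_UNIV_nat)
    then obtain a b :: nat where "a \<noteq> b" "\<rho> (x [^] a) = \<rho> (x [^] b)"
      unfolding inj_on_def by blast
    then obtain n k :: nat where nk: "n < k" "\<rho> (x [^] n) = \<rho> (x [^] k)"
      by (cases a b rule: linorder_cases) auto
    let ?r = "\<rho> (x [^] n)"
    have c: "x \<in> carrier G" "?r \<in> carrier G" using x Ec RE \<rho>R pE by auto
    have "(x [^] k \<otimes> inv ?r) \<otimes> inv (x [^] n \<otimes> inv ?r) \<in> Z"
      using \<rho>(2)[OF pE[of n]] \<rho>(2)[OF pE[of k]] nk(2) by simp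
    moreover have "x [^] k = x [^] (k - n) \<otimes> x [^] n" using nk(1) c by (simp add: nat_pow_mult)
    ultimately have "x [^] (k - n) \<in> Z" using c by (simp add: m_assoc inv_mult_group)
    then show ?thesis using nk(1) by (intro exI[of _ "k - n"]) simp
  qed
  have "m > 0" using Rne R(1) by (simp add: m_def card_gt_0_iff)
  from that[OF this VZ Vm Vz root] show ?thesis .
qed

text \<open>The FC-group \<open>E\<close> generated by \<open>X\<close> has a centre of finite index, so that the transfer
  embeds \<open>E\<close> modulo torsion into an orderable abelian group.\<close>

lemma fc_group_cone:
  assumes H: "subgroup H G" and X: "finite X" "X \<subseteq> fc_center H"
    and conj: "\<And>h x. h \<in> H \<Longrightarrow> x \<in> X \<Longrightarrow> h \<otimes> x \<otimes> inv h \<in> X"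
  obtains E P where "subgroup E G" "X \<subseteq> E" "E \<subseteq> fc_center H" "\<And>h x. h \<in> H \<Longrightarrow> x \<in> E \<Longrightarrow> h \<otimes> x \<otimes> inv h \<in> E"
    "subgroup (torsion E) G" "P \<subseteq> E" "torsion E \<subseteq> P"
    "\<And>x y. x \<in> P \<Longrightarrow> y \<in> P \<Longrightarrow> x \<otimes> y \<in> P"
    "\<And>x. x \<in> P \<Longrightarrow> inv x \<in> P \<Longrightarrow> x \<in> torsion E"
    "\<And>x. x \<in> E \<Longrightarrow> x \<in> P \<or> inv x \<in> P"
    "\<And>x y. x \<in> P \<Longrightarrow> y \<in> E \<Longrightarrow> y \<otimes> x \<otimes> inv y \<in> P"
proof -
  interpret H: subgroup H G by fact
  have Xc: "X \<subseteq> carrier G" and XH: "X \<subseteq> H" using X(2) H.subset by (auto simp: fc_center_def)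
  define E where "E = generate G X"
  have E: "subgroup E G" unfolding E_def by (rule generate_is_subgroup[OF Xc])
  interpret E: subgroup E G by fact
  have Ec: "E \<subseteq> carrier G" by (rule E.subset)
  have XE: "X \<subseteq> E" unfolding E_def by (auto intro: generate.incl)
  have EH: "E \<subseteq> H" unfolding E_def by (rule generate_subgroup_incl[OF XH H])
  have EF: "E \<subseteq> fc_center H" unfolding E_def
    by (rule generate_subgroup_incl[OF X(2) fc_center_subgroup[OF H]])
  have Econj: "h \<otimes> x \<otimes> inv h \<in> E" if h: "h \<in> H" and x: "x \<in> E" for h x
    using x unfolding E_def
  proof induction
    case one
    then show ?case using h H.subset generate.one by simp
  next
    case (incl x)
    then show ?case using conj[OF h] generate.incl by metis
  next
    case (inv x)
    have "h \<in> carrier G" "x \<in> carrier G" using h H.subset inv Xc by auto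
    then have "h \<otimes> inv x \<otimes> inv h = inv (h \<otimes> x \<otimes> inv h)" by (simp add: inv_mult_group m_assoc)
    then show ?case using generate.inv[OF conj[OF h inv]] by simp
  next
    case (eng x y)
    have "h \<in> carrier G" "x \<in> carrier G" "y \<in> carrier G"
      using h H.subset eng Ec by (auto simp: E_def)
    then have "h \<otimes> (x \<otimes> y) \<otimes> inv h = (h \<otimes> x \<otimes> inv h) \<otimes> (h \<otimes> y \<otimes> inv h)" by (simp add: m_assoc)
    then show ?case using eng generate.eng by metis
  qed
  \<comment> \<open>Centralizing the finitely many generators amounts to being central in
    \<open>E\<close>, and this subgroup has finite index since each generator has finitely many
    conjugates.\<close>
  define Z where "Z = cent E X"
  have Z: "subgroup Z G" "Z \<subseteq> E" unfolding Z_def using cent_subgroup[OF E Xc] by (auto simp: cent_def)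
  interpret Z: subgroup Z G by fact
  have Zfin: "fin_cover Z E" unfolding Z_def
    by (rule cent_fin_cover[OF E X(1) Xc]) (use X(2) fin_conj_mono[OF _ EH] in \<open>auto simp: fc_center_def\<close>)
  have central: "z \<otimes> x = x \<otimes> z" if z: "z \<in> Z" and x: "x \<in> E" for z x
  proof -
    have zc: "z \<in> carrier G" using z Z(2) Ec by auto
    have "X \<subseteq> cent E {z}" using z XE by (auto simp: Z_def cent_def)
    moreover have "subgroup (cent E {z}) G" by (rule cent_subgroup[OF E]) (use zc in auto)
    ultimately have "generate G X \<subseteq> cent E {z}" by (rule generate_subgroup_incl)
    then have "E \<subseteq> cent E {z}" unfolding E_def .
    then have "x \<otimes> z = z \<otimes> x" using x unfolding cent_def by blast
    then show ?thesis by (rule sym)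
  qed
  obtain V and m :: nat where V: "m > 0" "\<And>x. x \<in> E \<Longrightarrow> V x \<in> Z"
    "\<And>x y. x \<in> E \<Longrightarrow> y \<in> E \<Longrightarrow> V (x \<otimes> y) = V x \<otimes> V y"
    "\<And>z. z \<in> Z \<Longrightarrow> V z = z [^] m" "\<And>x. x \<in> E \<Longrightarrow> \<exists>k::nat. k > 0 \<and> x [^] k \<in> Z"
    using exists_transfer[OF E Z Zfin central] by metis
  let ?Z = "G\<lparr>carrier := Z\<rparr>"
  interpret ZG: group ?Z by (rule subgroup_imp_group) fact
  interpret ZC: comm_group ?Z
    by (rule ZG.group_comm_groupI) (use central Z(2) in auto)
  have torZ: "ZG.torsion (carrier ?Z) = torsion Z"
    by (auto simp: ZG.torsion_def torsion_def simp flip: nat_pow_consistent)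
  have invZ: "inv\<^bsub>?Z\<^esub> z = inv z" if "z \<in> Z" for z using m_inv_consistent[OF Z(1) that] .
  obtain Q where Q: "Q \<subseteq> Z" "torsion Z \<subseteq> Q" "\<And>x y. x \<in> Q \<Longrightarrow> y \<in> Q \<Longrightarrow> x \<otimes> y \<in> Q"
    "\<And>x. x \<in> Q \<Longrightarrow> inv x \<in> Q \<Longrightarrow> x \<in> torsion Z" "\<And>x. x \<in> Z \<Longrightarrow> x \<in> Q \<or> inv x \<in> Q"
  proof -
    obtain Q where Q: "Q \<subseteq> carrier ?Z" "torsion Z \<subseteq> Q"
      "\<And>x y. x \<in> Q \<Longrightarrow> y \<in> Q \<Longrightarrow> x \<otimes>\<^bsub>?Z\<^esub> y \<in> Q"
      "\<And>x. x \<in> Q \<Longrightarrow> inv\<^bsub>?Z\<^esub> x \<in> Q \<Longrightarrow> x \<in> torsion Z"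
      "\<And>x. x \<in> carrier ?Z \<Longrightarrow> x \<in> Q \<or> inv\<^bsub>?Z\<^esub> x \<in> Q"
      using ZC.exists_cone unfolding torZ by blast
    have QZ: "Q \<subseteq> Z" using Q(1) by simp
    show thesis
      by (rule that[OF QZ Q(2)]) (use Q(3-5) QZ invZ in \<open>auto simp: subset_eq\<close>)
  qed
  have Vc: "V x \<in> carrier G" if "x \<in> E" for x using V(2)[OF that] Z(2) Ec by auto
  have V1: "V \<one> = \<one>" using V(4)[OF Z.one_closed] by simp
  have Vi: "V (inv x) = inv (V x)" if x: "x \<in> E" for x
  proof -
    have "V (inv x) \<otimes> V x = \<one>" using V(3)[of "inv x" x] x V1 Ec by (simp add: subset_eq)
    then show ?thesis using Vc x by (simp add: inv_equality)
  qed
  have Vpow: "V (x [^] n) = V x [^] n" if x: "x \<in> E" for x and n :: nat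
  proof -
    have "x [^] n \<in> E \<and> V (x [^] n) = V x [^] n"
      by (induction n) (use x V1 V(3) in auto)
    then show ?thesis ..
  qed
  \<comment> \<open>Modulo torsion \<open>V\<close> is injective:
    \<open>x^(k m n) = (V x)^(k n)\<close> as soon as \<open>x^k\<close> lies in
    \<open>Z\<close>.\<close>
  have tor_iff: "x \<in> torsion E \<longleftrightarrow> V x \<in> torsion Z" if x: "x \<in> E" for x
  proof
    assume "x \<in> torsion E"
    then obtain n where n: "n > (0::nat)" "x [^] n = \<one>" by (auto simp: torsion_def)
    then show "V x \<in> torsion Z" using V(2)[OF x] Vpow[OF x, of n] V1 by (auto simp: torsion_def)
  next
    assume "V x \<in> torsion Z"
    then obtain n where n: "n > (0::nat)" "V x [^] n = \<one>" by (auto simp: torsion_def)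
    obtain k where k: "k > (0::nat)" "x [^] k \<in> Z" using V(5) x by blast
    have xc: "x \<in> carrier G" using x Ec by auto
    have "x [^] (k * m * n) = ((x [^] k) [^] m) [^] n" using xc by (simp add: nat_pow_pow)
    also have "\<dots> = (V x [^] k) [^] n" using V(4)[OF k(2)] Vpow[OF x] by simp
    also have "\<dots> = (V x [^] n) [^] k" using Vc[OF x] by (simp add: nat_pow_pow mult.commute)
    finally show "x \<in> torsion E" using n(1,2) k(1) V(1) x
      by (auto simp: torsion_def intro!: exI[of _ "k * m * n"])
  qed
  have torZsub: "torsion Z \<subseteq> Z" by (auto simp: torsion_def)
  have Ztm: "x \<otimes> y \<in> torsion Z" if xy: "x \<in> torsion Z" "y \<in> torsion Z" for x y
  proof -
    obtain n k where nk: "n > (0::nat)" "k > (0::nat)" "x [^] n = \<one>" "y [^] k = \<one>"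
      using xy by (auto simp: torsion_def)
    have c: "x \<in> Z" "y \<in> Z" "x \<in> carrier G" "y \<in> carrier G" using xy torZsub Z(2) Ec by auto
    have "(x \<otimes> y) [^] (n * k) = x [^] (n * k) \<otimes> y [^] (n * k)"
      using c central Z(2) by (intro pow_mult_distrib) auto
    also have "\<dots> = (x [^] n) [^] k \<otimes> (y [^] k) [^] n"
      using c by (simp add: nat_pow_pow mult.commute)
    finally show ?thesis using nk c by (auto simp: torsion_def intro!: exI[of _ "n * k"])
  qed
  have Zti: "inv x \<in> torsion Z" if "x \<in> torsion Z" for x
  proof -
    have "x \<in> carrier G" "x \<in> Z" using that torZsub Z(2) Ec by auto
    then show ?thesis using that by (auto simp: torsion_def nat_pow_inv)
  qed
  have torE: "subgroup (torsion E) G"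
  proof (rule subgroupI)
    show "torsion E \<subseteq> carrier G" using Ec by (auto simp: torsion_def)
    have "\<one> \<in> torsion E" by (auto simp: torsion_def intro!: exI[of _ "1::nat"])
    then show "torsion E \<noteq> {}" by blast
  next
    fix x assume x: "x \<in> torsion E"
    then have "x \<in> E" by (auto simp: torsion_def)
    then show "inv x \<in> torsion E" using x tor_iff[of x] tor_iff[of "inv x"] Vi Zti by simp
  next
    fix x y assume xy: "x \<in> torsion E" "y \<in> torsion E"
    then have "x \<in> E" "y \<in> E" by (auto simp: torsion_def)
    then show "x \<otimes> y \<in> torsion E"
      using xy tor_iff[of x] tor_iff[of y] tor_iff[of "x \<otimes> y"] V(3) Ztm by simp
  qed
  \<comment> \<open>The cone of \<open>Z\<close> is pulled back along \<open>V\<close>; it is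
    invariant under conjugation by \<open>E\<close> because the values of \<open>V\<close> are
    central.\<close>
  define P where "P = {x \<in> E. V x \<in> Q}"
  have "y \<otimes> x \<otimes> inv y \<in> P" if x: "x \<in> P" and y: "y \<in> E" for x y
  proof -
    have xE: "x \<in> E" using x by (simp add: P_def)
    have "V (y \<otimes> x \<otimes> inv y) = V y \<otimes> V x \<otimes> inv (V y)" using xE y V(3) Vi by simp
    also have "\<dots> = V x"
      using central[of "V y" "V x"] V(2) xE y Vc Z(2) by (simp add: m_assoc subset_eq)
    finally show ?thesis using x y xE by (simp add: P_def)
  qed
  moreover have "torsion E \<subseteq> P" using tor_iff Q(2) by (auto simp: P_def torsion_def)
  moreover have "x \<otimes> y \<in> P" if "x \<in> P" "y \<in> P" for x y
    using that V(3) Q(3) by (simp add: P_def)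
  moreover have "x \<in> torsion E" if "x \<in> P" "inv x \<in> P" for x
    using that Vi Q(4) tor_iff by (simp add: P_def)
  moreover have "x \<in> P \<or> inv x \<in> P" if "x \<in> E" for x
    using that Vi Q(5) V(2) by (simp add: P_def)
  moreover have "P \<subseteq> E" by (auto simp: P_def)
  ultimately show ?thesis using that[of E P] E XE EF Econj torE by blast
qed

end

section \<open>Graded rings\<close>

text \<open>Associativity is required of homogeneous elements only and is extended later.
  \<open>res C\<close> keeps the components with degree in an arbitrary set \<open>C\<close>, so
  that single degrees and cosets are treated alike. The two unit axioms take the place of invertible
  homogeneous elements.\<close>

locale graded_rng = group G + T: abelian_group T for G (structure) and T (structure) +
  fixes res :: "'a set \<Rightarrow> 'c \<Rightarrow> 'c"
  assumes T_closed [simp]: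
      "\<lbrakk>x \<in> carrier T; y \<in> carrier T\<rbrakk> \<Longrightarrow> x \<otimes>\<^bsub>T\<^esub> y \<in> carrier T"
    and T_l_distr: "\<lbrakk>x \<in> carrier T; y \<in> carrier T; z \<in> carrier T\<rbrakk>
      \<Longrightarrow> (x \<oplus>\<^bsub>T\<^esub> y) \<otimes>\<^bsub>T\<^esub> z = x \<otimes>\<^bsub>T\<^esub> z \<oplus>\<^bsub>T\<^esub> y \<otimes>\<^bsub>T\<^esub> z"
    and T_r_distr: "\<lbrakk>x \<in> carrier T; y \<in> carrier T; z \<in> carrier T\<rbrakk>
      \<Longrightarrow> z \<otimes>\<^bsub>T\<^esub> (x \<oplus>\<^bsub>T\<^esub> y) = z \<otimes>\<^bsub>T\<^esub> x \<oplus>\<^bsub>T\<^esub> z \<otimes>\<^bsub>T\<^esub> y"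
    and res_closed [simp]: "x \<in> carrier T \<Longrightarrow> res C x \<in> carrier T"
    and res_add: "\<lbrakk>x \<in> carrier T; y \<in> carrier T\<rbrakk> \<Longrightarrow> res C (x \<oplus>\<^bsub>T\<^esub> y) = res C x \<oplus>\<^bsub>T\<^esub> res C y"
    and res_res [simp]: "x \<in> carrier T \<Longrightarrow> res C (res C' x) = res (C \<inter> C') x"
    and res_empty [simp]: "x \<in> carrier T \<Longrightarrow> res {} x = \<zero>\<^bsub>T\<^esub>"
    and res_finite: "x \<in> carrier T \<Longrightarrow> finite {g \<in> carrier G. res {g} x \<noteq> \<zero>\<^bsub>T\<^esub>}"
    and res_eq_zero: "\<lbrakk>x \<in> carrier T; \<And>g. g \<in> carrier G \<Longrightarrow> res {g} x = \<zero>\<^bsub>T\<^esub>\<rbrakk> \<Longrightarrow> x = \<zero>\<^bsub>T\<^esub>"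
    and homog_mult: "\<lbrakk>g \<in> carrier G; h \<in> carrier G; x \<in> carrier T; y \<in> carrier T;
      res {g} x = x; res {h} y = y\<rbrakk> \<Longrightarrow> res {g \<otimes> h} (x \<otimes>\<^bsub>T\<^esub> y) = x \<otimes>\<^bsub>T\<^esub> y"
    and homog_assoc: "\<lbrakk>g \<in> carrier G; h \<in> carrier G; k \<in> carrier G;
      x \<in> carrier T; y \<in> carrier T; z \<in> carrier T; res {g} x = x; res {h} y = y; res {k} z = z\<rbrakk>
      \<Longrightarrow> (x \<otimes>\<^bsub>T\<^esub> y) \<otimes>\<^bsub>T\<^esub> z = x \<otimes>\<^bsub>T\<^esub> (y \<otimes>\<^bsub>T\<^esub> z)"
    and homog_unit_right: "\<lbrakk>g \<in> carrier G; x \<in> carrier T; res {g} x = x\<rbrakk>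
      \<Longrightarrow> \<exists>s t. s \<in> carrier T \<and> t \<in> carrier T \<and> res {inv g} s = s \<and> res {g} t = t
        \<and> x = x \<otimes>\<^bsub>T\<^esub> s \<otimes>\<^bsub>T\<^esub> t"
    and homog_unit_left: "\<lbrakk>g \<in> carrier G; x \<in> carrier T; res {g} x = x\<rbrakk>
      \<Longrightarrow> \<exists>s t. s \<in> carrier T \<and> t \<in> carrier T \<and> res {inv g} s = s \<and> res {g} t = t
        \<and> x = t \<otimes>\<^bsub>T\<^esub> (s \<otimes>\<^bsub>T\<^esub> x)"
begin

abbreviation mul (infixl "\<star>" 70) where "x \<star> y \<equiv> x \<otimes>\<^bsub>T\<^esub> y"
abbreviation plus (infixl "\<boxplus>" 65) where "x \<boxplus> y \<equiv> x \<oplus>\<^bsub>T\<^esub> y"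
abbreviation minus (infixl "\<boxminus>" 65) where "x \<boxminus> y \<equiv> x \<ominus>\<^bsub>T\<^esub> y"

definition deg :: "'a \<Rightarrow> 'c set" where
  "deg g = {x \<in> carrier T. res {g} x = x}"

definition supp :: "'c \<Rightarrow> 'a set" where
  "supp x = {g \<in> carrier G. res {g} x \<noteq> \<zero>\<^bsub>T\<^esub>}"

section \<open>Homogeneous components, supports and restriction to sets of degrees\<close>

lemma deg_carrier [simp]: "x \<in> deg g \<Longrightarrow> x \<in> carrier T" by (simp add: deg_def)

lemma degI: "x \<in> carrier T \<Longrightarrow> res {g} x = x \<Longrightarrow> x \<in> deg g" unfolding deg_def by blast

lemma degD: "x \<in> deg g \<Longrightarrow> res {g} x = x" unfolding deg_def by blast

lemma supp_carrier: "supp x \<subseteq> carrier G" by (auto simp: supp_def)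

lemma finite_supp [simp]: "x \<in> carrier T \<Longrightarrow> finite (supp x)"
  unfolding supp_def by (rule res_finite)

lemma res_zero [simp]: "res C \<zero>\<^bsub>T\<^esub> = \<zero>\<^bsub>T\<^esub>"
  using res_add[of "\<zero>\<^bsub>T\<^esub>" "\<zero>\<^bsub>T\<^esub>" C] T.add.l_cancel_one[of "res C \<zero>\<^bsub>T\<^esub>" "res C \<zero>\<^bsub>T\<^esub>"] by simp

lemma res_neg: assumes "x \<in> carrier T" shows "res C (\<ominus>\<^bsub>T\<^esub> x) = \<ominus>\<^bsub>T\<^esub> res C x"
proof -
  have "res C (\<ominus>\<^bsub>T\<^esub> x) \<boxplus> res C x = \<zero>\<^bsub>T\<^esub>"
    using res_add[of "\<ominus>\<^bsub>T\<^esub> x" x C] assms by (simp add: T.l_neg)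
  then show ?thesis using assms by (simp add: T.minus_equality)
qed

lemma res_minus: "x \<in> carrier T \<Longrightarrow> y \<in> carrier T \<Longrightarrow> res C (x \<boxminus> y) = res C x \<boxminus> res C y"
  by (simp add: a_minus_def res_add res_neg)

lemma minus_closed [simp]: "x \<in> carrier T \<Longrightarrow> y \<in> carrier T \<Longrightarrow> x \<boxminus> y \<in> carrier T"
  by (simp add: a_minus_def)

lemma minus_zero_iff: "x \<in> carrier T \<Longrightarrow> y \<in> carrier T \<Longrightarrow> x \<boxminus> y = \<zero>\<^bsub>T\<^esub> \<longleftrightarrow> x = y"
  by (metis T.add.inv_closed T.minus_equality T.minus_minus T.r_neg a_minus_def)

lemma eq_by_comps:
  assumes "x \<in> carrier T" "y \<in> carrier T" "\<And>g. g \<in> carrier G \<Longrightarrow> res {g} x = res {g} y"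
  shows "x = y"
proof -
  have "x \<boxminus> y = \<zero>\<^bsub>T\<^esub>"
    by (rule res_eq_zero) (use assms in \<open>auto simp: res_minus minus_zero_iff\<close>)
  then show ?thesis using assms by (simp add: minus_zero_iff)
qed

lemma supp_empty_iff: "x \<in> carrier T \<Longrightarrow> supp x = {} \<longleftrightarrow> x = \<zero>\<^bsub>T\<^esub>"
  using res_eq_zero[of x] by (auto simp: supp_def)

lemma supp_nonempty: "x \<in> carrier T \<Longrightarrow> x \<noteq> \<zero>\<^bsub>T\<^esub> \<Longrightarrow> \<exists>g. g \<in> supp x"
  using supp_empty_iff by blast

lemma supp_zero [simp]: "supp \<zero>\<^bsub>T\<^esub> = {}" by (simp add: supp_def)

lemma supp_res: assumes "x \<in> carrier T" shows "supp (res C x) = supp x \<inter> C"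
proof -
  have "{g} \<inter> C = (if g \<in> C then {g} else {})" for g by auto
  then show ?thesis using assms by (auto simp: supp_def split: if_splits)
qed

lemma supp_add: "x \<in> carrier T \<Longrightarrow> y \<in> carrier T \<Longrightarrow> supp (x \<boxplus> y) \<subseteq> supp x \<union> supp y"
  by (auto simp: supp_def res_add)

lemma supp_minus: "x \<in> carrier T \<Longrightarrow> y \<in> carrier T \<Longrightarrow> supp (x \<boxminus> y) \<subseteq> supp x \<union> supp y"
  by (auto simp: supp_def res_minus minus_zero_iff)

lemma res_sub: assumes "x \<in> carrier T" "supp x \<subseteq> C" shows "res C x = x"
proof (rule eq_by_comps)
  fix g assume g: "g \<in> carrier G"
  show "res {g} (res C x) = res {g} x"
  proof (cases "g \<in> C")
    case True
    then have "{g} \<inter> C = {g}" by auto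
    then show ?thesis using assms by simp
  next
    case False
    then have "{g} \<inter> C = {}" by auto
    then show ?thesis using assms g False by (auto simp: supp_def)
  qed
qed (use assms in auto)

lemma res_disj: assumes "x \<in> carrier T" "supp x \<inter> C = {}" shows "res C x = \<zero>\<^bsub>T\<^esub>"
  using supp_empty_iff[of "res C x"] assms by (simp add: supp_res)

lemma deg_iff: "g \<in> carrier G \<Longrightarrow> x \<in> deg g \<longleftrightarrow> x \<in> carrier T \<and> supp x \<subseteq> {g}"
proof
  assume x: "x \<in> deg g"
  then have "x \<in> carrier T" "res {g} x = x" by (simp_all add: degD)
  then show "x \<in> carrier T \<and> supp x \<subseteq> {g}" using supp_res[of x "{g}"] by (metis Int_lower2)
next
  assume "x \<in> carrier T \<and> supp x \<subseteq> {g}"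
  then show "x \<in> deg g" using res_sub[of x "{g}"] by (simp add: degI)
qed

lemma res_deg [simp]: "x \<in> carrier T \<Longrightarrow> res {g} x \<in> deg g" by (rule degI) auto

lemma zero_deg [simp]: "\<zero>\<^bsub>T\<^esub> \<in> deg g" by (rule degI) auto

lemma neg_deg: "x \<in> deg g \<Longrightarrow> \<ominus>\<^bsub>T\<^esub> x \<in> deg g" by (rule degI) (auto simp: res_neg degD)

lemma res_split:
  assumes "x \<in> carrier T" "C \<inter> C' = {}"
  shows "res (C \<union> C') x = res C x \<boxplus> res C' x"
proof (rule eq_by_comps)
  fix g assume g: "g \<in> carrier G"
  consider "g \<in> C" "g \<notin> C'" | "g \<in> C'" "g \<notin> C" | "g \<notin> C" "g \<notin> C'" using assms by auto
  then show "res {g} (res (C \<union> C') x) = res {g} (res C x \<boxplus> res C' x)"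
  proof cases
    case 1
    then have "{g} \<inter> (C \<union> C') = {g}" "{g} \<inter> C = {g}" "{g} \<inter> C' = {}" by auto
    then show ?thesis using assms by (simp add: res_add)
  next
    case 2
    then have "{g} \<inter> (C \<union> C') = {g}" "{g} \<inter> C' = {g}" "{g} \<inter> C = {}" by auto
    then show ?thesis using assms by (simp add: res_add)
  next
    case 3
    then have "{g} \<inter> (C \<union> C') = {}" "{g} \<inter> C' = {}" "{g} \<inter> C = {}" by auto
    then show ?thesis using assms by (simp add: res_add)
  qed
qed (use assms in auto)

lemma res_compl: assumes "x \<in> carrier T" shows "x = res C x \<boxplus> res (- C) x"
  using res_split[of x C "- C"] res_sub[of x UNIV] assms by simp

text \<open>The homogeneous case is limited to degrees in the support of \<open>x\<close>, which
  lets support conditions enter such inductions.\<close>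

lemma decomp_induct [consumes 1, case_names zero add comp]:
  assumes "x \<in> carrier T" "Q \<zero>\<^bsub>T\<^esub>"
    "\<And>u v. u \<in> carrier T \<Longrightarrow> v \<in> carrier T \<Longrightarrow> Q u \<Longrightarrow> Q v \<Longrightarrow> Q (u \<boxplus> v)"
    "\<And>g. g \<in> supp x \<Longrightarrow> Q (res {g} x)"
  shows "Q x"
proof -
  have "Q (res F x)" if "finite F" "F \<subseteq> supp x" for F
    using that
  proof (induction F rule: finite_induct)
    case empty
    then show ?case using assms by simp
  next
    case (insert g F)
    have "res (insert g F) x = res {g} x \<boxplus> res F x"
      using res_split[of x "{g}" F] assms(1) insert by simp
    then show ?case using assms insert by simp
  qed
  from this[OF finite_supp[OF assms(1)] order.refl] show ?thesis using assms(1) by (simp add: res_sub)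
qed

section \<open>Ring laws, degrees of products and local units\<close>

lemma T_null [simp]:
  assumes "x \<in> carrier T"
  shows "\<zero>\<^bsub>T\<^esub> \<star> x = \<zero>\<^bsub>T\<^esub>" "x \<star> \<zero>\<^bsub>T\<^esub> = \<zero>\<^bsub>T\<^esub>"
  using T_l_distr[of "\<zero>\<^bsub>T\<^esub>" "\<zero>\<^bsub>T\<^esub>" x] T_r_distr[of "\<zero>\<^bsub>T\<^esub>" "\<zero>\<^bsub>T\<^esub>" x]
    T.add.l_cancel_one[of "\<zero>\<^bsub>T\<^esub> \<star> x" "\<zero>\<^bsub>T\<^esub> \<star> x"] T.add.l_cancel_one[of "x \<star> \<zero>\<^bsub>T\<^esub>" "x \<star> \<zero>\<^bsub>T\<^esub>"] assms
  by simp_all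

lemma T_assoc:
  assumes "x \<in> carrier T" "y \<in> carrier T" "z \<in> carrier T"
  shows "x \<star> y \<star> z = x \<star> (y \<star> z)"
  using assms(1)
proof (induction x rule: decomp_induct)
  case (comp g)
  have g: "g \<in> carrier G" using comp by (simp add: supp_def)
  show ?case using assms(2)
  proof (induction y rule: decomp_induct)
    case (comp h)
    have h: "h \<in> carrier G" using comp by (simp add: supp_def)
    show ?case using assms(3)
    proof (induction z rule: decomp_induct)
      case (comp k)
      have k: "k \<in> carrier G" using comp by (simp add: supp_def)
      show ?case by (rule homog_assoc[OF g h k]) (use assms in auto)
    qed (use assms in \<open>auto simp: T_r_distr\<close>)
  qed (use assms in \<open>auto simp: T_l_distr T_r_distr\<close>)
qed (use assms in \<open>auto simp: T_l_distr\<close>)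

sublocale T: nonunital_ring T
  by unfold_locales (auto simp: T_assoc T_l_distr T_r_distr)

lemma T_neg_mult:
  assumes "x \<in> carrier T" "y \<in> carrier T"
  shows "(\<ominus>\<^bsub>T\<^esub> x) \<star> y = \<ominus>\<^bsub>T\<^esub> (x \<star> y)" "x \<star> (\<ominus>\<^bsub>T\<^esub> y) = \<ominus>\<^bsub>T\<^esub> (x \<star> y)"
proof -
  have "(\<ominus>\<^bsub>T\<^esub> x) \<star> y \<boxplus> x \<star> y = \<zero>\<^bsub>T\<^esub>" using assms by (simp add: T.l_neg flip: T_l_distr)
  then show "(\<ominus>\<^bsub>T\<^esub> x) \<star> y = \<ominus>\<^bsub>T\<^esub> (x \<star> y)" using assms by (simp add: T.minus_equality)
  have "x \<star> (\<ominus>\<^bsub>T\<^esub> y) \<boxplus> x \<star> y = \<zero>\<^bsub>T\<^esub>" using assms by (simp add: T.l_neg flip: T_r_distr)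
  then show "x \<star> (\<ominus>\<^bsub>T\<^esub> y) = \<ominus>\<^bsub>T\<^esub> (x \<star> y)" using assms by (simp add: T.minus_equality)
qed

lemma T_minus_distr:
  assumes "x \<in> carrier T" "y \<in> carrier T" "z \<in> carrier T"
  shows "(x \<boxminus> y) \<star> z = x \<star> z \<boxminus> y \<star> z" "z \<star> (x \<boxminus> y) = z \<star> x \<boxminus> z \<star> y"
  using assms by (simp_all add: a_minus_def T_l_distr T_r_distr T_neg_mult)

lemma deg_mult: "\<lbrakk>g \<in> carrier G; h \<in> carrier G; x \<in> deg g; y \<in> deg h\<rbrakk> \<Longrightarrow> x \<star> y \<in> deg (g \<otimes> h)"
  by (rule degI) (auto simp: degD homog_mult)

lemma unit_right:
  assumes "g \<in> carrier G" "x \<in> deg g"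
  obtains s t where "s \<in> deg (inv g)" "t \<in> deg g" "x = x \<star> s \<star> t"
  using homog_unit_right[of g x] assms by (metis deg_carrier degD degI)

lemma unit_left:
  assumes "g \<in> carrier G" "x \<in> deg g"
  obtains s t where "s \<in> deg (inv g)" "t \<in> deg g" "x = t \<star> (s \<star> x)"
  using homog_unit_left[of g x] assms by (metis deg_carrier degD degI)

lemma supp_mult:
  assumes "x \<in> carrier T" "y \<in> carrier T"
  shows "supp (x \<star> y) \<subseteq> {a \<otimes> b | a b. a \<in> supp x \<and> b \<in> supp y}" 
proof -
  define P where "P = {a \<otimes> b | a b. a \<in> supp x \<and> b \<in> supp y}"
  have "supp (x \<star> y) \<subseteq> P"
    using assms(1)
  proof (induction x rule: decomp_induct)
    case zero
    then show ?case using assms by simp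
  next
    case (add u v)
    then show ?case using assms supp_add[of "u \<star> y" "v \<star> y"] by (auto simp: T_l_distr)
  next
    case (comp g)
    show ?case using assms(2)
    proof (induction y rule: decomp_induct)
      case zero
      then show ?case using assms by simp
    next
      case (add u v)
      then show ?case using assms supp_add[of "res {g} x \<star> u" "res {g} x \<star> v"] by (auto simp: T_r_distr)
    next
      case c2: (comp h)
      have c: "g \<in> carrier G" "h \<in> carrier G" using comp c2 by (auto simp: supp_def)
      then have "supp (res {g} x \<star> res {h} y) \<subseteq> {g \<otimes> h}"
        using deg_mult[OF c, of "res {g} x" "res {h} y"] assms deg_iff[of "g \<otimes> h"] by simp
      then show ?case using comp c2 by (auto simp: P_def)
    qed
  qed
  then show ?thesis by (simp add: P_def)
qed

text \<open>When membership of a product degree in \<open>K\<close> is decided by the left factor,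
  products from \<open>C\<close> stay in \<open>K\<close> and the others leave it. With cosets for
  \<open>K\<close> and \<open>C\<close> this identifies a part of a product with a product of
  parts.\<close>

lemma res_mult_left:
  assumes "x \<in> carrier T" "y \<in> carrier T"
    "\<And>a b. a \<in> supp x \<Longrightarrow> b \<in> supp y \<Longrightarrow> a \<otimes> b \<in> K \<longleftrightarrow> a \<in> C"
  shows "res K (x \<star> y) = res C x \<star> y"
proof -
  have "x \<star> y = res C x \<star> y \<boxplus> res (- C) x \<star> y"
    using assms res_compl[of x C] by (metis T_l_distr res_closed)
  moreover have "res K (res C x \<star> y) = res C x \<star> y"
    by (rule res_sub) (use assms supp_mult[of "res C x" y] in \<open>auto simp: supp_res\<close>)
  moreover have "res K (res (- C) x \<star> y) = \<zero>\<^bsub>T\<^esub>"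
    by (rule res_disj) (use assms supp_mult[of "res (- C) x" y] in \<open>auto simp: supp_res\<close>)
  ultimately show ?thesis using assms by (simp add: res_add)
qed

lemma res_mult_right:
  assumes "x \<in> carrier T" "y \<in> carrier T"
    "\<And>a b. a \<in> supp x \<Longrightarrow> b \<in> supp y \<Longrightarrow> a \<otimes> b \<in> K \<longleftrightarrow> b \<in> C"
  shows "res K (x \<star> y) = x \<star> res C y"
proof -
  have "x \<star> y = x \<star> res C y \<boxplus> x \<star> res (- C) y"
    using assms res_compl[of y C] by (metis T_r_distr res_closed)
  moreover have "res K (x \<star> res C y) = x \<star> res C y"
    by (rule res_sub) (use assms supp_mult[of x "res C y"] in \<open>auto simp: supp_res\<close>)
  moreover have "res K (x \<star> res (- C) y) = \<zero>\<^bsub>T\<^esub>"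
    by (rule res_disj) (use assms supp_mult[of x "res (- C) y"] in \<open>auto simp: supp_res\<close>)
  ultimately show ?thesis using assms by (simp add: res_add)
qed

lemma supp_deg: "g \<in> carrier G \<Longrightarrow> s \<in> deg g \<Longrightarrow> supp s \<subseteq> {g}"
  by (simp add: deg_iff)

lemma res_mult_deg_right:
  assumes "x \<in> carrier T" "t \<in> carrier G" "s \<in> deg t" "g \<in> carrier G"
  shows "res {g \<otimes> t} (x \<star> s) = res {g} x \<star> s"
  by (rule res_mult_left)
    (use assms supp_deg[of t s] supp_carrier in \<open>auto simp: right_cancel subset_eq\<close>)

lemma res_mult_deg_left:
  assumes "x \<in> carrier T" "t \<in> carrier G" "s \<in> deg t" "g \<in> carrier G"
  shows "res {t \<otimes> g} (s \<star> x) = s \<star> res {g} x"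
  by (rule res_mult_right)
    (use assms supp_deg[of t s] supp_carrier in \<open>auto simp: Units_l_cancel subset_eq\<close>)

lemma supp_mult_deg_right:
  "\<lbrakk>x \<in> carrier T; t \<in> carrier G; s \<in> deg t\<rbrakk> \<Longrightarrow> supp (x \<star> s) \<subseteq> (\<lambda>g. g \<otimes> t) ` supp x"
  using supp_mult[of x s] supp_deg[of t s] by fastforce

lemma supp_mult_deg_left:
  "\<lbrakk>x \<in> carrier T; t \<in> carrier G; s \<in> deg t\<rbrakk> \<Longrightarrow> supp (s \<star> x) \<subseteq> (\<lambda>g. t \<otimes> g) ` supp x"
  using supp_mult[of s x] supp_deg[of t s] by fastforce

text \<open>Substitute for translation by \<open>g^-1\<close>: one factor of a local unit for the
  component of degree \<open>g\<close> moves this component to degree \<open>\<one>\<close> without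
  killing it.\<close>

lemma shift_right:
  assumes "x \<in> carrier T" "g \<in> supp x"
  obtains s where "s \<in> deg (inv g)" "res {g} x \<star> s \<noteq> \<zero>\<^bsub>T\<^esub>" "\<one> \<in> supp (x \<star> s)"
proof -
  have g: "g \<in> carrier G" "res {g} x \<noteq> \<zero>\<^bsub>T\<^esub>" using assms by (auto simp: supp_def)
  obtain s t where st: "s \<in> deg (inv g)" "t \<in> deg g" "res {g} x = res {g} x \<star> s \<star> t"
    using unit_right[of g "res {g} x"] g assms by auto
  have "res {g} x \<star> s \<noteq> \<zero>\<^bsub>T\<^esub>" using st g by (metis T_null(1) deg_carrier)
  then have "\<one> \<in> supp (x \<star> s)"
    using res_mult_deg_right[of x "inv g" s g] g assms st by (simp add: supp_def)
  then show ?thesis using that st(1) \<open>res {g} x \<star> s \<noteq> \<zero>\<^bsub>T\<^esub>\<close> by blast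
qed

lemma shift_left:
  assumes "x \<in> carrier T" "g \<in> supp x"
  obtains s where "s \<in> deg (inv g)" "s \<star> res {g} x \<noteq> \<zero>\<^bsub>T\<^esub>" "\<one> \<in> supp (s \<star> x)"
proof -
  have g: "g \<in> carrier G" "res {g} x \<noteq> \<zero>\<^bsub>T\<^esub>" using assms by (auto simp: supp_def)
  obtain s t where st: "s \<in> deg (inv g)" "t \<in> deg g" "res {g} x = t \<star> (s \<star> res {g} x)"
    using unit_left[of g "res {g} x"] g assms by auto
  have "s \<star> res {g} x \<noteq> \<zero>\<^bsub>T\<^esub>" using st g by (metis T_null(2) deg_carrier)
  then have "\<one> \<in> supp (s \<star> x)"
    using res_mult_deg_left[of x "inv g" s g] g assms st by (simp add: supp_def)
  then show ?thesis using that st(1) \<open>s \<star> res {g} x \<noteq> \<zero>\<^bsub>T\<^esub>\<close> by blast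
qed

text \<open>Induction on the support: \<open>e\<close> fixes one component, \<open>f\<close> fixes
  the remainder \<open>x - e x\<close> of smaller support, and the two are joined by
  \<open>1 - e' = (1 - f)(1 - e)\<close>.\<close>

lemma common_left_unit:
  assumes "x \<in> carrier T"
  shows "\<exists>e\<in>deg \<one>. e \<star> x = x"
  using assms
proof (induction "card (supp x)" arbitrary: x rule: less_induct)
  case less
  show ?case
  proof (cases "x = \<zero>\<^bsub>T\<^esub>")
    case True
    then show ?thesis by (intro bexI[of _ "\<zero>\<^bsub>T\<^esub>"]) auto
  next
    case False
    then obtain g where g: "g \<in> supp x" using supp_nonempty less by blast
    have gc: "g \<in> carrier G" using g by (simp add: supp_def)
    obtain s t where st: "s \<in> deg (inv g)" "t \<in> deg g" "res {g} x = t \<star> (s \<star> res {g} x)"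
      using unit_left[of g "res {g} x"] gc less by auto
    define e where "e = t \<star> s"
    have e: "e \<in> deg \<one>" using deg_mult[of g "inv g" t s] st gc by (simp add: e_def)
    have eg: "e \<star> res {g} x = res {g} x" using st less by (simp add: e_def T_assoc)
    define y where "y = x \<boxminus> e \<star> x"
    have yc: "y \<in> carrier T" using less e by (simp add: y_def)
    have "supp y \<subseteq> supp x"
      using supp_minus[of x "e \<star> x"] supp_mult_deg_left[of x \<one> e] less e supp_carrier
      by (force simp: y_def)
    moreover have "g \<notin> supp y"
      using res_mult_deg_left[of x \<one> e g] eg gc less e by (simp add: supp_def y_def res_minus minus_zero_iff)
    ultimately have "card (supp y) < card (supp x)"
      using g less by (intro psubset_card_mono) auto
    then obtain f where f: "f \<in> deg \<one>" "f \<star> y = y" using less yc by blast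
    define e' where "e' = (e \<boxplus> f) \<boxminus> f \<star> e"
    have e': "e' \<in> deg \<one>"
      using e f deg_mult[of \<one> \<one> f e]
      by (intro degI) (auto simp: e'_def degD res_add res_minus)
    have cc: "e \<in> carrier T" "f \<in> carrier T" "x \<in> carrier T" using e f less by auto
    have "e' \<star> x = (e \<star> x \<boxplus> f \<star> x) \<boxminus> f \<star> (e \<star> x)"
      using cc by (simp add: e'_def T_minus_distr T_l_distr T_assoc)
    also have "\<dots> = e \<star> x \<boxplus> f \<star> y"
      using cc by (simp add: y_def T_minus_distr) (simp add: a_minus_def T.a_assoc)
    also have "\<dots> = e \<star> x \<boxplus> (x \<boxminus> e \<star> x)" using f(2) by (simp add: y_def)
    also have "\<dots> = x" using cc by (simp add: a_minus_def T.a_lcomm T.r_neg)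
    finally show ?thesis using e' by blast
  qed
qed

end

section \<open>Homogeneous ideals and graded primeness\<close>

text \<open>On \<open>S\<close> the map \<open>q\<close> factors through \<open>p\<close>, so its
  image is no larger, and strictly smaller once two values of \<open>p\<close> are identified. This
  compares numbers of cosets of different subgroups.\<close>

lemma card_image_factor:
  assumes "finite S" "\<And>a b. a \<in> S \<Longrightarrow> b \<in> S \<Longrightarrow> p a = p b \<Longrightarrow> q a = q b"
  shows "card (q ` S) \<le> card (p ` S)"
    and "a \<in> S \<Longrightarrow> b \<in> S \<Longrightarrow> p a \<noteq> p b \<Longrightarrow> q a = q b \<Longrightarrow> card (q ` S) < card (p ` S)"
proof -
  define f where "f c = q (SOME a. a \<in> S \<and> p a = c)" for c
  have f: "f (p a) = q a" if a: "a \<in> S" for a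
  proof -
    have "(SOME b. b \<in> S \<and> p b = p a) \<in> S \<and> p (SOME b. b \<in> S \<and> p b = p a) = p a"
      by (rule someI_ex) (use a in blast)
    then show ?thesis unfolding f_def using assms(2) a by metis
  qed
  have img: "q ` S = f ` p ` S" using f by (force simp: image_image)
  show "card (q ` S) \<le> card (p ` S)" unfolding img using assms(1) by (intro card_image_le) auto
  show "card (q ` S) < card (p ` S)" if ab: "a \<in> S" "b \<in> S" "p a \<noteq> p b" "q a = q b"
  proof (rule ccontr)
    assume "\<not> ?thesis"
    then have "card (f ` p ` S) = card (p ` S)"
      using card_image_le[of "p ` S" f] assms(1) unfolding img by simp
    then have "inj_on f (p ` S)" using assms(1) by (intro eq_card_imp_inj_on) auto
    then show False using ab f[of a] f[of b] unfolding inj_on_def by fastforce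
  qed
qed

lemma (in group) rcos_eq_iff:
  assumes "subgroup D G" "g \<in> carrier G" "h \<in> carrier G"
  shows "D #> g = D #> h \<longleftrightarrow> g \<otimes> inv h \<in> D"
proof
  assume "D #> g = D #> h"
  then have "g \<in> D #> h" using rcos_self[OF assms(2,1)] by simp
  then obtain d where d: "d \<in> D" "g = d \<otimes> h" by (auto simp: r_coset_def)
  have "d \<in> carrier G" using d assms(1) by (auto dest: subgroup.mem_carrier)
  then show "g \<otimes> inv h \<in> D" using d assms by (simp add: m_assoc)
next
  assume d: "g \<otimes> inv h \<in> D"
  have "(g \<otimes> inv h) \<otimes> h \<in> D #> h" using d by (auto simp: r_coset_def)
  then have "g \<in> D #> h" using assms by (simp add: m_assoc)
  then show "D #> g = D #> h" using repr_independence[OF _ assms(3,1)] by simp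
qed

lemma (in group) rcos_mem_iff:
  assumes "subgroup D G" "g \<in> carrier G" "h \<in> carrier G"
  shows "g \<in> D #> h \<longleftrightarrow> g \<otimes> inv h \<in> D"
  using assms rcos_eq_iff[OF assms] repr_independence[OF _ assms(3,1), of g] rcos_self[OF assms(2,1)]
  by auto

context graded_rng
begin

lemma res_deg_cases: "g \<in> carrier G \<Longrightarrow> x \<in> deg g \<Longrightarrow> res C x = (if g \<in> C then x else \<zero>\<^bsub>T\<^esub>)"
  using supp_deg[of g x] by (auto intro!: res_sub res_disj)

text \<open>The two-sided ideal generated over the degrees in a subgroup \<open>U\<close>. Sums of
  multiples \<open>s a t\<close> suffice: zero, negatives and, by local units, a generator of degree
  \<open>\<one>\<close> itself are among them.\<close>

inductive_set gen :: "'a set \<Rightarrow> 'c \<Rightarrow> 'c set" for U a where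
  gen_base: "\<lbrakk>u \<in> U; v \<in> U; s \<in> deg u; t \<in> deg v\<rbrakk> \<Longrightarrow> s \<star> a \<star> t \<in> gen U a"
| gen_add: "\<lbrakk>x \<in> gen U a; y \<in> gen U a\<rbrakk> \<Longrightarrow> x \<boxplus> y \<in> gen U a"

text \<open>Graded counterpart of \<open>I S_H\<close>. The last clause is the annihilation
  condition in (ii) for degrees outside \<open>H\<close>, written without the action;
  \<open>I\<close> is recovered as the part of degree \<open>\<one>\<close>.\<close>

definition homog_ideal :: "'a set \<Rightarrow> 'c set \<Rightarrow> bool" where
  "homog_ideal H J \<longleftrightarrow> J \<subseteq> carrier T \<and> (\<forall>x\<in>J. supp x \<subseteq> H) \<and> \<zero>\<^bsub>T\<^esub> \<in> J \<and>
    (\<forall>x\<in>J. \<forall>y\<in>J. x \<boxplus> y \<in> J) \<and> (\<forall>x\<in>J. \<forall>C. res C x \<in> J) \<and>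
    (\<forall>x\<in>J. \<forall>h\<in>H. \<forall>s\<in>deg h. s \<star> x \<in> J \<and> x \<star> s \<in> J) \<and>
    (\<forall>x\<in>J. \<forall>y\<in>J. \<forall>g\<in>carrier G - H. \<forall>s\<in>deg g. x \<star> s \<star> y = \<zero>\<^bsub>T\<^esub>)"

lemma homog_idealD:
  assumes "homog_ideal H J"
  shows "x \<in> J \<Longrightarrow> x \<in> carrier T" "x \<in> J \<Longrightarrow> supp x \<subseteq> H" "\<zero>\<^bsub>T\<^esub> \<in> J"
    "x \<in> J \<Longrightarrow> y \<in> J \<Longrightarrow> x \<boxplus> y \<in> J" "x \<in> J \<Longrightarrow> res C x \<in> J"
    "x \<in> J \<Longrightarrow> h \<in> H \<Longrightarrow> s \<in> deg h \<Longrightarrow> s \<star> x \<in> J"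
    "x \<in> J \<Longrightarrow> h \<in> H \<Longrightarrow> s \<in> deg h \<Longrightarrow> x \<star> s \<in> J"
    "x \<in> J \<Longrightarrow> y \<in> J \<Longrightarrow> g \<in> carrier G \<Longrightarrow> s \<in> deg g \<Longrightarrow> x \<star> s \<star> y \<noteq> \<zero>\<^bsub>T\<^esub> \<Longrightarrow> g \<in> H"
  using assms unfolding homog_ideal_def by blast+

lemma homog_ideal_mult:
  assumes "homog_ideal H J" "x \<in> J" "y \<in> carrier T" "supp y \<subseteq> H"
  shows "x \<star> y \<in> J" "y \<star> x \<in> J"
proof -
  note J = homog_idealD[OF assms(1)]
  have xc: "x \<in> carrier T" using J assms(2) by blast
  show "x \<star> y \<in> J" using assms(3)
  proof (induction y rule: decomp_induct)
    case (comp g)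
    then show ?case using J(7)[OF assms(2), of g "res {g} y"] assms by auto
  qed (use J xc in \<open>auto simp: T_r_distr\<close>)
  show "y \<star> x \<in> J" using assms(3)
  proof (induction y rule: decomp_induct)
    case (comp g)
    then show ?case using J(6)[OF assms(2), of g "res {g} y"] assms by auto
  qed (use J xc in \<open>auto simp: T_l_distr\<close>)
qed

lemma gen_carrier: assumes "a \<in> carrier T" shows "x \<in> gen U a \<Longrightarrow> x \<in> carrier T"
  by (induction rule: gen.induct) (use assms in auto)

lemma gen_mult:
  assumes "subgroup U G" "a \<in> carrier T" "x \<in> gen U a" "g \<in> U" "r \<in> deg g"
  shows "r \<star> x \<in> gen U a" "x \<star> r \<in> gen U a"
proof -
  interpret U: subgroup U G by fact
  have rc: "r \<in> carrier T" using assms(5) by simp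
  show "r \<star> x \<in> gen U a" using assms(3)
  proof induction
    case (gen_base u v s t)
    then have "r \<star> s \<in> deg (g \<otimes> u)" using assms(4,5) by (intro deg_mult) auto
    then have "(r \<star> s) \<star> a \<star> t \<in> gen U a"
      using gen_base assms(4) by (intro gen.gen_base[of "g \<otimes> u" _ v]) auto
    then show ?case using gen_base rc assms(2) by (simp add: T_assoc)
  next
    case (gen_add x y)
    then show ?case
      using gen_carrier[OF assms(2)] rc by (simp add: T_r_distr gen.gen_add)
  qed
  show "x \<star> r \<in> gen U a" using assms(3)
  proof induction
    case (gen_base u v s t)
    then have "t \<star> r \<in> deg (v \<otimes> g)" using assms(4,5) by (intro deg_mult) auto
    then have "s \<star> a \<star> (t \<star> r) \<in> gen U a"
      using gen_base assms(4) by (intro gen.gen_base[of u _ "v \<otimes> g"]) auto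
    then show ?case using gen_base rc assms(2) by (simp add: T_assoc)
  next
    case (gen_add x y)
    then show ?case
      using gen_carrier[OF assms(2)] rc by (simp add: T_l_distr gen.gen_add)
  qed
qed

text \<open>For \<open>g\<close> outside \<open>U\<close> the degree \<open>v g u'\<close> of
  \<open>t r s'\<close> is outside \<open>U\<close> as well, so \<open>k (t r s') k\<close> vanishes
  inside the product of \<open>s k t\<close>, \<open>r\<close> and \<open>s' k t'\<close>.\<close>

lemma homog_ideal_gen:
  assumes U: "subgroup U G" and k: "k \<in> deg \<one>"
    and off: "\<And>g s. g \<in> carrier G \<Longrightarrow> s \<in> deg g \<Longrightarrow> k \<star> s \<star> k \<noteq> \<zero>\<^bsub>T\<^esub> \<Longrightarrow> g \<in> U"
  shows "homog_ideal U (gen U k)"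
proof -
  interpret U: subgroup U G by fact
  have kc: "k \<in> carrier T" using k by simp
  note gc = gen_carrier[OF kc]
  have zero: "\<zero>\<^bsub>T\<^esub> \<in> gen U k"
    using gen_base[of \<one> U \<one> "\<zero>\<^bsub>T\<^esub>" "\<zero>\<^bsub>T\<^esub>" k] kc by simp
  have base_deg: "s \<star> k \<star> t \<in> deg (u \<otimes> v)" if "u \<in> U" "v \<in> U" "s \<in> deg u" "t \<in> deg v" for s t u v
  proof -
    have "s \<star> k \<in> deg u" using deg_mult[of u \<one> s k] that k by simp
    then show ?thesis using deg_mult[of u v] that by simp
  qed
  have "supp x \<subseteq> U" if "x \<in> gen U k" for x
    using that
  proof induction
    case (gen_base u v s t)
    then show ?case using supp_deg[OF _ base_deg[OF gen_base]] by auto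
  next
    case (gen_add x y)
    then show ?case using supp_add[of x y] gc by blast
  qed
  moreover have "res C x \<in> gen U k" if "x \<in> gen U k" for x C
    using that
  proof induction
    case (gen_base u v s t)
    then show ?case
      using res_deg_cases[OF _ base_deg[OF gen_base]] zero gen.gen_base[OF gen_base, of k] by auto
  next
    case (gen_add x y)
    then show ?case using gc by (simp add: res_add gen.gen_add)
  qed
  moreover have "x \<star> r \<star> y = \<zero>\<^bsub>T\<^esub>"
    if x: "x \<in> gen U k" and y: "y \<in> gen U k" and g: "g \<in> carrier G - U" and r: "r \<in> deg g" for x y g r
    using x
  proof induction
    case (gen_base u v s t)
    note xb = this
    have rc: "r \<in> carrier T" using r by simp
    show ?case using y
    proof induction
      case (gen_base u' v' s' t')
      have c: "u \<in> carrier G" "v \<in> carrier G" "u' \<in> carrier G" "v' \<in> carrier G" "g \<in> carrier G"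
        using xb gen_base g by auto
      have tc: "s \<in> carrier T" "t \<in> carrier T" "s' \<in> carrier T" "t' \<in> carrier T"
        using xb gen_base by auto
      have d: "t \<star> r \<star> s' \<in> deg (v \<otimes> g \<otimes> u')"
        using deg_mult[of "v \<otimes> g" u'] deg_mult[of v g t r] xb gen_base r c by simp
      have "v \<otimes> g \<otimes> u' \<notin> U"
      proof
        assume "v \<otimes> g \<otimes> u' \<in> U"
        then have "inv v \<otimes> (v \<otimes> g \<otimes> u') \<otimes> inv u' \<in> U" using xb gen_base by simp
        then show False using c g by (simp add: m_assoc)
      qed
      then have "k \<star> (t \<star> r \<star> s') \<star> k = \<zero>\<^bsub>T\<^esub>" using off[OF _ d] c by auto
      then have "s \<star> (k \<star> (t \<star> r \<star> s') \<star> k) \<star> t' = \<zero>\<^bsub>T\<^esub>" using tc by simp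
      then show ?case using tc kc rc by (simp add: T_assoc)
    next
      case (gen_add y z)
      then show ?case using gc xb kc rc by (simp add: T_r_distr)
    qed
  next
    case (gen_add x z)
    then show ?case using gc y r by (simp add: T_l_distr)
  qed
  moreover have "r \<star> x \<in> gen U k \<and> x \<star> r \<in> gen U k" if "x \<in> gen U k" "g \<in> U" "r \<in> deg g" for x g r
    using gen_mult[OF U kc that] by simp
  moreover have "gen U k \<subseteq> carrier T" using gc by blast
  ultimately show ?thesis
    unfolding homog_ideal_def using zero gen_add by (intro conjI ballI allI) simp_all
qed

lemma homog_right_unit:
  assumes "g \<in> carrier G" "x \<in> deg g"
  shows "\<exists>e\<in>deg \<one>. x \<star> e = x"
proof -
  obtain s t where st: "s \<in> deg (inv g)" "t \<in> deg g" "x = x \<star> s \<star> t" using unit_right assms by blast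
  have "s \<star> t \<in> deg \<one>" using deg_mult[of "inv g" g s t] st assms by simp
  moreover have "x \<star> (s \<star> t) = x" using st assms by (simp add: T_assoc)
  ultimately show ?thesis by blast
qed

lemma gen_self:
  assumes "\<one> \<in> U" "k \<in> deg \<one>"
  shows "k \<in> gen U k"
proof -
  obtain e f where "e \<in> deg \<one>" "e \<star> k = k" "f \<in> deg \<one>" "k \<star> f = k"
    using common_left_unit homog_right_unit assms by (metis deg_carrier one_closed)
  then show ?thesis using gen_base[of \<one> U \<one> e f k] assms by simp
qed

end

locale graded_prime = graded_rng +
  assumes homog_prime: "\<lbrakk>g \<in> carrier G; h \<in> carrier G; a \<in> deg g; b \<in> deg h;
    a \<noteq> \<zero>\<^bsub>T\<^esub>; b \<noteq> \<zero>\<^bsub>T\<^esub>\<rbrakk> \<Longrightarrow> \<exists>x\<in>carrier G. \<exists>s\<in>deg x. a \<star> s \<star> b \<noteq> \<zero>\<^bsub>T\<^esub>"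
begin

lemma homog_prime_left:
  assumes "x \<in> carrier T" "x \<noteq> \<zero>\<^bsub>T\<^esub>" "h \<in> carrier G" "b \<in> deg h" "b \<noteq> \<zero>\<^bsub>T\<^esub>"
  shows "\<exists>y\<in>carrier G. \<exists>s\<in>deg y. x \<star> s \<star> b \<noteq> \<zero>\<^bsub>T\<^esub>"
proof -
  obtain g where g: "g \<in> supp x" using supp_nonempty assms by blast
  have gc: "g \<in> carrier G" "res {g} x \<noteq> \<zero>\<^bsub>T\<^esub>" using g by (auto simp: supp_def)
  obtain y s where s: "y \<in> carrier G" "s \<in> deg y" "res {g} x \<star> s \<star> b \<noteq> \<zero>\<^bsub>T\<^esub>"
    using homog_prime[OF gc(1) assms(3) _ assms(4) gc(2) assms(5)] assms(1) by auto
  have "res {g \<otimes> y \<otimes> h} (x \<star> s \<star> b) = res {g} x \<star> s \<star> b"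
    using res_mult_deg_right[of "x \<star> s" h b "g \<otimes> y"] res_mult_deg_right[of x y s g] s gc assms by simp
  then show ?thesis using s by (metis res_zero)
qed

lemma homog_prime_right:
  assumes "x \<in> carrier T" "x \<noteq> \<zero>\<^bsub>T\<^esub>" "h \<in> carrier G" "b \<in> deg h" "b \<noteq> \<zero>\<^bsub>T\<^esub>"
  shows "\<exists>y\<in>carrier G. \<exists>s\<in>deg y. b \<star> s \<star> x \<noteq> \<zero>\<^bsub>T\<^esub>"
proof -
  obtain g where g: "g \<in> supp x" using supp_nonempty assms by blast
  have gc: "g \<in> carrier G" "res {g} x \<noteq> \<zero>\<^bsub>T\<^esub>" using g by (auto simp: supp_def)
  obtain y s where s: "y \<in> carrier G" "s \<in> deg y" "b \<star> s \<star> res {g} x \<noteq> \<zero>\<^bsub>T\<^esub>"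
    using homog_prime[OF assms(3) gc(1) assms(4) _ assms(5) gc(2)] assms(1) by auto
  have "b \<star> s \<in> deg (h \<otimes> y)" using deg_mult s assms by blast
  then have "res {h \<otimes> y \<otimes> g} (b \<star> s \<star> x) = b \<star> s \<star> res {g} x"
    using res_mult_deg_left[of x "h \<otimes> y" "b \<star> s" g] s gc assms by simp
  then show ?thesis using s by (metis res_zero)
qed

text \<open>Semiprimeness passes to a subgroup of finite index: in a nonzero product
  \<open>c s\<^sub>1 c s\<^sub>2 c \<dots>\<close> that is longer than the index, the degrees of two initial segments lie in
  the same coset.\<close>

lemma finite_index_semiprime:
  assumes H: "subgroup H G" and J: "homog_ideal H J" and W: "subgroup W G" "W \<subseteq> H" "fin_cover W H"
    and c: "c \<in> J" "c \<in> deg k" "k \<in> H" "c \<noteq> \<zero>\<^bsub>T\<^esub>"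
  shows "\<exists>w\<in>W. \<exists>y\<in>deg (inv k \<otimes> w). c \<star> y \<star> c \<noteq> \<zero>\<^bsub>T\<^esub>"
proof (rule ccontr)
  assume "\<not> ?thesis"
  then have zero: "c \<star> y \<star> c = \<zero>\<^bsub>T\<^esub>" if "w \<in> W" "y \<in> deg (inv k \<otimes> w)" for w y using that by blast
  interpret H: subgroup H G by fact
  interpret W: subgroup W G by fact
  note JD = homog_idealD[OF J]
  have cc: "c \<in> carrier T" using c by simp
  have kc: "k \<in> carrier G" using c by simp
  \<comment> \<open>\<open>z\<close> is a product \<open>c s1 c s2 ... c\<close> of degree
    \<open>t\<close>, and \<open>P\<close> collects the degrees of its initial segments that end in
    some \<open>s_i\<close>. The last clause says that continuing \<open>z\<close> by
    \<open>s\<close> and a further \<open>c\<close> gives zero whenever the new initial segment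
    repeats a coset \<open>p W\<close>.\<close>
  define good where "good z t P n \<longleftrightarrow>
      (z \<in> J \<and> z \<in> deg t \<and> t \<in> H \<and> z \<noteq> \<zero>\<^bsub>T\<^esub> \<and> finite P \<and> P \<subseteq> H \<and> card P = n) \<and>
      (\<forall>p\<in>P. \<forall>q\<in>P. inv p \<otimes> q \<in> W \<longrightarrow> p = q) \<and>
      (\<forall>p\<in>P. \<forall>x\<in>H. inv p \<otimes> (t \<otimes> x) \<in> W \<longrightarrow> (\<forall>s\<in>deg x. z \<star> s \<star> c = \<zero>\<^bsub>T\<^esub>))"
    for z t P and n :: nat
  have chain: "\<exists>z t P. good z t P n" for n
  proof (induction n)
    case 0
    have "good c k {} 0" unfolding good_def using c by simp
    then show ?case by blast
  next
    case (Suc n)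
    then obtain z t P where good: "good z t P n" by blast
    have z: "z \<in> J" "z \<in> deg t" "t \<in> H" "z \<noteq> \<zero>\<^bsub>T\<^esub>" and P1: "finite P" "P \<subseteq> H" "card P = n"
      using good unfolding good_def by simp_all
    have P2: "p = q" if "p \<in> P" "q \<in> P" "inv p \<otimes> q \<in> W" for p q
      using good that unfolding good_def by simp
    note P = P1 P2
    have kill: "z \<star> s \<star> c = \<zero>\<^bsub>T\<^esub>" if "p \<in> P" "x \<in> H" "inv p \<otimes> (t \<otimes> x) \<in> W" "s \<in> deg x" for p x s
      using good that unfolding good_def by blast
    have tc: "t \<in> carrier G" using z by simp
    have zc: "z \<in> carrier T" using z by simp
    obtain x s where s: "x \<in> carrier G" "s \<in> deg x" "z \<star> s \<star> c \<noteq> \<zero>\<^bsub>T\<^esub>"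
      using homog_prime[OF tc kc z(2) c(2) z(4) c(4)] by blast
    have xH: "x \<in> H" using JD(8) z(1) c(1) s by blast
    have sc: "s \<in> carrier T" using s by simp
    have new: "inv p \<otimes> (t \<otimes> x) \<notin> W" if "p \<in> P" for p using kill[OF that xH _ s(2)] s(3) by blast
    have new': "inv (t \<otimes> x) \<otimes> p \<notin> W" if p: "p \<in> P" for p
    proof
      assume "inv (t \<otimes> x) \<otimes> p \<in> W"
      then have "inv (inv (t \<otimes> x) \<otimes> p) \<in> W" by simp
      moreover have "p \<in> carrier G" using p P(2) by auto
      ultimately show False using new[OF p] tc s(1) by (simp add: inv_mult_group m_assoc)
    qed
    define P' where "P' = insert (t \<otimes> x) P"
    have "t \<otimes> x \<notin> P" using new[of "t \<otimes> x"] tc s(1) by auto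
    then have cardP: "card P' = Suc n" using P by (simp add: P'_def)
    have "z \<star> s \<in> J" using JD(7) z(1) xH s(2) by blast
    then have zJ: "z \<star> s \<star> c \<in> J" using JD(7)[of "z \<star> s" k c] c by blast
    have zd: "z \<star> s \<star> c \<in> deg (t \<otimes> x \<otimes> k)"
      using deg_mult[of "t \<otimes> x" k] deg_mult[of t x z s] z s c tc kc by simp
    have kill': "z \<star> s \<star> c \<star> r \<star> c = \<zero>\<^bsub>T\<^esub>"
      if p: "p \<in> P'" and y: "y \<in> H" and pW: "inv p \<otimes> ((t \<otimes> x \<otimes> k) \<otimes> y) \<in> W" and r: "r \<in> deg y" for p y r
    proof -
      have yc: "y \<in> carrier G" using y by simp
      have rc: "r \<in> carrier T" using r by simp
      show ?thesis
      proof (cases "p = t \<otimes> x")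
        \<comment> \<open>The coset just added is repeated: then \<open>k y\<close> lies in
          \<open>W\<close>, \<open>y = k^-1 (k y)\<close>, and the last three factors
          \<open>c r c\<close> vanish by assumption.\<close>
        case True
        then have "k \<otimes> y \<in> W" using pW tc s(1) kc yc by (simp add: m_assoc inv_mult_group)
        moreover have "inv k \<otimes> (k \<otimes> y) = y" using kc yc by simp
        ultimately have "c \<star> r \<star> c = \<zero>\<^bsub>T\<^esub>" using zero[of "k \<otimes> y" r] r by simp
        then have "(z \<star> s) \<star> (c \<star> r \<star> c) = \<zero>\<^bsub>T\<^esub>" using zc sc by simp
        then show ?thesis using zc sc cc rc by (simp add: T_assoc)
      next
        case False
        then have pP: "p \<in> P" using p by (simp add: P'_def)
        then have pc: "p \<in> carrier G" using P(2) by auto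
        have "s \<star> c \<star> r \<in> deg (x \<otimes> k \<otimes> y)"
          using deg_mult[of "x \<otimes> k" y] deg_mult[of x k s c] s c kc yc r by simp
        moreover have "inv p \<otimes> (t \<otimes> (x \<otimes> k \<otimes> y)) \<in> W" using pW tc s(1) kc yc pc by (simp add: m_assoc)
        ultimately have "z \<star> (s \<star> c \<star> r) \<star> c = \<zero>\<^bsub>T\<^esub>"
          using kill[OF pP, of "x \<otimes> k \<otimes> y"] xH c(3) y by simp
        then show ?thesis using zc sc cc rc by (simp add: T_assoc)
      qed
    qed
    have dist: "\<forall>p\<in>P'. \<forall>q\<in>P'. inv p \<otimes> q \<in> W \<longrightarrow> p = q"
      using P(4) new new' by (auto simp: P'_def)
    have "finite P'" "P' \<subseteq> H" "t \<otimes> x \<otimes> k \<in> H" using P1 z(3) xH c(3) by (auto simp: P'_def)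
    then have "good (z \<star> s \<star> c) (t \<otimes> x \<otimes> k) P' (Suc n)"
      unfolding good_def using zJ zd s(3) cardP dist kill' by blast
    then show ?case by blast
  qed
  obtain F where F: "finite F" "F \<subseteq> H" "\<And>h. h \<in> H \<Longrightarrow> \<exists>f\<in>F. h \<otimes> inv f \<in> W"
    using W(3) unfolding fin_cover_def by blast
  obtain z t P where "good z t P (Suc (card F))" using chain by blast
  then have P: "finite P" "P \<subseteq> H" "card P = Suc (card F)"
    "\<And>p q. p \<in> P \<Longrightarrow> q \<in> P \<Longrightarrow> inv p \<otimes> q \<in> W \<Longrightarrow> p = q"
    unfolding good_def by simp_all
  define f where "f p = (SOME f. f \<in> F \<and> inv p \<otimes> inv f \<in> W)" for p
  have f: "f p \<in> F" "inv p \<otimes> inv (f p) \<in> W" if "p \<in> P" for p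
  proof -
    \<comment> \<open>Degrees of initial segments are compared by left cosets \<open>p W\<close>,
      while the covering uses right cosets; hence the inverse.\<close>
    have "\<exists>f. f \<in> F \<and> inv p \<otimes> inv f \<in> W" using F(3)[of "inv p"] that P(2) by blast
    from someI_ex[OF this] show "f p \<in> F" "inv p \<otimes> inv (f p) \<in> W" by (simp_all add: f_def)
  qed
  have "inj_on f P"
  proof (rule inj_onI)
    fix p q assume pq: "p \<in> P" "q \<in> P" "f p = f q"
    have "f q \<in> H" using f(1) pq F(2) by blast
    then have c: "p \<in> carrier G" "q \<in> carrier G" "f q \<in> carrier G" using pq P(2) by auto
    have "(inv p \<otimes> inv (f p)) \<otimes> inv (inv q \<otimes> inv (f q)) \<in> W"
      using f(2)[OF pq(1)] f(2)[OF pq(2)] by (rule W.m_closed[OF _ W.m_inv_closed])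
    then have "inv p \<otimes> q \<in> W" using pq(3) c by (simp add: m_assoc inv_mult_group)
    then show "p = q" using P(4) pq by blast
  qed
  then have "card P \<le> card F" using f(1) F(1) by (intro card_inj_on_le[of f]) auto
  then show False using P(3) by simp
qed

end

section \<open>Minimal forms\<close>

context graded_rng
begin

definition coset_count :: "'a set \<Rightarrow> 'c \<Rightarrow> nat" where
  "coset_count D x = card ((\<lambda>g. D #> g) ` supp x)"

end

text \<open>Minimality runs at once over all subgroups, their homogeneous ideals and the nonzero
  elements of \<open>A\<close> in them, each counted with its own FC-centre; the contradiction will
  come from a different \<open>H'\<close>. The last assumption normalizes \<open>\<alpha>\<close> so
  that its part in the FC-centre is nonzero.\<close>

locale minimal_form = graded_prime +
  fixes A B :: "'c set" and H :: "'a set" and J :: "'c set" and \<alpha> :: 'c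
  assumes A_ideal: "rng_ideal A T" and B_ideal: "rng_ideal B T"
    and AB: "\<lbrakk>a \<in> A; b \<in> B\<rbrakk> \<Longrightarrow> a \<otimes>\<^bsub>T\<^esub> b = \<zero>\<^bsub>T\<^esub>"
    and H: "subgroup H G" and J: "homog_ideal H J"
    and \<alpha>A: "\<alpha> \<in> A" and \<alpha>J: "\<alpha> \<in> J"
    and minimal: "\<lbrakk>subgroup H' G; homog_ideal H' J'; x \<in> A; x \<in> J'; x \<noteq> \<zero>\<^bsub>T\<^esub>\<rbrakk>
      \<Longrightarrow> coset_count (fc_center H) \<alpha> \<le> coset_count (fc_center H') x"
    and \<alpha>_meets: "supp \<alpha> \<inter> fc_center H \<noteq> {}"
begin

section \<open>Normality of the FC-centre in \<open>H\<close> and the counting of its cosets\<close>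

definition "D = fc_center H"
definition "\<alpha>0 = res D \<alpha>"

lemmas JD = homog_idealD[OF J]

lemma H_closed: "h \<in> H \<Longrightarrow> h \<in> carrier G" "h \<in> H \<Longrightarrow> k \<in> H \<Longrightarrow> h \<otimes> k \<in> H" "h \<in> H \<Longrightarrow> inv h \<in> H" "\<one> \<in> H"
  using H by (auto simp: subgroup.m_closed subgroup.m_inv_closed subgroup.one_closed dest: subgroup.mem_carrier)

lemma D: "subgroup D G" unfolding D_def by (rule fc_center_subgroup[OF H])

lemma D_H: "d \<in> D \<Longrightarrow> d \<in> H" by (simp add: D_def fc_center_def)

lemma D_closed: "d \<in> D \<Longrightarrow> d \<in> carrier G" "d \<in> D \<Longrightarrow> e \<in> D \<Longrightarrow> d \<otimes> e \<in> D" "d \<in> D \<Longrightarrow> inv d \<in> D" "\<one> \<in> D"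
  using D by (auto simp: subgroup.m_closed subgroup.m_inv_closed subgroup.one_closed dest: subgroup.mem_carrier)

lemma D_conj: assumes "d \<in> D" "h \<in> H" shows "h \<otimes> d \<otimes> inv h \<in> D" "inv h \<otimes> d \<otimes> h \<in> D"
  using fc_center_conj[OF H, of d h] fc_center_conj[OF H, of d "inv h"] assms H_closed
  by (simp_all add: D_def)

lemma D_conj_iff:
  assumes "h \<in> H" "g \<in> carrier G"
  shows "h \<otimes> g \<otimes> inv h \<in> D \<longleftrightarrow> g \<in> D"
proof
  assume "h \<otimes> g \<otimes> inv h \<in> D"
  then have "inv h \<otimes> (h \<otimes> g \<otimes> inv h) \<otimes> h \<in> D" using D_conj(2) assms by blast
  then show "g \<in> D" using assms H_closed by (simp add: m_assoc)
qed (use D_conj assms in auto)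

lemma D_mult_iff:
  assumes "d \<in> D" "g \<in> carrier G"
  shows "d \<otimes> g \<in> D \<longleftrightarrow> g \<in> D" "g \<otimes> d \<in> D \<longleftrightarrow> g \<in> D"
proof -
  have dc: "d \<in> carrier G" using D_closed assms by blast
  have "g \<in> D" if "d \<otimes> g \<in> D"
  proof -
    have "inv d \<otimes> (d \<otimes> g) \<in> D" using D_closed(2,3) assms that by blast
    then show ?thesis using assms dc by simp
  qed
  then show "d \<otimes> g \<in> D \<longleftrightarrow> g \<in> D" using D_closed(2) assms by blast
  have "g \<in> D" if "g \<otimes> d \<in> D"
  proof -
    have "(g \<otimes> d) \<otimes> inv d \<in> D" using D_closed(2,3) assms that by blast
    then show ?thesis using assms dc by (simp add: m_assoc)
  qed
  then show "g \<otimes> d \<in> D \<longleftrightarrow> g \<in> D" using D_closed(2) assms by blast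
qed

lemma A_closed: "x \<in> A \<Longrightarrow> x \<in> carrier T" "x \<in> A \<Longrightarrow> y \<in> carrier T \<Longrightarrow> x \<star> y \<in> A"
    "x \<in> A \<Longrightarrow> y \<in> carrier T \<Longrightarrow> y \<star> x \<in> A"
  using A_ideal additive_subgroup.a_subset[of A T] by (auto simp: rng_ideal_def)

lemma B_closed: "x \<in> B \<Longrightarrow> x \<in> carrier T" "x \<in> B \<Longrightarrow> y \<in> carrier T \<Longrightarrow> x \<star> y \<in> B"
    "x \<in> B \<Longrightarrow> y \<in> carrier T \<Longrightarrow> y \<star> x \<in> B"
  using B_ideal additive_subgroup.a_subset[of B T] by (auto simp: rng_ideal_def)

lemma \<alpha>c [simp]: "\<alpha> \<in> carrier T" using A_closed \<alpha>A by blast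
lemma \<alpha>0c [simp]: "\<alpha>0 \<in> carrier T" by (simp add: \<alpha>0_def)
lemma \<alpha>0_supp: "supp \<alpha>0 = supp \<alpha> \<inter> D" by (simp add: \<alpha>0_def supp_res)
lemma \<alpha>0_J: "\<alpha>0 \<in> J" unfolding \<alpha>0_def using JD(5) \<alpha>J by blast

definition cosets :: "'c \<Rightarrow> 'a set set" where "cosets x = (\<lambda>g. D #> g) ` supp x"

lemma cosets_count: "coset_count D x = card (cosets x)" by (simp add: coset_count_def cosets_def)

lemma finite_cosets: "x \<in> carrier T \<Longrightarrow> finite (cosets x)" by (simp add: cosets_def)

lemma minimal': "x \<in> A \<Longrightarrow> x \<in> J \<Longrightarrow> x \<noteq> \<zero>\<^bsub>T\<^esub> \<Longrightarrow> card (cosets \<alpha>) \<le> card (cosets x)"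
  using minimal[OF H J] by (simp add: D_def cosets_count[symmetric])

text \<open>If multiplication by \<open>s\<close> killed only the part of \<open>x\<close> in \<open>D\<close>, then \<open>x s\<close> would meet fewer
  cosets.\<close>

lemma vanish_of_res:
  assumes x: "x \<in> A" "x \<in> J" "cosets x \<subseteq> cosets \<alpha>" "supp x \<inter> D \<noteq> {}"
    and h: "h \<in> H" "s \<in> deg h" and z: "res D x \<star> s = \<zero>\<^bsub>T\<^esub>"
  shows "x \<star> s = \<zero>\<^bsub>T\<^esub>"
proof (rule ccontr)
  assume nz: "x \<star> s \<noteq> \<zero>\<^bsub>T\<^esub>"
  have xc: "x \<in> carrier T" "s \<in> carrier T" "h \<in> carrier G" using x A_closed h H_closed by auto
  have "x \<star> s \<in> A" "x \<star> s \<in> J" using A_closed(2) x(1) xc JD(7) x(2) h by blast+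
  then have le: "card (cosets \<alpha>) \<le> card (cosets (x \<star> s))" using minimal' nz by blast
  have DC: "D \<in> cosets x"
  proof -
    obtain g where "g \<in> supp x" "g \<in> D" using x(4) by blast
    then show ?thesis
      using coset_join2[OF _ D, of g] D_closed(1) by (auto simp: cosets_def intro!: image_eqI[of _ _ g])
  qed
  have "res (D #> h) (x \<star> s) = res D x \<star> s"
  proof (rule res_mult_left)
    fix a b assume a: "a \<in> supp x" and b: "b \<in> supp s"
    have "b = h" "a \<in> carrier G" using b supp_deg[OF xc(3) h(2)] a supp_carrier by auto
    then show "a \<otimes> b \<in> D #> h \<longleftrightarrow> a \<in> D"
      using rcos_mem_iff[OF D, of "a \<otimes> h" h] xc by (simp add: m_assoc)
  qed (use xc in auto)
  then have off: "supp (x \<star> s) \<inter> (D #> h) = {}" using z supp_res[of "x \<star> s" "D #> h"] xc by simp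
  have "cosets (x \<star> s) \<subseteq> (\<lambda>C. C #> h) ` (cosets x - {D})"
  proof
    fix C assume "C \<in> cosets (x \<star> s)"
    then obtain k where k: "k \<in> supp (x \<star> s)" "C = D #> k" by (auto simp: cosets_def)
    obtain g where g: "g \<in> supp x" "k = g \<otimes> h"
      using supp_mult_deg_right[OF xc(1,3) h(2)] k(1) by blast
    have gc: "g \<in> carrier G" using g supp_carrier by blast
    have "k \<notin> D #> h" using off k by blast
    then have "g \<notin> D" using g gc xc rcos_mem_iff[OF D, of k h] by (auto simp: m_assoc)
    then have "D #> g \<noteq> D" using rcos_self[OF gc D] by blast
    moreover have "C = (D #> g) #> h"
      using k g gc xc D_closed(1) by (simp add: coset_mult_assoc subset_eq)
    ultimately show "C \<in> (\<lambda>C. C #> h) ` (cosets x - {D})" using g by (auto simp: cosets_def)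
  qed
  then have "card (cosets (x \<star> s)) \<le> card (cosets x - {D})"
    using finite_cosets[OF xc(1)] by (meson card_image_le card_mono finite_Diff finite_imageI le_trans)
  also have "\<dots> < card (cosets x)" by (rule card_Diff1_less[OF finite_cosets[OF xc(1)] DC])
  also have "\<dots> \<le> card (cosets \<alpha>)" using x(3) finite_cosets[OF \<alpha>c] by (rule card_mono[rotated])
  finally show False using le by simp
qed

text \<open>By normality of \<open>D\<close> in \<open>H\<close> a factor \<open>d\<close> to the
  right of \<open>g\<close> becomes \<open>g d g^-1\<close> to its left, so the coset of
  \<open>g\<close> does not change.\<close>

lemma cosets_mult:
  assumes "\<beta> \<in> carrier T" "supp \<beta> \<subseteq> D"
  shows "cosets (\<alpha> \<star> \<beta>) \<subseteq> cosets \<alpha>"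
proof
  fix C assume "C \<in> cosets (\<alpha> \<star> \<beta>)"
  then obtain k where k: "k \<in> supp (\<alpha> \<star> \<beta>)" "C = D #> k" by (auto simp: cosets_def)
  obtain g d where gd: "g \<in> supp \<alpha>" "d \<in> D" "k = g \<otimes> d"
    using supp_mult[OF \<alpha>c assms(1)] k(1) assms(2) by blast
  have gH: "g \<in> H" using gd JD(2) \<alpha>J by blast
  have c: "g \<in> carrier G" "d \<in> carrier G" using gH H_closed gd D_closed by auto
  have "k \<otimes> inv g \<in> D" using D_conj(1)[OF gd(2) gH] gd(3) by simp
  then have "D #> k = D #> g" using rcos_eq_iff[OF D, of k g] c gd by simp
  then show "C \<in> cosets \<alpha>" using k gd by (auto simp: cosets_def)
qed

lemma res_D_mult:
  assumes "\<beta> \<in> carrier T" "supp \<beta> \<subseteq> D" "x \<in> carrier T"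
  shows "res D (x \<star> \<beta>) = res D x \<star> \<beta>"
  by (rule res_mult_left) (use assms D_mult_iff supp_carrier in \<open>auto simp: subset_eq\<close>)

section \<open>Small sets of degrees and annihilation modulo small sets\<close>

definition Y :: "'a set" where
  "Y = {y \<in> H. y \<notin> D \<and> (\<exists>g\<in>supp \<alpha>. D #> y = D #> g)}"

text \<open>Elements of \<open>Y\<close> lie outside the FC-centre, so the centralizers used here
  have infinite index in \<open>H\<close>. The pairs remember which \<open>y\<close> occur: one of
  them will become an FC-element of a smaller group.\<close>

definition small :: "'a set \<Rightarrow> bool" where
  "small X \<longleftrightarrow> X \<subseteq> H \<and> (\<exists>F. finite F \<and> F \<subseteq> Y \<times> H \<and>
     (\<forall>x\<in>X. \<exists>p\<in>F. x \<otimes> inv (snd p) \<in> cent H {fst p}))"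

lemma smallI:
  assumes "X \<subseteq> H" "finite F" "F \<subseteq> Y \<times> H"
    "\<And>x. x \<in> X \<Longrightarrow> \<exists>p\<in>F. x \<otimes> inv (snd p) \<in> cent H {fst p}"
  shows "small X"
  unfolding small_def by (intro conjI exI[of _ F] ballI assms)

lemma smallE:
  assumes "small X"
  obtains F where "finite F" "F \<subseteq> Y \<times> H"
    "\<And>x. x \<in> X \<Longrightarrow> \<exists>p\<in>F. x \<otimes> inv (snd p) \<in> cent H {fst p}"
  using assms unfolding small_def by (elim conjE exE) (rule that, assumption+, erule (1) bspec)

lemma small_H: "small X \<Longrightarrow> X \<subseteq> H"
  unfolding small_def by (erule conjunct1)

lemma small_subset: assumes "small X" "X' \<subseteq> X" shows "small X'"
proof -
  obtain F where F: "finite F" "F \<subseteq> Y \<times> H"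
    "\<And>x. x \<in> X \<Longrightarrow> \<exists>p\<in>F. x \<otimes> inv (snd p) \<in> cent H {fst p}"
    using assms(1) by (rule smallE) blast
  show ?thesis
    by (rule smallI[OF _ F(1,2)]) (use small_H[OF assms(1)] assms(2) F(3) in auto)
qed

lemma small_Un: assumes "small X" "small X'" shows "small (X \<union> X')"
proof -
  obtain F where F: "finite F" "F \<subseteq> Y \<times> H"
    "\<And>x. x \<in> X \<Longrightarrow> \<exists>p\<in>F. x \<otimes> inv (snd p) \<in> cent H {fst p}"
    using assms(1) by (rule smallE) blast
  obtain F' where F': "finite F'" "F' \<subseteq> Y \<times> H"
    "\<And>x. x \<in> X' \<Longrightarrow> \<exists>p\<in>F'. x \<otimes> inv (snd p) \<in> cent H {fst p}"
    using assms(2) by (rule smallE) blast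
  show ?thesis
    by (rule smallI[of _ "F \<union> F'"])
      (use small_H[OF assms(1)] small_H[OF assms(2)] F(1,2) F'(1,2) F(3) F'(3) in blast)+
qed

lemma small_translate:
  assumes "small X" "h \<in> H"
  shows "small {t \<in> H. t \<otimes> h \<in> X}"
proof -
  obtain F where F: "finite F" "F \<subseteq> Y \<times> H"
    "\<And>x. x \<in> X \<Longrightarrow> \<exists>p\<in>F. x \<otimes> inv (snd p) \<in> cent H {fst p}"
    using assms(1) by (rule smallE) blast
  show ?thesis
  proof (rule smallI[of _ "(\<lambda>p. (fst p, snd p \<otimes> inv h)) ` F"])
    fix x assume x: "x \<in> {t \<in> H. t \<otimes> h \<in> X}"
    then obtain p where p: "p \<in> F" "x \<otimes> h \<otimes> inv (snd p) \<in> cent H {fst p}" using F(3) by blast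
    have "snd p \<in> carrier G" "x \<in> carrier G" "h \<in> carrier G" using p F(2) x assms H_closed by auto
    then have "x \<otimes> inv (snd p \<otimes> inv h) = x \<otimes> h \<otimes> inv (snd p)" by (simp add: m_assoc inv_mult_group)
    then have "x \<otimes> inv (snd (fst p, snd p \<otimes> inv h)) \<in> cent H {fst (fst p, snd p \<otimes> inv h)}"
      using p(2) by simp
    then show "\<exists>p\<in>(\<lambda>p. (fst p, snd p \<otimes> inv h)) ` F. x \<otimes> inv (snd p) \<in> cent H {fst p}"
      using p(1) by blast
  qed (use F(1,2) assms(2) H_closed in auto)
qed

definition nonvanish :: "'c \<Rightarrow> 'c \<Rightarrow> 'a set" where
  "nonvanish x \<beta> = {t \<in> H. \<exists>s\<in>deg t. x \<star> s \<star> \<beta> \<noteq> \<zero>\<^bsub>T\<^esub>}"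

text \<open>Annihilation by \<open>\<alpha>0 S_t\<close> is demanded only for \<open>t\<close>
  outside a small set. The resulting set contains \<open>B\<close> and is closed under differences,
  \<open>res D\<close>, right multiplication, and left multiplication by homogeneous elements with
  degree in \<open>H\<close>.\<close>

definition L :: "'c set" where
  "L = {\<beta> \<in> carrier T. small (nonvanish \<alpha>0 \<beta>)}"

lemma L_I: "nonvanish \<alpha>0 \<beta> \<subseteq> X \<Longrightarrow> small X \<Longrightarrow> \<beta> \<in> carrier T \<Longrightarrow> \<beta> \<in> L"
  unfolding L_def using small_subset by simp

lemma L_D: "\<beta> \<in> L \<Longrightarrow> \<beta> \<in> carrier T" "\<beta> \<in> L \<Longrightarrow> small (nonvanish \<alpha>0 \<beta>)"
  unfolding L_def by simp_all

text \<open>Since \<open>\<alpha> s \<beta> = 0\<close>, a nonzero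
  \<open>\<alpha>0 s \<beta>\<close> must be cancelled by the rest of \<open>\<alpha>\<close>, so
  the supports share a degree \<open>d t y = x t y'\<close> with \<open>d\<close> in
  \<open>D\<close> and \<open>x\<close> outside. Then \<open>t^-1 (d^-1 x) t = y y'^-1\<close> takes
  finitely many values, and the \<open>t\<close> belonging to a fixed pair of \<open>d^-1 x\<close>
  and value lie in one coset of a centralizer.\<close>

lemma B_L: assumes b: "\<beta> \<in> B" shows "\<beta> \<in> L"
proof -
  have bc: "\<beta> \<in> carrier T" using B_closed b by blast
  define E where "E = (\<lambda>(d, x). inv d \<otimes> x) ` (supp \<alpha>0 \<times> (supp \<alpha> - D))"
  define Z where "Z = (\<lambda>(y, y'). y \<otimes> inv y') ` (supp \<beta> \<times> supp \<beta>)"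
  have fin: "finite E" "finite Z" using bc by (auto simp: E_def Z_def)
  have EY: "e \<in> Y" if e: "e \<in> E" for e
  proof -
    obtain d x where dx: "d \<in> D" "x \<in> supp \<alpha>" "x \<notin> D" "e = inv d \<otimes> x"
      using e by (auto simp: E_def \<alpha>0_supp)
    have xH: "x \<in> H" using dx JD(2) \<alpha>J by blast
    have c: "x \<in> carrier G" "d \<in> carrier G" using xH H_closed dx D_closed by auto
    have "inv d \<in> D" using dx D_closed by blast
    then have "e \<in> H" "e \<notin> D" using dx xH D_H H_closed c D_mult_iff(1)[of "inv d" x] by auto
    moreover have "D #> e = D #> x"
      using rcos_eq_iff[OF D, of e x] dx c D_closed by (simp add: m_assoc)
    ultimately show ?thesis using dx by (auto simp: Y_def)
  qed
  have key: "\<exists>e\<in>E. \<exists>z\<in>Z. inv t \<otimes> e \<otimes> t = z" if t: "t \<in> nonvanish \<alpha>0 \<beta>" for t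
  proof -
    obtain s where s: "t \<in> H" "s \<in> deg t" "\<alpha>0 \<star> s \<star> \<beta> \<noteq> \<zero>\<^bsub>T\<^esub>" using t by (auto simp: nonvanish_def)
    have tc: "t \<in> carrier G" "s \<in> carrier T" using s H_closed by auto
    define \<alpha>1 where "\<alpha>1 = res (- D) \<alpha>"
    have a1: "\<alpha>1 \<in> carrier T" "supp \<alpha>1 = supp \<alpha> - D" by (auto simp: \<alpha>1_def supp_res)
    have "\<alpha> = \<alpha>0 \<boxplus> \<alpha>1" unfolding \<alpha>0_def \<alpha>1_def by (rule res_compl) simp
    moreover have "\<alpha> \<star> s \<star> \<beta> = \<zero>\<^bsub>T\<^esub>" using AB A_closed(2) \<alpha>A tc b by blast
    moreover have "(\<alpha>0 \<boxplus> \<alpha>1) \<star> s \<star> \<beta> = \<alpha>0 \<star> s \<star> \<beta> \<boxplus> \<alpha>1 \<star> s \<star> \<beta>"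
      using a1 tc bc by (simp add: T_l_distr)
    ultimately have sum: "\<alpha>0 \<star> s \<star> \<beta> \<boxplus> \<alpha>1 \<star> s \<star> \<beta> = \<zero>\<^bsub>T\<^esub>" by metis
    \<comment> \<open>With disjoint supports, restriction to the first one would recover
      \<open>\<alpha>0 s \<beta>\<close> from a sum that is zero.\<close>
    have "supp (\<alpha>0 \<star> s \<star> \<beta>) \<inter> supp (\<alpha>1 \<star> s \<star> \<beta>) \<noteq> {}"
    proof
      assume dis: "supp (\<alpha>0 \<star> s \<star> \<beta>) \<inter> supp (\<alpha>1 \<star> s \<star> \<beta>) = {}"
      have "res (supp (\<alpha>0 \<star> s \<star> \<beta>)) (\<alpha>0 \<star> s \<star> \<beta> \<boxplus> \<alpha>1 \<star> s \<star> \<beta>) = \<alpha>0 \<star> s \<star> \<beta>"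
        using a1 tc bc dis by (simp add: res_add res_sub res_disj Int_commute)
      then show False using sum s(3) by simp
    qed
    then obtain k where k: "k \<in> supp (\<alpha>0 \<star> s \<star> \<beta>)" "k \<in> supp (\<alpha>1 \<star> s \<star> \<beta>)" by blast
    obtain p y where py: "p \<in> supp (\<alpha>0 \<star> s)" "y \<in> supp \<beta>" "k = p \<otimes> y"
      using supp_mult[of "\<alpha>0 \<star> s" \<beta>] k tc bc by auto
    obtain d where d: "d \<in> supp \<alpha>0" "p = d \<otimes> t" using supp_mult_deg_right[OF _ tc(1) s(2), of \<alpha>0] py by auto
    obtain p' y' where py': "p' \<in> supp (\<alpha>1 \<star> s)" "y' \<in> supp \<beta>" "k = p' \<otimes> y'"
      using supp_mult[of "\<alpha>1 \<star> s" \<beta>] k tc bc a1 by auto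
    obtain x where x: "x \<in> supp \<alpha>1" "p' = x \<otimes> t" using supp_mult_deg_right[OF _ tc(1) s(2), of \<alpha>1] py' a1 by auto
    have c: "d \<in> carrier G" "x \<in> carrier G" "y \<in> carrier G" "y' \<in> carrier G"
      using d x py py' supp_carrier by auto
    have "d \<otimes> t \<otimes> y = x \<otimes> t \<otimes> y'" using py py' d x by simp
    then have "inv t \<otimes> inv d \<otimes> (d \<otimes> t \<otimes> y) \<otimes> inv y' = inv t \<otimes> inv d \<otimes> (x \<otimes> t \<otimes> y') \<otimes> inv y'" by simp
    then have "y \<otimes> inv y' = inv t \<otimes> (inv d \<otimes> x) \<otimes> t" using c tc by (simp add: m_assoc)
    moreover have "inv d \<otimes> x \<in> E" using d x a1 by (auto simp: E_def)
    moreover have "y \<otimes> inv y' \<in> Z" using py py' by (auto simp: Z_def)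
    ultimately show ?thesis by metis
  qed
  \<comment> \<open>One solution of \<open>t^-1 e t = z\<close> for each solvable pair serves as
    coset representative; unsolvable pairs are left out of \<open>F\<close>.\<close>
  define \<tau> where "\<tau> e z = (SOME t. t \<in> H \<and> inv t \<otimes> e \<otimes> t = z)" for e z
  define F where "F = (\<lambda>(e, z). (e, \<tau> e z)) ` {(e, z) \<in> E \<times> Z. \<exists>t. t \<in> H \<and> inv t \<otimes> e \<otimes> t = z}"
  have \<tau>: "\<tau> e z \<in> H \<and> inv (\<tau> e z) \<otimes> e \<otimes> \<tau> e z = z" if "t \<in> H" "inv t \<otimes> e \<otimes> t = z" for e z t
    unfolding \<tau>_def by (rule someI[of "\<lambda>t. t \<in> H \<and> inv t \<otimes> e \<otimes> t = z" t]) (use that in blast)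
  have "finite F" unfolding F_def by (rule finite_imageI, rule finite_subset[of _ "E \<times> Z"]) (use fin in auto)
  moreover have "F \<subseteq> Y \<times> H" using EY \<tau> by (auto simp: F_def)
  moreover have "\<exists>p\<in>F. t \<otimes> inv (snd p) \<in> cent H {fst p}" if t: "t \<in> nonvanish \<alpha>0 \<beta>" for t
  proof -
    have tH: "t \<in> H" using t by (simp add: nonvanish_def)
    obtain e z where ez: "e \<in> E" "z \<in> Z" "inv t \<otimes> e \<otimes> t = z" using key[OF t] by blast
    let ?t = "\<tau> e z"
    have t': "?t \<in> H" "inv ?t \<otimes> e \<otimes> ?t = z" using \<tau>[OF tH ez(3)] by auto
    have eH: "e \<in> H" using EY ez by (simp add: Y_def)
    have c: "t \<in> carrier G" "?t \<in> carrier G" "e \<in> carrier G" using tH t' eH H_closed by auto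
    have "t \<otimes> (inv t \<otimes> e \<otimes> t) \<otimes> inv ?t = t \<otimes> (inv ?t \<otimes> e \<otimes> ?t) \<otimes> inv ?t" using ez t' by simp
    then have "e \<otimes> (t \<otimes> inv ?t) = (t \<otimes> inv ?t) \<otimes> e" using c by (simp add: m_assoc)
    then have "t \<otimes> inv ?t \<in> cent H {e}" using tH t' H_closed by (simp add: cent_def)
    moreover have "(e, ?t) \<in> F" using ez tH by (auto simp: F_def)
    ultimately show ?thesis by (intro bexI[of _ "(e, ?t)"]) simp_all
  qed
  moreover have "nonvanish \<alpha>0 \<beta> \<subseteq> H" by (auto simp: nonvanish_def)
  ultimately have "small (nonvanish \<alpha>0 \<beta>)" by (intro smallI)
  then show ?thesis using bc by (simp add: L_def)
qed

lemma L_left: assumes "\<beta> \<in> L" "h \<in> H" "u \<in> deg h" shows "u \<star> \<beta> \<in> L"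
proof -
  have bc: "\<beta> \<in> carrier T" "u \<in> carrier T" "h \<in> carrier G" using assms H_closed L_D(1) by auto
  have "nonvanish \<alpha>0 (u \<star> \<beta>) \<subseteq> {t \<in> H. t \<otimes> h \<in> nonvanish \<alpha>0 \<beta>}"
  proof
    fix t assume "t \<in> nonvanish \<alpha>0 (u \<star> \<beta>)"
    then obtain s where s: "t \<in> H" "s \<in> deg t" "\<alpha>0 \<star> s \<star> (u \<star> \<beta>) \<noteq> \<zero>\<^bsub>T\<^esub>" by (auto simp: nonvanish_def)
    then have "s \<star> u \<in> deg (t \<otimes> h)" "\<alpha>0 \<star> (s \<star> u) \<star> \<beta> \<noteq> \<zero>\<^bsub>T\<^esub>"
      using assms bc H_closed by (auto simp: deg_mult T_assoc)
    then show "t \<in> {t \<in> H. t \<otimes> h \<in> nonvanish \<alpha>0 \<beta>}"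
      using s assms H_closed by (auto simp: nonvanish_def)
  qed
  then show ?thesis
    by (rule L_I[OF _ small_translate[OF L_D(2)[OF assms(1)] assms(2)]]) (use bc in simp)
qed

lemma L_right: assumes "\<beta> \<in> L" "v \<in> carrier T" shows "\<beta> \<star> v \<in> L"
proof -
  have bc: "\<beta> \<in> carrier T" using assms L_D(1) by auto
  have "nonvanish \<alpha>0 (\<beta> \<star> v) \<subseteq> nonvanish \<alpha>0 \<beta>"
  proof
    fix t assume "t \<in> nonvanish \<alpha>0 (\<beta> \<star> v)"
    then obtain s where s: "t \<in> H" "s \<in> deg t" "\<alpha>0 \<star> s \<star> (\<beta> \<star> v) \<noteq> \<zero>\<^bsub>T\<^esub>" by (auto simp: nonvanish_def)
    then have "(\<alpha>0 \<star> s \<star> \<beta>) \<star> v \<noteq> \<zero>\<^bsub>T\<^esub>" using assms bc by (simp add: T_assoc)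
    then have "\<alpha>0 \<star> s \<star> \<beta> \<noteq> \<zero>\<^bsub>T\<^esub>" using assms by auto
    then show "t \<in> nonvanish \<alpha>0 \<beta>" using s by (auto simp: nonvanish_def)
  qed
  then show ?thesis by (rule L_I[OF _ L_D(2)[OF assms(1)]]) (use bc assms in simp)
qed

lemma L_minus: assumes "\<beta> \<in> L" "\<gamma> \<in> L" shows "\<beta> \<boxminus> \<gamma> \<in> L"
proof -
  have bc: "\<beta> \<in> carrier T" "\<gamma> \<in> carrier T" using assms L_D(1) by auto
  have "nonvanish \<alpha>0 (\<beta> \<boxminus> \<gamma>) \<subseteq> nonvanish \<alpha>0 \<beta> \<union> nonvanish \<alpha>0 \<gamma>"
    using bc by (auto simp: nonvanish_def T_minus_distr minus_zero_iff)
  then show ?thesis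
    by (rule L_I[OF _ small_Un[OF L_D(2)[OF assms(1)] L_D(2)[OF assms(2)]]]) (use bc in simp)
qed

text \<open>As \<open>D\<close> is normalized by \<open>t\<close> and contains the support of
  \<open>\<alpha>0\<close>, the product with \<open>res D \<beta>\<close> is exactly the part of
  \<open>\<alpha>0 s \<beta>\<close> in the coset \<open>D t\<close>.\<close>

lemma L_res: assumes "\<beta> \<in> L" shows "res D \<beta> \<in> L"
proof -
  have bc: "\<beta> \<in> carrier T" using assms L_D(1) by auto
  have "nonvanish \<alpha>0 (res D \<beta>) \<subseteq> nonvanish \<alpha>0 \<beta>"
  proof
    fix t assume "t \<in> nonvanish \<alpha>0 (res D \<beta>)"
    then obtain s where s: "t \<in> H" "s \<in> deg t" "\<alpha>0 \<star> s \<star> res D \<beta> \<noteq> \<zero>\<^bsub>T\<^esub>" by (auto simp: nonvanish_def)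
    have tc: "t \<in> carrier G" "s \<in> carrier T" using s H_closed by auto
    have "res (D #> t) (\<alpha>0 \<star> s \<star> \<beta>) = \<alpha>0 \<star> s \<star> res D \<beta>"
    proof (rule res_mult_right)
      fix a b assume a: "a \<in> supp (\<alpha>0 \<star> s)" and b: "b \<in> supp \<beta>"
      obtain d where d: "d \<in> D" "a = d \<otimes> t"
        using supp_mult_deg_right[OF _ tc(1) s(2), of \<alpha>0] a \<alpha>0_supp by auto
      have c: "d \<in> carrier G" "b \<in> carrier G" using d D_closed subsetD[OF supp_carrier b] by auto
      have "a \<otimes> b \<in> D #> t \<longleftrightarrow> d \<otimes> (t \<otimes> b \<otimes> inv t) \<in> D"
        using rcos_mem_iff[OF D, of "a \<otimes> b" t] c tc d by (simp add: m_assoc)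
      also have "\<dots> \<longleftrightarrow> b \<in> D" using D_mult_iff(1) D_conj_iff d s(1) c tc by simp
      finally show "a \<otimes> b \<in> D #> t \<longleftrightarrow> b \<in> D" .
    qed (use tc bc in auto)
    then have "\<alpha>0 \<star> s \<star> \<beta> \<noteq> \<zero>\<^bsub>T\<^esub>" using s(3) by (metis res_zero)
    then show "t \<in> nonvanish \<alpha>0 \<beta>" using s by (auto simp: nonvanish_def)
  qed
  then show ?thesis by (rule L_I[OF _ L_D(2)[OF assms(1)]]) (use bc assms in simp)
qed

text \<open>A shift moves some component of \<open>\<alpha>0 s \<beta>\<close> to degree
  \<open>\<one>\<close>, which lies in \<open>D\<close>; so \<open>\<alpha>0\<close> does not kill
  the restriction of \<open>s \<beta> v\<close> to \<open>D\<close>. This restriction lies in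
  \<open>L\<close>, though not necessarily in \<open>B\<close>.\<close>

lemma exists_nonvanishing:
  assumes h: "h \<in> H" "s \<in> deg h" and b: "\<beta> \<in> B" and nz: "\<alpha>0 \<star> s \<star> \<beta> \<noteq> \<zero>\<^bsub>T\<^esub>"
  shows "\<exists>\<gamma>\<in>L. supp \<gamma> \<subseteq> D \<and> \<alpha>0 \<star> \<gamma> \<noteq> \<zero>\<^bsub>T\<^esub>"
proof -
  have bc: "\<beta> \<in> carrier T" "s \<in> carrier T" using b B_closed h by auto
  define x where "x = s \<star> \<beta>"
  have x: "x \<in> B" "x \<in> carrier T" using B_closed b bc by (auto simp: x_def)
  have "\<alpha>0 \<star> x \<noteq> \<zero>\<^bsub>T\<^esub>" using nz bc by (simp add: x_def T_assoc)
  then obtain k where k: "k \<in> supp (\<alpha>0 \<star> x)" using supp_nonempty x by (meson T_closed \<alpha>0c)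
  obtain v where v: "v \<in> deg (inv k)" "\<one> \<in> supp (\<alpha>0 \<star> x \<star> v)"
    using shift_right[OF _ k] x by (metis T_closed \<alpha>0c)
  have vc: "v \<in> carrier T" using v by simp
  define \<gamma> where "\<gamma> = res D (x \<star> v)"
  have "\<gamma> \<in> L" unfolding \<gamma>_def using L_res B_L B_closed(2) x vc by blast
  moreover have "supp \<gamma> \<subseteq> D" using x vc by (simp add: \<gamma>_def supp_res)
  moreover have "\<alpha>0 \<star> \<gamma> \<noteq> \<zero>\<^bsub>T\<^esub>"
  proof -
    have "res D (\<alpha>0 \<star> (x \<star> v)) = \<alpha>0 \<star> res D (x \<star> v)"
    proof (rule res_mult_right)
      fix a c assume "a \<in> supp \<alpha>0" "c \<in> supp (x \<star> v)"
      then show "a \<otimes> c \<in> D \<longleftrightarrow> c \<in> D" using D_mult_iff(1)[of a c] \<alpha>0_supp supp_carrier by auto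
    qed (use x vc in auto)
    moreover have "\<one> \<in> supp (res D (\<alpha>0 \<star> (x \<star> v)))"
      using v(2) x vc D_closed(4) by (simp add: supp_res T_assoc)
    ultimately show ?thesis unfolding \<gamma>_def by auto
  qed
  ultimately show ?thesis by blast
qed

text \<open>The element \<open>k\<close> contains a component of \<open>\<omega>\<close> as a
  factor, which keeps products nonzero, and ends in a component of some \<open>\<beta>\<close> in
  \<open>L\<close> of least support, which allows \<open>\<beta>\<close> to be moved to the right
  end, where its smallness applies. Both properties are stated for all \<open>p k q\<close>, because
  \<open>k\<close> will later be replaced by such multiples.\<close>

lemma first_half:
  assumes "\<exists>\<gamma>\<in>L. supp \<gamma> \<subseteq> D \<and> \<alpha>0 \<star> \<gamma> \<noteq> \<zero>\<^bsub>T\<^esub>"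
  obtains \<omega> k W where "\<omega> \<in> A" "\<omega> \<in> J" "supp \<omega> \<inter> D \<noteq> {}" "cosets \<omega> \<subseteq> cosets \<alpha>"
    "k \<in> J" "k \<in> deg \<one>" "k \<noteq> \<zero>\<^bsub>T\<^esub>" "subgroup W G" "W \<subseteq> H" "fin_cover W H"
    "\<And>p q. p \<in> deg \<one> \<Longrightarrow> q \<in> deg \<one> \<Longrightarrow> p \<star> k \<star> q \<noteq> \<zero>\<^bsub>T\<^esub> \<Longrightarrow> nonvanish \<omega> (p \<star> k \<star> q) \<inter> W \<noteq> {}"
    "\<And>p q. p \<in> deg \<one> \<Longrightarrow> q \<in> deg \<one> \<Longrightarrow> small (nonvanish \<omega> (p \<star> k \<star> q) \<inter> W)"
proof -
  define Q where "Q \<gamma> \<longleftrightarrow> \<gamma> \<in> L \<and> supp \<gamma> \<subseteq> D \<and> \<alpha>0 \<star> \<gamma> \<noteq> \<zero>\<^bsub>T\<^esub>" for \<gamma>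
  have "\<exists>\<gamma>. Q \<gamma>" using assms unfolding Q_def by blast
  then obtain \<beta> where "Q \<beta>" and bmin: "\<And>\<gamma>. Q \<gamma> \<Longrightarrow> card (supp \<beta>) \<le> card (supp \<gamma>)"
    using ex_has_least_nat[of Q _ "\<lambda>\<gamma>. card (supp \<gamma>)"] by blast
  then have \<beta>: "\<beta> \<in> L" "supp \<beta> \<subseteq> D" "\<alpha>0 \<star> \<beta> \<noteq> \<zero>\<^bsub>T\<^esub>" by (auto simp: Q_def)
  have bc: "\<beta> \<in> carrier T" using \<beta> L_D by blast
  define Z where "Z = supp \<alpha>0 \<union> supp \<beta>"
  \<comment> \<open>Degrees in \<open>W\<close> commute with those of \<open>\<alpha>0\<close> and
    \<open>\<beta>\<close>, so moving factors of such degrees across \<open>\<beta>\<close> does not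
    change supports; the index is finite because FC-elements are centralized.\<close>
  define W where "W = cent H Z"
  have ZD: "Z \<subseteq> D" using \<beta>(2) \<alpha>0_supp by (auto simp: Z_def)
  have Zc: "Z \<subseteq> carrier G" using ZD D_closed by auto
  have Zfin: "finite Z" using bc by (simp add: Z_def)
  have W: "subgroup W G" unfolding W_def by (rule cent_subgroup[OF H Zc])
  have WH: "W \<subseteq> H" by (auto simp: W_def cent_def)
  have Wcov: "fin_cover W H" unfolding W_def
    by (rule cent_fin_cover[OF H Zfin Zc]) (use ZD in \<open>auto simp: D_def fc_center_def\<close>)
  interpret W: subgroup W G by (rule W)
  have Wcomm: "w \<otimes> z = z \<otimes> w" if "w \<in> W" "z \<in> Z" for w z
    using that unfolding W_def cent_def by blast
  \<comment> \<open>The difference \<open>\<tau>\<close> of the two products, with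
    \<open>\<beta>\<close> and its component \<open>b\<close> exchanged, has support inside that of
    \<open>\<beta>\<close> and loses the degree \<open>g\<close>, where both products give
    \<open>b y b s'\<close>. By minimality of \<open>\<beta>\<close> it is killed by
    \<open>\<alpha>0\<close>.\<close>
  have swap: "\<alpha>0 \<star> \<beta> \<star> y \<star> res {g} \<beta> \<star> s' = \<alpha>0 \<star> (res {g} \<beta> \<star> y) \<star> \<beta> \<star> s'"
    if g: "g \<in> supp \<beta>" and w: "w \<in> W" and y: "y \<in> deg (inv g \<otimes> w)" and s': "s' \<in> deg (inv w)" for g w y s'
  proof -
    define b where "b = res {g} \<beta>"
    have gD: "g \<in> D" "g \<in> Z" using g \<beta>(2) by (auto simp: Z_def)
    have gc: "g \<in> carrier G" using gD D_closed by blast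
    have wc: "w \<in> carrier G" using w by simp
    have cT: "b \<in> carrier T" "y \<in> carrier T" "s' \<in> carrier T" using y s' bc by (auto simp: b_def)
    have bd: "b \<in> deg g" using bc by (simp add: b_def)
    have gw: "w \<otimes> g = g \<otimes> w" using Wcomm w gD by blast
    have dby: "b \<star> y \<in> deg w" using deg_mult[of g "inv g \<otimes> w" b y] bd y gc wc by simp
    have dyb: "y \<star> b \<in> deg w"
    proof -
      have "inv g \<otimes> w \<otimes> g = w" using gc wc gw by (simp add: m_assoc)
      then show ?thesis using deg_mult[of "inv g \<otimes> w" g y b] bd y gc wc by simp
    qed
    define \<tau> where "\<tau> = b \<star> y \<star> \<beta> \<star> s' \<boxminus> \<beta> \<star> (y \<star> b) \<star> s'"
    have conj: "w \<otimes> x \<otimes> inv w = x" "x \<otimes> w \<otimes> inv w = x" if "x \<in> supp \<beta>" for x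
    proof -
      have xc: "x \<in> carrier G" using that supp_carrier by blast
      have "w \<otimes> x = x \<otimes> w" using Wcomm[OF w] that by (simp add: Z_def)
      then show "w \<otimes> x \<otimes> inv w = x" "x \<otimes> w \<otimes> inv w = x" using xc wc by (simp_all add: m_assoc)
    qed
    have iw: "inv w \<in> carrier G" using wc by simp
    have "supp (b \<star> y \<star> \<beta> \<star> s') \<subseteq> (\<lambda>a. a \<otimes> inv w) ` (\<lambda>a. w \<otimes> a) ` supp \<beta>"
      using supp_mult_deg_right[OF _ iw s', of "b \<star> y \<star> \<beta>"] supp_mult_deg_left[OF bc wc dby] cT bc by force
    also have "\<dots> = supp \<beta>" using conj by (force simp: image_image)
    finally have S1: "supp (b \<star> y \<star> \<beta> \<star> s') \<subseteq> supp \<beta>" .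
    have "supp (\<beta> \<star> (y \<star> b) \<star> s') \<subseteq> (\<lambda>a. a \<otimes> inv w) ` (\<lambda>a. a \<otimes> w) ` supp \<beta>"
      using supp_mult_deg_right[OF _ iw s', of "\<beta> \<star> (y \<star> b)"] supp_mult_deg_right[OF bc wc dyb] cT bc by force
    also have "\<dots> = supp \<beta>" using conj by (force simp: image_image)
    finally have S2: "supp (\<beta> \<star> (y \<star> b) \<star> s') \<subseteq> supp \<beta>" .
    have \<tau>c: "\<tau> \<in> carrier T" using cT bc by (simp add: \<tau>_def)
    have S: "supp \<tau> \<subseteq> supp \<beta>" unfolding \<tau>_def
      using supp_minus[of "b \<star> y \<star> \<beta> \<star> s'" "\<beta> \<star> (y \<star> b) \<star> s'"] S1 S2 cT bc by auto
    have "res {g} (b \<star> y \<star> \<beta> \<star> s') = b \<star> y \<star> b \<star> s'"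
      using res_mult_deg_right[OF _ iw s', of "b \<star> y \<star> \<beta>" "w \<otimes> g"] res_mult_deg_left[OF bc wc dby gc]
        conj(1)[OF g] cT bc gc wc by (simp add: b_def)
    moreover have "res {g} (\<beta> \<star> (y \<star> b) \<star> s') = b \<star> (y \<star> b) \<star> s'"
      using res_mult_deg_right[OF _ iw s', of "\<beta> \<star> (y \<star> b)" "g \<otimes> w"] res_mult_deg_right[OF bc wc dyb gc]
        conj(2)[OF g] cT bc gc wc by (simp add: b_def)
    ultimately have "res {g} \<tau> = \<zero>\<^bsub>T\<^esub>" using cT bc by (simp add: \<tau>_def res_minus minus_zero_iff T_assoc)
    then have "g \<notin> supp \<tau>" by (simp add: supp_def)
    then have "supp \<tau> \<subset> supp \<beta>" using S g by blast
    then have "card (supp \<tau>) < card (supp \<beta>)" using bc by (intro psubset_card_mono) auto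
    then have "\<not> Q \<tau>" using bmin[of \<tau>] by auto
    moreover have "\<tau> \<in> L" unfolding \<tau>_def
    proof (rule L_minus)
      show "b \<star> y \<star> \<beta> \<star> s' \<in> L"
        using L_right[OF L_left[OF \<beta>(1) _ dby]] w WH cT by blast
      show "\<beta> \<star> (y \<star> b) \<star> s' \<in> L" using L_right[OF L_right[OF \<beta>(1)]] cT by simp
    qed
    ultimately have "\<alpha>0 \<star> \<tau> = \<zero>\<^bsub>T\<^esub>" using S \<beta>(2) by (auto simp: Q_def)
    then have "\<alpha>0 \<star> (b \<star> y \<star> \<beta> \<star> s') = \<alpha>0 \<star> (\<beta> \<star> (y \<star> b) \<star> s')"
      using cT bc by (simp add: \<tau>_def T_minus_distr minus_zero_iff)
    then show ?thesis using cT bc by (simp add: b_def T_assoc)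
  qed
  define \<omega> where "\<omega> = \<alpha> \<star> \<beta>"
  have \<omega>c: "\<omega> \<in> carrier T" using bc by (simp add: \<omega>_def)
  have \<omega>A: "\<omega> \<in> A" using A_closed(2) \<alpha>A bc by (simp add: \<omega>_def)
  have \<omega>J: "\<omega> \<in> J" unfolding \<omega>_def
    by (rule homog_ideal_mult(1)[OF J \<alpha>J bc]) (use \<beta>(2) D_H in blast)
  have \<omega>0: "res D \<omega> = \<alpha>0 \<star> \<beta>" unfolding \<omega>_def \<alpha>0_def using res_D_mult bc \<beta>(2) by simp
  have \<omega>D: "supp \<omega> \<inter> D \<noteq> {}"
    using supp_res[OF \<omega>c, of D] \<beta>(3) supp_empty_iff[of "\<alpha>0 \<star> \<beta>"] bc by (simp add: \<omega>0)
  have \<omega>cos: "cosets \<omega> \<subseteq> cosets \<alpha>" unfolding \<omega>_def by (rule cosets_mult[OF bc \<beta>(2)])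
  obtain k where k: "k \<in> supp (\<alpha>0 \<star> \<beta>)" using supp_nonempty \<beta>(3) bc by (meson T_closed \<alpha>0c)
  have kD: "k \<in> D" using k supp_res[OF \<omega>c, of D] by (simp add: \<omega>0)
  have kc: "k \<in> carrier G" "k \<in> H" using kD D_closed D_H by auto
  define c where "c = res {k} (\<alpha>0 \<star> \<beta>)"
  have c\<omega>: "c = res {k} \<omega>"
  proof -
    have "{k} \<inter> D = {k}" using kD by auto
    then show ?thesis unfolding c_def using res_res[OF \<omega>c, of "{k}" D] by (simp add: \<omega>0)
  qed
  have cJ: "c \<in> J" unfolding c\<omega> by (rule JD(5)[OF \<omega>J])
  have cd: "c \<in> deg k" unfolding c\<omega> using \<omega>c by simp
  have cc: "c \<in> carrier T" using cd by simp
  have cnz: "c \<noteq> \<zero>\<^bsub>T\<^esub>" using k by (simp add: c_def supp_def)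
  \<comment> \<open>Semiprimeness on the finite-index subgroup \<open>W\<close> provides a middle
    factor whose degree is \<open>k^-1\<close> times an element of \<open>W\<close>; this keeps the
    later degrees inside \<open>W\<close>.\<close>
  obtain w y where w: "w \<in> W" and y: "y \<in> deg (inv k \<otimes> w)" and cyc: "c \<star> y \<star> c \<noteq> \<zero>\<^bsub>T\<^esub>"
    using finite_index_semiprime[OF H J W WH Wcov cJ cd kc(2) cnz] by blast
  have wc: "w \<in> carrier G" using w by simp
  have yc: "y \<in> carrier T" using y by simp
  \<comment> \<open>The right-hand \<open>c\<close> is the sum of the products of components with
    degrees \<open>d\<close>, \<open>g\<close> such that \<open>d g = k\<close>; if
    \<open>c y\<close> killed all of them, it would kill \<open>c\<close>.\<close>
  have "\<exists>d g. d \<in> supp \<alpha>0 \<and> g \<in> supp \<beta> \<and> d \<otimes> g = k \<and> c \<star> y \<star> res {d} \<alpha>0 \<star> res {g} \<beta> \<noteq> \<zero>\<^bsub>T\<^esub>"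
  proof (rule ccontr)
    assume no: "\<not> ?thesis"
    define Q1 where "Q1 u \<longleftrightarrow> c \<star> y \<star> res {k} (u \<star> \<beta>) = \<zero>\<^bsub>T\<^esub>" for u
    have "Q1 \<alpha>0"
    proof (rule decomp_induct[OF \<alpha>0c, of Q1])
      show "Q1 \<zero>\<^bsub>T\<^esub>" using cc yc bc by (simp add: Q1_def)
    next
      fix u v assume "u \<in> carrier T" "v \<in> carrier T" "Q1 u" "Q1 v"
      then show "Q1 (u \<boxplus> v)" using cc yc bc by (simp add: Q1_def T_l_distr T_r_distr res_add)
    next
      fix d assume comp: "d \<in> supp \<alpha>0"
      have dc: "d \<in> carrier G" using comp supp_carrier by blast
      have ac: "res {d} \<alpha>0 \<in> carrier T" by simp
      define Q2 where "Q2 v \<longleftrightarrow> c \<star> y \<star> res {k} (res {d} \<alpha>0 \<star> v) = \<zero>\<^bsub>T\<^esub>" for v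
      have "Q2 \<beta>" using bc
      proof (induction \<beta> rule: decomp_induct)
        case zero
        then show ?case using cc yc by (simp add: Q2_def)
      next
        case (add u v)
        then show ?case using cc yc by (simp add: Q2_def T_l_distr T_r_distr res_add)
      next
        case c2: (comp g)
        have gc: "g \<in> carrier G" using c2 supp_carrier by blast
        have dd: "res {d} \<alpha>0 \<star> res {g} \<beta> \<in> deg (d \<otimes> g)" using deg_mult[OF dc gc] bc by simp
        show ?case
        proof (cases "d \<otimes> g = k")
          case True
          then have "c \<star> y \<star> res {d} \<alpha>0 \<star> res {g} \<beta> = \<zero>\<^bsub>T\<^esub>" using no comp c2 by blast
          then show ?thesis using True degD[OF dd] cc yc bc by (simp add: Q2_def T_assoc)
        next
          case False
          then have "res {k} (res {d} \<alpha>0 \<star> res {g} \<beta>) = \<zero>\<^bsub>T\<^esub>" using res_deg_cases[OF _ dd] dc gc by simp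
          then show ?thesis using cc yc by (simp add: Q2_def)
        qed
      qed
      then show "Q1 (res {d} \<alpha>0)" by (simp add: Q1_def Q2_def)
    qed
    then show False using cyc by (simp add: Q1_def c_def)
  qed
  then obtain d g where dg: "d \<in> supp \<alpha>0" "g \<in> supp \<beta>" "d \<otimes> g = k"
    and nz: "c \<star> y \<star> res {d} \<alpha>0 \<star> res {g} \<beta> \<noteq> \<zero>\<^bsub>T\<^esub>" by blast
  have dgc: "d \<in> carrier G" "g \<in> carrier G" "d \<in> Z" "g \<in> Z" using dg supp_carrier by (auto simp: Z_def)
  define b where "b = res {g} \<beta>"
  have b: "b \<in> deg g" "b \<in> carrier T" using bc by (auto simp: b_def)
  \<comment> \<open>Absorbing the component of \<open>\<alpha>0\<close> into \<open>y\<close> leaves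
    \<open>b\<close> as the last factor and produces the degree \<open>g^-1 w\<close> that
    \<open>swap\<close> requires.\<close>
  define y0 where "y0 = y \<star> res {d} \<alpha>0"
  have y0: "y0 \<in> deg (inv g \<otimes> w)" "y0 \<in> carrier T"
  proof -
    have "inv k \<otimes> w \<otimes> d = inv g \<otimes> w"
      using dg(3)[symmetric] dgc wc Wcomm[OF w dgc(3)] by (simp add: inv_mult_group m_assoc)
    moreover have "y0 \<in> deg (inv k \<otimes> w \<otimes> d)" unfolding y0_def using y wc kc dgc by (intro deg_mult) auto
    ultimately show "y0 \<in> deg (inv g \<otimes> w)" by simp
    show "y0 \<in> carrier T" using yc by (simp add: y0_def)
  qed
  have y0b: "y0 \<star> b \<in> deg w"
  proof -
    have "inv g \<otimes> w \<otimes> g = w" using dgc wc Wcomm[OF w dgc(4)] by (simp add: m_assoc)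
    then show ?thesis using deg_mult[of "inv g \<otimes> w" g y0 b] y0 b dgc wc by simp
  qed
  define c' where "c' = c \<star> y0 \<star> b"
  have c'nz: "c' \<noteq> \<zero>\<^bsub>T\<^esub>" using nz cc yc b by (simp add: c'_def y0_def b_def T_assoc)
  have c'd: "c' \<in> deg (k \<otimes> w)" using deg_mult[OF kc(1) wc cd y0b] cc y0 b by (simp add: c'_def T_assoc)
  have kwc: "k \<otimes> w \<in> carrier G" using kc wc by simp
  obtain s t where s: "s \<in> deg (inv (k \<otimes> w))" and ts: "t \<in> deg (k \<otimes> w)" "c' = t \<star> (s \<star> c')"
    using unit_left[OF kwc c'd] by blast
  have sc: "s \<in> carrier T" using s by simp
  \<comment> \<open>The local-unit factor \<open>s\<close> brings the product to degree
    \<open>\<one>\<close> without making it zero.\<close>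
  define k1 where "k1 = s \<star> c'"
  have k1nz: "k1 \<noteq> \<zero>\<^bsub>T\<^esub>" using ts c'nz by (metis T_null(2) deg_carrier k1_def)
  have k1d: "k1 \<in> deg \<one>" using deg_mult[OF _ kwc s c'd] kwc by (simp add: k1_def)
  have k1J: "k1 \<in> J"
  proof -
    have wH: "w \<in> H" using w WH by blast
    have "c \<star> (y0 \<star> b) \<in> J" using JD(7)[OF cJ wH y0b] .
    then have "c' \<in> J" using cc y0 b by (simp add: c'_def T_assoc)
    then show ?thesis unfolding k1_def using JD(6)[of c' "inv (k \<otimes> w)" s] s H_closed kc wH by simp
  qed
  have k1c: "k1 \<in> carrier T" using k1d by simp
  \<comment> \<open>Semiprimeness gives a nonzero \<open>k' y' k'\<close>. The factor
    \<open>c\<close> inside the first \<open>k'\<close> is the component of \<open>\<omega>\<close>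
    of degree \<open>k\<close>, so replacing it by \<open>\<omega>\<close> keeps the product
    nonzero.\<close>
  have nonempty: "nonvanish \<omega> (p \<star> k1 \<star> q) \<inter> W \<noteq> {}"
    if p: "p \<in> deg \<one>" and q: "q \<in> deg \<one>" and nz: "p \<star> k1 \<star> q \<noteq> \<zero>\<^bsub>T\<^esub>" for p q
  proof -
    define k' where "k' = p \<star> k1 \<star> q"
    have pq: "p \<in> carrier T" "q \<in> carrier T" using p q by auto
    have k'c: "k' \<in> carrier T" using pq k1c by (simp add: k'_def)
    have k'd: "k' \<in> deg \<one>"
      using deg_mult[of \<one> \<one> "p \<star> k1" q] deg_mult[of \<one> \<one> p k1] p q k1d by (simp add: k'_def)
    have k'J: "k' \<in> J"
      unfolding k'_def using JD(7)[OF JD(6)[OF k1J _ p] _ q] H_closed by blast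
    obtain w' y' where w': "w' \<in> W" "y' \<in> deg (inv \<one> \<otimes> w')" "k' \<star> y' \<star> k' \<noteq> \<zero>\<^bsub>T\<^esub>"
      using finite_index_semiprime[OF H J W WH Wcov k'J k'd] H_closed nz by (auto simp: k'_def)
    have w'c: "w' \<in> carrier G" using w' by simp
    have y': "y' \<in> deg w'" "y' \<in> carrier T" using w' w'c by auto
    have r: "y0 \<star> b \<star> (q \<star> y') \<in> deg (w \<otimes> w')"
      using deg_mult[OF wc w'c y0b, of "q \<star> y'"] deg_mult[of \<one> w' q y'] q y' w'c by simp
    have rc: "y0 \<star> b \<star> (q \<star> y') \<in> carrier T" using y0 b pq y' by simp
    have "k' \<star> y' \<star> k' = p \<star> s \<star> (c \<star> (y0 \<star> b \<star> (q \<star> y')) \<star> k')"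
    proof -
      have "k' \<star> y' \<star> k' = p \<star> (s \<star> (c \<star> y0 \<star> b)) \<star> q \<star> y' \<star> k'"
        by (rule arg_cong[where f = "\<lambda>z. z \<star> y' \<star> k'"]) (simp add: k'_def k1_def c'_def)
      also have "\<dots> = p \<star> s \<star> (c \<star> (y0 \<star> b \<star> (q \<star> y')) \<star> k')"
        using pq sc cc y0 b y' k'c by (simp add: T_assoc)
      finally show ?thesis .
    qed
    then have nz': "c \<star> (y0 \<star> b \<star> (q \<star> y')) \<star> k' \<noteq> \<zero>\<^bsub>T\<^esub>"
      using w'(3) pq sc by auto
    have "res {k \<otimes> (w \<otimes> w') \<otimes> \<one>} (\<omega> \<star> (y0 \<star> b \<star> (q \<star> y')) \<star> k') = c \<star> (y0 \<star> b \<star> (q \<star> y')) \<star> k'"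
    proof -
      have "res {k \<otimes> (w \<otimes> w')} (\<omega> \<star> (y0 \<star> b \<star> (q \<star> y'))) = c \<star> (y0 \<star> b \<star> (q \<star> y'))"
        unfolding c\<omega> by (rule res_mult_deg_right[OF \<omega>c _ r kc(1)]) (use wc w'c in simp)
      then show ?thesis
        using res_mult_deg_right[of "\<omega> \<star> (y0 \<star> b \<star> (q \<star> y'))" \<one> k' "k \<otimes> (w \<otimes> w')"] k'd \<omega>c rc wc w'c kc by simp
    qed
    then have "\<omega> \<star> (y0 \<star> b \<star> (q \<star> y')) \<star> k' \<noteq> \<zero>\<^bsub>T\<^esub>" using nz' by (metis res_zero)
    moreover have "w \<otimes> w' \<in> W" using w w' by simp
    ultimately show ?thesis using r WH unfolding nonvanish_def k'_def[symmetric] by blast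
  qed
  \<comment> \<open>By \<open>vanish_of_res\<close> nonvanishing passes from \<open>\<omega>\<close>
    to \<open>\<alpha>0 \<beta>\<close>; then \<open>swap\<close> moves \<open>\<beta>\<close>
    behind \<open>b y'\<close>, whose degree is again \<open>x\<close>.\<close>
  have small': "small (nonvanish \<omega> (p \<star> k1 \<star> q) \<inter> W)" if p: "p \<in> deg \<one>" and q: "q \<in> deg \<one>" for p q
  proof (rule small_subset[OF L_D(2)[OF \<beta>(1)]], rule subsetI)
    fix x assume "x \<in> nonvanish \<omega> (p \<star> k1 \<star> q) \<inter> W"
    then obtain r where x: "x \<in> H" "x \<in> W" and r: "r \<in> deg x" "\<omega> \<star> r \<star> (p \<star> k1 \<star> q) \<noteq> \<zero>\<^bsub>T\<^esub>"
      by (auto simp: nonvanish_def)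
    have xc: "x \<in> carrier G" using x H_closed by blast
    have pq: "p \<in> carrier T" "q \<in> carrier T" "r \<in> carrier T" using p q r by auto
    have pkq: "p \<star> k1 \<star> q \<in> deg \<one>"
      using deg_mult[of \<one> \<one> "p \<star> k1" q] deg_mult[of \<one> \<one> p k1] p q k1d by simp
    have rk: "r \<star> (p \<star> k1 \<star> q) \<in> deg x" using deg_mult[OF xc _ r(1) pkq] xc by simp
    have "res D \<omega> \<star> (r \<star> (p \<star> k1 \<star> q)) \<noteq> \<zero>\<^bsub>T\<^esub>"
      using vanish_of_res[OF \<omega>A \<omega>J \<omega>cos \<omega>D x(1) rk] r(2) \<omega>c pq k1c by (auto simp: T_assoc)
    then have n1: "\<alpha>0 \<star> \<beta> \<star> (r \<star> (p \<star> k1 \<star> q)) \<noteq> \<zero>\<^bsub>T\<^esub>" by (simp add: \<omega>0)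
    define y' where "y' = r \<star> p \<star> s \<star> c \<star> y0"
    have y'c: "y' \<in> carrier T" using pq sc cc y0 by (simp add: y'_def)
    have xg: "x \<otimes> g = g \<otimes> x" using Wcomm x dgc by blast
    have wg: "w \<otimes> g = g \<otimes> w" using Wcomm w dgc by blast
    have y'd: "y' \<in> deg (inv g \<otimes> x)"
    proof -
      have 1: "r \<star> p \<in> deg x" using deg_mult[OF xc _ r(1) p] xc by simp
      have 2: "s \<star> c \<in> deg (inv (k \<otimes> w) \<otimes> k)" using deg_mult[OF _ kc(1) s cd] kwc by simp
      have 3: "s \<star> c \<star> y0 \<in> deg (inv (k \<otimes> w) \<otimes> k \<otimes> (inv g \<otimes> w))"
        using deg_mult[OF _ _ 2 y0(1)] kwc kc dgc wc by simp
      have "inv (k \<otimes> w) \<otimes> k \<otimes> (inv g \<otimes> w) = inv w \<otimes> (inv g \<otimes> w)"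
        using kc wc dgc by (simp add: inv_mult_group m_assoc)
      also have "\<dots> = inv g"
      proof -
        have "inv w \<otimes> (inv g \<otimes> w) = inv (g \<otimes> w) \<otimes> w" using wc dgc by (simp add: inv_mult_group m_assoc)
        also have "\<dots> = inv (w \<otimes> g) \<otimes> w" by (simp add: wg)
        also have "\<dots> = inv g" using wc dgc by (simp add: inv_mult_group m_assoc)
        finally show ?thesis .
      qed
      finally have "s \<star> c \<star> y0 \<in> deg (inv g)" using 3 by simp
      then have "(r \<star> p) \<star> (s \<star> c \<star> y0) \<in> deg (x \<otimes> inv g)" using 1 xc dgc by (intro deg_mult) auto
      moreover have "x \<otimes> inv g = inv g \<otimes> x"
      proof -
        have "inv g \<otimes> (x \<otimes> g) \<otimes> inv g = inv g \<otimes> (g \<otimes> x) \<otimes> inv g" by (simp add: xg)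
        then show ?thesis using xc dgc by (simp add: m_assoc)
      qed
      ultimately show ?thesis using pq sc cc y0 by (simp add: y'_def T_assoc)
    qed
    have "\<alpha>0 \<star> \<beta> \<star> (r \<star> (p \<star> k1 \<star> q)) = (\<alpha>0 \<star> \<beta> \<star> y' \<star> b) \<star> q"
      using pq sc cc y0 b bc by (simp add: k1_def c'_def y'_def T_assoc)
    then have n2: "\<alpha>0 \<star> \<beta> \<star> y' \<star> b \<noteq> \<zero>\<^bsub>T\<^esub>" using n1 pq by auto
    have y'b: "y' \<star> b \<in> deg x"
    proof -
      have "inv g \<otimes> x \<otimes> g = x" using dgc xc xg by (simp add: m_assoc)
      then show ?thesis using deg_mult[of "inv g \<otimes> x" g y' b] y'd b dgc xc by simp
    qed
    \<comment> \<open>\<open>swap\<close> carries a factor of degree \<open>x^-1\<close>; it is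
      inserted by means of a local unit for \<open>y' b\<close>.\<close>
    obtain s' t' where s': "s' \<in> deg (inv x)" "t' \<in> deg x" "y' \<star> b = y' \<star> b \<star> s' \<star> t'"
      using unit_right[OF xc y'b] by blast
    have s'c: "s' \<in> carrier T" "t' \<in> carrier T" using s' by auto
    have "\<alpha>0 \<star> \<beta> \<star> y' \<star> b = \<alpha>0 \<star> \<beta> \<star> (y' \<star> b \<star> s' \<star> t')" using bc y'c b s'(3) by (simp add: T_assoc)
    also have "\<dots> = (\<alpha>0 \<star> \<beta> \<star> y' \<star> b \<star> s') \<star> t'" using bc y'c b s'c by (simp add: T_assoc)
    finally have n3: "\<alpha>0 \<star> \<beta> \<star> y' \<star> b \<star> s' \<noteq> \<zero>\<^bsub>T\<^esub>" using n2 s'c by auto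
    have "\<alpha>0 \<star> (b \<star> y') \<star> \<beta> \<star> s' \<noteq> \<zero>\<^bsub>T\<^esub>"
      using swap[OF dg(2) x(2) y'd s'(1)] n3 unfolding b_def by simp
    then have "\<alpha>0 \<star> (b \<star> y') \<star> \<beta> \<noteq> \<zero>\<^bsub>T\<^esub>" using s'c by auto
    moreover have "b \<star> y' \<in> deg x" using deg_mult[of g "inv g \<otimes> x" b y'] b y'd dgc xc by simp
    ultimately show "x \<in> nonvanish \<alpha>0 \<beta>" using x(1) by (auto simp: nonvanish_def)
  qed
  show ?thesis
    using that[OF \<omega>A \<omega>J \<omega>D \<omega>cos k1J k1d k1nz W WH Wcov nonempty small'] .
qed

text \<open>The stabilizer \<open>H'\<close> of a hull of the surviving degrees makes a conjugate of
  some element of \<open>Y\<close> an FC-element. A suitable multiple of \<open>\<omega>\<close>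
  over \<open>H'\<close> meets no more cosets than \<open>\<alpha>\<close>, yet two of them are
  forced to merge.\<close>

lemma second_half:
  assumes \<omega>: "\<omega> \<in> A" "\<omega> \<in> J" "supp \<omega> \<inter> D \<noteq> {}" "cosets \<omega> \<subseteq> cosets \<alpha>"
    and k1: "k1 \<in> J" "k1 \<in> deg \<one>" "k1 \<noteq> \<zero>\<^bsub>T\<^esub>"
    and W: "subgroup W G" "W \<subseteq> H" "fin_cover W H"
    and meets: "\<And>p q. p \<in> deg \<one> \<Longrightarrow> q \<in> deg \<one> \<Longrightarrow> p \<star> k1 \<star> q \<noteq> \<zero>\<^bsub>T\<^esub> \<Longrightarrow>
      nonvanish \<omega> (p \<star> k1 \<star> q) \<inter> W \<noteq> {}"
    and smallW: "\<And>p q. p \<in> deg \<one> \<Longrightarrow> q \<in> deg \<one> \<Longrightarrow> small (nonvanish \<omega> (p \<star> k1 \<star> q) \<inter> W)"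
  shows False
proof -
  interpret W: subgroup W G by fact
  interpret H: subgroup H G by (rule H)
  have \<omega>c: "\<omega> \<in> carrier T" using \<omega> A_closed by blast
  have k1c: "k1 \<in> carrier T" using k1 by simp
  define K where "K = {p \<star> k1 \<star> q | p q. p \<in> deg \<one> \<and> q \<in> deg \<one> \<and> p \<star> k1 \<star> q \<noteq> \<zero>\<^bsub>T\<^esub>}"
  have Kd: "k \<in> deg \<one>" "k \<in> carrier T" "k \<in> J" "k \<noteq> \<zero>\<^bsub>T\<^esub>" if kK: "k \<in> K" for k
  proof -
    obtain p q where pq: "p \<in> deg \<one>" "q \<in> deg \<one>" "p \<star> k1 \<star> q \<noteq> \<zero>\<^bsub>T\<^esub>" "k = p \<star> k1 \<star> q"
      using kK by (auto simp: K_def)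
    show "k \<in> deg \<one>" using deg_mult[of \<one> \<one> "p \<star> k1" q] deg_mult[of \<one> \<one> p k1] pq k1 by simp
    then show "k \<in> carrier T" by simp
    show "k \<in> J" using JD(7)[OF JD(6)[OF k1(1) _ pq(1)] _ pq(2)] H_closed pq(4) by blast
    show "k \<noteq> \<zero>\<^bsub>T\<^esub>" using pq by simp
  qed
  have Kmult: "r \<star> k \<star> r' \<in> K"
    if kK: "k \<in> K" and r: "r \<in> deg \<one>" "r' \<in> deg \<one>" "r \<star> k \<star> r' \<noteq> \<zero>\<^bsub>T\<^esub>" for k r r'
  proof -
    obtain p q where pq: "p \<in> deg \<one>" "q \<in> deg \<one>" "k = p \<star> k1 \<star> q" using kK by (auto simp: K_def)
    have c: "p \<in> carrier T" "q \<in> carrier T" "r \<in> carrier T" "r' \<in> carrier T" using pq r by auto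
    have "r \<star> k \<star> r' = (r \<star> p) \<star> k1 \<star> (q \<star> r')" using c k1c pq by (simp add: T_assoc)
    moreover have "r \<star> p \<in> deg \<one>" "q \<star> r' \<in> deg \<one>"
      using deg_mult[of \<one> \<one> r p] deg_mult[of \<one> \<one> q r'] pq r by auto
    ultimately show ?thesis unfolding K_def using r(3)
      by (intro CollectI exI[of _ "r \<star> p"] exI[of _ "q \<star> r'"]) simp
  qed
  have k1K: "k1 \<in> K"
  proof -
    obtain e f where "e \<in> deg \<one>" "e \<star> k1 = k1" "f \<in> deg \<one>" "k1 \<star> f = k1"
      using common_left_unit[OF k1c] homog_right_unit[OF _ k1(2)] by auto
    then show ?thesis unfolding K_def using k1(3) by (intro CollectI exI[of _ e] exI[of _ f]) simp
  qed
  obtain F where F: "finite F" "F \<subseteq> Y \<times> H"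
    "\<And>x. x \<in> nonvanish \<omega> k1 \<inter> W \<Longrightarrow> \<exists>p\<in>F. x \<otimes> inv (snd p) \<in> cent H {fst p}"
  proof -
    obtain p q where "p \<in> deg \<one>" "q \<in> deg \<one>" "k1 = p \<star> k1 \<star> q" using k1K by (auto simp: K_def)
    then have "small (nonvanish \<omega> k1 \<inter> W)" using smallW by metis
    then show ?thesis by (rule smallE) (rule that)
  qed
  have YH: "y \<in> H" "y \<in> carrier G" "y \<notin> D" if "y \<in> Y" for y using that H_closed by (auto simp: Y_def)
  obtain FW where FW: "finite FW" "FW \<subseteq> H" "\<And>h. h \<in> H \<Longrightarrow> \<exists>f\<in>FW. h \<otimes> inv f \<in> W"
    using W(3) unfolding fin_cover_def by blast
  \<comment> \<open>\<open>W\<close> is included so that the part of the hull inside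
    \<open>W\<close> can be separated from the other cosets of \<open>W\<close>.\<close>
  define \<C> where "\<C> = insert W ((\<lambda>p. cent H {fst p}) ` F)"
  have C: "finite \<C>" "\<And>C. C \<in> \<C> \<Longrightarrow> subgroup C G"
    using F(1) W(1) cent_subgroup[OF H] YH F(2) by (auto simp: \<C>_def)
  obtain X Z where X: "X \<in> nonvanish \<omega> ` K" "X \<subseteq> Z" "coset_union H \<C> Z"
    and Zmin: "\<And>X' Z'. X' \<in> nonvanish \<omega> ` K \<Longrightarrow> X' \<subseteq> X \<Longrightarrow> coset_union H \<C> Z' \<Longrightarrow> X' \<subseteq> Z' \<Longrightarrow> Z \<subseteq> Z'"
    using stable_coset_union[OF H C, of "nonvanish \<omega> k1" "nonvanish \<omega> ` K"] k1K
    by (auto simp: nonvanish_def)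
  obtain k where k: "k \<in> K" "X = nonvanish \<omega> k" using X(1) by blast
  note kd = Kd[OF k(1)]
  have ZH: "Z \<subseteq> H" using X(3) unfolding coset_union_def coset_inter_def by auto
  \<comment> \<open>The cosets listed in \<open>F\<close> together with the cosets of
    \<open>W\<close> other than \<open>W\<close> itself cover \<open>X\<close>, because
    \<open>\<omega> S_x k\<close> nonzero forces \<open>\<omega> S_x k1\<close> nonzero. Stability
    puts \<open>Z\<close> into this union.\<close>
  have ZW: "\<exists>p\<in>F. z \<otimes> inv (snd p) \<in> cent H {fst p}" if z: "z \<in> Z" "z \<in> W" for z
  proof -
    define R where "R = (\<lambda>p. ({cent H {fst p}}, snd p)) ` F \<union> (\<lambda>f. ({W}, f)) ` (FW - W)"
    define Z' where "Z' = (\<Union>p\<in>R. coset_inter H p)"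
    have "R \<subseteq> Pow \<C> \<times> H" using F(2) FW(2) by (auto simp: R_def \<C>_def)
    moreover have "finite R" using F(1) FW(1) by (simp add: R_def)
    ultimately have "coset_union H \<C> Z'" unfolding coset_union_def Z'_def by blast
    moreover have "X \<subseteq> Z'"
    proof
      fix x assume x: "x \<in> X"
      then have xH: "x \<in> H" by (auto simp: k nonvanish_def)
      obtain f where f: "f \<in> FW" "x \<otimes> inv f \<in> W" using FW(3) xH by blast
      show "x \<in> Z'"
      proof (cases "f \<in> W")
        case False
        then have "({W}, f) \<in> R" using f by (auto simp: R_def)
        moreover have "x \<in> coset_inter H ({W}, f)" using xH f by (simp add: coset_inter_def)
        ultimately show ?thesis unfolding Z'_def by blast
      next
        case True
        then have "x \<otimes> inv f \<otimes> f \<in> W" using f(2) by simp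
        moreover have "x \<in> carrier G" "f \<in> carrier G" using xH True by auto
        ultimately have xW: "x \<in> W" by (simp add: m_assoc)
        obtain p q where pq: "p \<in> deg \<one>" "q \<in> deg \<one>" "k = p \<star> k1 \<star> q" using k(1) by (auto simp: K_def)
        obtain s where s: "s \<in> deg x" "\<omega> \<star> s \<star> k \<noteq> \<zero>\<^bsub>T\<^esub>" using x by (auto simp: k nonvanish_def)
        have c: "p \<in> carrier T" "q \<in> carrier T" "s \<in> carrier T" using pq s by auto
        have "\<omega> \<star> s \<star> k = (\<omega> \<star> (s \<star> p) \<star> k1) \<star> q" using c \<omega>c k1c pq(3) by (simp add: T_assoc)
        then have "\<omega> \<star> (s \<star> p) \<star> k1 \<noteq> \<zero>\<^bsub>T\<^esub>" using s(2) c by auto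
        moreover have "s \<star> p \<in> deg x" using deg_mult[of x \<one> s p] s pq xH by simp
        ultimately have "x \<in> nonvanish \<omega> k1 \<inter> W" using xH xW by (auto simp: nonvanish_def)
        then obtain p where p: "p \<in> F" "x \<otimes> inv (snd p) \<in> cent H {fst p}" using F(3) by blast
        then have "x \<in> coset_inter H ({cent H {fst p}}, snd p)" using xH by (simp add: coset_inter_def)
        then show ?thesis using p(1) unfolding Z'_def R_def by blast
      qed
    qed
    ultimately have "Z \<subseteq> Z'" using Zmin[OF X(1)] by blast
    then obtain r where r: "r \<in> R" "z \<in> coset_inter H r" using z by (auto simp: Z'_def)
    from r(1) show ?thesis unfolding R_def
    proof
      assume "r \<in> (\<lambda>p. ({cent H {fst p}}, snd p)) ` F"
      then show ?thesis using r(2) by (auto simp: coset_inter_def)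
    next
      assume "r \<in> (\<lambda>f. ({W}, f)) ` (FW - W)"
      then obtain f where f: "f \<in> FW" "f \<notin> W" "z \<otimes> inv f \<in> W" using r(2) by (auto simp: coset_inter_def)
      have fc: "f \<in> carrier G" "z \<in> carrier G" using f FW(2) z by auto
      have "inv (z \<otimes> inv f) \<otimes> z \<in> W" using f(3) z(2) by simp
      moreover have "inv (z \<otimes> inv f) \<otimes> z = f" using fc by (simp add: inv_mult_group m_assoc)
      ultimately show ?thesis using f(2) by simp
    qed
  qed
  \<comment> \<open>New degrees enter \<open>\<omega> S_t k\<close> to the right of
    \<open>t\<close>, and right translation preserves unions of right cosets; hence the right
    stabilizer.\<close>
  define H' where "H' = {x \<in> H. (\<lambda>z. z \<otimes> x) ` Z = Z}"
  have H'I: "x \<in> H'" if x: "x \<in> H" and sub: "\<And>z. z \<in> Z \<Longrightarrow> z \<otimes> x \<in> Z" "\<And>z. z \<in> Z \<Longrightarrow> z \<otimes> inv x \<in> Z" for x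
  proof -
    have "z \<in> (\<lambda>z. z \<otimes> x) ` Z" if z: "z \<in> Z" for z
      by (rule image_eqI[of _ _ "z \<otimes> inv x"]) (use sub(2)[OF z] z ZH x in \<open>auto simp: m_assoc subset_eq\<close>)
    then show ?thesis using x sub(1) by (auto simp: H'_def)
  qed
  have H'D: "z \<otimes> x \<in> Z" "z \<otimes> inv x \<in> Z" if x: "x \<in> H'" and z: "z \<in> Z" for x z
  proof -
    show "z \<otimes> x \<in> Z" using x z by (auto simp: H'_def)
    obtain z' where z': "z' \<in> Z" "z = z' \<otimes> x" using x z by (auto simp: H'_def)
    have "z' \<in> carrier G" "x \<in> carrier G" using z' ZH x by (auto simp: H'_def)
    then show "z \<otimes> inv x \<in> Z" using z' by (simp add: m_assoc)
  qed
  have H'H: "H' \<subseteq> H" by (auto simp: H'_def)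
  have H': "subgroup H' G"
  proof (rule subgroupI)
    show "H' \<subseteq> carrier G" using H'H by auto
    have "\<one> \<in> H'" by (rule H'I) (use ZH in \<open>auto simp: subset_eq\<close>)
    then show "H' \<noteq> {}" by blast
  next
    fix x assume x: "x \<in> H'"
    then have "x \<in> H" using H'H by blast
    then show "inv x \<in> H'" by (intro H'I) (use H'D[OF x] in auto)
  next
    fix x y assume xy: "x \<in> H'" "y \<in> H'"
    then have xyH: "x \<in> H" "y \<in> H" using H'H by auto
    have c: "x \<in> carrier G" "y \<in> carrier G" using xyH by auto
    show "x \<otimes> y \<in> H'"
    proof (rule H'I)
      fix z assume z: "z \<in> Z"
      have zc: "z \<in> carrier G" using z ZH by auto
      have "z \<otimes> x \<otimes> y \<in> Z" using H'D(1)[OF xy(2) H'D(1)[OF xy(1) z]] .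
      then show "z \<otimes> (x \<otimes> y) \<in> Z" using c zc by (simp add: m_assoc)
      have "z \<otimes> inv y \<otimes> inv x \<in> Z" using H'D(2)[OF xy(1) H'D(2)[OF xy(2) z]] .
      then show "z \<otimes> inv (x \<otimes> y) \<in> Z" using c zc by (simp add: m_assoc inv_mult_group)
    qed (use xyH in simp)
  qed
  interpret H': subgroup H' G by (rule H')
  \<comment> \<open>Stability of \<open>Z\<close>, applied to a multiple \<open>k2\<close> of
    \<open>k\<close> whose surviving degrees all lie in the translate \<open>Z x\<close>.\<close>
  have sub: "Z \<subseteq> (\<lambda>z. z \<otimes> x) ` Z"
    if x: "x \<in> H" and k2: "k2 \<in> K" "nonvanish \<omega> k2 \<subseteq> X" "\<And>t. t \<in> nonvanish \<omega> k2 \<Longrightarrow> t \<otimes> inv x \<in> Z" for x k2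
  proof (rule Zmin[OF imageI[OF k2(1)] k2(2)])
    show "coset_union H \<C> ((\<lambda>z. z \<otimes> x) ` Z)" by (rule coset_union_translate[OF H X(3) x C(2)])
    show "nonvanish \<omega> k2 \<subseteq> (\<lambda>z. z \<otimes> x) ` Z"
    proof
      fix t assume t: "t \<in> nonvanish \<omega> k2"
      then have "t \<in> carrier G" "x \<in> carrier G" using x by (auto simp: nonvanish_def)
      then show "t \<in> (\<lambda>z. z \<otimes> x) ` Z"
        using k2(3)[OF t] by (intro image_eqI[of _ _ "t \<otimes> inv x"]) (auto simp: m_assoc)
    qed
  qed
  \<comment> \<open>Two multiples of \<open>k\<close> are built from \<open>k s k\<close>:
    \<open>k2\<close> survives only at degrees in \<open>Z x\<close>, and \<open>k3\<close>, with a
    further factor of degree \<open>x\<close> on the left, only at degrees in \<open>Z x^-1\<close>.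
    Stability turns this into both inclusions between \<open>Z\<close> and
    \<open>Z x\<close>.\<close>
  have key: "x \<in> H'" if x: "x \<in> carrier G" and s: "s \<in> deg x" and nz: "k \<star> s \<star> k \<noteq> \<zero>\<^bsub>T\<^esub>" for x s
  proof -
    have xH: "x \<in> H" using JD(8) kd(3) x s nz by blast
    have sc: "s \<in> carrier T" using s by simp
    have ks: "k \<star> s \<in> deg x" "k \<star> s \<star> k \<in> deg x"
      using deg_mult[of \<one> x k s] deg_mult[of x \<one> "k \<star> s" k] kd s x by auto
    obtain s1 t1 where s1: "s1 \<in> deg (inv x)" "t1 \<in> deg x" "k \<star> s \<star> k = t1 \<star> (s1 \<star> (k \<star> s \<star> k))"
      using unit_left[OF x ks(2)] by blast
    have s1c: "s1 \<in> carrier T" "t1 \<in> carrier T" using s1 by auto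
    define k2 where "k2 = s1 \<star> (k \<star> s \<star> k)"
    have k2nz: "k2 \<noteq> \<zero>\<^bsub>T\<^esub>" using s1(3) nz s1c by (metis T_null(2) k2_def)
    have sks: "s1 \<star> (k \<star> s) \<in> deg \<one>" using deg_mult[OF _ x s1(1) ks(1)] x by simp
    have k2': "k2 = (s1 \<star> (k \<star> s)) \<star> k" using s1c kd sc by (simp add: k2_def T_assoc)
    have k2d: "k2 \<in> deg \<one>" using deg_mult[of \<one> \<one> "s1 \<star> (k \<star> s)" k] sks kd by (simp add: k2')
    have k2c: "k2 \<in> carrier T" using k2d by simp
    have k2K: "k2 \<in> K"
    proof -
      obtain f where f: "f \<in> deg \<one>" "k2 \<star> f = k2" using homog_right_unit[OF _ k2d] by auto
      have "(s1 \<star> (k \<star> s)) \<star> k \<star> f \<in> K" by (rule Kmult[OF k(1) sks f(1)]) (use f k2nz in \<open>simp add: k2'[symmetric]\<close>)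
      then show ?thesis using f by (simp add: k2'[symmetric])
    qed
    have k2X: "nonvanish \<omega> k2 \<subseteq> X"
    proof
      fix t assume "t \<in> nonvanish \<omega> k2"
      then obtain r where r: "t \<in> H" "r \<in> deg t" "\<omega> \<star> r \<star> k2 \<noteq> \<zero>\<^bsub>T\<^esub>" by (auto simp: nonvanish_def)
      have rc: "r \<in> carrier T" using r by simp
      have "\<omega> \<star> (r \<star> (s1 \<star> (k \<star> s))) \<star> k \<noteq> \<zero>\<^bsub>T\<^esub>" using r(3) rc \<omega>c s1c sc kd by (simp add: k2' T_assoc)
      moreover have "r \<star> (s1 \<star> (k \<star> s)) \<in> deg t" using deg_mult[of t \<one> r] r sks by simp
      ultimately show "t \<in> X" using r(1) by (auto simp: k nonvanish_def)
    qed
    have k2x: "t \<otimes> inv x \<in> Z" if "t \<in> nonvanish \<omega> k2" for t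
    proof -
      obtain r where r: "t \<in> H" "r \<in> deg t" "\<omega> \<star> r \<star> k2 \<noteq> \<zero>\<^bsub>T\<^esub>" using \<open>t \<in> nonvanish \<omega> k2\<close> by (auto simp: nonvanish_def)
      have rc: "r \<in> carrier T" using r by simp
      have "\<omega> \<star> r \<star> k2 = (\<omega> \<star> (r \<star> s1) \<star> k) \<star> (s \<star> k)" using rc \<omega>c s1c sc kd by (simp add: k2' T_assoc)
      then have "\<omega> \<star> (r \<star> s1) \<star> k \<noteq> \<zero>\<^bsub>T\<^esub>" using r(3) sc kd by auto
      moreover have "r \<star> s1 \<in> deg (t \<otimes> inv x)" using deg_mult r s1 x by simp
      ultimately have "t \<otimes> inv x \<in> X" using r(1) xH by (auto simp: k nonvanish_def)
      then show ?thesis using X(2) by blast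
    qed
    have Z1: "Z \<subseteq> (\<lambda>z. z \<otimes> x) ` Z" by (rule sub[OF xH k2K k2X k2x])
    \<comment> \<open>Choosing \<open>s2\<close> from a local unit of \<open>s1\<close> keeps
      \<open>s2 k2\<close> nonzero, while \<open>s2 s1\<close> has degree \<open>\<one>\<close>, so
      that the result is again a multiple of \<open>k\<close> of the admissible kind.\<close>
    obtain s2 t2 where s2: "s2 \<in> deg x" "t2 \<in> deg (inv x)" "s1 = t2 \<star> (s2 \<star> s1)"
      using unit_left[OF _ s1(1)] x by (metis inv_closed inv_inv)
    have s2c: "s2 \<in> carrier T" "t2 \<in> carrier T" using s2 by auto
    have "k2 = t2 \<star> (s2 \<star> k2)"
    proof -
      have "k2 = (t2 \<star> (s2 \<star> s1)) \<star> (k \<star> s \<star> k)" unfolding k2_def using s2(3) by simp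
      then show ?thesis using s2c s1c kd sc by (simp add: k2_def T_assoc)
    qed
    then have s2k2: "s2 \<star> k2 \<noteq> \<zero>\<^bsub>T\<^esub>" using k2nz s2c by (metis T_null(2))
    have s2k2d: "s2 \<star> k2 \<in> deg x" using deg_mult[of x \<one> s2 k2] s2 k2d x by simp
    obtain s3 t3 where s3: "s3 \<in> deg (inv x)" "t3 \<in> deg x" "s2 \<star> k2 = s2 \<star> k2 \<star> s3 \<star> t3"
      using unit_right[OF x s2k2d] by blast
    have s3c: "s3 \<in> carrier T" "t3 \<in> carrier T" using s3 by auto
    define k3 where "k3 = s2 \<star> k2 \<star> s3"
    have k3nz: "k3 \<noteq> \<zero>\<^bsub>T\<^esub>" using s3(3) s2k2 s3c by (metis T_null(1) k3_def)
    have k3': "k3 = (s2 \<star> s1) \<star> k \<star> (s \<star> k \<star> s3)" using s1c s2c s3c sc kd by (simp add: k3_def k2' T_assoc)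
    have d1: "s2 \<star> s1 \<in> deg \<one>" using deg_mult[OF x _ s2(1) s1(1)] x by simp
    have d2: "s \<star> k \<star> s3 \<in> deg \<one>"
    proof -
      have "s \<star> k \<in> deg x" using deg_mult[of x \<one> s k] s kd x by simp
      then show ?thesis using deg_mult[of x "inv x" "s \<star> k" s3] s3 x by simp
    qed
    have k3K: "k3 \<in> K" unfolding k3' by (rule Kmult[OF k(1) d1 d2]) (use k3nz in \<open>simp add: k3'[symmetric]\<close>)
    have k3X: "nonvanish \<omega> k3 \<subseteq> X"
    proof
      fix t assume "t \<in> nonvanish \<omega> k3"
      then obtain r where r: "t \<in> H" "r \<in> deg t" "\<omega> \<star> r \<star> k3 \<noteq> \<zero>\<^bsub>T\<^esub>" by (auto simp: nonvanish_def)
      have rc: "r \<in> carrier T" using r by simp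
      have "\<omega> \<star> r \<star> k3 = (\<omega> \<star> (r \<star> (s2 \<star> s1)) \<star> k) \<star> (s \<star> k \<star> s3)"
        using rc \<omega>c s1c s2c s3c sc kd by (simp add: k3' T_assoc)
      then have "\<omega> \<star> (r \<star> (s2 \<star> s1)) \<star> k \<noteq> \<zero>\<^bsub>T\<^esub>" using r(3) s3c sc kd by auto
      moreover have "r \<star> (s2 \<star> s1) \<in> deg t" using deg_mult[of t \<one> r] r d1 by simp
      ultimately show "t \<in> X" using r(1) by (auto simp: k nonvanish_def)
    qed
    have k3x: "t \<otimes> inv (inv x) \<in> Z" if "t \<in> nonvanish \<omega> k3" for t
    proof -
      obtain r where r: "t \<in> H" "r \<in> deg t" "\<omega> \<star> r \<star> k3 \<noteq> \<zero>\<^bsub>T\<^esub>" using \<open>t \<in> nonvanish \<omega> k3\<close> by (auto simp: nonvanish_def)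
      have rc: "r \<in> carrier T" using r by simp
      have "\<omega> \<star> r \<star> k3 = (\<omega> \<star> (r \<star> s2) \<star> k2) \<star> s3" using rc \<omega>c s2c s3c k2c by (simp add: k3_def T_assoc)
      then have "\<omega> \<star> (r \<star> s2) \<star> k2 \<noteq> \<zero>\<^bsub>T\<^esub>" using r(3) s3c by auto
      moreover have "r \<star> s2 \<in> deg (t \<otimes> x)" using deg_mult r s2 x by simp
      ultimately have "t \<otimes> x \<in> nonvanish \<omega> k2" using r(1) xH by (auto simp: nonvanish_def)
      then show ?thesis using k2X X(2) x by auto
    qed
    have Z2: "Z \<subseteq> (\<lambda>z. z \<otimes> inv x) ` Z" by (rule sub[OF _ k3K k3X k3x]) (use xH in simp)
    show "x \<in> H'"
    proof (rule H'I[OF xH])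
      fix z assume z: "z \<in> Z"
      obtain z' where z': "z' \<in> Z" "z = z' \<otimes> inv x" using Z2 z by blast
      have "z' \<in> carrier G" using z' ZH by auto
      then show "z \<otimes> x \<in> Z" using z' x by (simp add: m_assoc)
      obtain z'' where z'': "z'' \<in> Z" "z = z'' \<otimes> x" using Z1 z by blast
      have "z'' \<in> carrier G" using z'' ZH by auto
      then show "z \<otimes> inv x \<in> Z" using z'' x by (simp add: m_assoc)
    qed
  qed
  define J' where "J' = gen H' k"
  have J': "homog_ideal H' J'" unfolding J'_def by (rule homog_ideal_gen[OF H' kd(1) key])
  note J'D = homog_idealD[OF J']
  \<comment> \<open>A surviving degree in \<open>W\<close>; as \<open>H'\<close> stabilizes
    \<open>Z\<close>, the whole coset \<open>u H'\<close> lies in \<open>Z\<close>.\<close>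
  obtain u where u: "u \<in> nonvanish \<omega> k" "u \<in> W"
  proof -
    obtain p q where "p \<in> deg \<one>" "q \<in> deg \<one>" "k = p \<star> k1 \<star> q" using k(1) by (auto simp: K_def)
    then show ?thesis using meets[of p q] kd(4) that by blast
  qed
  obtain su where su: "u \<in> H" "su \<in> deg u" "\<omega> \<star> su \<star> k \<noteq> \<zero>\<^bsub>T\<^esub>" using u(1) by (auto simp: nonvanish_def)
  have uc: "u \<in> carrier G" "su \<in> carrier T" using su by auto
  have uZ: "u \<in> Z" using u(1) k(2) X(2) by blast
  obtain v sv where sv: "v \<in> carrier G" "sv \<in> deg v" "k \<star> sv \<star> (\<omega> \<star> su \<star> k) \<noteq> \<zero>\<^bsub>T\<^esub>"
    using homog_prime_right[of "\<omega> \<star> su \<star> k" \<one> k] su(3) kd \<omega>c uc by auto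
  have svc: "sv \<in> carrier T" using sv by simp
  have vH: "v \<in> H"
  proof -
    have "\<omega> \<star> su \<star> k \<in> J"
      by (rule homog_ideal_mult(1)[OF J]) (use JD(7)[OF \<omega>(2) su(1,2)] kd supp_deg[OF _ kd(1)] in auto)
    then show ?thesis using JD(8)[OF kd(3)] sv by blast
  qed
  \<comment> \<open>Flanking \<open>\<omega>\<close> by \<open>k\<close> on both sides kills every
    component whose shifted degree \<open>v g u\<close> is outside \<open>H'\<close>; this puts an
    element of \<open>A\<close> into the ideal generated by \<open>k\<close> over
    \<open>H'\<close>.\<close>
  define x where "x = k \<star> sv \<star> \<omega> \<star> su \<star> k"
  have xc: "x \<in> carrier T" using kd svc \<omega>c uc by (simp add: x_def)
  have xnz: "x \<noteq> \<zero>\<^bsub>T\<^esub>" using sv(3) kd svc \<omega>c uc by (simp add: x_def T_assoc)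
  have xA: "x \<in> A" unfolding x_def using A_closed(2,3) \<omega>(1) kd svc uc by (simp add: T_assoc \<omega>c)
  have xJ: "x \<in> J'"
  proof -
    define Q where "Q a \<longleftrightarrow> k \<star> sv \<star> a \<star> su \<star> k \<in> J'" for a
    have "Q \<omega>" using \<omega>c
    proof (induction \<omega> rule: decomp_induct)
      case zero
      show ?case using kd svc uc J'D(3) by (simp add: Q_def)
    next
      case (add a b)
      then show ?case using kd svc uc J'D(4) by (simp add: Q_def T_l_distr T_r_distr)
    next
      case (comp g)
      have gc: "g \<in> carrier G" using comp supp_carrier by blast
      define a where "a = res {g} \<omega>"
      have a: "a \<in> deg g" "a \<in> carrier T" using \<omega>c by (auto simp: a_def)
      have d: "sv \<star> a \<star> su \<in> deg (v \<otimes> g \<otimes> u)"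
        using deg_mult[of "v \<otimes> g" u] deg_mult[OF sv(1) gc sv(2) a(1)] su(2) sv(1) gc uc by simp
      have eq: "k \<star> sv \<star> a \<star> su \<star> k = k \<star> (sv \<star> a \<star> su) \<star> k" using kd svc a uc by (simp add: T_assoc)
      show ?case
      proof (cases "k \<star> (sv \<star> a \<star> su) \<star> k = \<zero>\<^bsub>T\<^esub>")
        case True
        then show ?thesis using J'D(3) by (simp add: Q_def eq flip: a_def)
      next
        case False
        then have vgu: "v \<otimes> g \<otimes> u \<in> H'" using key[OF _ d] sv(1) gc uc by simp
        have kJ: "k \<in> J'" unfolding J'_def by (rule gen_self[OF H'.one_closed kd(1)])
        have "k \<star> (sv \<star> a \<star> su) \<in> J'" by (rule J'D(7)[OF kJ vgu d])
        then have "k \<star> (sv \<star> a \<star> su) \<star> k \<in> J'" by (rule J'D(7)[OF _ H'.one_closed kd(1)])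
        then show ?thesis by (simp add: Q_def eq flip: a_def)
      qed
    qed
    then show ?thesis by (simp add: Q_def x_def)
  qed
  have xsupp: "supp x \<subseteq> (\<lambda>g. v \<otimes> g \<otimes> u) ` supp \<omega>"
  proof
    fix a assume a: "a \<in> supp x"
    have d: "k \<star> sv \<in> deg v" using deg_mult[of \<one> v k sv] kd sv by simp
    have d': "su \<star> k \<in> deg u" using deg_mult[of u \<one> su k] kd su uc by simp
    have "x = (k \<star> sv) \<star> \<omega> \<star> (su \<star> k)" using kd svc \<omega>c uc by (simp add: x_def T_assoc)
    then obtain b where b: "b \<in> supp ((k \<star> sv) \<star> \<omega>)" "a = b \<otimes> u"
      using supp_mult_deg_right[OF _ uc(1) d', of "(k \<star> sv) \<star> \<omega>"] a kd svc \<omega>c by auto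
    then show "a \<in> (\<lambda>g. v \<otimes> g \<otimes> u) ` supp \<omega>"
      using supp_mult_deg_left[OF \<omega>c sv(1) d] by auto
  qed
  define conj where "conj y = inv u \<otimes> y \<otimes> u" for y
  \<comment> \<open>\<open>u H'\<close> lies in \<open>Z\<close>, and \<open>Z\<close> meets
    \<open>W\<close> inside finitely many cosets of centralizers of elements of \<open>Y\<close>.
    Cutting \<open>H'\<close> along cosets of \<open>W\<close> and cancelling \<open>u\<close>
    covers \<open>H'\<close> by finitely many cosets of centralizers of elements
    \<open>u^-1 y u\<close>; Neumann's lemma gives one of finite index.\<close>
  have "\<exists>y\<in>Y. fin_conj H' (conj y)"
  proof -
    \<comment> \<open>Representatives inside \<open>H'\<close> for the cosets of \<open>W\<close>
      that meet it, so that quotients stay in both groups.\<close>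
    define f' where "f' f = (SOME h. h \<in> H' \<and> h \<otimes> inv f \<in> W)" for f
    have f': "f' f \<in> H' \<and> f' f \<otimes> inv f \<in> W" if "h \<in> H'" "h \<otimes> inv f \<in> W" for h f
      unfolding f'_def by (rule someI[of "\<lambda>h. h \<in> H' \<and> h \<otimes> inv f \<in> W" h]) (use that in blast)
    define FW' where "FW' = {f \<in> FW. \<exists>h\<in>H'. h \<otimes> inv f \<in> W}"
    have f'H: "f' f \<in> H'" "f' f \<in> carrier G" if f: "f \<in> FW'" for f
    proof -
      obtain h where "h \<in> H'" "h \<otimes> inv f \<in> W" using f by (auto simp: FW'_def)
      then show "f' f \<in> H'" using f' by blast
      then show "f' f \<in> carrier G" by simp
    qed
    define I where "I = F \<times> FW'"
    define E where "E i = {h \<in> H'. u \<otimes> (h \<otimes> inv (f' (snd i))) \<otimes> inv (snd (fst i)) \<in> cent H {fst (fst i)}}" for i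
    define Ci where "Ci i = cent H' {conj (fst (fst i))}" for i :: "('a \<times> 'a) \<times> 'a"
    have iI: "fst (fst i) \<in> Y" "snd (fst i) \<in> carrier G" "snd i \<in> FW'" if "i \<in> I" for i
      using that F(2) by (auto simp: I_def)
    have conjc: "conj y \<in> carrier G" if "y \<in> Y" for y using YH[OF that] uc by (simp add: conj_def)
    have "\<exists>i\<in>I. fin_cover (Ci i) H'"
    proof (rule neumann[OF H', where E = E])
      show "finite I" using F(1) FW(1) by (simp add: I_def FW'_def)
      show "subgroup (Ci i) G" if "i \<in> I" for i
        unfolding Ci_def by (rule cent_subgroup[OF H']) (use conjc iI[OF that] in simp)
      show "H' \<subseteq> (\<Union>i\<in>I. E i)"
      proof
        fix h assume h: "h \<in> H'"
        have hc: "h \<in> carrier G" "h \<in> H" using h H'H by auto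
        obtain f where f: "f \<in> FW" "h \<otimes> inv f \<in> W" using FW(3) hc by blast
        have fF: "f \<in> FW'" using f h by (auto simp: FW'_def)
        have ff: "f' f \<otimes> inv f \<in> W" using f' h f(2) by blast
        have fc: "f \<in> carrier G" using f FW(2) by auto
        have "(h \<otimes> inv f) \<otimes> inv (f' f \<otimes> inv f) \<in> W" using f(2) ff by simp
        then have hW: "h \<otimes> inv (f' f) \<in> W" using hc fc f'H[OF fF] by (simp add: m_assoc inv_mult_group)
        have "h \<otimes> inv (f' f) \<in> H'" using h f'H[OF fF] by simp
        then have "u \<otimes> (h \<otimes> inv (f' f)) \<in> Z" using H'D(1) uZ by blast
        moreover have "u \<otimes> (h \<otimes> inv (f' f)) \<in> W" using hW u(2) by simp
        ultimately obtain p where p: "p \<in> F" "u \<otimes> (h \<otimes> inv (f' f)) \<otimes> inv (snd p) \<in> cent H {fst p}"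
          using ZW by blast
        then have "h \<in> E (p, f)" using h by (simp add: E_def)
        then show "h \<in> (\<Union>i\<in>I. E i)" using p fF by (auto simp: I_def)
      qed
      show "p \<otimes> inv q \<in> Ci i" if i: "i \<in> I" and p: "p \<in> E i" and q: "q \<in> E i" for i p q
      proof -
        define y where "y = fst (fst i)"
        define t where "t = snd (fst i)"
        define f where "f = f' (snd i)"
        have yc: "y \<in> carrier G" "y \<in> Y" using iI[OF i] YH by (auto simp: y_def)
        have c: "t \<in> carrier G" "f \<in> carrier G" using iI[OF i] f'H by (auto simp: t_def f_def)
        have pq: "p \<in> H'" "q \<in> H'" "p \<in> carrier G" "q \<in> carrier G" using p q by (auto simp: E_def)
        have S: "subgroup (cent H {y}) G" by (rule cent_subgroup[OF H]) (use yc in simp)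
        have "u \<otimes> (p \<otimes> inv f) \<otimes> inv t \<in> cent H {y}" "u \<otimes> (q \<otimes> inv f) \<otimes> inv t \<in> cent H {y}"
          using p q by (auto simp: E_def y_def t_def f_def)
        then have "(u \<otimes> (p \<otimes> inv f) \<otimes> inv t) \<otimes> inv (u \<otimes> (q \<otimes> inv f) \<otimes> inv t) \<in> cent H {y}"
          using S by (simp add: subgroup.m_closed subgroup.m_inv_closed)
        then have "u \<otimes> (p \<otimes> inv q) \<otimes> inv u \<in> cent H {y}"
          using pq c uc by (simp add: m_assoc inv_mult_group)
        then have "u \<otimes> (p \<otimes> inv q) \<otimes> inv u \<otimes> y = y \<otimes> (u \<otimes> (p \<otimes> inv q) \<otimes> inv u)" by (simp add: cent_def)
        then have "inv u \<otimes> (u \<otimes> (p \<otimes> inv q) \<otimes> inv u \<otimes> y) \<otimes> u = inv u \<otimes> (y \<otimes> (u \<otimes> (p \<otimes> inv q) \<otimes> inv u)) \<otimes> u"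
          by simp
        then have "(p \<otimes> inv q) \<otimes> conj y = conj y \<otimes> (p \<otimes> inv q)"
          using pq yc uc by (simp add: conj_def m_assoc)
        then show ?thesis using pq by (simp add: Ci_def cent_def y_def)
      qed
    qed
    then obtain i where i: "i \<in> I" "fin_cover (Ci i) H'" by blast
    have "fin_conj H' (conj (fst (fst i)))"
      by (rule fin_conj_of_fin_cover[OF H' conjc[OF iI(1)[OF i(1)]]]) (use i(2) in \<open>simp add: Ci_def\<close>)
    then show ?thesis using iI(1)[OF i(1)] by blast
  qed
  then obtain y where y: "y \<in> Y" "fin_conj H' (conj y)" by blast
  note yH = YH[OF y(1)]
  define D' where "D' = fc_center H'"
  have D': "subgroup D' G" unfolding D'_def by (rule fc_center_subgroup[OF H'])
  interpret D': subgroup D' G by (rule D')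
  interpret D: subgroup D G by (rule D)
  have DD': "d \<in> D'" if "d \<in> D" "d \<in> H'" for d
    using that fin_conj_mono[OF _ H'H] by (auto simp: D'_def D_def fc_center_def)
  have xH': "supp x \<subseteq> H'" using J'D(2)[OF xJ] .
  define p where "p h = D #> h" for h
  define q where "q h = D' #> h" for h
  define \<phi> where "\<phi> g = D #> (v \<otimes> g \<otimes> u)" for g
  have \<phi>_iff: "\<phi> g = \<phi> g' \<longleftrightarrow> D #> g = D #> g'" if "g \<in> carrier G" "g' \<in> carrier G" for g g'
  proof -
    have "\<phi> g = \<phi> g' \<longleftrightarrow> v \<otimes> g \<otimes> u \<otimes> inv (v \<otimes> g' \<otimes> u) \<in> D"
      unfolding \<phi>_def using rcos_eq_iff[OF D] that sv(1) uc by simp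
    also have "v \<otimes> g \<otimes> u \<otimes> inv (v \<otimes> g' \<otimes> u) = v \<otimes> (g \<otimes> inv g') \<otimes> inv v"
      using that sv(1) uc by (simp add: m_assoc inv_mult_group)
    also have "\<dots> \<in> D \<longleftrightarrow> g \<otimes> inv g' \<in> D" using D_conj_iff[OF vH] that by simp
    also have "\<dots> \<longleftrightarrow> D #> g = D #> g'" using rcos_eq_iff[OF D] that by simp
    finally show ?thesis .
  qed
  have respects: "q a = q b" if ab: "a \<in> supp x" "b \<in> supp x" "p a = p b" for a b
  proof -
    have abH: "a \<in> H'" "b \<in> H'" using ab xH' by auto
    have "a \<otimes> inv b \<in> D" using ab(3) rcos_eq_iff[OF D, of a b] abH by (simp add: p_def)
    then have "a \<otimes> inv b \<in> D'" using DD' abH by simp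
    then show ?thesis using rcos_eq_iff[OF D', of a b] abH by (simp add: q_def)
  qed
  have fin: "finite (supp x)" "finite (supp \<omega>)" using xc \<omega>c by auto
  \<comment> \<open>The chain \<open>c1\<close> to \<open>c5\<close> begins and ends with the number
    of cosets of \<open>D'\<close> met by \<open>x\<close>, so all its inequalities are
    equalities.\<close>
  have c1: "card (q ` supp x) \<le> card (p ` supp x)" by (rule card_image_factor(1)[OF fin(1) respects])
  have psub: "p ` supp x \<subseteq> \<phi> ` supp \<omega>" using xsupp by (auto simp: p_def \<phi>_def)
  have c2: "card (p ` supp x) \<le> card (\<phi> ` supp \<omega>)" using psub fin by (intro card_mono) auto
  have c3: "card (\<phi> ` supp \<omega>) \<le> card (cosets \<omega>)" unfolding cosets_def
    by (rule card_image_factor(1)[OF fin(2)]) (use \<phi>_iff supp_carrier in blast)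
  have c4: "card (cosets \<omega>) \<le> card (cosets \<alpha>)" using \<omega>(4) by (intro card_mono finite_cosets) simp
  have c5: "card (cosets \<alpha>) \<le> card (q ` supp x)"
    using minimal[OF H' J' xA xJ xnz] by (simp add: coset_count_def cosets_def q_def D_def D'_def)
  have e1: "p ` supp x = \<phi> ` supp \<omega>" by (rule card_subset_eq[OF _ psub]) (use fin c1 c2 c3 c4 c5 in auto)
  have e2: "cosets \<omega> = cosets \<alpha>" by (rule card_subset_eq[OF finite_cosets \<omega>(4)]) (use c1 c2 c3 c4 c5 in auto)
  have inj: "p a = p b" if "a \<in> supp x" "b \<in> supp x" "q a = q b" for a b
  proof (rule ccontr)
    assume "p a \<noteq> p b"
    then have "card (q ` supp x) < card (p ` supp x)"
      using card_image_factor(2)[OF fin(1) respects that(1,2) _ that(3)] by blast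
    then show False using c1 c2 c3 c4 c5 by linarith
  qed
  obtain g0 where g0: "g0 \<in> supp \<omega>" "g0 \<in> D" using \<omega>(3) by blast
  obtain g1 where g1: "g1 \<in> supp \<omega>" "D #> y = D #> g1"
  proof -
    obtain g where "g \<in> supp \<alpha>" "D #> y = D #> g" using y(1) by (auto simp: Y_def)
    then have "D #> y \<in> cosets \<omega>" unfolding e2 by (auto simp: cosets_def)
    then show ?thesis using that by (auto simp: cosets_def)
  qed
  have gc: "g0 \<in> carrier G" "g1 \<in> carrier G" using g0 g1 supp_carrier by auto
  have "\<phi> g0 \<in> p ` supp x" "\<phi> g1 \<in> p ` supp x" unfolding e1 using g0(1) g1(1) by blast+
  then obtain a b where a: "a \<in> supp x" "p a = \<phi> g0" and b: "b \<in> supp x" "p b = \<phi> g1"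
    by fastforce
  have abH: "a \<in> H'" "b \<in> H'" "a \<in> carrier G" "b \<in> carrier G" using a b xH' by auto
  define d1 where "d1 = a \<otimes> inv (v \<otimes> g0 \<otimes> u)"
  define d2 where "d2 = b \<otimes> inv (v \<otimes> g1 \<otimes> u)"
  define d3 where "d3 = g1 \<otimes> inv y"
  have d1: "d1 \<in> D" using a(2) rcos_eq_iff[OF D] abH gc sv(1) uc by (simp add: d1_def p_def \<phi>_def)
  have d2: "d2 \<in> D" using b(2) rcos_eq_iff[OF D] abH gc sv(1) uc by (simp add: d2_def p_def \<phi>_def)
  have d3: "d3 \<in> D" using g1(2)[symmetric] rcos_eq_iff[OF D] gc yH by (simp add: d3_def)
  have dc: "d1 \<in> carrier G" "d2 \<in> carrier G" "d3 \<in> carrier G" using d1 d2 d3 by auto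
  \<comment> \<open>Solved from \<open>a^-1 b = e (u^-1 y u)\<close>. Its ingredients lie in
    \<open>D\<close> and are conjugated only by \<open>v\<close> and \<open>u\<close> from
    \<open>H\<close>, so \<open>e\<close> lies in \<open>D\<close>.\<close>
  define e where "e = inv u \<otimes> (inv g0 \<otimes> (inv v \<otimes> (inv d1 \<otimes> d2) \<otimes> v) \<otimes> d3) \<otimes> u"
  have eD: "e \<in> D" unfolding e_def
    using d1 d2 d3 g0(2) D_conj(2)[OF _ vH, of "inv d1 \<otimes> d2"] by (intro D_conj(2)[OF _ su(1)]) simp
  have eq: "inv a \<otimes> b = e \<otimes> conj y"
  proof -
    have "a = d1 \<otimes> (v \<otimes> g0 \<otimes> u)" using abH gc sv(1) uc by (simp add: d1_def m_assoc inv_mult_group)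
    moreover have "b = d2 \<otimes> (v \<otimes> g1 \<otimes> u)" using abH gc sv(1) uc by (simp add: d2_def m_assoc inv_mult_group)
    moreover have "g1 = d3 \<otimes> y" using gc yH by (simp add: d3_def m_assoc)
    ultimately show ?thesis
      using dc gc sv(1) uc yH by (simp add: e_def conj_def m_assoc inv_mult_group)
  qed
  have "fin_conj H' e" using eD fin_conj_mono[OF _ H'H] by (simp add: D_def fc_center_def)
  then have "fin_conj H' (e \<otimes> conj y)"
    by (intro fin_conj_mult) (use y(2) eD yH uc H'.subset in \<open>auto simp: conj_def\<close>)
  then have "fin_conj H' (inv a \<otimes> b)" by (simp only: eq)
  moreover have "inv a \<otimes> b \<in> H'" using abH by simp
  ultimately have "inv a \<otimes> b \<in> D'" by (simp add: D'_def fc_center_def)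
  then have "a \<otimes> (inv a \<otimes> b) \<otimes> inv a \<in> D'" unfolding D'_def by (rule fc_center_conj[OF H' _ abH(1)])
  then have "b \<otimes> inv a \<in> D'" using abH by simp
  then have "q b = q a" using rcos_eq_iff[OF D', of b a] abH by (simp add: q_def)
  \<comment> \<open>Equality of the counts means that cosets equal over \<open>D'\<close> were
    already equal over \<open>D\<close>; thus \<open>y\<close> would lie in the coset of
    \<open>g0\<close>, which is \<open>D\<close>.\<close>
  then have "\<phi> g1 = \<phi> g0" using inj[OF b(1) a(1)] a b by simp
  then have "D #> y = D #> g0" using \<phi>_iff[OF gc(2,1)] g1(2) by simp
  then have "y \<otimes> inv g0 \<in> D" using rcos_eq_iff[OF D, of y g0] yH gc by simp
  then have "y \<in> D" using D_mult_iff(2)[of "inv g0" y] g0 yH by simp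
  then show False using yH by blast
qed

lemma core_vanish:
  assumes "h \<in> H" "s \<in> deg h" "\<beta> \<in> B"
  shows "\<alpha>0 \<star> s \<star> \<beta> = \<zero>\<^bsub>T\<^esub>"
proof (rule ccontr)
  assume nz: "\<not> ?thesis"
  show False
    by (rule first_half[OF exists_nonvanishing[OF assms nz]]) (rule second_half; assumption)
qed

end

section \<open>Reduction to a finite normal subgroup\<close>

context group
begin

lemma pow_conj:
  assumes "h \<in> carrier G" "x \<in> carrier G"
  shows "(h \<otimes> x \<otimes> inv h) [^] (n::nat) = h \<otimes> x [^] n \<otimes> inv h"
  by (induction n) (use assms in \<open>simp_all add: m_assoc\<close>)

text \<open>The relation \<open>m x^-1 \<in> P\<close> is a total preorder on \<open>E\<close>, so a
  maximum exists, but it is unique only modulo elements that lie in \<open>P\<close> together with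
  their inverses. In the application these are the torsion elements.\<close>

lemma exists_max:
  assumes "finite S" "S \<noteq> {}" "S \<subseteq> E" "subgroup E G" "\<one> \<in> P"
    "\<And>x y. x \<in> P \<Longrightarrow> y \<in> P \<Longrightarrow> x \<otimes> y \<in> P" "\<And>x. x \<in> E \<Longrightarrow> x \<in> P \<or> inv x \<in> P"
  shows "\<exists>m\<in>S. \<forall>x\<in>S. m \<otimes> inv x \<in> P"
  using assms(1-3)
proof (induction S rule: finite_ne_induct)
  case (singleton x)
  then have "x \<in> carrier G" using assms(4) by (auto dest: subgroup.mem_carrier)
  then show ?case using assms(5) by simp
next
  case (insert x S)
  then obtain m where m: "m \<in> S" "\<And>y. y \<in> S \<Longrightarrow> m \<otimes> inv y \<in> P" by auto
  have E: "x \<in> E" "m \<in> E" "S \<subseteq> E" using insert m by auto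
  have c: "x \<in> carrier G" "m \<in> carrier G" using E assms(4) by (auto dest: subgroup.mem_carrier)
  have "m \<otimes> inv x \<in> E" using E assms(4) by (simp add: subgroup.m_closed subgroup.m_inv_closed)
  then consider "m \<otimes> inv x \<in> P" | "x \<otimes> inv m \<in> P"
    using assms(7)[of "m \<otimes> inv x"] c by (auto simp: inv_mult_group)
  then show ?case
  proof cases
    case 1
    then show ?thesis using m by auto
  next
    case 2
    have "x \<otimes> inv y \<in> P" if y: "y \<in> S" for y
    proof -
      have "y \<in> carrier G" using y E assms(4) by (auto dest: subgroup.mem_carrier)
      then have "x \<otimes> inv y = (x \<otimes> inv m) \<otimes> (m \<otimes> inv y)" using c by (simp add: m_assoc)
      then show ?thesis using assms(6)[OF 2 m(2)[OF y]] by simp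
    qed
    then show ?thesis using c assms(5) by auto
  qed
qed

end

lemma (in graded_rng) res_mult_both:
  assumes "x \<in> carrier T" "y \<in> carrier T"
    "\<And>a b. a \<in> supp x \<Longrightarrow> b \<in> supp y \<Longrightarrow> a \<otimes> b \<in> K \<longleftrightarrow> a \<in> C \<and> b \<in> C'"
  shows "res K (x \<star> y) = res C x \<star> res C' y"
proof -
  have "x \<star> y = res C x \<star> y \<boxplus> res (- C) x \<star> y"
    using assms res_compl[of x C] by (metis T_l_distr res_closed)
  moreover have "res K (res C x \<star> y) = res C x \<star> res C' y"
    by (rule res_mult_right) (use assms in \<open>auto simp: supp_res\<close>)
  moreover have "res K (res (- C) x \<star> y) = \<zero>\<^bsub>T\<^esub>"
    by (rule res_disj) (use assms supp_mult[of "res (- C) x" y] in \<open>auto simp: supp_res\<close>)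
  ultimately show ?thesis using assms by (simp add: res_add)
qed

text \<open>The two ideals of (iii) are represented by single generators \<open>a\<close> and
  \<open>b\<close>, and the ideal \<open>I\<close> by the graded ideal \<open>J\<close>.\<close>

definition (in graded_rng) np_datum :: "'a set \<Rightarrow> 'a set \<Rightarrow> 'c set \<Rightarrow> 'c \<Rightarrow> 'c \<Rightarrow> bool" where
  "np_datum H N J a b \<longleftrightarrow> subgroup H G \<and> homog_ideal H J \<and> subgroup N G \<and> N \<subseteq> H \<and> finite N \<and>
    (\<forall>h\<in>H. \<forall>n\<in>N. h \<otimes> n \<otimes> inv h \<in> N) \<and> a \<in> J \<and> b \<in> J \<and> a \<noteq> \<zero>\<^bsub>T\<^esub> \<and> b \<noteq> \<zero>\<^bsub>T\<^esub> \<and>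
    supp a \<subseteq> N \<and> supp b \<subseteq> N \<and> (\<forall>h\<in>H. \<forall>s\<in>deg h. a \<star> s \<star> b = \<zero>\<^bsub>T\<^esub>)"

context minimal_form
begin

text \<open>Candidates for the second generator before its support is cut down. Membership in
  \<open>J\<close> is required, so elements of \<open>B\<close> first have to be forced into
  \<open>J\<close>.\<close>

definition "\<B> = {\<beta> \<in> J. \<beta> \<noteq> \<zero>\<^bsub>T\<^esub> \<and> (\<forall>h\<in>H. \<forall>s\<in>deg h. \<alpha>0 \<star> s \<star> \<beta> = \<zero>\<^bsub>T\<^esub>)}"

lemma \<alpha>0_nonzero: "\<alpha>0 \<noteq> \<zero>\<^bsub>T\<^esub>"
  using \<alpha>_meets \<alpha>0_supp by (auto simp: D_def)

text \<open>An element of \<open>B\<close> placed between two copies of a homogeneous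
  \<open>j\<close> in \<open>J\<close> remains in \<open>B\<close> and falls into \<open>J\<close>,
  since \<open>j S_g j = 0\<close> for \<open>g\<close> outside \<open>H\<close>; graded primeness
  keeps the product nonzero.\<close>

lemma \<B>_nonempty: assumes "B \<noteq> {\<zero>\<^bsub>T\<^esub>}" shows "\<B> \<noteq> {}"
proof -
  have "\<zero>\<^bsub>T\<^esub> \<in> B" using B_ideal additive_subgroup.zero_closed by (auto simp: rng_ideal_def)
  then obtain b where b: "b \<in> B" "b \<noteq> \<zero>\<^bsub>T\<^esub>" using assms by blast
  have bc: "b \<in> carrier T" using b B_closed by blast
  obtain g where g: "g \<in> supp \<alpha>0" using supp_nonempty \<alpha>0_nonzero by (meson \<alpha>0c)
  define j where "j = res {g} \<alpha>0"
  have gc: "g \<in> carrier G" using g supp_carrier by blast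
  have jJ: "j \<in> J" unfolding j_def by (rule JD(5)[OF \<alpha>0_J])
  have jd: "j \<in> deg g" by (simp add: j_def)
  have jc: "j \<in> carrier T" using jd by simp
  have jnz: "j \<noteq> \<zero>\<^bsub>T\<^esub>" using g by (simp add: j_def supp_def)
  have gH: "g \<in> H" using g \<alpha>0_supp D_H by blast
  obtain y s where s: "y \<in> carrier G" "s \<in> deg y" "j \<star> s \<star> b \<noteq> \<zero>\<^bsub>T\<^esub>"
    using homog_prime_right[OF bc b(2) gc jd jnz] by blast
  have sc: "s \<in> carrier T" using s by simp
  have jsb: "j \<star> s \<star> b \<in> carrier T" using jc sc bc by simp
  obtain y' s' where s': "y' \<in> carrier G" "s' \<in> deg y'" "j \<star> s \<star> b \<star> s' \<star> j \<noteq> \<zero>\<^bsub>T\<^esub>"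
    using homog_prime_left[OF jsb s(3) gc jd jnz] by blast
  have s'c: "s' \<in> carrier T" using s' by simp
  define \<beta> where "\<beta> = j \<star> s \<star> b \<star> s' \<star> j"
  have "j \<star> s \<star> b \<star> s' \<star> j \<in> B" using B_closed(2,3) b jc sc s'c by (simp add: T_assoc bc)
  then have \<beta>B: "\<beta> \<in> B" by (simp add: \<beta>_def)
  have "\<beta> \<in> J"
  proof -
    define Q where "Q z \<longleftrightarrow> j \<star> s \<star> z \<star> s' \<star> j \<in> J" for z
    have "Q b" using bc
    proof (induction b rule: decomp_induct)
      case zero
      then show ?case using jc sc s'c JD(3) by (simp add: Q_def)
    next
      case (add u v)
      then show ?case using jc sc s'c JD(4) by (simp add: Q_def T_l_distr T_r_distr)
    next
      case (comp k)
      have kc: "k \<in> carrier G" using comp supp_carrier by blast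
      define z where "z = res {k} b"
      have z: "z \<in> deg k" "z \<in> carrier T" using bc by (auto simp: z_def)
      have d: "s \<star> z \<star> s' \<in> deg (y \<otimes> k \<otimes> y')"
        using deg_mult[of "y \<otimes> k" y'] deg_mult[OF s(1) kc s(2) z(1)] s s' kc by simp
      have eq: "j \<star> s \<star> z \<star> s' \<star> j = j \<star> (s \<star> z \<star> s') \<star> j" using jc sc s'c z by (simp add: T_assoc)
      show ?case
      proof (cases "j \<star> (s \<star> z \<star> s') \<star> j = \<zero>\<^bsub>T\<^esub>")
        case True
        then show ?thesis using JD(3) by (simp add: Q_def eq flip: z_def)
      next
        case False
        then have "y \<otimes> k \<otimes> y' \<in> H" using JD(8)[OF jJ jJ _ d] s s' kc by simp
        then have "j \<star> (s \<star> z \<star> s') \<star> j \<in> J" using JD(7)[OF JD(7)[OF jJ _ d] gH jd] by blast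
        then show ?thesis by (simp add: Q_def eq flip: z_def)
      qed
    qed
    then show ?thesis by (simp add: Q_def \<beta>_def)
  qed
  moreover have "\<beta> \<noteq> \<zero>\<^bsub>T\<^esub>" using s' by (simp add: \<beta>_def)
  ultimately have "\<beta> \<in> \<B>" using core_vanish \<beta>B by (auto simp: \<B>_def)
  then show ?thesis by blast
qed

text \<open>The order on \<open>E\<close> modulo torsion singles out the leading part of \<open>\<alpha>0\<close>. For each \<open>h\<close> it
  annihilates the leading part of \<open>h \<beta> h\<inverse>\<close>, which depends on \<open>h\<close>; by minimality of \<open>\<beta>\<close> it
  then annihilates all of \<open>h \<beta> h\<inverse>\<close>.\<close>

lemma final_datum:
  assumes "B \<noteq> {\<zero>\<^bsub>T\<^esub>}"
  shows "\<exists>H N J a b. np_datum H N J a b"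
proof -
  interpret H: subgroup H G by (rule H)
  \<comment> \<open>All \<open>H\<close>-conjugates of the support of \<open>\<alpha>0\<close>:
    finitely many, since these are FC-elements, and permuted by \<open>H\<close>, as
    \<open>fc_group_cone\<close> requires.\<close>
  define X where "X = (\<Union>g\<in>supp \<alpha>0. (\<lambda>h. h \<otimes> g \<otimes> inv h) ` H)"
  have \<alpha>0D: "g \<in> D" "g \<in> carrier G" "fin_conj H g" if "g \<in> supp \<alpha>0" for g
    using that \<alpha>0_supp supp_carrier by (auto simp: D_def fc_center_def)
  have Xfin: "finite X" unfolding X_def using \<alpha>0D(3) by (auto simp: fin_conj_def)
  have XD: "X \<subseteq> fc_center H" using \<alpha>0D(1) D_conj(1) by (auto simp: X_def D_def)
  have Xconj: "h \<otimes> x \<otimes> inv h \<in> X" if h: "h \<in> H" and x: "x \<in> X" for h x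
  proof -
    obtain k g where kg: "k \<in> H" "g \<in> supp \<alpha>0" "x = k \<otimes> g \<otimes> inv k" using x by (auto simp: X_def)
    have "h \<otimes> x \<otimes> inv h = (h \<otimes> k) \<otimes> g \<otimes> inv (h \<otimes> k)"
      using kg h \<alpha>0D(2) by (simp add: m_assoc inv_mult_group)
    then show ?thesis using kg h by (auto simp: X_def)
  qed
  obtain E P where E: "subgroup E G" "X \<subseteq> E" "E \<subseteq> fc_center H"
    and Econj: "\<And>h x. h \<in> H \<Longrightarrow> x \<in> E \<Longrightarrow> h \<otimes> x \<otimes> inv h \<in> E"
    and N: "subgroup (torsion E) G" and P: "P \<subseteq> E" "torsion E \<subseteq> P"
    and Pm: "\<And>x y. x \<in> P \<Longrightarrow> y \<in> P \<Longrightarrow> x \<otimes> y \<in> P"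
    and Pi: "\<And>x. x \<in> P \<Longrightarrow> inv x \<in> P \<Longrightarrow> x \<in> torsion E"
    and Pt: "\<And>x. x \<in> E \<Longrightarrow> x \<in> P \<or> inv x \<in> P"
    and Pc: "\<And>x y. x \<in> P \<Longrightarrow> y \<in> E \<Longrightarrow> y \<otimes> x \<otimes> inv y \<in> P"
    by (rule fc_group_cone[OF H Xfin XD Xconj]) (assumption | rule that)+
  define N where "N = torsion E"
  have NS: "subgroup N G" unfolding N_def by (rule N)
  interpret N: subgroup N G by (rule NS)
  interpret E: subgroup E G by (rule E(1))
  have NP: "N \<subseteq> P" and PN: "\<And>x. x \<in> P \<Longrightarrow> inv x \<in> P \<Longrightarrow> x \<in> N" using P(2) Pi by (auto simp: N_def)
  have NE: "N \<subseteq> E" by (auto simp: N_def torsion_def)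
  have EH: "E \<subseteq> H" using E(3) by (auto simp: fc_center_def)
  have Nconj: "h \<otimes> n \<otimes> inv h \<in> N" if h: "h \<in> H" and n: "n \<in> N" for h n
  proof -
    obtain k where k: "k > (0::nat)" "n [^] k = \<one>" "n \<in> E" using n by (auto simp: N_def torsion_def)
    have "(h \<otimes> n \<otimes> inv h) [^] k = \<one>" using pow_conj[of h n k] k h by simp
    then show ?thesis using Econj[OF h k(3)] k(1) by (auto simp: N_def torsion_def)
  qed
  have Nconj': "inv h \<otimes> n \<otimes> h \<in> N" if "h \<in> H" "n \<in> N" for h n
    using Nconj[of "inv h" n] that by simp
  have Nconj_iff: "h \<otimes> g \<otimes> inv h \<in> N \<longleftrightarrow> g \<in> N" if "h \<in> H" "g \<in> carrier G" for h g
  proof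
    assume "h \<otimes> g \<otimes> inv h \<in> N"
    then have "inv h \<otimes> (h \<otimes> g \<otimes> inv h) \<otimes> h \<in> N" by (rule Nconj'[OF that(1)])
    then show "g \<in> N" using that by (simp add: m_assoc)
  qed (rule Nconj[OF that(1)])
  have Econj_iff: "h \<otimes> g \<otimes> inv h \<in> E \<longleftrightarrow> g \<in> E" if "h \<in> H" "g \<in> carrier G" for h g
  proof
    assume "h \<otimes> g \<otimes> inv h \<in> E"
    then have "inv h \<otimes> (h \<otimes> g \<otimes> inv h) \<otimes> inv (inv h) \<in> E" by (rule Econj[rotated]) (use that in simp)
    then show "g \<in> E" using that by (simp add: m_assoc)
  qed (rule Econj[OF that(1)])
  \<comment> \<open>Cosets of \<open>N\<close> are counted because the order on \<open>E\<close>
    sees elements only modulo torsion.\<close>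
  define \<nu> where "\<nu> \<beta> = card ((\<lambda>g. N #> g) ` supp \<beta>)" for \<beta>
  obtain \<beta>' where \<beta>': "\<beta>' \<in> \<B>" and min': "\<And>\<gamma>. \<gamma> \<in> \<B> \<Longrightarrow> \<nu> \<beta>' \<le> \<nu> \<gamma>"
    using ex_has_least_nat[of "\<lambda>\<gamma>. \<gamma> \<in> \<B>" _ \<nu>] \<B>_nonempty[OF assms] by blast
  have \<beta>'c: "\<beta>' \<in> carrier T" "\<beta>' \<in> J" using \<beta>' JD(1) by (auto simp: \<B>_def)
  obtain y where y: "y \<in> supp \<beta>'" using supp_nonempty[OF \<beta>'c(1)] \<beta>' by (auto simp: \<B>_def)
  have yH: "y \<in> H" using y JD(2)[OF \<beta>'c(2)] by blast
  have yc: "y \<in> carrier G" using yH by simp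
  \<comment> \<open>Inside one coset of \<open>E\<close> the degrees can be compared by the order on
    \<open>E\<close>. The restriction stays in \<open>\<B>\<close> because \<open>E\<close> contains
    the support of \<open>\<alpha>0\<close> and is normalized by \<open>H\<close>; it stays minimal
    because it meets no more cosets of \<open>N\<close>.\<close>
  define \<beta> where "\<beta> = res (E #> y) \<beta>'"
  have \<beta>c: "\<beta> \<in> carrier T" "\<beta> \<in> J" using \<beta>'c JD(5) by (auto simp: \<beta>_def)
  have \<beta>supp: "supp \<beta> = supp \<beta>' \<inter> (E #> y)" using \<beta>'c by (simp add: \<beta>_def supp_res)
  have \<beta>H: "supp \<beta> \<subseteq> H" using JD(2)[OF \<beta>c(2)] .
  have "y \<in> supp \<beta>" using y rcos_self[OF yc E(1)] by (simp add: \<beta>supp)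
  then have \<beta>nz: "\<beta> \<noteq> \<zero>\<^bsub>T\<^esub>" by auto
  have \<alpha>0E: "supp \<alpha>0 \<subseteq> E"
  proof
    fix g assume g: "g \<in> supp \<alpha>0"
    then have "\<one> \<otimes> g \<otimes> inv \<one> \<in> X" unfolding X_def using H.one_closed by blast
    then show "g \<in> E" using E(2) \<alpha>0D[OF g] by auto
  qed
  have \<beta>ann: "\<alpha>0 \<star> s \<star> \<beta> = \<zero>\<^bsub>T\<^esub>" if h: "h \<in> H" and s: "s \<in> deg h" for h s
  proof -
    have sc: "s \<in> carrier T" "h \<in> carrier G" using s h by auto
    have "res (E #> (h \<otimes> y)) (\<alpha>0 \<star> s \<star> \<beta>') = \<alpha>0 \<star> s \<star> res (E #> y) \<beta>'"
    proof (rule res_mult_right)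
      fix a b assume a: "a \<in> supp (\<alpha>0 \<star> s)" and b: "b \<in> supp \<beta>'"
      obtain e where e: "e \<in> E" "a = e \<otimes> h"
        using supp_mult_deg_right[OF _ sc(2) s, of \<alpha>0] a \<alpha>0E by auto
      have bc: "b \<in> carrier G" using b supp_carrier by blast
      have ec: "e \<in> carrier G" using e by simp
      have "a \<otimes> b \<in> E #> (h \<otimes> y) \<longleftrightarrow> e \<otimes> (h \<otimes> (b \<otimes> inv y) \<otimes> inv h) \<in> E"
        using rcos_mem_iff[OF E(1), of "a \<otimes> b" "h \<otimes> y"] e ec bc sc yc by (simp add: m_assoc inv_mult_group)
      also have "\<dots> \<longleftrightarrow> h \<otimes> (b \<otimes> inv y) \<otimes> inv h \<in> E"
      proof
        assume "e \<otimes> (h \<otimes> (b \<otimes> inv y) \<otimes> inv h) \<in> E"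
        then have "inv e \<otimes> (e \<otimes> (h \<otimes> (b \<otimes> inv y) \<otimes> inv h)) \<in> E" using e by simp
        then show "h \<otimes> (b \<otimes> inv y) \<otimes> inv h \<in> E" using ec bc sc yc by simp
      qed (use e in simp)
      also have "\<dots> \<longleftrightarrow> b \<otimes> inv y \<in> E" using Econj_iff[OF h] bc yc by simp
      also have "\<dots> \<longleftrightarrow> b \<in> E #> y" using rcos_mem_iff[OF E(1) bc yc] by simp
      finally show "a \<otimes> b \<in> E #> (h \<otimes> y) \<longleftrightarrow> b \<in> E #> y" .
    qed (use sc \<beta>'c in auto)
    moreover have "\<alpha>0 \<star> s \<star> \<beta>' = \<zero>\<^bsub>T\<^esub>" using \<beta>' h s by (auto simp: \<B>_def)
    ultimately show ?thesis by (simp add: \<beta>_def)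
  qed
  have \<beta>\<B>: "\<beta> \<in> \<B>" using \<beta>c \<beta>nz \<beta>ann by (simp add: \<B>_def)
  have "\<nu> \<beta> \<le> \<nu> \<beta>'" unfolding \<nu>_def using \<beta>'c by (intro card_mono finite_imageI) (auto simp: \<beta>supp)
  then have min: "\<nu> \<beta> \<le> \<nu> \<gamma>" if "\<gamma> \<in> \<B>" for \<gamma> using min'[OF that] by simp
  have P1: "\<one> \<in> P" using NP N.one_closed by blast
  obtain x0 where x0: "x0 \<in> supp \<alpha>0" "\<And>x. x \<in> supp \<alpha>0 \<Longrightarrow> x0 \<otimes> inv x \<in> P"
    using exists_max[OF finite_supp[OF \<alpha>0c] _ \<alpha>0E E(1) P1 Pm Pt] supp_nonempty[OF \<alpha>0c \<alpha>0_nonzero] by blast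
  have x0E: "x0 \<in> E" "x0 \<in> H" "x0 \<in> carrier G" using x0 \<alpha>0E EH by auto
  define \<alpha>m where "\<alpha>m = res (N #> x0) \<alpha>0"
  have \<alpha>mc: "\<alpha>m \<in> carrier T" "\<alpha>m \<in> J" using JD(5)[OF \<alpha>0_J] by (auto simp: \<alpha>m_def)
  have \<alpha>ms: "supp \<alpha>m = supp \<alpha>0 \<inter> (N #> x0)" by (simp add: \<alpha>m_def supp_res)
  have \<alpha>mH: "supp \<alpha>m \<subseteq> H" using JD(2)[OF \<alpha>mc(2)] .
  have rw: "N #> (x \<otimes> h \<otimes> b) = N #> (x0 \<otimes> h \<otimes> b)"
    if "x \<in> N #> x0" "h \<in> H" "b \<in> carrier G" "x \<in> carrier G" for x h b
  proof -
    have "x \<otimes> h \<otimes> b \<otimes> inv (x0 \<otimes> h \<otimes> b) = x \<otimes> inv x0"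
      using that x0E by (simp add: m_assoc inv_mult_group)
    then show ?thesis
      using that x0E rcos_mem_iff[OF NS, of x x0] rcos_eq_iff[OF NS, of "x \<otimes> h \<otimes> b" "x0 \<otimes> h \<otimes> b"] by simp
  qed
  have rw2: "N #> (x0 \<otimes> h \<otimes> b) = N #> (x0 \<otimes> h \<otimes> b') \<longleftrightarrow> N #> b = N #> b'"
    if "h \<in> H" "b \<in> carrier G" "b' \<in> carrier G" for h b b'
  proof -
    have "x0 \<otimes> h \<otimes> b \<otimes> inv (x0 \<otimes> h \<otimes> b') = (x0 \<otimes> h) \<otimes> (b \<otimes> inv b') \<otimes> inv (x0 \<otimes> h)"
      using that x0E by (simp add: m_assoc inv_mult_group)
    moreover have "x0 \<otimes> h \<in> H" using x0E that by simp
    ultimately show ?thesis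
      using that x0E rcos_eq_iff[OF NS, of b b'] rcos_eq_iff[OF NS, of "x0 \<otimes> h \<otimes> b" "x0 \<otimes> h \<otimes> b'"]
        Nconj_iff[of "x0 \<otimes> h" "b \<otimes> inv b'"] by simp
  qed
  have claim1: "\<alpha>m \<star> s \<star> \<beta> = \<zero>\<^bsub>T\<^esub>" if h: "h \<in> H" and s: "s \<in> deg h" for h s
  proof (rule ccontr)
    assume nz: "\<alpha>m \<star> s \<star> \<beta> \<noteq> \<zero>\<^bsub>T\<^esub>"
    have sc: "s \<in> carrier T" "h \<in> carrier G" using s h by auto
    \<comment> \<open>The order is invariant under conjugation by \<open>E\<close> but not known to
      be so under \<open>H\<close>; the leading coset is therefore taken after conjugation by
      \<open>h\<close>.\<close>
    define S where "S = (\<lambda>b. h \<otimes> (b \<otimes> inv y) \<otimes> inv h) ` supp \<beta>"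
    have bE: "b \<otimes> inv y \<in> E" "b \<in> carrier G" if "b \<in> supp \<beta>" for b
    proof -
      show "b \<in> carrier G" using that supp_carrier by blast
      then show "b \<otimes> inv y \<in> E" using that rcos_mem_iff[OF E(1) _ yc, of b] by (simp add: \<beta>supp)
    qed
    have S: "finite S" "S \<noteq> {}" "S \<subseteq> E"
      using \<beta>c supp_nonempty[OF \<beta>c(1) \<beta>nz] Econj[OF h] bE by (auto simp: S_def)
    obtain m where m: "m \<in> S" "\<And>x. x \<in> S \<Longrightarrow> m \<otimes> inv x \<in> P"
      using exists_max[OF S E(1) P1 Pm Pt] by blast
    obtain b0 where b0: "b0 \<in> supp \<beta>" "m = h \<otimes> (b0 \<otimes> inv y) \<otimes> inv h" using m(1) by (auto simp: S_def)
    have b0c: "b0 \<in> carrier G" using bE b0 by blast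
    have b0max: "h \<otimes> (b0 \<otimes> inv b) \<otimes> inv h \<in> P" if b: "b \<in> supp \<beta>" for b
    proof -
      have "m \<otimes> inv (h \<otimes> (b \<otimes> inv y) \<otimes> inv h) \<in> P" using m(2) b by (auto simp: S_def)
      moreover have "m \<otimes> inv (h \<otimes> (b \<otimes> inv y) \<otimes> inv h) = h \<otimes> (b0 \<otimes> inv b) \<otimes> inv h"
        using b0 bE[OF b] b0c sc yc by (simp add: m_assoc inv_mult_group)
      ultimately show ?thesis by simp
    qed
    define K where "K = N #> (x0 \<otimes> h \<otimes> b0)"
    \<comment> \<open>The leading coset of the product arises only from the leading cosets of the
      factors: a competing pair gives \<open>p\<close> and \<open>q'\<close> in \<open>P\<close>
      with product in \<open>N\<close>, which forces both into \<open>N\<close>.\<close>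
    have both: "x \<otimes> h \<otimes> b \<in> K \<longleftrightarrow> x \<in> N #> x0 \<and> b \<in> N #> b0"
      if x: "x \<in> supp \<alpha>0" and b: "b \<in> supp \<beta>" for x b
    proof
      have xE: "x \<in> E" "x \<in> carrier G" using x \<alpha>0E by auto
      note bc = bE(2)[OF b]
      assume "x \<in> N #> x0 \<and> b \<in> N #> b0"
      then have "N #> (x \<otimes> h \<otimes> b) = N #> (x0 \<otimes> h \<otimes> b0)"
        using rw[OF _ h bc xE(2)] rw2[OF h bc b0c] repr_independence[OF _ b0c NS, of b] by simp
      moreover have "x \<otimes> h \<otimes> b \<in> N #> (x \<otimes> h \<otimes> b)" using rcos_self[OF _ NS] xE bc sc by simp
      ultimately show "x \<otimes> h \<otimes> b \<in> K" by (simp add: K_def)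
    next
      have xE: "x \<in> E" "x \<in> carrier G" using x \<alpha>0E by auto
      note bc = bE(2)[OF b]
      assume "x \<otimes> h \<otimes> b \<in> K"
      then have n: "x \<otimes> h \<otimes> b \<otimes> inv (x0 \<otimes> h \<otimes> b0) \<in> N"
        unfolding K_def using rcos_mem_iff[OF NS, of "x \<otimes> h \<otimes> b" "x0 \<otimes> h \<otimes> b0"] xE bc b0c sc x0E by simp
      define n where "n = x \<otimes> h \<otimes> b \<otimes> inv (x0 \<otimes> h \<otimes> b0)"
      define p where "p = x0 \<otimes> inv x"
      define q where "q = h \<otimes> (b0 \<otimes> inv b) \<otimes> inv h"
      define q' where "q' = x0 \<otimes> q \<otimes> inv x0"
      have c: "p \<in> carrier G" "q \<in> carrier G" "q' \<in> carrier G" "n \<in> carrier G"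
        using xE bc b0c sc x0E by (auto simp: p_def q_def q'_def n_def)
      have nN: "n \<in> N" using n by (simp add: n_def)
      have pP: "p \<in> P" using x0(2)[OF x] by (simp add: p_def)
      have qP: "q' \<in> P" unfolding q'_def using Pc[OF _ x0E(1)] b0max[OF b] by (simp add: q_def)
      have eq: "inv n = q' \<otimes> p"
        using xE bc b0c sc x0E by (simp add: n_def p_def q_def q'_def m_assoc inv_mult_group)
      have ip: "inv p = n \<otimes> q'"
      proof -
        have "n \<otimes> q' \<otimes> p = n \<otimes> (q' \<otimes> p)" using c by (simp add: m_assoc)
        also have "\<dots> = \<one>" using c by (simp flip: eq)
        finally show ?thesis using c by (simp add: inv_equality)
      qed
      have "inv p \<in> P" unfolding ip using Pm NP nN qP by blast
      then have pN: "p \<in> N" using PN pP by blast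
      have "q' = inv n \<otimes> inv p" using c by (simp add: eq m_assoc)
      then have "q' \<in> N" using nN pN by simp
      then have "q \<in> N" unfolding q'_def using Nconj_iff[OF x0E(2) c(2)] by simp
      then have "b0 \<otimes> inv b \<in> N" unfolding q_def using Nconj_iff[OF h] b0c bc by simp
      then have "inv (b0 \<otimes> inv b) \<in> N" by simp
      then have 1: "b \<otimes> inv b0 \<in> N" using b0c bc by (simp add: inv_mult_group)
      have "inv p \<in> N" using pN by simp
      then have "x \<otimes> inv x0 \<in> N" using xE x0E by (simp add: p_def inv_mult_group)
      then show "x \<in> N #> x0 \<and> b \<in> N #> b0"
        using 1 rcos_mem_iff[OF NS xE(2) x0E(3)] rcos_mem_iff[OF NS bc b0c] by simp
    qed
    define C where "C = (N #> x0) #> h"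
    have Ch: "x \<otimes> h \<in> C \<longleftrightarrow> x \<in> N #> x0" if "x \<in> carrier G" for x
    proof -
      have "C = N #> (x0 \<otimes> h)" unfolding C_def using x0E sc by (simp add: coset_mult_assoc N.subset)
      then show ?thesis
        using rcos_mem_iff[OF NS, of "x \<otimes> h" "x0 \<otimes> h"] rcos_mem_iff[OF NS that x0E(3)] that x0E sc
        by (simp add: m_assoc inv_mult_group)
    qed
    have r1: "res C (\<alpha>0 \<star> s) = \<alpha>m \<star> s"
      unfolding \<alpha>m_def
    proof (rule res_mult_left)
      fix a b assume "a \<in> supp \<alpha>0" "b \<in> supp s"
      then have "b = h" "a \<in> carrier G" using supp_deg[OF sc(2) s] supp_carrier by auto
      then show "a \<otimes> b \<in> C \<longleftrightarrow> a \<in> N #> x0" using Ch by simp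
    qed (use sc in auto)
    have "res K (\<alpha>0 \<star> s \<star> \<beta>) = res C (\<alpha>0 \<star> s) \<star> res (N #> b0) \<beta>"
    proof (rule res_mult_both)
      fix a b assume a: "a \<in> supp (\<alpha>0 \<star> s)" and b: "b \<in> supp \<beta>"
      obtain x where x: "x \<in> supp \<alpha>0" "a = x \<otimes> h" using supp_mult_deg_right[OF _ sc(2) s, of \<alpha>0] a by auto
      then have "x \<in> carrier G" using supp_carrier by blast
      then show "a \<otimes> b \<in> K \<longleftrightarrow> a \<in> C \<and> b \<in> N #> b0" using both[OF x(1) b] Ch x by simp
    qed (use sc \<beta>c in auto)
    then have top: "\<alpha>m \<star> s \<star> res (N #> b0) \<beta> = \<zero>\<^bsub>T\<^esub>" using \<beta>ann[OF h s] by (simp add: r1)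
    \<comment> \<open>If nonzero, \<open>\<gamma>\<close> is again a member of \<open>\<B>\<close>,
      but its cosets of \<open>N\<close> come from those of \<open>\<beta>\<close> other than
      \<open>N b0\<close>, against minimality.\<close>
    define \<gamma> where "\<gamma> = \<alpha>m \<star> s \<star> \<beta>"
    have \<gamma>eq: "\<gamma> = \<alpha>m \<star> s \<star> res (- (N #> b0)) \<beta>"
    proof -
      have "\<gamma> = \<alpha>m \<star> s \<star> (res (N #> b0) \<beta> \<boxplus> res (- (N #> b0)) \<beta>)"
        unfolding \<gamma>_def using res_compl[OF \<beta>c(1), of "N #> b0"] by simp
      then show ?thesis using \<alpha>mc sc \<beta>c top by (simp add: T_r_distr)
    qed
    have \<alpha>ms': "\<alpha>m \<star> s \<in> J" using JD(7)[OF \<alpha>mc(2) h s] .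
    have \<gamma>J: "\<gamma> \<in> J" unfolding \<gamma>_def
      by (rule homog_ideal_mult(2)[OF J \<beta>c(2)]) (use \<alpha>mc sc JD(2)[OF \<alpha>ms'] in auto)
    have "\<alpha>0 \<star> s' \<star> \<gamma> = \<zero>\<^bsub>T\<^esub>" if h': "h' \<in> H" and s': "s' \<in> deg h'" for h' s'
    proof -
      have s'c: "s' \<in> carrier T" "h' \<in> carrier G" using s' h' by auto
      define Q where "Q z \<longleftrightarrow> \<alpha>0 \<star> s' \<star> (z \<star> s \<star> \<beta>) = \<zero>\<^bsub>T\<^esub>" for z
      have "Q \<alpha>m"
      proof (rule decomp_induct[OF \<alpha>mc(1), of Q])
        show "Q \<zero>\<^bsub>T\<^esub>" using sc \<beta>c s'c by (simp add: Q_def)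
      next
        fix u v assume "u \<in> carrier T" "v \<in> carrier T" "Q u" "Q v"
        then show "Q (u \<boxplus> v)" using sc \<beta>c s'c by (simp add: Q_def T_l_distr T_r_distr)
      next
        fix x assume x: "x \<in> supp \<alpha>m"
        have xH: "x \<in> H" using x \<alpha>mH by blast
        have d: "s' \<star> res {x} \<alpha>m \<star> s \<in> deg (h' \<otimes> x \<otimes> h)"
          using deg_mult[of "h' \<otimes> x" h] deg_mult[of h' x s' "res {x} \<alpha>m"] xH s' s'c s sc \<alpha>mc by simp
        have "\<alpha>0 \<star> (s' \<star> res {x} \<alpha>m \<star> s) \<star> \<beta> = \<zero>\<^bsub>T\<^esub>" by (rule \<beta>ann[OF _ d]) (use h' xH h in simp)
        then show "Q (res {x} \<alpha>m)" using sc \<beta>c s'c \<alpha>mc by (simp add: Q_def T_assoc)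
      qed
      then show ?thesis by (simp add: Q_def \<gamma>_def)
    qed
    then have "\<gamma> \<in> \<B>" using \<gamma>J nz by (simp add: \<B>_def \<gamma>_def)
    then have le: "\<nu> \<beta> \<le> \<nu> \<gamma>" by (rule min)
    define R where "R = supp \<beta> - (N #> b0)"
    have "(\<lambda>g. N #> g) ` supp \<gamma> \<subseteq> (\<lambda>b. N #> (x0 \<otimes> h \<otimes> b)) ` R"
    proof
      fix U assume "U \<in> (\<lambda>g. N #> g) ` supp \<gamma>"
      then obtain k where k: "k \<in> supp \<gamma>" "U = N #> k" by auto
      have rc: "res (- (N #> b0)) \<beta> \<in> carrier T" using \<beta>c by simp
      obtain a b where ab: "a \<in> supp (\<alpha>m \<star> s)" "b \<in> supp (res (- (N #> b0)) \<beta>)" "k = a \<otimes> b"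
        using supp_mult[OF _ rc, of "\<alpha>m \<star> s"] k(1) \<alpha>mc sc by (auto simp: \<gamma>eq)
      have b: "b \<in> R" using ab(2) \<beta>c by (auto simp: supp_res R_def)
      obtain x where x: "x \<in> supp \<alpha>m" "a = x \<otimes> h"
        using supp_mult_deg_right[OF \<alpha>mc(1) sc(2) s] ab(1) by auto
      have "x \<in> N #> x0" "x \<in> carrier G" using x \<alpha>ms supp_carrier by auto
      then have "U = N #> (x0 \<otimes> h \<otimes> b)" using rw[OF _ h] bE(2) b k(2) ab(3) x(2) by (simp add: R_def)
      then show "U \<in> (\<lambda>b. N #> (x0 \<otimes> h \<otimes> b)) ` R" using b by blast
    qed
    then have "\<nu> \<gamma> \<le> card ((\<lambda>b. N #> (x0 \<otimes> h \<otimes> b)) ` R)"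
      unfolding \<nu>_def using \<beta>c by (intro card_mono) (auto simp: R_def)
    also have "\<dots> \<le> card ((\<lambda>b. N #> b) ` R)"
      by (rule card_image_factor(1)) (use \<beta>c rw2[OF h] bE(2) in \<open>auto simp: R_def\<close>)
    also have "\<dots> < \<nu> \<beta>"
      unfolding \<nu>_def
    proof (rule psubset_card_mono)
      have "N #> b0 \<notin> (\<lambda>b. N #> b) ` R"
        using rcos_self[OF bE(2) NS] by (auto simp: R_def)
      moreover have "N #> b0 \<in> (\<lambda>b. N #> b) ` supp \<beta>" using b0(1) by blast
      ultimately show "(\<lambda>b. N #> b) ` R \<subset> (\<lambda>b. N #> b) ` supp \<beta>" by (auto simp: R_def)
    qed (use \<beta>c in simp)
    finally show False using le by simp
  qed
  \<comment> \<open>Any coset of \<open>N\<close> met by \<open>\<beta>\<close> will do, as the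
    parts of \<open>\<alpha>m s \<beta>\<close> in different cosets of \<open>N\<close> vanish
    separately.\<close>
  obtain b1 where b1: "b1 \<in> supp \<beta>" using supp_nonempty[OF \<beta>c(1) \<beta>nz] by blast
  have b1H: "b1 \<in> H" "b1 \<in> carrier G" using b1 \<beta>H by auto
  define \<beta>m where "\<beta>m = res (N #> b1) \<beta>"
  have \<beta>mc: "\<beta>m \<in> carrier T" "\<beta>m \<in> J" using \<beta>c JD(5) by (auto simp: \<beta>m_def)
  have \<beta>ms: "supp \<beta>m = supp \<beta> \<inter> (N #> b1)" using \<beta>c by (simp add: \<beta>m_def supp_res)
  have claim2: "\<alpha>m \<star> s \<star> \<beta>m = \<zero>\<^bsub>T\<^esub>" if h: "h \<in> H" and s: "s \<in> deg h" for h s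
  proof -
    have sc: "s \<in> carrier T" "h \<in> carrier G" using s h by auto
    have "res (N #> (x0 \<otimes> h \<otimes> b1)) (\<alpha>m \<star> s \<star> \<beta>) = \<alpha>m \<star> s \<star> res (N #> b1) \<beta>"
    proof (rule res_mult_right)
      fix a b assume a: "a \<in> supp (\<alpha>m \<star> s)" and b: "b \<in> supp \<beta>"
      obtain x where x: "x \<in> supp \<alpha>m" "a = x \<otimes> h"
        using supp_mult_deg_right[OF \<alpha>mc(1) sc(2) s] a by auto
      have xc: "x \<in> N #> x0" "x \<in> carrier G" using x \<alpha>ms supp_carrier by auto
      have bc: "b \<in> carrier G" using b supp_carrier by blast
      have "a \<otimes> b \<in> N #> (x0 \<otimes> h \<otimes> b1) \<longleftrightarrow> N #> (x \<otimes> h \<otimes> b) = N #> (x0 \<otimes> h \<otimes> b1)"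
        using x rcos_mem_iff[OF NS, of "a \<otimes> b" "x0 \<otimes> h \<otimes> b1"] rcos_eq_iff[OF NS, of "a \<otimes> b" "x0 \<otimes> h \<otimes> b1"]
          xc bc sc x0E b1H by simp
      also have "\<dots> \<longleftrightarrow> N #> b = N #> b1" using rw[OF xc(1) h bc xc(2)] rw2[OF h bc b1H(2)] by simp
      also have "\<dots> \<longleftrightarrow> b \<in> N #> b1"
        using rcos_mem_iff[OF NS bc b1H(2)] rcos_eq_iff[OF NS bc b1H(2)] by simp
      finally show "a \<otimes> b \<in> N #> (x0 \<otimes> h \<otimes> b1) \<longleftrightarrow> b \<in> N #> b1" .
    qed (use \<alpha>mc sc \<beta>c in auto)
    then show ?thesis using claim1[OF h s] by (simp add: \<beta>m_def)
  qed
  have x0m: "x0 \<in> supp \<alpha>m" using x0(1) rcos_self[OF x0E(3) NS] by (simp add: \<alpha>ms)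
  have b1m: "b1 \<in> supp \<beta>m" using b1 rcos_self[OF b1H(2) NS] by (simp add: \<beta>ms)
  obtain s1 where s1: "s1 \<in> deg (inv x0)" "\<one> \<in> supp (s1 \<star> \<alpha>m)" using shift_left[OF \<alpha>mc(1) x0m] by blast
  obtain s2 where s2: "s2 \<in> deg (inv b1)" "\<one> \<in> supp (\<beta>m \<star> s2)" using shift_right[OF \<beta>mc(1) b1m] by blast
  have sc: "s1 \<in> carrier T" "s2 \<in> carrier T" using s1 s2 by auto
  define a where "a = s1 \<star> \<alpha>m"
  define b where "b = \<beta>m \<star> s2"
  have ab: "a \<in> J" "b \<in> J" "a \<noteq> \<zero>\<^bsub>T\<^esub>" "b \<noteq> \<zero>\<^bsub>T\<^esub>"
    using JD(6)[OF \<alpha>mc(2) _ s1(1)] JD(7)[OF \<beta>mc(2) _ s2(1)] x0E b1H s1(2) s2(2) by (auto simp: a_def b_def)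
  have abc: "a \<in> carrier T" "b \<in> carrier T" using ab JD(1) by auto
  have aN: "supp a \<subseteq> N"
  proof
    fix g assume "g \<in> supp a"
    then obtain x where x: "x \<in> supp \<alpha>m" "g = inv x0 \<otimes> x"
      using supp_mult_deg_left[OF \<alpha>mc(1) _ s1(1)] x0E by (auto simp: a_def)
    have xc: "x \<in> carrier G" "x \<in> N #> x0" using x \<alpha>ms supp_carrier by auto
    then have "x \<otimes> inv x0 \<in> N" using rcos_mem_iff[OF NS xc(1) x0E(3)] by simp
    then have "inv x0 \<otimes> (x \<otimes> inv x0) \<otimes> x0 \<in> N" by (rule Nconj'[OF x0E(2)])
    then show "g \<in> N" using x xc x0E by (simp add: m_assoc)
  qed
  have bN: "supp b \<subseteq> N"
  proof
    fix g assume "g \<in> supp b"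
    then obtain x where x: "x \<in> supp \<beta>m" "g = x \<otimes> inv b1"
      using supp_mult_deg_right[OF \<beta>mc(1) _ s2(1)] b1H by (auto simp: b_def)
    have xc: "x \<in> carrier G" "x \<in> N #> b1" using x \<beta>ms supp_carrier by auto
    then show "g \<in> N" using rcos_mem_iff[OF NS xc(1) b1H(2)] x by simp
  qed
  \<comment> \<open>\<open>N\<close> may be infinite. The \<open>H\<close>-conjugates of the two
    supports are finitely many torsion elements, so Dietzmann's lemma gives a finite subgroup that
    contains both supports and is normalized by \<open>H\<close>.\<close>
  define X0 where "X0 = (\<Union>g\<in>supp a \<union> supp b. (\<lambda>h. h \<otimes> g \<otimes> inv h) ` H)"
  have gN: "g \<in> N" "g \<in> carrier G" "fin_conj H g" if "g \<in> supp a \<union> supp b" for g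
  proof -
    show "g \<in> N" using that aN bN by blast
    then show "g \<in> carrier G" "fin_conj H g" using NE E(3) by (auto simp: fc_center_def)
  qed
  have X0fin: "finite X0" unfolding X0_def using gN(3) abc by (auto simp: fin_conj_def)
  have X0N: "X0 \<subseteq> N" using gN(1) Nconj by (auto simp: X0_def)
  have X0c: "X0 \<subseteq> carrier G" using X0N by auto
  have X0conj: "h \<otimes> x \<otimes> inv h \<in> X0" if h: "h \<in> H" and x: "x \<in> X0" for h x
  proof -
    obtain k g where kg: "k \<in> H" "g \<in> supp a \<union> supp b" "x = k \<otimes> g \<otimes> inv k" using x by (auto simp: X0_def)
    have "h \<otimes> x \<otimes> inv h = (h \<otimes> k) \<otimes> g \<otimes> inv (h \<otimes> k)"
      using kg h gN(2) by (simp add: m_assoc inv_mult_group)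
    then show ?thesis using kg h by (auto simp: X0_def)
  qed
  have X0tor: "\<exists>m::nat. m > 0 \<and> x [^] m = \<one>" if "x \<in> X0" for x
    using that X0N by (auto simp: N_def torsion_def)
  have NH: "N \<subseteq> H" using NE EH by blast
  have d: "finite (words X0)" "subgroup (words X0) G"
    using dietzmann[OF X0fin X0c _ X0tor] X0conj X0N NH by blast+
  have sub: "supp a \<subseteq> words X0" "supp b \<subseteq> words X0"
  proof -
    have "g \<in> words X0" if g: "g \<in> supp a \<union> supp b" for g
    proof (rule words_base[OF X0c])
      have "\<one> \<otimes> g \<otimes> inv \<one> \<in> X0" unfolding X0_def using H.one_closed g by blast
      then show "g \<in> X0" using gN(2)[OF g] by simp
    qed
    then show "supp a \<subseteq> words X0" "supp b \<subseteq> words X0" by auto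
  qed
  have wH: "words X0 \<subseteq> H" by (rule words_subset[OF H]) (use X0N NH in blast)
  have wconj: "h \<otimes> n \<otimes> inv h \<in> words X0" if "h \<in> H" "n \<in> words X0" for h n
    by (rule words_conj[OF X0c _ _ that(2)]) (use that X0conj in auto)
  have ann: "a \<star> s \<star> b = \<zero>\<^bsub>T\<^esub>" if h: "h \<in> H" and s: "s \<in> deg h" for h s
  proof -
    have "s \<in> carrier T" using s by simp
    then have "a \<star> s \<star> b = s1 \<star> (\<alpha>m \<star> s \<star> \<beta>m) \<star> s2"
      using sc \<alpha>mc \<beta>mc by (simp add: a_def b_def T_assoc)
    then show ?thesis using claim2[OF h s] sc by simp
  qed
  have "np_datum H (words X0) J a b"
    unfolding np_datum_def using H J d wH wconj ab sub ann by blast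
  then show ?thesis by blast
qed

end

text \<open>The whole group, the whole ring and any nonzero element of \<open>A\<close> form a first
  candidate, so a least coset count is attained. Shifting the minimal element to bring
  \<open>\<one>\<close> into its support does not raise the count, since right translation respects
  right cosets.\<close>

lemma (in graded_prime) exists_np_datum_aux:
  assumes A: "rng_ideal A T" "A \<noteq> {\<zero>\<^bsub>T\<^esub>}" and B: "rng_ideal B T" "B \<noteq> {\<zero>\<^bsub>T\<^esub>}"
    and AB: "\<And>a b. a \<in> A \<Longrightarrow> b \<in> B \<Longrightarrow> a \<star> b = \<zero>\<^bsub>T\<^esub>"
  shows "\<exists>H N J a b. np_datum H N J a b"
proof -
  have A_cl: "x \<in> A \<Longrightarrow> x \<in> carrier T" "x \<in> A \<Longrightarrow> y \<in> carrier T \<Longrightarrow> x \<star> y \<in> A" for x y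
    using A(1) additive_subgroup.a_subset[of A T] by (auto simp: rng_ideal_def)
  have "\<zero>\<^bsub>T\<^esub> \<in> A" using A(1) additive_subgroup.zero_closed by (auto simp: rng_ideal_def)
  then obtain a where a: "a \<in> A" "a \<noteq> \<zero>\<^bsub>T\<^esub>" using A(2) by blast
  define Q where "Q = (\<lambda>(H, J, x). subgroup H G \<and> homog_ideal H J \<and> x \<in> A \<and> x \<in> J \<and> x \<noteq> \<zero>\<^bsub>T\<^esub>)"
  define \<mu> where "\<mu> = (\<lambda>(H, J :: 'c set, x). coset_count (fc_center H) x)"
  have "homog_ideal (carrier G) (carrier T)"
    unfolding homog_ideal_def using supp_carrier by auto
  then have "Q (carrier G, carrier T, a)" using a A_cl(1) by (auto simp: Q_def subgroup_self)
  then obtain t where t: "Q t" "\<And>t'. Q t' \<Longrightarrow> \<mu> t \<le> \<mu> t'"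
    using ex_has_least_nat[of Q _ \<mu>] by blast
  obtain H J x where HJx: "t = (H, J, x)" by (cases t)
  have H: "subgroup H G" and J: "homog_ideal H J" and x: "x \<in> A" "x \<in> J" "x \<noteq> \<zero>\<^bsub>T\<^esub>"
    using t(1) by (auto simp: Q_def HJx)
  have min: "coset_count (fc_center H) x \<le> coset_count (fc_center H') x'"
    if "subgroup H' G" "homog_ideal H' J'" "x' \<in> A" "x' \<in> J'" "x' \<noteq> \<zero>\<^bsub>T\<^esub>" for H' J' x'
    using t(2)[of "(H', J', x')"] that by (auto simp: Q_def \<mu>_def HJx)
  note JD = homog_idealD[OF J]
  have xc: "x \<in> carrier T" using JD x by blast
  obtain g where g: "g \<in> supp x" using supp_nonempty xc x by blast
  have gH: "g \<in> H" using g JD(2)[OF x(2)] by blast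
  have gc: "g \<in> carrier G" using g supp_carrier by blast
  obtain s where s: "s \<in> deg (inv g)" "\<one> \<in> supp (x \<star> s)" using shift_right[OF xc g] by blast
  define \<alpha> where "\<alpha> = x \<star> s"
  have D: "subgroup (fc_center H) G" by (rule fc_center_subgroup[OF H])
  have le: "coset_count (fc_center H) \<alpha> \<le> coset_count (fc_center H) x"
  proof -
    have sub: "supp \<alpha> \<subseteq> (\<lambda>k. k \<otimes> inv g) ` supp x"
      unfolding \<alpha>_def using supp_mult_deg_right[OF xc _ s(1)] gc by simp
    then have "(\<lambda>k. fc_center H #> k) ` supp \<alpha> \<subseteq> (\<lambda>k. fc_center H #> (k \<otimes> inv g)) ` supp x" by auto
    then have "coset_count (fc_center H) \<alpha> \<le> card ((\<lambda>k. fc_center H #> (k \<otimes> inv g)) ` supp x)"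
      unfolding coset_count_def using xc by (intro card_mono) auto
    also have "\<dots> \<le> card ((\<lambda>k. fc_center H #> k) ` supp x)"
    proof (rule card_image_factor(1))
      fix k l assume kl: "k \<in> supp x" "l \<in> supp x" "fc_center H #> k = fc_center H #> l"
      then have "k \<in> carrier G" "l \<in> carrier G" using supp_carrier by auto
      then show "fc_center H #> (k \<otimes> inv g) = fc_center H #> (l \<otimes> inv g)"
        using kl(3) rcos_eq_iff[OF D] gc by (simp add: m_assoc inv_mult_group)
    qed (use xc in simp)
    finally show ?thesis by (simp add: coset_count_def)
  qed
  have \<alpha>A: "\<alpha> \<in> A" using A_cl(2) x(1) s(1) by (simp add: \<alpha>_def)
  have \<alpha>J: "\<alpha> \<in> J" unfolding \<alpha>_def
    using JD(7)[OF x(2) _ s(1)] gH H by (simp add: subgroup.m_inv_closed)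
  have "\<one> \<in> supp \<alpha> \<inter> fc_center H" using s(2) D by (simp add: \<alpha>_def subgroup.one_closed)
  then have meets: "supp \<alpha> \<inter> fc_center H \<noteq> {}" by blast
  interpret minimal_form G T res A B H J \<alpha>
    by (intro minimal_form.intro[OF graded_prime_axioms] minimal_form_axioms.intro)
      (rule A(1) B(1) AB H J \<alpha>A \<alpha>J meets order_trans[OF le min]; assumption)+
  show ?thesis by (rule final_datum[OF B(2)])
qed

text \<open>Where graded primeness fails, the homogeneous witnesses are shifted to degree
  \<open>\<one>\<close>, so that both have support in the trivial subgroup and the whole ring serves
  as \<open>J\<close>.\<close>

lemma (in graded_rng) exists_np_datum:
  assumes A: "rng_ideal A T" "A \<noteq> {\<zero>\<^bsub>T\<^esub>}" and B: "rng_ideal B T" "B \<noteq> {\<zero>\<^bsub>T\<^esub>}"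
    and AB: "\<And>a b. a \<in> A \<Longrightarrow> b \<in> B \<Longrightarrow> a \<star> b = \<zero>\<^bsub>T\<^esub>"
  shows "\<exists>H N J a b. np_datum H N J a b"
proof (cases "\<forall>g\<in>carrier G. \<forall>h\<in>carrier G. \<forall>a\<in>deg g. \<forall>b\<in>deg h. a \<noteq> \<zero>\<^bsub>T\<^esub> \<longrightarrow> b \<noteq> \<zero>\<^bsub>T\<^esub> \<longrightarrow>
    (\<exists>x\<in>carrier G. \<exists>s\<in>deg x. a \<star> s \<star> b \<noteq> \<zero>\<^bsub>T\<^esub>)")
  case True
  interpret graded_prime G T res by unfold_locales (use True in blast)
  show ?thesis by (rule exists_np_datum_aux[OF assms])
next
  case False
  then obtain g h a b where gh: "g \<in> carrier G" "h \<in> carrier G" and a: "a \<in> deg g" "a \<noteq> \<zero>\<^bsub>T\<^esub>"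
    and b: "b \<in> deg h" "b \<noteq> \<zero>\<^bsub>T\<^esub>"
    and ab: "\<And>x s. x \<in> carrier G \<Longrightarrow> s \<in> deg x \<Longrightarrow> a \<star> s \<star> b = \<zero>\<^bsub>T\<^esub>" by blast
  have c: "a \<in> carrier T" "b \<in> carrier T" using a b by auto
  have ga: "g \<in> supp a" "h \<in> supp b" using degD[OF a(1)] degD[OF b(1)] a b gh by (auto simp: supp_def)
  obtain s where s: "s \<in> deg (inv g)" "\<one> \<in> supp (s \<star> a)" using shift_left[OF c(1) ga(1)] by blast
  obtain t where t: "t \<in> deg (inv h)" "\<one> \<in> supp (b \<star> t)" using shift_right[OF c(2) ga(2)] by blast
  have sc: "s \<in> carrier T" "t \<in> carrier T" using s t by auto
  have "s \<star> a \<in> deg \<one>" "b \<star> t \<in> deg \<one>"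
    using deg_mult[OF _ gh(1) s(1) a(1)] deg_mult[OF gh(2) _ b(1) t(1)] gh by auto
  then have supp: "supp (s \<star> a) \<subseteq> {\<one>}" "supp (b \<star> t) \<subseteq> {\<one>}" using supp_deg by auto
  have "s \<star> a \<star> r \<star> (b \<star> t) = \<zero>\<^bsub>T\<^esub>" if r: "x \<in> carrier G" "r \<in> deg x" for x r
  proof -
    have "r \<in> carrier T" using r by simp
    then have "s \<star> a \<star> r \<star> (b \<star> t) = s \<star> (a \<star> r \<star> b) \<star> t" using c sc by (simp add: T_assoc)
    then show ?thesis using ab[OF r] sc by simp
  qed
  moreover have "homog_ideal (carrier G) (carrier T)"
    unfolding homog_ideal_def using supp_carrier by auto
  moreover have "subgroup {\<one>} G" by (rule triv_subgroup)
  moreover have "s \<star> a \<noteq> \<zero>\<^bsub>T\<^esub>" "b \<star> t \<noteq> \<zero>\<^bsub>T\<^esub>" using s(2) t(2) by auto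
  moreover have "s \<star> a \<in> carrier T" "b \<star> t \<in> carrier T" using c sc by simp_all
  ultimately have "np_datum (carrier G) {\<one>} (carrier T) (s \<star> a) (b \<star> t)"
    unfolding np_datum_def using supp subgroup_self by (intro conjI ballI) simp_all
  then show ?thesis by blast
qed

section \<open>The grading of a partial skew group ring\<close>

text \<open>An element of the intersection is a single product \<open>x k\<close> with a local unit
  \<open>k\<close> from \<open>K\<close>. The products of \<open>D g\<close> with \<open>D h\<close>
  and of \<open>I\<close> with \<open>D g\<close> thus become intersections.\<close>

lemma (in nonunital_ring) ideal_prod_eq_inter:
  assumes I: "rng_ideal I R" and K: "rng_ideal K R" and u: "s_unital (R\<lparr>carrier := K\<rparr>)"
  shows "I \<cdot>\<^bsub>R\<^esub> K = I \<inter> K"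
proof
  have sub: "I \<subseteq> carrier R" "K \<subseteq> carrier R"
    using I K additive_subgroup.a_subset by (auto simp: rng_ideal_def)
  show "I \<cdot>\<^bsub>R\<^esub> K \<subseteq> I \<inter> K"
  proof
    fix x assume "x \<in> I \<cdot>\<^bsub>R\<^esub> K"
    then show "x \<in> I \<inter> K"
    proof induction
      case (prod i k)
      then have "i \<in> carrier R" "k \<in> carrier R" using sub by auto
      then show ?case using I K prod by (simp add: rng_ideal_def)
    next
      case (sum x y)
      then show ?case
        using additive_subgroup.a_closed[of I R x y] additive_subgroup.a_closed[of K R x y] I K
        by (simp add: rng_ideal_def)
    qed
  qed
  show "I \<inter> K \<subseteq> I \<cdot>\<^bsub>R\<^esub> K"
  proof
    fix x assume x: "x \<in> I \<inter> K"
    then obtain k where "k \<in> K" "x = x \<otimes>\<^bsub>R\<^esub> k" using u by (auto simp: s_unital_def)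
    then show "x \<in> I \<cdot>\<^bsub>R\<^esub> K" using x ideal_prod.prod[of x I k K R] by simp
  qed
qed

context partial_action
begin

section \<open>The ideals \<open>D g\<close> and the additive group of the skew group ring\<close>

abbreviation "S \<equiv> partial_skew_group_ring G R \<alpha> D"

definition restr :: "'a set \<Rightarrow> ('a \<Rightarrow> 'c) \<Rightarrow> 'a \<Rightarrow> 'c" where
  "restr C f = (\<lambda>x. if x \<in> C then f x else \<zero>\<^bsub>R\<^esub>)"

lemma DR: "g \<in> carrier G \<Longrightarrow> x \<in> D g \<Longrightarrow> x \<in> carrier R" using D_subset by blast

lemma D_add: "g \<in> carrier G \<Longrightarrow> x \<in> D g \<Longrightarrow> y \<in> D g \<Longrightarrow> x \<oplus>\<^bsub>R\<^esub> y \<in> D g"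
  using D_ideal[of g] additive_subgroup.a_closed[of "D g" R x y] by (simp add: rng_ideal_def)

lemma D_neg: "g \<in> carrier G \<Longrightarrow> x \<in> D g \<Longrightarrow> \<ominus>\<^bsub>R\<^esub> x \<in> D g"
  using D_ideal[of g] abelian_group.a_inv_closed[OF R.abelian_group_axioms]
    group.subgroupE(3)[of "add_monoid R" "D g" x] R.a_group by (simp add: rng_ideal_def additive_subgroup_def a_inv_def)

lemma D_mult: "g \<in> carrier G \<Longrightarrow> x \<in> D g \<Longrightarrow> y \<in> carrier R \<Longrightarrow> x \<otimes>\<^bsub>R\<^esub> y \<in> D g"
    "g \<in> carrier G \<Longrightarrow> x \<in> D g \<Longrightarrow> y \<in> carrier R \<Longrightarrow> y \<otimes>\<^bsub>R\<^esub> x \<in> D g"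
  using D_ideal by (auto simp: rng_ideal_def)

lemma D_unit_right: assumes "g \<in> carrier G" "x \<in> D g" obtains e where "e \<in> D g" "x \<otimes>\<^bsub>R\<^esub> e = x"
  using D_s_unital[OF assms(1)] assms(2) by (auto simp: s_unital_def)

lemma D_unit_left: assumes "g \<in> carrier G" "x \<in> D g" obtains e where "e \<in> D g" "e \<otimes>\<^bsub>R\<^esub> x = x"
  using D_s_unital[OF assms(1)] assms(2) by (auto simp: s_unital_def)

lemma D_prod: "g \<in> carrier G \<Longrightarrow> h \<in> carrier G \<Longrightarrow> D g \<cdot>\<^bsub>R\<^esub> D h = D g \<inter> D h"
  by (intro R.ideal_prod_eq_inter D_ideal D_s_unital)

lemma \<alpha>_mult: "\<lbrakk>g \<in> carrier G; x \<in> D (inv g); y \<in> D (inv g)\<rbrakk> \<Longrightarrow>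
    \<alpha> g (x \<otimes>\<^bsub>R\<^esub> y) = \<alpha> g x \<otimes>\<^bsub>R\<^esub> \<alpha> g y"
  using \<alpha>_iso[of g] by (auto simp: rng_iso_def hom_def)

lemma \<alpha>_add: "\<lbrakk>g \<in> carrier G; x \<in> D (inv g); y \<in> D (inv g)\<rbrakk> \<Longrightarrow>
    \<alpha> g (x \<oplus>\<^bsub>R\<^esub> y) = \<alpha> g x \<oplus>\<^bsub>R\<^esub> \<alpha> g y"
  using \<alpha>_iso[of g] by (auto simp: rng_iso_def iso_def hom_def)

lemma \<alpha>_inter: assumes "g \<in> carrier G" "h \<in> carrier G" "x \<in> D (inv g)" "x \<in> D h"
  shows "\<alpha> g x \<in> D (g \<otimes> h)"
  using \<alpha>_image[OF assms(1,2)] assms by (auto simp: D_prod)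

lemma \<alpha>_comp': assumes "g \<in> carrier G" "h \<in> carrier G" "x \<in> D (inv h)" "x \<in> D (inv (g \<otimes> h))"
  shows "\<alpha> g (\<alpha> h x) = \<alpha> (g \<otimes> h) x"
  using \<alpha>_comp[OF assms(1,2)] assms by (simp add: D_prod)

lemma \<alpha>_inv: assumes "g \<in> carrier G" "x \<in> D (inv g)" shows "\<alpha> (inv g) (\<alpha> g x) = x"
  using \<alpha>_comp'[of "inv g" g x] assms DR[of "inv g" x] by (simp add: D_one \<alpha>_one)

lemma \<alpha>_inv': assumes "g \<in> carrier G" "x \<in> D g" shows "\<alpha> g (\<alpha> (inv g) x) = x"
  using \<alpha>_inv[of "inv g" x] assms by simp

lemma \<alpha>_closed': "g \<in> carrier G \<Longrightarrow> x \<in> D g \<Longrightarrow> \<alpha> (inv g) x \<in> D (inv g)"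
  using \<alpha>_closed[of "inv g" x] by simp

lemma S_carrier: "f \<in> carrier S \<longleftrightarrow> (\<forall>g\<in>carrier G. f g \<in> D g) \<and> (\<forall>g. g \<notin> carrier G \<longrightarrow> f g = \<zero>\<^bsub>R\<^esub>) \<and>
    finite {g \<in> carrier G. f g \<noteq> \<zero>\<^bsub>R\<^esub>}"
  by (simp add: partial_skew_group_ring_def)

lemma S_zero: "\<zero>\<^bsub>S\<^esub> = (\<lambda>x. \<zero>\<^bsub>R\<^esub>)" and S_add: "f \<oplus>\<^bsub>S\<^esub> k = (\<lambda>x. f x \<oplus>\<^bsub>R\<^esub> k x)"
  by (simp_all add: partial_skew_group_ring_def)

lemma S_R: "f \<in> carrier S \<Longrightarrow> f g \<in> carrier R"
  unfolding S_carrier using DR by (cases "g \<in> carrier G") auto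

lemma S_abelian: "abelian_group S"
proof (rule abelian_groupI)
  fix f k assume f: "f \<in> carrier S" and k: "k \<in> carrier S"
  have "{g \<in> carrier G. (f \<oplus>\<^bsub>S\<^esub> k) g \<noteq> \<zero>\<^bsub>R\<^esub>} \<subseteq>
      {g \<in> carrier G. f g \<noteq> \<zero>\<^bsub>R\<^esub>} \<union> {g \<in> carrier G. k g \<noteq> \<zero>\<^bsub>R\<^esub>}"
    by (auto simp: S_add)
  moreover have "finite ({g \<in> carrier G. f g \<noteq> \<zero>\<^bsub>R\<^esub>} \<union> {g \<in> carrier G. k g \<noteq> \<zero>\<^bsub>R\<^esub>})"
    using f k by (simp add: S_carrier)
  ultimately have "finite {g \<in> carrier G. (f \<oplus>\<^bsub>S\<^esub> k) g \<noteq> \<zero>\<^bsub>R\<^esub>}" by (rule finite_subset)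
  then show "f \<oplus>\<^bsub>S\<^esub> k \<in> carrier S" using f k by (auto simp: S_carrier S_add D_add)
  show "f \<oplus>\<^bsub>S\<^esub> k = k \<oplus>\<^bsub>S\<^esub> f" using S_R f k by (auto simp: S_add R.a_comm)
next
  show "\<zero>\<^bsub>S\<^esub> \<in> carrier S" by (auto simp: S_carrier S_zero D_zero)
next
  fix f k l assume "f \<in> carrier S" "k \<in> carrier S" "l \<in> carrier S"
  then show "f \<oplus>\<^bsub>S\<^esub> k \<oplus>\<^bsub>S\<^esub> l = f \<oplus>\<^bsub>S\<^esub> (k \<oplus>\<^bsub>S\<^esub> l)" using S_R by (simp add: S_add R.a_assoc)
next
  fix f assume f: "f \<in> carrier S"
  then show "\<zero>\<^bsub>S\<^esub> \<oplus>\<^bsub>S\<^esub> f = f" using S_R by (simp add: S_add S_zero)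
  define k where "k = (\<lambda>x. \<ominus>\<^bsub>R\<^esub> f x)"
  have "{g \<in> carrier G. k g \<noteq> \<zero>\<^bsub>R\<^esub>} \<subseteq> {g \<in> carrier G. f g \<noteq> \<zero>\<^bsub>R\<^esub>}" by (auto simp: k_def)
  then have "finite {g \<in> carrier G. k g \<noteq> \<zero>\<^bsub>R\<^esub>}" using f by (auto simp: S_carrier intro: finite_subset)
  then have "k \<in> carrier S" using f by (auto simp: S_carrier k_def D_neg)
  moreover have "k \<oplus>\<^bsub>S\<^esub> f = \<zero>\<^bsub>S\<^esub>" using S_R f by (simp add: S_add S_zero k_def R.l_neg)
  ultimately show "\<exists>y\<in>carrier S. y \<oplus>\<^bsub>S\<^esub> f = \<zero>\<^bsub>S\<^esub>" by blast
qed

section \<open>The product as a finite sum\<close>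

definition mterm :: "('a \<Rightarrow> 'c) \<Rightarrow> ('a \<Rightarrow> 'c) \<Rightarrow> 'a \<Rightarrow> 'a \<Rightarrow> 'c" where
  "mterm f k x g = \<alpha> g (\<alpha> (inv g) (f g) \<otimes>\<^bsub>R\<^esub> k (inv g \<otimes> x))"

lemma mterm_arg:
  assumes "f \<in> carrier S" "k \<in> carrier S" "x \<in> carrier G" "g \<in> carrier G"
  shows "\<alpha> (inv g) (f g) \<in> D (inv g)" "k (inv g \<otimes> x) \<in> D (inv g \<otimes> x)"
    "\<alpha> (inv g) (f g) \<otimes>\<^bsub>R\<^esub> k (inv g \<otimes> x) \<in> D (inv g)"
    "\<alpha> (inv g) (f g) \<otimes>\<^bsub>R\<^esub> k (inv g \<otimes> x) \<in> D (inv g \<otimes> x)"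
proof -
  show 1: "\<alpha> (inv g) (f g) \<in> D (inv g)" using \<alpha>_closed' assms by (auto simp: S_carrier)
  show 2: "k (inv g \<otimes> x) \<in> D (inv g \<otimes> x)" using assms by (auto simp: S_carrier)
  show "\<alpha> (inv g) (f g) \<otimes>\<^bsub>R\<^esub> k (inv g \<otimes> x) \<in> D (inv g)"
    using D_mult(1)[OF _ 1] S_R assms by simp
  show "\<alpha> (inv g) (f g) \<otimes>\<^bsub>R\<^esub> k (inv g \<otimes> x) \<in> D (inv g \<otimes> x)"
    using D_mult(2)[OF _ 2] DR[OF _ 1] assms by simp
qed

lemma mterm_closed:
  assumes "f \<in> carrier S" "k \<in> carrier S" "x \<in> carrier G" "g \<in> carrier G"
  shows "mterm f k x g \<in> D x"
  using \<alpha>_inter[OF assms(4) _ mterm_arg(3,4)[OF assms]] assms by (simp add: mterm_def)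

lemma mterm_zero:
  assumes "f \<in> carrier S" "k \<in> carrier S" "x \<in> carrier G" "g \<in> carrier G"
    "f g = \<zero>\<^bsub>R\<^esub> \<or> k (inv g \<otimes> x) = \<zero>\<^bsub>R\<^esub>"
  shows "mterm f k x g = \<zero>\<^bsub>R\<^esub>"
  using assms(5) mterm_arg(1)[OF assms(1-4)] DR[of "inv g"] S_R[OF assms(2)] assms(4)
  by (auto simp: mterm_def \<alpha>_zero R_zero_mult)

text \<open>The sum may run over any finite set containing the support; distributivity needs a
  common index set for two elements with different supports.\<close>

lemma S_mult:
  assumes "f \<in> carrier S" "k \<in> carrier S" "x \<in> carrier G"
    "finite F" "F \<subseteq> carrier G" "{g \<in> carrier G. f g \<noteq> \<zero>\<^bsub>R\<^esub>} \<subseteq> F"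
  shows "(f \<otimes>\<^bsub>S\<^esub> k) x = (\<Oplus>\<^bsub>R\<^esub> g \<in> F. mterm f k x g)"
proof -
  have "(f \<otimes>\<^bsub>S\<^esub> k) x = (\<Oplus>\<^bsub>R\<^esub> g \<in> {g \<in> carrier G. f g \<noteq> \<zero>\<^bsub>R\<^esub>}. mterm f k x g)"
    using assms(3) by (simp add: partial_skew_group_ring_def mterm_def)
  also have "\<dots> = (\<Oplus>\<^bsub>R\<^esub> g \<in> F. mterm f k x g)"
    by (rule R.add.finprod_mono_neutral_cong_left)
      (use assms mterm_zero[OF assms(1-3)] mterm_closed[OF assms(1-3)] DR in \<open>auto simp: subset_eq\<close>)
  finally show ?thesis .
qed

lemma S_mult_outside: "x \<notin> carrier G \<Longrightarrow> (f \<otimes>\<^bsub>S\<^esub> k) x = \<zero>\<^bsub>R\<^esub>"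
  by (simp add: partial_skew_group_ring_def)

lemma finsum_D:
  assumes "x \<in> carrier G" "finite F" "\<And>g. g \<in> F \<Longrightarrow> t g \<in> D x"
  shows "(\<Oplus>\<^bsub>R\<^esub> g \<in> F. t g) \<in> D x"
  using assms(2,3)
proof (induction F rule: finite_induct)
  case empty
  then show ?case using D_zero assms(1) by simp
next
  case (insert g F)
  then show ?case using D_add[OF assms(1)] DR[OF assms(1)] by (simp add: R.finsum_insert Pi_def)
qed

lemma S_mult_closed: assumes f: "f \<in> carrier S" and k: "k \<in> carrier S" shows "f \<otimes>\<^bsub>S\<^esub> k \<in> carrier S"
proof -
  let ?F = "{g \<in> carrier G. f g \<noteq> \<zero>\<^bsub>R\<^esub>}"
  let ?K = "{g \<in> carrier G. k g \<noteq> \<zero>\<^bsub>R\<^esub>}"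
  have F: "finite ?F" "finite ?K" using f k by (auto simp: S_carrier)
  have eq: "(f \<otimes>\<^bsub>S\<^esub> k) x = (\<Oplus>\<^bsub>R\<^esub> g \<in> ?F. mterm f k x g)" if "x \<in> carrier G" for x
    by (rule S_mult[OF f k that F(1)]) auto
  have "(f \<otimes>\<^bsub>S\<^esub> k) x \<in> D x" if "x \<in> carrier G" for x
    unfolding eq[OF that] by (rule finsum_D[OF that F(1)]) (use mterm_closed[OF f k that] in auto)
  moreover have "{x \<in> carrier G. (f \<otimes>\<^bsub>S\<^esub> k) x \<noteq> \<zero>\<^bsub>R\<^esub>} \<subseteq> (\<lambda>(g, h). g \<otimes> h) ` (?F \<times> ?K)"
  proof
    fix x assume x: "x \<in> {x \<in> carrier G. (f \<otimes>\<^bsub>S\<^esub> k) x \<noteq> \<zero>\<^bsub>R\<^esub>}"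
    have "\<exists>g\<in>?F. mterm f k x g \<noteq> \<zero>\<^bsub>R\<^esub>"
    proof (rule ccontr)
      assume "\<not> ?thesis"
      then have "(\<Oplus>\<^bsub>R\<^esub> g \<in> ?F. mterm f k x g) = \<zero>\<^bsub>R\<^esub>" by (intro R.add.finprod_one_eqI) auto
      then show False using x eq by auto
    qed
    then obtain g where g: "g \<in> ?F" "mterm f k x g \<noteq> \<zero>\<^bsub>R\<^esub>" by blast
    then have "k (inv g \<otimes> x) \<noteq> \<zero>\<^bsub>R\<^esub>" using mterm_zero[OF f k, of x g] x by auto
    then have "inv g \<otimes> x \<in> ?K" using x g by auto
    then show "x \<in> (\<lambda>(g, h). g \<otimes> h) ` (?F \<times> ?K)"
      using g x by (intro image_eqI[of _ _ "(g, inv g \<otimes> x)"]) auto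
  qed
  then have "finite {x \<in> carrier G. (f \<otimes>\<^bsub>S\<^esub> k) x \<noteq> \<zero>\<^bsub>R\<^esub>}"
    using F by (meson finite_SigmaI finite_imageI finite_subset)
  ultimately show ?thesis using S_mult_outside by (auto simp: S_carrier)
qed

lemma S_l_distr:
  assumes f: "f \<in> carrier S" "f' \<in> carrier S" and k: "k \<in> carrier S"
  shows "(f \<oplus>\<^bsub>S\<^esub> f') \<otimes>\<^bsub>S\<^esub> k = f \<otimes>\<^bsub>S\<^esub> k \<oplus>\<^bsub>S\<^esub> f' \<otimes>\<^bsub>S\<^esub> k"
proof
  fix x
  interpret S: abelian_group S by (rule S_abelian)
  have ff: "f \<oplus>\<^bsub>S\<^esub> f' \<in> carrier S" using f by simp
  show "((f \<oplus>\<^bsub>S\<^esub> f') \<otimes>\<^bsub>S\<^esub> k) x = (f \<otimes>\<^bsub>S\<^esub> k \<oplus>\<^bsub>S\<^esub> f' \<otimes>\<^bsub>S\<^esub> k) x"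
  proof (cases "x \<in> carrier G")
    case x: True
    define F where "F = {g \<in> carrier G. f g \<noteq> \<zero>\<^bsub>R\<^esub>} \<union> {g \<in> carrier G. f' g \<noteq> \<zero>\<^bsub>R\<^esub>}"
    have F: "finite F" "F \<subseteq> carrier G" using f by (auto simp: F_def S_carrier)
    have "mterm (f \<oplus>\<^bsub>S\<^esub> f') k x g = mterm f k x g \<oplus>\<^bsub>R\<^esub> mterm f' k x g" if g: "g \<in> F" for g
    proof -
      have gc: "g \<in> carrier G" "inv g \<in> carrier G" using g F by auto
      note m = mterm_arg[OF f(1) k x gc(1)] and m' = mterm_arg[OF f(2) k x gc(1)]
      have "\<alpha> (inv g) (f g \<oplus>\<^bsub>R\<^esub> f' g) = \<alpha> (inv g) (f g) \<oplus>\<^bsub>R\<^esub> \<alpha> (inv g) (f' g)"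
        using \<alpha>_add[of "inv g"] f gc by (simp add: S_carrier)
      then show ?thesis
        using \<alpha>_add[OF gc(1) m(3) m'(3)] DR[OF gc(2) m(1)] DR[OF gc(2) m'(1)] S_R[OF k]
        by (simp add: mterm_def S_add R.l_distr)
    qed
    note eq = this
    have cl: "mterm f k x g \<in> carrier R" "mterm f' k x g \<in> carrier R" if "g \<in> F" for g
      using that F(2) DR[OF x mterm_closed[OF f(1) k x]] DR[OF x mterm_closed[OF f(2) k x]] by auto
    have "((f \<oplus>\<^bsub>S\<^esub> f') \<otimes>\<^bsub>S\<^esub> k) x = (\<Oplus>\<^bsub>R\<^esub> g \<in> F. mterm (f \<oplus>\<^bsub>S\<^esub> f') k x g)"
      by (rule S_mult[OF ff k x F]) (auto simp: F_def S_add)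
    also have "\<dots> = (\<Oplus>\<^bsub>R\<^esub> g \<in> F. mterm f k x g \<oplus>\<^bsub>R\<^esub> mterm f' k x g)"
      by (rule R.finsum_cong'[OF refl]) (use cl eq in simp_all)
    also have "\<dots> = (\<Oplus>\<^bsub>R\<^esub> g \<in> F. mterm f k x g) \<oplus>\<^bsub>R\<^esub> (\<Oplus>\<^bsub>R\<^esub> g \<in> F. mterm f' k x g)"
      by (rule R.finsum_addf) (use cl in simp_all)
    finally show ?thesis
      using S_mult[OF f(1) k x F] S_mult[OF f(2) k x F] by (simp add: S_add F_def)
  qed (simp add: S_mult_outside S_add)
qed

lemma S_r_distr:
  assumes f: "f \<in> carrier S" and k: "k \<in> carrier S" "k' \<in> carrier S"
  shows "f \<otimes>\<^bsub>S\<^esub> (k \<oplus>\<^bsub>S\<^esub> k') = f \<otimes>\<^bsub>S\<^esub> k \<oplus>\<^bsub>S\<^esub> f \<otimes>\<^bsub>S\<^esub> k'"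
proof
  fix x
  interpret S: abelian_group S by (rule S_abelian)
  have kk: "k \<oplus>\<^bsub>S\<^esub> k' \<in> carrier S" using k by simp
  show "(f \<otimes>\<^bsub>S\<^esub> (k \<oplus>\<^bsub>S\<^esub> k')) x = (f \<otimes>\<^bsub>S\<^esub> k \<oplus>\<^bsub>S\<^esub> f \<otimes>\<^bsub>S\<^esub> k') x"
  proof (cases "x \<in> carrier G")
    case x: True
    define F where "F = {g \<in> carrier G. f g \<noteq> \<zero>\<^bsub>R\<^esub>}"
    have F: "finite F" "F \<subseteq> carrier G" "{g \<in> carrier G. f g \<noteq> \<zero>\<^bsub>R\<^esub>} \<subseteq> F" using f by (auto simp: F_def S_carrier)
    have "mterm f (k \<oplus>\<^bsub>S\<^esub> k') x g = mterm f k x g \<oplus>\<^bsub>R\<^esub> mterm f k' x g" if g: "g \<in> F" for g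
    proof -
      have gc: "g \<in> carrier G" "inv g \<in> carrier G" using g F by auto
      note m = mterm_arg[OF f k(1) x gc(1)] and m' = mterm_arg[OF f k(2) x gc(1)]
      show ?thesis
        using \<alpha>_add[OF gc(1) m(3) m'(3)] DR[OF gc(2) m(1)] S_R[OF k(1)] S_R[OF k(2)]
        by (simp add: mterm_def S_add R.r_distr)
    qed
    note eq = this
    have cl: "mterm f k x g \<in> carrier R" "mterm f k' x g \<in> carrier R" if "g \<in> F" for g
      using that F(2) DR[OF x mterm_closed[OF f k(1) x]] DR[OF x mterm_closed[OF f k(2) x]] by auto
    have "(f \<otimes>\<^bsub>S\<^esub> (k \<oplus>\<^bsub>S\<^esub> k')) x = (\<Oplus>\<^bsub>R\<^esub> g \<in> F. mterm f (k \<oplus>\<^bsub>S\<^esub> k') x g)"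
      by (rule S_mult[OF f kk x F])
    also have "\<dots> = (\<Oplus>\<^bsub>R\<^esub> g \<in> F. mterm f k x g \<oplus>\<^bsub>R\<^esub> mterm f k' x g)"
      by (rule R.finsum_cong'[OF refl]) (use cl eq in simp_all)
    also have "\<dots> = (\<Oplus>\<^bsub>R\<^esub> g \<in> F. mterm f k x g) \<oplus>\<^bsub>R\<^esub> (\<Oplus>\<^bsub>R\<^esub> g \<in> F. mterm f k' x g)"
      by (rule R.finsum_addf) (use cl in simp_all)
    finally show ?thesis
      using S_mult[OF f k(1) x F] S_mult[OF f k(2) x F] by (simp add: S_add)
  qed (simp add: S_mult_outside S_add)
qed

section \<open>Homogeneous elements, associativity and local units\<close>

lemma restr_closed: assumes "f \<in> carrier S" shows "restr C f \<in> carrier S"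
proof -
  have "{g \<in> carrier G. restr C f g \<noteq> \<zero>\<^bsub>R\<^esub>} \<subseteq> {g \<in> carrier G. f g \<noteq> \<zero>\<^bsub>R\<^esub>}" by (auto simp: restr_def)
  then have "finite {g \<in> carrier G. restr C f g \<noteq> \<zero>\<^bsub>R\<^esub>}"
    using assms by (auto simp: S_carrier intro: finite_subset)
  then show ?thesis using assms D_zero by (auto simp: S_carrier restr_def)
qed

lemma restr_single: "restr {g} f = delta R (f g) g" by (auto simp: restr_def delta_def)

lemma delta_zero: "delta R \<zero>\<^bsub>R\<^esub> g = \<zero>\<^bsub>S\<^esub>" by (auto simp: delta_def S_zero)

lemma delta_self [simp]: "delta R r g g = r" by (simp add: delta_def)

lemma delta_inj: "delta R r g = delta R s g \<longleftrightarrow> r = s" by (metis delta_self)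

lemma delta_closed: assumes "g \<in> carrier G" "r \<in> D g" shows "delta R r g \<in> carrier S"
proof -
  have "{h \<in> carrier G. delta R r g h \<noteq> \<zero>\<^bsub>R\<^esub>} \<subseteq> {g}" by (auto simp: delta_def)
  then have "finite {h \<in> carrier G. delta R r g h \<noteq> \<zero>\<^bsub>R\<^esub>}" by (rule finite_subset) simp
  then show ?thesis using assms D_zero by (auto simp: S_carrier delta_def)
qed

text \<open>The crux of associativity: \<open>a\<close> need not lie in \<open>D h\<close>, so
  \<open>\<alpha> (inv h)\<close> says nothing about it. A left unit \<open>f\<close> of
  \<open>s\<close> moves it there, \<open>a s = (a f) s\<close>, and is absorbed again at the
  end.\<close>

lemma \<alpha>_scalar:
  assumes h: "h \<in> carrier G" and s: "s \<in> D h" and a: "a \<in> carrier R" and t: "t \<in> carrier R"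
  shows "\<alpha> h (\<alpha> (inv h) (a \<otimes>\<^bsub>R\<^esub> s) \<otimes>\<^bsub>R\<^esub> t) = a \<otimes>\<^bsub>R\<^esub> \<alpha> h (\<alpha> (inv h) s \<otimes>\<^bsub>R\<^esub> t)"
proof -
  obtain f where f: "f \<in> D h" "f \<otimes>\<^bsub>R\<^esub> s = s" using D_unit_left[OF h s] .
  have ih: "inv h \<in> carrier G" "inv (inv h) = h" using h by auto
  have c: "f \<in> carrier R" "s \<in> carrier R" using f s DR h by auto
  have af: "a \<otimes>\<^bsub>R\<^esub> f \<in> D h" using D_mult(2)[OF h f(1) a] .
  have d: "\<alpha> (inv h) s \<in> D (inv h)" "\<alpha> (inv h) f \<in> D (inv h)" "\<alpha> (inv h) (a \<otimes>\<^bsub>R\<^esub> f) \<in> D (inv h)"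
    using \<alpha>_closed' h s f af by auto
  have dc: "\<alpha> (inv h) s \<in> carrier R" "\<alpha> (inv h) f \<in> carrier R" "\<alpha> (inv h) (a \<otimes>\<^bsub>R\<^esub> f) \<in> carrier R"
    using d DR ih by blast+
  have u: "\<alpha> (inv h) s \<otimes>\<^bsub>R\<^esub> t \<in> D (inv h)" using D_mult(1)[OF ih(1) d(1) t] .
  have uc: "\<alpha> h (\<alpha> (inv h) s \<otimes>\<^bsub>R\<^esub> t) \<in> carrier R" using DR[OF h \<alpha>_closed[OF h u]] .
  have "\<alpha> (inv h) f \<otimes>\<^bsub>R\<^esub> \<alpha> (inv h) s = \<alpha> (inv h) s"
    using \<alpha>_mult[of "inv h" f s] ih f s by simp
  then have "\<alpha> (inv h) f \<otimes>\<^bsub>R\<^esub> (\<alpha> (inv h) s \<otimes>\<^bsub>R\<^esub> t) = \<alpha> (inv h) s \<otimes>\<^bsub>R\<^esub> t"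
    using dc t by (simp flip: R.m_assoc)
  then have "\<alpha> h (\<alpha> (inv h) f) \<otimes>\<^bsub>R\<^esub> \<alpha> h (\<alpha> (inv h) s \<otimes>\<^bsub>R\<^esub> t) = \<alpha> h (\<alpha> (inv h) s \<otimes>\<^bsub>R\<^esub> t)"
    using \<alpha>_mult[OF h d(2) u] by simp
  then have fu: "f \<otimes>\<^bsub>R\<^esub> \<alpha> h (\<alpha> (inv h) s \<otimes>\<^bsub>R\<^esub> t) = \<alpha> h (\<alpha> (inv h) s \<otimes>\<^bsub>R\<^esub> t)"
    using \<alpha>_inv'[OF h f(1)] by simp
  have "\<alpha> (inv h) (a \<otimes>\<^bsub>R\<^esub> s) = \<alpha> (inv h) ((a \<otimes>\<^bsub>R\<^esub> f) \<otimes>\<^bsub>R\<^esub> s)"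
    using a c f by (simp add: R.m_assoc)
  also have "\<dots> = \<alpha> (inv h) (a \<otimes>\<^bsub>R\<^esub> f) \<otimes>\<^bsub>R\<^esub> \<alpha> (inv h) s"
    using \<alpha>_mult[of "inv h"] ih af s by simp
  finally have "\<alpha> h (\<alpha> (inv h) (a \<otimes>\<^bsub>R\<^esub> s) \<otimes>\<^bsub>R\<^esub> t)
      = \<alpha> h (\<alpha> (inv h) (a \<otimes>\<^bsub>R\<^esub> f) \<otimes>\<^bsub>R\<^esub> (\<alpha> (inv h) s \<otimes>\<^bsub>R\<^esub> t))"
    using dc t by (simp add: R.m_assoc)
  also have "\<dots> = (a \<otimes>\<^bsub>R\<^esub> f) \<otimes>\<^bsub>R\<^esub> \<alpha> h (\<alpha> (inv h) s \<otimes>\<^bsub>R\<^esub> t)"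
    using \<alpha>_mult[OF h d(3) u] \<alpha>_inv'[OF h af] by simp
  also have "\<dots> = a \<otimes>\<^bsub>R\<^esub> \<alpha> h (\<alpha> (inv h) s \<otimes>\<^bsub>R\<^esub> t)" using a c uc fu by (simp add: R.m_assoc)
  finally show ?thesis .
qed

lemma delta_prod_closed:
  assumes "g \<in> carrier G" "h \<in> carrier G" "r \<in> D g" "s \<in> D h"
  shows "\<alpha> (inv g) r \<otimes>\<^bsub>R\<^esub> s \<in> D (inv g)" "\<alpha> (inv g) r \<otimes>\<^bsub>R\<^esub> s \<in> D h"
    "\<alpha> g (\<alpha> (inv g) r \<otimes>\<^bsub>R\<^esub> s) \<in> D (g \<otimes> h)"
proof -
  have d: "\<alpha> (inv g) r \<in> D (inv g)" using \<alpha>_closed' assms by blast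
  show 1: "\<alpha> (inv g) r \<otimes>\<^bsub>R\<^esub> s \<in> D (inv g)" using D_mult(1)[OF _ d] DR assms by simp
  show 2: "\<alpha> (inv g) r \<otimes>\<^bsub>R\<^esub> s \<in> D h" using D_mult(2)[OF _ assms(4)] DR[OF _ d] assms by simp
  show "\<alpha> g (\<alpha> (inv g) r \<otimes>\<^bsub>R\<^esub> s) \<in> D (g \<otimes> h)" using \<alpha>_inter[OF assms(1,2) 1 2] .
qed

text \<open>The composition axiom merges the isomorphisms of the left-hand side, and
  \<open>\<alpha>_scalar\<close> pulls \<open>\<alpha> (inv g) r\<close> out of the inner one, which
  gives the coefficient of the right-hand side.\<close>

lemma delta_assoc:
  assumes g: "g \<in> carrier G" "r \<in> D g" and h: "h \<in> carrier G" "s \<in> D h" and k: "k \<in> carrier G" "t \<in> D k"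
  shows "delta R r g \<otimes>\<^bsub>S\<^esub> delta R s h \<otimes>\<^bsub>S\<^esub> delta R t k
    = delta R r g \<otimes>\<^bsub>S\<^esub> (delta R s h \<otimes>\<^bsub>S\<^esub> delta R t k)"
proof -
  define x where "x = \<alpha> (inv g) r \<otimes>\<^bsub>R\<^esub> s"
  have x: "x \<in> D (inv g)" "x \<in> D h" "\<alpha> g x \<in> D (g \<otimes> h)"
    using delta_prod_closed[OF g(1) h(1) g(2) h(2)] by (auto simp: x_def)
  have gh: "g \<otimes> h \<in> carrier G" "inv h \<in> carrier G" "inv g \<in> carrier G" using g h by auto
  have tc: "t \<in> carrier R" using DR k by blast
  have ac: "\<alpha> (inv g) r \<in> carrier R" using DR[OF _ \<alpha>_closed'] g by simp
  have lhs: "delta R r g \<otimes>\<^bsub>S\<^esub> delta R s h \<otimes>\<^bsub>S\<^esub> delta R t k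
      = delta R (\<alpha> (g \<otimes> h) (\<alpha> (inv (g \<otimes> h)) (\<alpha> g x) \<otimes>\<^bsub>R\<^esub> t)) (g \<otimes> h \<otimes> k)"
    using delta_mult[OF g(1) h(1) g(2) h(2)] delta_mult[OF gh(1) k(1) x(3) k(2)] by (simp add: x_def)
  have rhs: "delta R r g \<otimes>\<^bsub>S\<^esub> (delta R s h \<otimes>\<^bsub>S\<^esub> delta R t k)
      = delta R (\<alpha> g (\<alpha> (inv g) r \<otimes>\<^bsub>R\<^esub> \<alpha> h (\<alpha> (inv h) s \<otimes>\<^bsub>R\<^esub> t))) (g \<otimes> (h \<otimes> k))"
    using delta_mult[OF h(1) k(1) h(2) k(2)]
      delta_mult[OF g(1) _ g(2) delta_prod_closed(3)[OF h(1) k(1) h(2) k(2)]] h k by simp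
  have e1: "inv (g \<otimes> h) \<otimes> g = inv h" using g h by (simp add: inv_mult_group m_assoc)
  have "\<alpha> (inv (g \<otimes> h)) (\<alpha> g x) = \<alpha> (inv h) x"
    using \<alpha>_comp'[of "inv (g \<otimes> h)" g x] x gh g h e1 by simp
  moreover have "\<alpha> (g \<otimes> h) (\<alpha> (inv h) x \<otimes>\<^bsub>R\<^esub> t) = \<alpha> g (\<alpha> h (\<alpha> (inv h) x \<otimes>\<^bsub>R\<^esub> t))"
  proof -
    have "\<alpha> (inv h) x \<in> D (inv h)" "\<alpha> (inv h) x \<in> D (inv h \<otimes> inv g)"
      using \<alpha>_closed'[OF h(1) x(2)] \<alpha>_inter[of "inv h" "inv g" x] x gh h by auto
    then have "\<alpha> (inv h) x \<otimes>\<^bsub>R\<^esub> t \<in> D (inv h)" "\<alpha> (inv h) x \<otimes>\<^bsub>R\<^esub> t \<in> D (inv h \<otimes> inv g)"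
      using D_mult(1) tc gh by auto
    then show ?thesis using \<alpha>_comp'[OF g(1) h(1)] g h by (simp add: inv_mult_group)
  qed
  moreover have "\<alpha> h (\<alpha> (inv h) x \<otimes>\<^bsub>R\<^esub> t) = \<alpha> (inv g) r \<otimes>\<^bsub>R\<^esub> \<alpha> h (\<alpha> (inv h) s \<otimes>\<^bsub>R\<^esub> t)"
    unfolding x_def by (rule \<alpha>_scalar[OF h ac tc])
  ultimately show ?thesis unfolding lhs rhs using g h k by (simp add: m_assoc)
qed

lemma S_graded: "graded_rng G S restr"
proof -
  interpret S: abelian_group S by (rule S_abelian)
  have homog: "x = delta R (x g) g" "x g \<in> D g"
    if "g \<in> carrier G" "x \<in> carrier S" "restr {g} x = x" for g x
    using that restr_single[of g x] by (auto simp: S_carrier)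
  have delta_restr: "restr {g} (delta R r g) = delta R r g" for r g by (simp add: restr_single)
  show ?thesis
  proof (rule graded_rng.intro[OF group_axioms S_abelian], rule graded_rng_axioms.intro)
    fix C :: "'a set" and x y assume "x \<in> carrier S" "y \<in> carrier S"
    then show "restr C (x \<oplus>\<^bsub>S\<^esub> y) = restr C x \<oplus>\<^bsub>S\<^esub> restr C y" by (auto simp: restr_def S_add)
  next
    fix C C' :: "'a set" and x show "restr C (restr C' x) = restr (C \<inter> C') x" by (auto simp: restr_def)
  next
    fix x show "restr {} x = \<zero>\<^bsub>S\<^esub>" by (simp add: restr_def S_zero)
  next
    fix x assume x: "x \<in> carrier S"
    have "restr {g} x \<noteq> \<zero>\<^bsub>S\<^esub> \<longleftrightarrow> x g \<noteq> \<zero>\<^bsub>R\<^esub>" for g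
      by (metis delta_self delta_zero restr_single)
    then show "finite {g \<in> carrier G. restr {g} x \<noteq> \<zero>\<^bsub>S\<^esub>}" using x by (simp add: S_carrier)
  next
    fix x assume x: "x \<in> carrier S" and z: "\<And>g. g \<in> carrier G \<Longrightarrow> restr {g} x = \<zero>\<^bsub>S\<^esub>"
    have "x g = \<zero>\<^bsub>R\<^esub>" for g
    proof (cases "g \<in> carrier G")
      case True
      then show ?thesis using z[OF True] by (metis delta_self delta_zero restr_single)
    qed (use x in \<open>auto simp: S_carrier\<close>)
    then show "x = \<zero>\<^bsub>S\<^esub>" by (auto simp: S_zero)
  next
    fix g h x y assume g: "g \<in> carrier G" "h \<in> carrier G" "x \<in> carrier S" "y \<in> carrier S"
      "restr {g} x = x" "restr {h} y = y"
    note hx = homog[OF g(1,3,5)] and hy = homog[OF g(2,4,6)]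
    show "restr {g \<otimes> h} (x \<otimes>\<^bsub>S\<^esub> y) = x \<otimes>\<^bsub>S\<^esub> y"
      by (subst (1 2) hx(1), subst (1 2) hy(1)) (simp add: delta_mult[OF g(1,2) hx(2) hy(2)] delta_restr)
  next
    fix g h k x y z assume g: "g \<in> carrier G" "h \<in> carrier G" "k \<in> carrier G"
      "x \<in> carrier S" "y \<in> carrier S" "z \<in> carrier S"
      "restr {g} x = x" "restr {h} y = y" "restr {k} z = z"
    note hx = homog[OF g(1,4,7)] and hy = homog[OF g(2,5,8)] and hz = homog[OF g(3,6,9)]
    show "x \<otimes>\<^bsub>S\<^esub> y \<otimes>\<^bsub>S\<^esub> z = x \<otimes>\<^bsub>S\<^esub> (y \<otimes>\<^bsub>S\<^esub> z)"
      using delta_assoc[OF g(1) hx(2) g(2) hy(2) g(3) hz(2)] by (simp flip: hx(1) hy(1) hz(1))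
  next
    fix g x assume g: "g \<in> carrier G" "x \<in> carrier S" "restr {g} x = x"
    note hx = homog[OF g]
    define r where "r = x g"
    have r: "r \<in> D g" "x = delta R r g" using hx by (auto simp: r_def)
    have ig: "inv g \<in> carrier G" "inv (inv g) = g" using g by auto
    have ar: "\<alpha> (inv g) r \<in> D (inv g)" using \<alpha>_closed' g r by blast
    \<comment> \<open>With \<open>f\<close> a right unit for \<open>\<alpha> (inv g) r\<close> and
      \<open>k\<close> one for \<open>r\<close>, the product of \<open>r \<delta>_g\<close> and
      \<open>f \<delta>_{g^-1}\<close> is \<open>r \<delta>_e\<close>, and multiplication by
      \<open>k \<delta>_g\<close> restores \<open>r \<delta>_g\<close>.\<close>
    obtain f where f: "f \<in> D (inv g)" "\<alpha> (inv g) r \<otimes>\<^bsub>R\<^esub> f = \<alpha> (inv g) r" using D_unit_right[OF ig(1) ar] .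
    obtain k where k: "k \<in> D g" "r \<otimes>\<^bsub>R\<^esub> k = r" using D_unit_right[OF g(1) r(1)] .
    have rc: "r \<in> D \<one>" "r \<in> carrier R" "k \<in> carrier R" using DR[OF g(1)] r k by (auto simp: D_one)
    have "x \<otimes>\<^bsub>S\<^esub> delta R f (inv g) = delta R r \<one>"
      using delta_mult[OF g(1) ig(1) r(1) f(1)] f(2) \<alpha>_inv'[OF g(1) r(1)] g(1) by (simp add: r(2))
    moreover have "delta R r \<one> \<otimes>\<^bsub>S\<^esub> delta R k g = x"
      using delta_mult[OF one_closed g(1) rc(1) k(1)] k(2) rc g(1) \<alpha>_one by (simp add: r(2))
    ultimately have "x = x \<otimes>\<^bsub>S\<^esub> delta R f (inv g) \<otimes>\<^bsub>S\<^esub> delta R k g" by simp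
    moreover have "delta R f (inv g) \<in> carrier S" "delta R k g \<in> carrier S"
      using delta_closed ig f g k by auto
    ultimately show "\<exists>s t. s \<in> carrier S \<and> t \<in> carrier S \<and> restr {inv g} s = s \<and> restr {g} t = t
        \<and> x = x \<otimes>\<^bsub>S\<^esub> s \<otimes>\<^bsub>S\<^esub> t"
      using delta_restr by blast
    \<comment> \<open>On the left the isomorphism transports the unit:
      \<open>\<alpha> (inv g) e\<close> is a left unit for
      \<open>\<alpha> (inv g) r\<close>.\<close>
    obtain e where e: "e \<in> D g" "e \<otimes>\<^bsub>R\<^esub> r = r" using D_unit_left[OF g(1) r(1)] .
    have ae: "\<alpha> (inv g) e \<in> D (inv g)" using \<alpha>_closed' g e by blast
    have "delta R (\<alpha> (inv g) e) (inv g) \<otimes>\<^bsub>S\<^esub> x = delta R (\<alpha> (inv g) r) \<one>"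
      using delta_mult[OF ig(1) g(1) ae r(1)] ig \<alpha>_inv'[OF g(1) e(1)] e(2) g(1) by (simp add: r(2))
    moreover have "delta R e g \<otimes>\<^bsub>S\<^esub> delta R (\<alpha> (inv g) r) \<one> = x"
    proof -
      have "\<alpha> (inv g) r \<in> D \<one>" using DR[OF ig(1) ar] by (simp add: D_one)
      moreover have "\<alpha> g (\<alpha> (inv g) e \<otimes>\<^bsub>R\<^esub> \<alpha> (inv g) r) = r"
        using \<alpha>_mult[OF g(1) ae ar] \<alpha>_inv'[OF g(1) e(1)] \<alpha>_inv'[OF g(1) r(1)] e(2) by simp
      ultimately show ?thesis using delta_mult[OF g(1) one_closed e(1)] g(1) by (simp add: r(2))
    qed
    ultimately have "x = delta R e g \<otimes>\<^bsub>S\<^esub> (delta R (\<alpha> (inv g) e) (inv g) \<otimes>\<^bsub>S\<^esub> x)" by simp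
    moreover have "delta R (\<alpha> (inv g) e) (inv g) \<in> carrier S" "delta R e g \<in> carrier S"
      using delta_closed ig ae g e by auto
    ultimately show "\<exists>s t. s \<in> carrier S \<and> t \<in> carrier S \<and> restr {inv g} s = s \<and> restr {g} t = t
        \<and> x = t \<otimes>\<^bsub>S\<^esub> (s \<otimes>\<^bsub>S\<^esub> x)"
      using delta_restr by blast
  qed (auto simp: S_mult_closed S_l_distr S_r_distr restr_closed)
qed

end

section \<open>The characterization\<close>

context graded_rng
begin

section \<open>Annihilators and generated ideals in a graded ring\<close>

lemma additive_subgroupI:
  assumes "X \<subseteq> carrier T" "\<zero>\<^bsub>T\<^esub> \<in> X" "\<And>x y. x \<in> X \<Longrightarrow> y \<in> X \<Longrightarrow> x \<boxplus> y \<in> X"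
    "\<And>x. x \<in> X \<Longrightarrow> \<ominus>\<^bsub>T\<^esub> x \<in> X"
  shows "additive_subgroup X T"
  unfolding additive_subgroup_def
  by (rule T.add.subgroupI) (use assms in \<open>auto simp: a_inv_def\<close>)

text \<open>\<open>B'\<close> is the right annihilator of \<open>A\<close> and of
  \<open>A S\<close>, and \<open>A'\<close> the left annihilator of \<open>B'\<close>; these are
  ideals with product zero that contain \<open>B\<close> and \<open>A\<close>. A local unit of
  \<open>b\<close> reduces \<open>a b = 0\<close> to the products \<open>a s b\<close>.\<close>

lemma not_prime_rngI:
  assumes A: "A \<subseteq> carrier T" "A \<noteq> {\<zero>\<^bsub>T\<^esub>}" "A \<noteq> {}" and B: "B \<subseteq> carrier T" "B \<noteq> {\<zero>\<^bsub>T\<^esub>}" "B \<noteq> {}"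
    and zero: "\<And>a b g s. a \<in> A \<Longrightarrow> b \<in> B \<Longrightarrow> g \<in> carrier G \<Longrightarrow> s \<in> deg g \<Longrightarrow> a \<star> s \<star> b = \<zero>\<^bsub>T\<^esub>"
  shows "\<not> prime_rng T"
proof
  assume prime: "prime_rng T"
  define B' where "B' = {z \<in> carrier T. \<forall>a\<in>A. a \<star> z = \<zero>\<^bsub>T\<^esub> \<and> (\<forall>x\<in>carrier T. a \<star> x \<star> z = \<zero>\<^bsub>T\<^esub>)}"
  define A' where "A' = {z \<in> carrier T. \<forall>w\<in>B'. z \<star> w = \<zero>\<^bsub>T\<^esub>}"
  have Ac: "a \<in> carrier T" if "a \<in> A" for a using that A(1) by blast
  have Bc: "w \<in> carrier T" if "w \<in> B'" for w using that by (simp add: B'_def)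
  have B'I: "rng_ideal B' T"
    unfolding rng_ideal_def
  proof (intro conjI ballI)
    show "additive_subgroup B' T"
      by (rule additive_subgroupI) (use Ac in \<open>auto simp: B'_def T_r_distr T_neg_mult\<close>)
    fix z x assume z: "z \<in> B'" and x: "x \<in> carrier T"
    have zc: "z \<in> carrier T" using Bc z by blast
    have k1: "a \<star> z = \<zero>\<^bsub>T\<^esub>" if "a \<in> A" for a using z that by (simp add: B'_def)
    have k2: "a \<star> y \<star> z = \<zero>\<^bsub>T\<^esub>" if "a \<in> A" "y \<in> carrier T" for a y
      using z that by (simp add: B'_def)
    have k3: "a \<star> y \<star> (x \<star> z) = \<zero>\<^bsub>T\<^esub>" if "a \<in> A" "y \<in> carrier T" for a y
      using k2[of a "y \<star> x"] that Ac x zc by (simp add: T_assoc)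
    have k4: "a \<star> (x \<star> z) = \<zero>\<^bsub>T\<^esub>" if "a \<in> A" for a
      using k2[of a x] that Ac x zc by (simp add: T_assoc)
    show "x \<star> z \<in> B'" using k3 k4 x zc by (simp add: B'_def)
    show "z \<star> x \<in> B'"
      using k1 k2 x zc Ac by (auto simp: B'_def simp flip: T_assoc)
  qed
  have A'I: "rng_ideal A' T"
    unfolding rng_ideal_def
  proof (intro conjI ballI)
    show "additive_subgroup A' T"
      by (rule additive_subgroupI) (use Bc in \<open>auto simp: A'_def T_l_distr T_neg_mult\<close>)
    fix z x assume z: "z \<in> A'" and x: "x \<in> carrier T"
    have zc: "z \<in> carrier T" using z by (simp add: A'_def)
    have k: "z \<star> w = \<zero>\<^bsub>T\<^esub>" if "w \<in> B'" for w using z that by (simp add: A'_def)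
    have "x \<star> w \<in> B'" if "w \<in> B'" for w using B'I that x by (simp add: rng_ideal_def)
    then show "z \<star> x \<in> A'" using k x zc Bc by (auto simp: A'_def T_assoc)
    show "x \<star> z \<in> A'" using k x zc Bc by (auto simp: A'_def T_assoc)
  qed
  have AA': "A \<subseteq> A'" using Ac by (auto simp: A'_def B'_def)
  have BB': "B \<subseteq> B'"
  proof
    fix b assume b: "b \<in> B"
    have bc: "b \<in> carrier T" using b B by blast
    have ax: "a \<star> x \<star> b = \<zero>\<^bsub>T\<^esub>" if a: "a \<in> A" and x: "x \<in> carrier T" for a x
      using x
    proof (induction x rule: decomp_induct)
      case zero
      then show ?case using Ac[OF a] bc by simp
    next
      case (add u v)
      then show ?case using Ac[OF a] bc by (simp add: T_l_distr T_r_distr)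
    next
      case (comp g)
      then show ?case using zero[OF a b, of g "res {g} x"] supp_carrier x by auto
    qed
    obtain e where e: "e \<in> deg \<one>" "e \<star> b = b" using common_left_unit[OF bc] by blast
    have "a \<star> b = \<zero>\<^bsub>T\<^esub>" if a: "a \<in> A" for a
      using ax[OF a, of e] e Ac[OF a] bc by (simp add: T_assoc)
    then show "b \<in> B'" using ax bc by (simp add: B'_def)
  qed
  have "A' \<cdot>\<^bsub>T\<^esub> B' = {\<zero>\<^bsub>T\<^esub>}"
  proof
    show "A' \<cdot>\<^bsub>T\<^esub> B' \<subseteq> {\<zero>\<^bsub>T\<^esub>}"
    proof
      fix x assume "x \<in> A' \<cdot>\<^bsub>T\<^esub> B'"
      then show "x \<in> {\<zero>\<^bsub>T\<^esub>}" by induction (auto simp: A'_def)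
    qed
    have "\<zero>\<^bsub>T\<^esub> \<in> A'" "\<zero>\<^bsub>T\<^esub> \<in> B'" using Bc Ac by (auto simp: A'_def B'_def)
    then show "{\<zero>\<^bsub>T\<^esub>} \<subseteq> A' \<cdot>\<^bsub>T\<^esub> B'" using ideal_prod.prod[of "\<zero>\<^bsub>T\<^esub>" A' "\<zero>\<^bsub>T\<^esub>" B' T] by simp
  qed
  then have "A' = {\<zero>\<^bsub>T\<^esub>} \<or> B' = {\<zero>\<^bsub>T\<^esub>}" using prime A'I B'I by (simp add: prime_rng_def)
  then show False using AA' BB' A B by blast
qed

lemma gen_additive:
  assumes "subgroup U G" "a \<in> carrier T"
  shows "additive_subgroup (gen U a) T"
proof (rule additive_subgroupI)
  have "\<one> \<in> U" using assms(1) by (rule subgroup.one_closed)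
  then show "\<zero>\<^bsub>T\<^esub> \<in> gen U a" using gen_base[of \<one> U \<one> "\<zero>\<^bsub>T\<^esub>" "\<zero>\<^bsub>T\<^esub>" a] assms by simp
  show "\<ominus>\<^bsub>T\<^esub> x \<in> gen U a" if "x \<in> gen U a" for x
    using that
  proof induction
    case (gen_base u v s t)
    then have "(\<ominus>\<^bsub>T\<^esub> s) \<star> a \<star> t \<in> gen U a" by (intro gen.gen_base[of u _ v]) (auto simp: neg_deg)
    then show ?case using gen_base assms by (simp add: T_neg_mult)
  next
    case (gen_add x y)
    then show ?case using gen_carrier[OF assms(2)] gen.gen_add[of "\<ominus>\<^bsub>T\<^esub> x" U a "\<ominus>\<^bsub>T\<^esub> y"]
      by (simp add: T.minus_add)
  qed
qed (use gen_carrier[OF assms(2)] gen_add in auto)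

lemma gen_mult_supp:
  assumes U: "subgroup U G" and a: "a \<in> carrier T" and x: "x \<in> gen U a"
    and r: "r \<in> carrier T" "supp r \<subseteq> U"
  shows "r \<star> x \<in> gen U a" "x \<star> r \<in> gen U a"
proof -
  have xc: "x \<in> carrier T" using gen_carrier[OF a x] .
  have z: "\<zero>\<^bsub>T\<^esub> \<in> gen U a" using gen_additive[OF U a] by (rule additive_subgroup.zero_closed)
  have "r \<star> x \<in> gen U a \<and> x \<star> r \<in> gen U a" using r(1)
  proof (induction r rule: decomp_induct)
    case (comp g)
    then have "g \<in> U" using r(2) by blast
    then show ?case using gen_mult[OF U a x, of g "res {g} r"] r(1) by simp
  qed (use z xc in \<open>auto simp: T_l_distr T_r_distr intro: gen_add\<close>)
  then show "r \<star> x \<in> gen U a" "x \<star> r \<in> gen U a" by auto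
qed

lemma gen_supp:
  assumes U: "subgroup U G" and a: "a \<in> carrier T" "supp a \<subseteq> U" and x: "x \<in> gen U a"
  shows "supp x \<subseteq> U"
  using x
proof induction
  case (gen_base u v s t)
  interpret U: subgroup U G by fact
  have c: "u \<in> carrier G" "v \<in> carrier G" using gen_base by auto
  have sc: "s \<in> carrier T" using gen_base by simp
  have "supp (s \<star> a \<star> t) \<subseteq> (\<lambda>g. g \<otimes> v) ` (\<lambda>g. u \<otimes> g) ` supp a"
    using supp_mult_deg_right[OF _ c(2) gen_base(4), of "s \<star> a"] supp_mult_deg_left[OF a(1) c(1) gen_base(3)] sc a
    by force
  then show ?case using a(2) gen_base(1,2) by auto
next
  case (gen_add x y)
  then show ?case using supp_add[of x y] gen_carrier[OF a(1)] by blast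
qed

text \<open>In \<open>e a f\<close> the left unit \<open>e\<close> fixes \<open>a\<close>, and
  \<open>f\<close> fixes one chosen nonzero component, so this element of the generated ideal is
  nonzero.\<close>

lemma gen_nonzero:
  assumes U: "subgroup U G" and a: "a \<in> carrier T" "a \<noteq> \<zero>\<^bsub>T\<^esub>"
  shows "gen U a \<noteq> {\<zero>\<^bsub>T\<^esub>}"
proof -
  obtain e where e: "e \<in> deg \<one>" "e \<star> a = a" using common_left_unit[OF a(1)] by blast
  obtain g where g: "g \<in> supp a" using supp_nonempty a by blast
  have gc: "g \<in> carrier G" "res {g} a \<noteq> \<zero>\<^bsub>T\<^esub>" using g by (auto simp: supp_def)
  obtain f where f: "f \<in> deg \<one>" "res {g} a \<star> f = res {g} a"
    using homog_right_unit[OF gc(1), of "res {g} a"] a by auto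
  have "res {g \<otimes> \<one>} (a \<star> f) = res {g} a" using res_mult_deg_right[OF a(1) _ f(1) gc(1)] f(2) by simp
  then have "a \<star> f \<noteq> \<zero>\<^bsub>T\<^esub>" using gc(2) by auto
  moreover have "e \<star> a \<star> f \<in> gen U a"
    by (rule gen_base[of \<one> U \<one>]) (use U e f in \<open>auto simp: subgroup.one_closed\<close>)
  ultimately show ?thesis using e(2) by auto
qed

text \<open>Between \<open>a\<close> and \<open>b\<close> the factors have degree
  \<open>v h u'\<close>, which stays in \<open>H\<close>, where annihilation is assumed.\<close>

lemma gen_annihilate:
  assumes H: "subgroup H G" and N: "N \<subseteq> H" and ab: "a \<in> carrier T" "b \<in> carrier T"
    and zero: "\<And>h s. h \<in> H \<Longrightarrow> s \<in> deg h \<Longrightarrow> a \<star> s \<star> b = \<zero>\<^bsub>T\<^esub>"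
    and x: "x \<in> gen N a" and y: "y \<in> gen N b" and h: "h \<in> H" "s \<in> deg h"
  shows "x \<star> s \<star> y = \<zero>\<^bsub>T\<^esub>"
  using x
proof induction
  case (gen_base u v p q)
  note xb = this
  interpret H: subgroup H G by fact
  have sc: "s \<in> carrier T" "p \<in> carrier T" "q \<in> carrier T" using h xb by auto
  show ?case using y
  proof induction
    case (gen_base u' v' p' q')
    have c: "p' \<in> carrier T" "q' \<in> carrier T" using gen_base by auto
    have hc: "v \<in> H" "u' \<in> H" using xb gen_base N by auto
    have "q \<star> s \<star> p' \<in> deg (v \<otimes> h \<otimes> u')"
      using deg_mult[of "v \<otimes> h" u'] deg_mult[of v h q s] xb gen_base h hc by simp
    then have "a \<star> (q \<star> s \<star> p') \<star> b = \<zero>\<^bsub>T\<^esub>" by (rule zero[rotated]) (use hc h in simp)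
    then have "p \<star> (a \<star> (q \<star> s \<star> p') \<star> b) \<star> q' = \<zero>\<^bsub>T\<^esub>" using sc c by simp
    then show ?case using sc c ab by (simp add: T_assoc)
  next
    case (gen_add y z)
    then show ?case using gen_carrier[OF ab(2)] sc ab by (simp add: T_r_distr)
  qed
next
  case (gen_add x z)
  then show ?case using gen_carrier[OF ab(1)] gen_carrier[OF ab(2) y] h by (simp add: T_l_distr)
qed

end

sublocale partial_action \<subseteq> SG: graded_rng G "partial_skew_group_ring G R \<alpha> D" restr
  by (rule S_graded)

context partial_action
begin

section \<open>Translation between data in \<open>R\<close> and homogeneous data\<close>

lemma deg_iff_delta: assumes "g \<in> carrier G" shows "x \<in> SG.deg g \<longleftrightarrow> (\<exists>r\<in>D g. x = delta R r g)"
proof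
  assume x: "x \<in> SG.deg g"
  then have "x \<in> carrier S" "x = delta R (x g) g" using SG.degD[OF x] restr_single[of g x] by auto
  then show "\<exists>r\<in>D g. x = delta R r g" using assms by (auto simp: S_carrier)
next
  assume "\<exists>r\<in>D g. x = delta R r g"
  then obtain r where r: "r \<in> D g" "x = delta R r g" by blast
  show "x \<in> SG.deg g"
    by (rule SG.degI) (use r assms delta_closed in \<open>auto simp: restr_single\<close>)
qed

lemma delta_deg: "g \<in> carrier G \<Longrightarrow> r \<in> D g \<Longrightarrow> delta R r g \<in> SG.deg g"
  using deg_iff_delta by blast

lemma supp_eq: "SG.supp f = {g \<in> carrier G. f g \<noteq> \<zero>\<^bsub>R\<^esub>}"
proof -
  have "restr {g} f = \<zero>\<^bsub>S\<^esub> \<longleftrightarrow> f g = \<zero>\<^bsub>R\<^esub>" for g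
    by (metis delta_self delta_zero restr_single)
  then show ?thesis by (simp add: SG.supp_def)
qed

lemma subring_carrier:
  assumes "N \<subseteq> carrier G"
  shows "f \<in> carrier (partial_skew_subring G R \<alpha> D N) \<longleftrightarrow> f \<in> carrier S \<and> SG.supp f \<subseteq> N"
  using assms by (auto simp: partial_skew_subring_def supp_eq S_carrier)

lemma I_D_prod:
  assumes "rng_ideal I R" "g \<in> carrier G" shows "I \<cdot>\<^bsub>R\<^esub> D g = I \<inter> D g"
  by (rule R.ideal_prod_eq_inter[OF assms(1) D_ideal[OF assms(2)] D_s_unital[OF assms(2)]])

lemma delta_I_mult:
  assumes "i \<in> carrier R" "g \<in> carrier G" "r \<in> D g"
  shows "delta R i \<one> \<otimes>\<^bsub>S\<^esub> delta R r g = delta R (i \<otimes>\<^bsub>R\<^esub> r) g"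
proof -
  have "r \<in> carrier R" using DR assms by blast
  then show ?thesis
    using delta_mult[of \<one> g i r] assms \<alpha>_one R.m_closed[of i r] by (simp add: D_one)
qed

lemma delta_mult_I:
  assumes "i \<in> carrier R" "g \<in> carrier G" "r \<in> D g"
  shows "delta R r g \<otimes>\<^bsub>S\<^esub> delta R i \<one> = delta R (\<alpha> g (\<alpha> (inv g) r \<otimes>\<^bsub>R\<^esub> i)) g"
  using delta_mult[of g \<one> r i] assms by (simp add: D_one)

text \<open>For degrees in \<open>H\<close> annihilation is condition (iii). For degrees outside
  \<open>H\<close> it comes from (ii): \<open>A\<close> and \<open>B\<close> lie in
  \<open>I S_N\<close>, and a factor with degree in \<open>N\<close> keeps a degree outside
  \<open>H\<close> outside.\<close>

lemma not_prime_of_datum: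
  assumes H: "subgroup H G" and N: "N \<subseteq> H"
    and I: "rng_ideal I R"
    and off: "\<And>g. g \<in> carrier G - H \<Longrightarrow>
      (I \<cdot>\<^bsub>R\<^esub> D g) \<cdot>\<^bsub>R\<^esub> (\<alpha> g ` (I \<cdot>\<^bsub>R\<^esub> D (inv g))) = {\<zero>\<^bsub>R\<^esub>}"
    and A: "A \<subseteq> delta_set R I \<one> \<cdot>\<^bsub>S\<^esub> carrier (partial_skew_subring G R \<alpha> D N)" "A \<noteq> {\<zero>\<^bsub>S\<^esub>}" "A \<noteq> {}"
    and B: "B \<subseteq> delta_set R I \<one> \<cdot>\<^bsub>S\<^esub> carrier (partial_skew_subring G R \<alpha> D N)" "B \<noteq> {\<zero>\<^bsub>S\<^esub>}" "B \<noteq> {}"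
    and on: "\<And>h. h \<in> H \<Longrightarrow> (A \<cdot>\<^bsub>S\<^esub> delta_set R (D h) h) \<cdot>\<^bsub>S\<^esub> B = {\<zero>\<^bsub>S\<^esub>}"
  shows "\<not> prime_rng S"
proof -
  interpret H: subgroup H G by fact
  have IR: "I \<subseteq> carrier R" using I additive_subgroup.a_subset by (auto simp: rng_ideal_def)
  have NG: "N \<subseteq> carrier G" using N by auto
  have dI: "delta R i \<one> \<in> carrier S" if "i \<in> I" for i
    using delta_closed[of \<one> i] that IR by (auto simp: D_one)
  define IS where "IS = delta_set R I \<one> \<cdot>\<^bsub>S\<^esub> carrier (partial_skew_subring G R \<alpha> D N)"
  have ISc: "x \<in> carrier S" if "x \<in> IS" for x
    using that unfolding IS_def
    by induction (use dI in \<open>auto simp: delta_set_def subring_carrier[OF NG]\<close>)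
  \<comment> \<open>The coefficient is \<open>i\<close> times \<open>\<alpha> k z\<close> with
    \<open>z\<close> in \<open>I D (inv k)\<close>; a left unit \<open>e\<close> from
    \<open>D k\<close> is inserted so that \<open>i e\<close> and \<open>\<alpha> k z\<close> belong
    to the two factors of (ii).\<close>
  have core: "delta R i \<one> \<otimes>\<^bsub>S\<^esub> y \<otimes>\<^bsub>S\<^esub> delta R j \<one> = \<zero>\<^bsub>S\<^esub>"
    if i: "i \<in> I" and j: "j \<in> I" and k: "k \<in> carrier G" "k \<notin> H" and y: "y \<in> SG.deg k" for i j k y
  proof -
    obtain r where r: "r \<in> D k" "y = delta R r k" using deg_iff_delta[OF k(1)] y by blast
    have c: "i \<in> carrier R" "j \<in> carrier R" "r \<in> carrier R" using i j IR DR[OF k(1) r(1)] by auto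
    have ik: "inv k \<in> carrier G" using k by simp
    have ar: "\<alpha> (inv k) r \<in> D (inv k)" "\<alpha> (inv k) r \<in> carrier R"
      using \<alpha>_closed'[OF k(1) r(1)] DR[OF ik] by auto
    define z where "z = \<alpha> (inv k) r \<otimes>\<^bsub>R\<^esub> j"
    have z: "z \<in> I \<cdot>\<^bsub>R\<^esub> D (inv k)"
      unfolding I_D_prod[OF I ik] z_def using D_mult(1)[OF ik ar(1) c(2)] I j ar(2) by (simp add: rng_ideal_def)
    have zD: "z \<in> D (inv k)" using z unfolding I_D_prod[OF I ik] by simp
    have w: "\<alpha> k z \<in> D k" using \<alpha>_closed[OF k(1) zD] .
    obtain e where e: "e \<in> D k" "e \<otimes>\<^bsub>R\<^esub> \<alpha> k z = \<alpha> k z" using D_unit_left[OF k(1) w] .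
    have ec: "e \<in> carrier R" "\<alpha> k z \<in> carrier R" using e w DR k by auto
    have "i \<otimes>\<^bsub>R\<^esub> e \<in> I \<cdot>\<^bsub>R\<^esub> D k" using i e(1) by (rule ideal_prod.prod)
    then have "(i \<otimes>\<^bsub>R\<^esub> e) \<otimes>\<^bsub>R\<^esub> \<alpha> k z \<in> (I \<cdot>\<^bsub>R\<^esub> D k) \<cdot>\<^bsub>R\<^esub> (\<alpha> k ` (I \<cdot>\<^bsub>R\<^esub> D (inv k)))"
      by (rule ideal_prod.prod[OF _ imageI[OF z]])
    then have "(i \<otimes>\<^bsub>R\<^esub> e) \<otimes>\<^bsub>R\<^esub> \<alpha> k z = \<zero>\<^bsub>R\<^esub>" using off[of k] k by simp
    then have iz: "i \<otimes>\<^bsub>R\<^esub> \<alpha> k z = \<zero>\<^bsub>R\<^esub>" using c ec e(2) by (simp add: R.m_assoc)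
    have "delta R i \<one> \<otimes>\<^bsub>S\<^esub> y \<otimes>\<^bsub>S\<^esub> delta R j \<one> = delta R i \<one> \<otimes>\<^bsub>S\<^esub> (y \<otimes>\<^bsub>S\<^esub> delta R j \<one>)"
      using SG.T_assoc dI i j y by simp
    also have "y \<otimes>\<^bsub>S\<^esub> delta R j \<one> = delta R (\<alpha> k z) k"
      using delta_mult_I[OF c(2) k(1) r(1)] by (simp add: r(2) z_def)
    also have "delta R i \<one> \<otimes>\<^bsub>S\<^esub> delta R (\<alpha> k z) k = delta R (i \<otimes>\<^bsub>R\<^esub> \<alpha> k z) k"
      by (rule delta_I_mult[OF c(1) k(1) w])
    finally show ?thesis by (simp add: iz delta_zero)
  qed
  have offS: "x \<otimes>\<^bsub>S\<^esub> s \<otimes>\<^bsub>S\<^esub> y = \<zero>\<^bsub>S\<^esub>"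
    if x: "x \<in> IS" and y: "y \<in> IS" and g: "g \<in> carrier G" "g \<notin> H" and s: "s \<in> SG.deg g" for x y g s
    using x unfolding IS_def
  proof induction
    case (prod p f)
    then obtain i where i: "i \<in> I" "p = delta R i \<one>" by (auto simp: delta_set_def)
    have f: "f \<in> carrier S" "SG.supp f \<subseteq> N" using prod subring_carrier[OF NG] by auto
    have sc: "s \<in> carrier S" using s by simp
    show ?case using y unfolding IS_def
    proof induction
      case (prod q f')
      then obtain j where j: "j \<in> I" "q = delta R j \<one>" by (auto simp: delta_set_def)
      have f': "f' \<in> carrier S" using prod subring_carrier[OF NG] by auto
      have "p \<otimes>\<^bsub>S\<^esub> f \<otimes>\<^bsub>S\<^esub> s \<otimes>\<^bsub>S\<^esub> q = \<zero>\<^bsub>S\<^esub>"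
        using f(1)
      proof (induction f rule: SG.decomp_induct)
        case zero
        then show ?case using dI i j sc by simp
      next
        case (add u v)
        then show ?case using dI i j sc by (simp add: SG.T_l_distr SG.T_r_distr)
      next
        case (comp n)
        have n: "n \<in> H" "n \<in> carrier G" using comp f(2) N by auto
        have fn: "restr {n} f \<in> SG.deg n" using f(1) by simp
        have d: "restr {n} f \<otimes>\<^bsub>S\<^esub> s \<in> SG.deg (n \<otimes> g)" by (rule SG.deg_mult[OF n(2) g(1) fn s])
        have nH: "n \<otimes> g \<notin> H"
        proof
          assume "n \<otimes> g \<in> H"
          then have "inv n \<otimes> (n \<otimes> g) \<in> H" using n by simp
          then show False using n g by simp
        qed
        have "p \<otimes>\<^bsub>S\<^esub> (restr {n} f \<otimes>\<^bsub>S\<^esub> s) \<otimes>\<^bsub>S\<^esub> q = \<zero>\<^bsub>S\<^esub>"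
          using core[OF i(1) j(1) _ nH d] n g i(2) j(2) by simp
        then show ?case using SG.T_assoc dI i j sc fn by simp
      qed
      then have "(p \<otimes>\<^bsub>S\<^esub> f \<otimes>\<^bsub>S\<^esub> s \<otimes>\<^bsub>S\<^esub> q) \<otimes>\<^bsub>S\<^esub> f' = \<zero>\<^bsub>S\<^esub>" using f' by simp
      then show ?case using SG.T_assoc dI i j sc f f' by simp
    next
      case (sum u v)
      then have "u \<in> carrier S" "v \<in> carrier S" using ISc by (auto simp: IS_def)
      then show ?case using sum dI i f sc by (simp add: SG.T_r_distr)
    qed
  next
    case (sum u v)
    then have "u \<in> carrier S" "v \<in> carrier S" using ISc by (auto simp: IS_def)
    then show ?case using sum ISc[OF y] s by (simp add: SG.T_l_distr)
  qed
  show ?thesis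
  proof (rule SG.not_prime_rngI[of A B])
    show "A \<subseteq> carrier S" "B \<subseteq> carrier S" using A(1) B(1) ISc by (auto simp: IS_def)
    fix a b g s assume a: "a \<in> A" and b: "b \<in> B" and g: "g \<in> carrier G" and s: "s \<in> SG.deg g"
    show "a \<otimes>\<^bsub>S\<^esub> s \<otimes>\<^bsub>S\<^esub> b = \<zero>\<^bsub>S\<^esub>"
    proof (cases "g \<in> H")
      case True
      have "s \<in> delta_set R (D g) g" using deg_iff_delta[OF g] s by (auto simp: delta_set_def)
      then have "a \<otimes>\<^bsub>S\<^esub> s \<in> A \<cdot>\<^bsub>S\<^esub> delta_set R (D g) g" using a by (intro ideal_prod.prod)
      then have "a \<otimes>\<^bsub>S\<^esub> s \<otimes>\<^bsub>S\<^esub> b \<in> (A \<cdot>\<^bsub>S\<^esub> delta_set R (D g) g) \<cdot>\<^bsub>S\<^esub> B" using b by (rule ideal_prod.prod)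
      then show ?thesis using on[OF True] by simp
    next
      case False
      then show ?thesis using offS[OF _ _ g _ s] a b A(1) B(1) by (auto simp: IS_def)
    qed
  qed (use A B in auto)
qed

text \<open>\<open>I\<close> is the part of \<open>J\<close> of degree \<open>\<one>\<close>.
  Multiplication by \<open>f \<delta>_{h^-1}\<close> with a local unit \<open>f\<close> moves
  coefficients of elements of \<open>J\<close> into \<open>I\<close>; this yields the invariance of
  \<open>I\<close> and the inclusion of both ideals in \<open>I S_N\<close>.\<close>

lemma datum_of_np_datum:
  assumes np: "SG.np_datum H N J a b"
  defines "I \<equiv> {r \<in> carrier R. delta R r \<one> \<in> J}"
    and "A \<equiv> SG.gen N a" and "B \<equiv> SG.gen N b" and "S\<^sub>N \<equiv> partial_skew_subring G R \<alpha> D N"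
  shows "subgroup H G" "normal N (G\<lparr>carrier := H\<rparr>)" "finite N" "rng_ideal I R"
    "\<And>h. h \<in> H \<Longrightarrow> \<alpha> h ` (I \<cdot>\<^bsub>R\<^esub> D (inv h)) = I \<cdot>\<^bsub>R\<^esub> D h"
    "\<And>g. g \<in> carrier G - H \<Longrightarrow> (I \<cdot>\<^bsub>R\<^esub> D g) \<cdot>\<^bsub>R\<^esub> (\<alpha> g ` (I \<cdot>\<^bsub>R\<^esub> D (inv g))) = {\<zero>\<^bsub>R\<^esub>}"
    "rng_ideal A S\<^sub>N" "A \<noteq> {\<zero>\<^bsub>S\<^esub>}" "rng_ideal B S\<^sub>N" "B \<noteq> {\<zero>\<^bsub>S\<^esub>}"
    "A \<subseteq> delta_set R I \<one> \<cdot>\<^bsub>S\<^esub> carrier S\<^sub>N" "B \<subseteq> delta_set R I \<one> \<cdot>\<^bsub>S\<^esub> carrier S\<^sub>N"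
    "\<And>h. h \<in> H \<Longrightarrow> (A \<cdot>\<^bsub>S\<^esub> delta_set R (D h) h) \<cdot>\<^bsub>S\<^esub> B = {\<zero>\<^bsub>S\<^esub>}"
proof -
  have H: "subgroup H G" and J: "SG.homog_ideal H J" and N: "subgroup N G" "N \<subseteq> H" "finite N"
    and Nconj: "\<And>h n. h \<in> H \<Longrightarrow> n \<in> N \<Longrightarrow> h \<otimes> n \<otimes> inv h \<in> N"
    and ab: "a \<in> J" "b \<in> J" "a \<noteq> \<zero>\<^bsub>S\<^esub>" "b \<noteq> \<zero>\<^bsub>S\<^esub>" "SG.supp a \<subseteq> N" "SG.supp b \<subseteq> N"
    and ann: "\<And>h s. h \<in> H \<Longrightarrow> s \<in> SG.deg h \<Longrightarrow> a \<otimes>\<^bsub>S\<^esub> s \<otimes>\<^bsub>S\<^esub> b = \<zero>\<^bsub>S\<^esub>"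
    using np unfolding SG.np_datum_def by blast+
  interpret H: subgroup H G by (rule H)
  interpret N: subgroup N G by (rule N(1))
  note JD = SG.homog_idealD[OF J]
  have NG: "N \<subseteq> carrier G" by (rule N.subset)
  have abc: "a \<in> carrier S" "b \<in> carrier S" using ab JD(1) by auto
  show "subgroup H G" "finite N" by (rule H, rule N(3))
  show "normal N (G\<lparr>carrier := H\<rparr>)"
  proof -
    interpret HG: group "G\<lparr>carrier := H\<rparr>" by (rule subgroup_imp_group[OF H])
    show ?thesis
      unfolding HG.normal_inv_iff
      using subgroup_incl[OF N(1) H N(2)] Nconj m_inv_consistent[OF H] by simp
  qed
  have JH: "x \<otimes>\<^bsub>S\<^esub> s \<in> J" "s \<otimes>\<^bsub>S\<^esub> x \<in> J" if "x \<in> J" "h \<in> H" "s \<in> SG.deg h" for x s h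
    using that JD(6,7) by blast+
  have Ic: "r \<in> carrier R" "delta R r \<one> \<in> J" "delta R r \<one> \<in> SG.deg \<one>" "delta R r \<one> \<in> carrier S" if "r \<in> I" for r
  proof -
    show "r \<in> carrier R" "delta R r \<one> \<in> J" using that by (auto simp: I_def)
    then show "delta R r \<one> \<in> SG.deg \<one>" using delta_deg[of \<one> r] by (simp add: D_one)
    then show "delta R r \<one> \<in> carrier S" by simp
  qed
  \<comment> \<open>Negatives are not among the clauses of \<open>homog_ideal\<close>; they are
    reached by multiplying with the negative of a local unit.\<close>
  have J_neg: "\<ominus>\<^bsub>S\<^esub> x \<in> J" if x: "x \<in> J" for x
  proof -
    have xc: "x \<in> carrier S" using JD(1) x by blast
    obtain e where e: "e \<in> SG.deg \<one>" "e \<otimes>\<^bsub>S\<^esub> x = x" using SG.common_left_unit[OF xc] by blast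
    have "(\<ominus>\<^bsub>S\<^esub> e) \<otimes>\<^bsub>S\<^esub> x \<in> J" using JH(2)[OF x H.one_closed] SG.neg_deg[OF e(1)] by blast
    then show ?thesis using SG.T_neg_mult(1)[of e x] e xc by simp
  qed
  have delta_add: "delta R (r \<oplus>\<^bsub>R\<^esub> s) g = delta R r g \<oplus>\<^bsub>S\<^esub> delta R s g" for r s and g :: 'a
    by (auto simp: delta_def S_add)
  have delta_neg: "delta R (\<ominus>\<^bsub>R\<^esub> r) \<one> = \<ominus>\<^bsub>S\<^esub> delta R r \<one>" if r: "r \<in> carrier R" for r
  proof -
    have c: "delta R r \<one> \<in> carrier S" "delta R (\<ominus>\<^bsub>R\<^esub> r) \<one> \<in> carrier S"
      using delta_closed[of \<one>] r by (auto simp: D_one)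
    have "delta R (\<ominus>\<^bsub>R\<^esub> r) \<one> \<oplus>\<^bsub>S\<^esub> delta R r \<one> = \<zero>\<^bsub>S\<^esub>"
      unfolding delta_add[symmetric] R.l_neg[OF r] by (rule delta_zero)
    then show ?thesis using c SG.T.minus_equality by metis
  qed
  show I: "rng_ideal I R"
    unfolding rng_ideal_def
  proof (intro conjI ballI)
    show "additive_subgroup I R"
      unfolding additive_subgroup_def
    proof (rule group.subgroupI[OF R.a_group])
      show "I \<subseteq> carrier (add_monoid R)" by (auto simp: I_def)
      have "\<zero>\<^bsub>R\<^esub> \<in> I" using JD(3) by (simp add: I_def delta_zero)
      then show "I \<noteq> {}" by blast
      fix x assume x: "x \<in> I"
      have "\<ominus>\<^bsub>R\<^esub> x \<in> I" using J_neg[OF Ic(2)[OF x]] Ic(1)[OF x] delta_neg[of x] by (simp add: I_def)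
      then show "inv\<^bsub>add_monoid R\<^esub> x \<in> I" by (simp only: a_inv_def)
      fix y assume "y \<in> I"
      then show "x \<otimes>\<^bsub>add_monoid R\<^esub> y \<in> I" using x JD(4) by (simp add: I_def delta_add)
    qed
    fix i x assume i: "i \<in> I" and x: "x \<in> carrier R"
    have xd: "delta R x \<one> \<in> SG.deg \<one>" using delta_deg[of \<one> x] x by (simp add: D_one)
    have "delta R (x \<otimes>\<^bsub>R\<^esub> i) \<one> \<in> J" "delta R (i \<otimes>\<^bsub>R\<^esub> x) \<one> \<in> J"
      using JH[OF Ic(2)[OF i] H.one_closed xd] delta_I_mult[of x \<one> i] delta_I_mult[of i \<one> x] x Ic(1)[OF i]
      by (simp_all add: D_one)
    then show "x \<otimes>\<^bsub>R\<^esub> i \<in> I" "i \<otimes>\<^bsub>R\<^esub> x \<in> I" using x Ic(1)[OF i] R.m_closed by (simp_all add: I_def)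
  qed
  note ID = I_D_prod[OF I]
  \<comment> \<open>With local units \<open>e\<close>, \<open>f\<close> of \<open>r\<close>, the
    coefficient \<open>\<alpha> h r\<close> is reached from \<open>r \<delta>_e\<close> by
    multiplying with \<open>\<alpha>_h(e) \<delta>_h\<close> on the left and
    \<open>f \<delta>_{h^-1}\<close> on the right, both steps staying in \<open>J\<close>.\<close>
  have \<alpha>I: "\<alpha> h r \<in> I \<inter> D h" if h: "h \<in> H" and r: "r \<in> I" "r \<in> D (inv h)" for h r
  proof -
    have hc: "h \<in> carrier G" "inv h \<in> carrier G" using h by auto
    have ar: "\<alpha> h r \<in> D h" using \<alpha>_closed[OF hc(1) r(2)] .
    obtain e where e: "e \<in> D (inv h)" "e \<otimes>\<^bsub>R\<^esub> r = r" using D_unit_left[OF hc(2) r(2)] .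
    obtain f where f: "f \<in> D (inv h)" "r \<otimes>\<^bsub>R\<^esub> f = r" using D_unit_right[OF hc(2) r(2)] .
    have ae: "\<alpha> h e \<in> D h" using \<alpha>_closed[OF hc(1) e(1)] .
    have 1: "delta R (\<alpha> h e) h \<otimes>\<^bsub>S\<^esub> delta R r \<one> = delta R (\<alpha> h r) h"
      using delta_mult_I[OF Ic(1)[OF r(1)] hc(1) ae] \<alpha>_inv[OF hc(1) e(1)] e(2) by simp
    have 2: "delta R (\<alpha> h r) h \<otimes>\<^bsub>S\<^esub> delta R f (inv h) = delta R (\<alpha> h r) \<one>"
      using delta_mult[OF hc ar f(1)] \<alpha>_inv[OF hc(1) r(2)] f(2) hc by simp
    have "delta R (\<alpha> h r) h \<in> J"
      using JH(2)[OF Ic(2)[OF r(1)] h delta_deg[OF hc(1) ae]] by (simp add: 1)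
    then have "delta R (\<alpha> h r) \<one> \<in> J"
      using JH(1)[of "delta R (\<alpha> h r) h" "inv h"] delta_deg[OF hc(2) f(1)] h by (simp flip: 2)
    then show ?thesis using ar DR[OF hc(1)] by (simp add: I_def)
  qed
  show "\<alpha> h ` (I \<cdot>\<^bsub>R\<^esub> D (inv h)) = I \<cdot>\<^bsub>R\<^esub> D h" if h: "h \<in> H" for h
  proof -
    have hc: "h \<in> carrier G" "inv h \<in> carrier G" "inv h \<in> H" using h by auto
    have "x \<in> \<alpha> h ` (I \<inter> D (inv h))" if x: "x \<in> I" "x \<in> D h" for x
      using \<alpha>I[OF hc(3), of x] x hc \<alpha>_inv'[OF hc(1) x(2)]
      by (intro image_eqI[of _ _ "\<alpha> (inv h) x"]) auto
    then show ?thesis unfolding ID[OF hc(1)] ID[OF hc(2)] using \<alpha>I[OF h] by auto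
  qed
  show "(I \<cdot>\<^bsub>R\<^esub> D g) \<cdot>\<^bsub>R\<^esub> (\<alpha> g ` (I \<cdot>\<^bsub>R\<^esub> D (inv g))) = {\<zero>\<^bsub>R\<^esub>}" if g: "g \<in> carrier G - H" for g
  proof -
    have gc: "g \<in> carrier G" "inv g \<in> carrier G" using g by auto
    \<comment> \<open>\<open>x\<close> times \<open>\<alpha> g z\<close> is the coefficient of a
      product of \<open>x \<delta>_e\<close>, an element of degree \<open>g\<close> and
      \<open>z \<delta>_e\<close>, to which the last clause of \<open>homog_ideal\<close>
      applies.\<close>
    have zero: "x \<otimes>\<^bsub>R\<^esub> \<alpha> g z = \<zero>\<^bsub>R\<^esub>" if x: "x \<in> I" and z: "z \<in> I" "z \<in> D (inv g)" for x z
    proof -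
      obtain f where f: "f \<in> D (inv g)" "f \<otimes>\<^bsub>R\<^esub> z = z" using D_unit_left[OF gc(2) z(2)] .
      have af: "\<alpha> g f \<in> D g" and az: "\<alpha> g z \<in> D g" using \<alpha>_closed[OF gc(1)] f z by auto
      have 1: "delta R (\<alpha> g f) g \<otimes>\<^bsub>S\<^esub> delta R z \<one> = delta R (\<alpha> g z) g"
        using delta_mult_I[OF Ic(1)[OF z(1)] gc(1) af] \<alpha>_inv[OF gc(1) f(1)] f(2) by simp
      have d: "delta R (\<alpha> g f) g \<in> SG.deg g" using delta_deg[OF gc(1) af] .
      have "delta R (x \<otimes>\<^bsub>R\<^esub> \<alpha> g z) g = delta R x \<one> \<otimes>\<^bsub>S\<^esub> delta R (\<alpha> g f) g \<otimes>\<^bsub>S\<^esub> delta R z \<one>"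
        using SG.T_assoc[of "delta R x \<one>" "delta R (\<alpha> g f) g" "delta R z \<one>"] Ic x z(1) d
          delta_I_mult[OF Ic(1)[OF x] gc(1) az] by (simp add: 1)
      also have "\<dots> = \<zero>\<^bsub>S\<^esub>" using JD(8)[OF Ic(2)[OF x] Ic(2)[OF z(1)] gc(1) d] g by blast
      finally show ?thesis by (metis delta_inj delta_zero)
    qed
    have z0: "\<zero>\<^bsub>R\<^esub> \<in> I" using JD(3) by (simp add: I_def delta_zero)
    show ?thesis
    proof
      show "(I \<cdot>\<^bsub>R\<^esub> D g) \<cdot>\<^bsub>R\<^esub> (\<alpha> g ` (I \<cdot>\<^bsub>R\<^esub> D (inv g))) \<subseteq> {\<zero>\<^bsub>R\<^esub>}"
      proof
        fix x assume "x \<in> (I \<cdot>\<^bsub>R\<^esub> D g) \<cdot>\<^bsub>R\<^esub> (\<alpha> g ` (I \<cdot>\<^bsub>R\<^esub> D (inv g)))"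
        then show "x \<in> {\<zero>\<^bsub>R\<^esub>}"
          unfolding ID[OF gc(1)] ID[OF gc(2)] by induction (auto simp: zero)
      qed
      have "\<zero>\<^bsub>R\<^esub> \<otimes>\<^bsub>R\<^esub> \<alpha> g \<zero>\<^bsub>R\<^esub> \<in> (I \<inter> D g) \<cdot>\<^bsub>R\<^esub> (\<alpha> g ` (I \<inter> D (inv g)))"
        using z0 D_zero gc by (intro ideal_prod.prod) auto
      then show "{\<zero>\<^bsub>R\<^esub>} \<subseteq> (I \<cdot>\<^bsub>R\<^esub> D g) \<cdot>\<^bsub>R\<^esub> (\<alpha> g ` (I \<cdot>\<^bsub>R\<^esub> D (inv g)))"
        unfolding ID[OF gc(1)] ID[OF gc(2)] using zero[OF z0 z0 D_zero[OF gc(2)]] by simp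
    qed
  qed
  have SN: "f \<in> carrier S\<^sub>N \<longleftrightarrow> f \<in> carrier S \<and> SG.supp f \<subseteq> N" for f
    unfolding S\<^sub>N_def by (rule subring_carrier[OF NG])
  have SN_ops: "x \<otimes>\<^bsub>S\<^sub>N\<^esub> y = x \<otimes>\<^bsub>S\<^esub> y" "add_monoid S\<^sub>N = (add_monoid S)\<lparr>carrier := carrier S\<^sub>N\<rparr>" for x y
    by (simp_all add: S\<^sub>N_def partial_skew_subring_def)
  have SN_sub: "subgroup (carrier S\<^sub>N) (add_monoid S)"
    unfolding additive_subgroup_def[symmetric]
  proof (rule SG.additive_subgroupI)
    show "x \<oplus>\<^bsub>S\<^esub> y \<in> carrier S\<^sub>N" if "x \<in> carrier S\<^sub>N" "y \<in> carrier S\<^sub>N" for x y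
      using that SG.supp_add[of x y] by (auto simp: SN)
    show "\<ominus>\<^bsub>S\<^esub> x \<in> carrier S\<^sub>N" if "x \<in> carrier S\<^sub>N" for x
      using that by (auto simp: SN SG.supp_def SG.res_neg)
  qed (auto simp: SN)
  have gen_ideal: "rng_ideal (SG.gen N c) S\<^sub>N" if c: "c \<in> carrier S" "SG.supp c \<subseteq> N" for c
    unfolding rng_ideal_def
  proof (intro conjI ballI)
    have "subgroup (SG.gen N c) (add_monoid S)"
      using SG.gen_additive[OF N(1) c(1)] by (simp add: additive_subgroup_def)
    moreover have "SG.gen N c \<subseteq> carrier S\<^sub>N"
      using SG.gen_supp[OF N(1) c] SG.gen_carrier[OF c(1)] by (auto simp: SN)
    ultimately show "additive_subgroup (SG.gen N c) S\<^sub>N"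
      unfolding additive_subgroup_def SN_ops(2) by (intro group.subgroup_incl SG.T.a_group SN_sub)
    fix x r assume "x \<in> SG.gen N c" "r \<in> carrier S\<^sub>N"
    then show "r \<otimes>\<^bsub>S\<^sub>N\<^esub> x \<in> SG.gen N c" "x \<otimes>\<^bsub>S\<^sub>N\<^esub> r \<in> SG.gen N c"
      using SG.gen_mult_supp[OF N(1) c(1)] by (auto simp: SN SN_ops)
  qed
  show "rng_ideal A S\<^sub>N" "rng_ideal B S\<^sub>N" using gen_ideal abc ab by (auto simp: A_def B_def)
  show "A \<noteq> {\<zero>\<^bsub>S\<^esub>}" "B \<noteq> {\<zero>\<^bsub>S\<^esub>}"
    using SG.gen_nonzero[OF N(1)] abc ab by (auto simp: A_def B_def)
  have gen_IS: "SG.gen N c \<subseteq> delta_set R I \<one> \<cdot>\<^bsub>S\<^esub> carrier S\<^sub>N" if c: "c \<in> J" "SG.supp c \<subseteq> N" for c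
  proof
    fix x assume x: "x \<in> SG.gen N c"
    have cc: "c \<in> carrier S" using c JD(1) by blast
    have xJ: "x \<in> J" using x
    proof induction
      case (gen_base u v s t)
      then show ?case using JH c(1) N(2) by blast
    next
      case (gen_add x y)
      then show ?case using JD(4) by blast
    qed
    have xc: "x \<in> carrier S" "SG.supp x \<subseteq> N" using xJ JD(1) SG.gen_supp[OF N(1) cc c(2) x] by auto
    have z0: "\<zero>\<^bsub>R\<^esub> \<in> I" using JD(3) by (simp add: I_def delta_zero)
    from xc(1) show "x \<in> delta_set R I \<one> \<cdot>\<^bsub>S\<^esub> carrier S\<^sub>N"
    proof (induction x rule: SG.decomp_induct)
      case zero
      have "delta R \<zero>\<^bsub>R\<^esub> \<one> \<otimes>\<^bsub>S\<^esub> \<zero>\<^bsub>S\<^esub> \<in> delta_set R I \<one> \<cdot>\<^bsub>S\<^esub> carrier S\<^sub>N"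
        using z0 by (intro ideal_prod.prod) (auto simp: delta_set_def SN)
      then show ?case by (simp add: delta_zero)
    next
      case (add u v)
      then show ?case by (intro ideal_prod.sum)
    next
      \<comment> \<open>The component \<open>r \<delta>_n\<close> is factored as
        \<open>r \<delta>_e\<close> times \<open>e \<delta>_n\<close> with a right unit
        \<open>e\<close> of \<open>r\<close>; that \<open>r\<close> lies in \<open>I\<close> is seen
        by multiplying back to degree \<open>\<one>\<close> inside \<open>J\<close>.\<close>
      case (comp n)
      have nN: "n \<in> N" using comp xc by blast
      have n: "n \<in> carrier G" "n \<in> H" "inv n \<in> H" "inv n \<in> carrier G" using nN N(2) NG by auto
      have nJ: "restr {n} x \<in> J" by (rule JD(5)[OF xJ])
      define r where "r = x n"
      have r: "restr {n} x = delta R r n" "r \<in> D n"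
        using xc(1) n(1) by (auto simp: restr_single r_def S_carrier)
      have ar: "\<alpha> (inv n) r \<in> D (inv n)" using \<alpha>_closed'[OF n(1) r(2)] .
      obtain f where f: "f \<in> D (inv n)" "\<alpha> (inv n) r \<otimes>\<^bsub>R\<^esub> f = \<alpha> (inv n) r" using D_unit_right[OF n(4) ar] .
      have "delta R r n \<otimes>\<^bsub>S\<^esub> delta R f (inv n) = delta R r \<one>"
        using delta_mult[OF n(1,4) r(2) f(1)] f(2) \<alpha>_inv'[OF n(1) r(2)] n(1) by simp
      then have "delta R r \<one> \<in> J" using JH(1)[OF nJ n(3) delta_deg[OF n(4) f(1)]] by (simp add: r(1))
      then have rI: "r \<in> I" using DR[OF n(1) r(2)] by (simp add: I_def)
      obtain e where e: "e \<in> D n" "r \<otimes>\<^bsub>R\<^esub> e = r" using D_unit_right[OF n(1) r(2)] .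
      have "delta R r \<one> \<otimes>\<^bsub>S\<^esub> delta R e n \<in> delta_set R I \<one> \<cdot>\<^bsub>S\<^esub> carrier S\<^sub>N"
      proof (rule ideal_prod.prod)
        show "delta R r \<one> \<in> delta_set R I \<one>" using rI by (simp add: delta_set_def)
        show "delta R e n \<in> carrier S\<^sub>N"
          using delta_closed[OF n(1) e(1)] nN by (auto simp: SN supp_eq delta_def)
      qed
      then show ?case using delta_I_mult[OF Ic(1)[OF rI] n(1) e(1)] e(2) by (simp add: r(1))
    qed
  qed
  show "A \<subseteq> delta_set R I \<one> \<cdot>\<^bsub>S\<^esub> carrier S\<^sub>N" "B \<subseteq> delta_set R I \<one> \<cdot>\<^bsub>S\<^esub> carrier S\<^sub>N"
    using gen_IS ab by (auto simp: A_def B_def)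
  show "(A \<cdot>\<^bsub>S\<^esub> delta_set R (D h) h) \<cdot>\<^bsub>S\<^esub> B = {\<zero>\<^bsub>S\<^esub>}" if h: "h \<in> H" for h
  proof -
    have hc: "h \<in> carrier G" using h by simp
    have Ac: "x \<in> carrier S" if "x \<in> A" for x using that SG.gen_carrier[OF abc(1)] by (simp add: A_def)
    have Bc: "x \<in> carrier S" if "x \<in> B" for x using that SG.gen_carrier[OF abc(2)] by (simp add: B_def)
    have ds: "s \<in> SG.deg h" if "s \<in> delta_set R (D h) h" for s
      using that delta_deg[OF hc] by (auto simp: delta_set_def)
    have AD: "x \<in> carrier S \<and> (\<forall>y\<in>B. x \<otimes>\<^bsub>S\<^esub> y = \<zero>\<^bsub>S\<^esub>)" if "x \<in> A \<cdot>\<^bsub>S\<^esub> delta_set R (D h) h" for x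
      using that
    proof induction
      case (prod x s)
      have "x \<otimes>\<^bsub>S\<^esub> s \<otimes>\<^bsub>S\<^esub> y = \<zero>\<^bsub>S\<^esub>" if "y \<in> B" for y
        by (rule SG.gen_annihilate[OF H N(2) abc ann _ _ h ds[OF prod(2)]])
          (use prod(1) that in \<open>simp_all add: A_def B_def\<close>)
      then show ?case using Ac[OF prod(1)] ds[OF prod(2)] by simp
    next
      case (sum u v)
      then show ?case using Bc by (simp add: SG.T_l_distr)
    qed
    have z: "\<zero>\<^bsub>S\<^esub> \<in> A" "\<zero>\<^bsub>S\<^esub> \<in> B"
      using SG.gen_additive[OF N(1)] abc additive_subgroup.zero_closed by (auto simp: A_def B_def)
    have "\<zero>\<^bsub>S\<^esub> \<in> delta_set R (D h) h"
      unfolding delta_set_def delta_zero[of h, symmetric] by (rule imageI) (rule D_zero[OF hc])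
    from ideal_prod.prod[OF z(1) this]
    have "\<zero>\<^bsub>S\<^esub> \<otimes>\<^bsub>S\<^esub> \<zero>\<^bsub>S\<^esub> \<in> A \<cdot>\<^bsub>S\<^esub> delta_set R (D h) h" .
    from ideal_prod.prod[OF this z(2)]
    have "\<zero>\<^bsub>S\<^esub> \<otimes>\<^bsub>S\<^esub> \<zero>\<^bsub>S\<^esub> \<otimes>\<^bsub>S\<^esub> \<zero>\<^bsub>S\<^esub> \<in> (A \<cdot>\<^bsub>S\<^esub> delta_set R (D h) h) \<cdot>\<^bsub>S\<^esub> B" .
    then have "\<zero>\<^bsub>S\<^esub> \<in> (A \<cdot>\<^bsub>S\<^esub> delta_set R (D h) h) \<cdot>\<^bsub>S\<^esub> B" by simp
    moreover have "(A \<cdot>\<^bsub>S\<^esub> delta_set R (D h) h) \<cdot>\<^bsub>S\<^esub> B \<subseteq> {\<zero>\<^bsub>S\<^esub>}"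
    proof
      fix x assume "x \<in> (A \<cdot>\<^bsub>S\<^esub> delta_set R (D h) h) \<cdot>\<^bsub>S\<^esub> B"
      then show "x \<in> {\<zero>\<^bsub>S\<^esub>}" by induction (use AD in auto)
    qed
    ultimately show ?thesis by blast
  qed
qed

lemma not_prime_iff:
  assumes "carrier R \<noteq> {\<zero>\<^bsub>R\<^esub>}"
  shows "\<not> prime_rng S \<longleftrightarrow>
    (\<exists>H N I A B.
       subgroup H G \<and> normal N (G\<lparr>carrier := H\<rparr>) \<and> finite N \<and>
       rng_ideal I R \<and>
       (\<forall>h\<in>H. \<alpha> h ` (I \<cdot>\<^bsub>R\<^esub> D (inv h)) = I \<cdot>\<^bsub>R\<^esub> D h) \<and>
       (\<forall>g\<in>carrier G - H.
          (I \<cdot>\<^bsub>R\<^esub> D g) \<cdot>\<^bsub>R\<^esub> (\<alpha> g ` (I \<cdot>\<^bsub>R\<^esub> D (inv g))) = {\<zero>\<^bsub>R\<^esub>}) \<and>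
       rng_ideal A (partial_skew_subring G R \<alpha> D N) \<and> A \<noteq> {\<zero>\<^bsub>partial_skew_subring G R \<alpha> D N\<^esub>} \<and>
       rng_ideal B (partial_skew_subring G R \<alpha> D N) \<and> B \<noteq> {\<zero>\<^bsub>partial_skew_subring G R \<alpha> D N\<^esub>} \<and>
       A \<subseteq> delta_set R I \<one> \<cdot>\<^bsub>S\<^esub> carrier (partial_skew_subring G R \<alpha> D N) \<and>
       B \<subseteq> delta_set R I \<one> \<cdot>\<^bsub>S\<^esub> carrier (partial_skew_subring G R \<alpha> D N) \<and>
       (\<forall>h\<in>H. (A \<cdot>\<^bsub>S\<^esub> delta_set R (D h) h) \<cdot>\<^bsub>S\<^esub> B = {\<zero>\<^bsub>S\<^esub>}))"
    (is "_ \<longleftrightarrow> (\<exists>H N I A B. ?P H N I A B)")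
proof
  have zN: "\<zero>\<^bsub>partial_skew_subring G R \<alpha> D N\<^esub> = \<zero>\<^bsub>S\<^esub>" for N by (simp add: partial_skew_subring_def)
  {
    assume np: "\<not> prime_rng S"
    \<comment> \<open>A zero ring is not prime either; nonprimeness yields a pair of nonzero ideals
      only once \<open>S\<close> is known to be nonzero.\<close>
    have "{\<zero>\<^bsub>S\<^esub>} \<noteq> carrier S"
    proof
      assume eq: "{\<zero>\<^bsub>S\<^esub>} = carrier S"
      have "r = \<zero>\<^bsub>R\<^esub>" if "r \<in> carrier R" for r
      proof -
        have "delta R r \<one> \<in> carrier S" using delta_closed[of \<one> r] that by (simp add: D_one)
        then have "delta R r \<one> = delta R \<zero>\<^bsub>R\<^esub> \<one>" by (simp flip: eq add: delta_zero)
        then show ?thesis by (simp only: delta_inj)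
      qed
      then have "carrier R = {\<zero>\<^bsub>R\<^esub>}" by auto
      then show False using assms by simp
    qed
    then obtain A B where AB: "rng_ideal A S" "rng_ideal B S" "A \<cdot>\<^bsub>S\<^esub> B = {\<zero>\<^bsub>S\<^esub>}" "A \<noteq> {\<zero>\<^bsub>S\<^esub>}" "B \<noteq> {\<zero>\<^bsub>S\<^esub>}"
      using np unfolding prime_rng_def by blast
    have "a \<otimes>\<^bsub>S\<^esub> b = \<zero>\<^bsub>S\<^esub>" if "a \<in> A" "b \<in> B" for a b
      using ideal_prod.prod[OF that, of S] AB(3) by simp
    from SG.exists_np_datum[OF AB(1,4) AB(2,5) this]
    obtain H N J a b where datum: "SG.np_datum H N J a b" by blast
    note d = datum_of_np_datum[OF datum]
    have "?P H N {r \<in> carrier R. delta R r \<one> \<in> J} (SG.gen N a) (SG.gen N b)"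
      unfolding zN by (intro conjI ballI d)
    then show "\<exists>H N I A B. ?P H N I A B" by (intro exI)
  }
  {
    assume "\<exists>H N I A B. ?P H N I A B"
    then obtain H N I A B where P: "?P H N I A B" by (elim exE) (rule that)
    have H: "subgroup H G" using P by blast
    have "N \<subseteq> H"
      using P normal_imp_subgroup[of N "G\<lparr>carrier := H\<rparr>"] subgroup.subset[of N "G\<lparr>carrier := H\<rparr>"] by simp
    moreover have "A \<noteq> {}" "B \<noteq> {}"
      using P additive_subgroup.zero_closed by (auto simp: rng_ideal_def)
    ultimately show "\<not> prime_rng S"
      using P by (intro not_prime_of_datum[OF H, of N I A B]) (simp_all add: zN)
  }
qed

end

theorem theorem13p7:
  fixes G :: "('g, 'k) monoid_scheme" and R :: "('r, 'm) ring_scheme"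
    and \<alpha> :: "'g \<Rightarrow> 'r \<Rightarrow> 'r" and D :: "'g \<Rightarrow> 'r set"
  assumes "partial_action G R \<alpha> D" and "carrier R \<noteq> {\<zero>\<^bsub>R\<^esub>}"
  defines "S \<equiv> partial_skew_group_ring G R \<alpha> D"
    and "S\<^sub>N \<equiv> partial_skew_subring G R \<alpha> D"
  shows "\<not> prime_rng S \<longleftrightarrow>
    (\<exists>H N I A B.
       subgroup H G \<and> normal N (G\<lparr>carrier := H\<rparr>) \<and> finite N \<and>
       rng_ideal I R \<and>
       (\<forall>h\<in>H. \<alpha> h ` (I \<cdot>\<^bsub>R\<^esub> D (inv\<^bsub>G\<^esub> h)) = I \<cdot>\<^bsub>R\<^esub> D h) \<and>
       (\<forall>g\<in>carrier G - H.
          (I \<cdot>\<^bsub>R\<^esub> D g) \<cdot>\<^bsub>R\<^esub> (\<alpha> g ` (I \<cdot>\<^bsub>R\<^esub> D (inv\<^bsub>G\<^esub> g))) = {\<zero>\<^bsub>R\<^esub>}) \<and>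
       rng_ideal A (S\<^sub>N N) \<and> A \<noteq> {\<zero>\<^bsub>S\<^sub>N N\<^esub>} \<and>
       rng_ideal B (S\<^sub>N N) \<and> B \<noteq> {\<zero>\<^bsub>S\<^sub>N N\<^esub>} \<and>
       A \<subseteq> delta_set R I \<one>\<^bsub>G\<^esub> \<cdot>\<^bsub>S\<^esub> carrier (S\<^sub>N N) \<and>
       B \<subseteq> delta_set R I \<one>\<^bsub>G\<^esub> \<cdot>\<^bsub>S\<^esub> carrier (S\<^sub>N N) \<and>
       (\<forall>h\<in>H. (A \<cdot>\<^bsub>S\<^esub> delta_set R (D h) h) \<cdot>\<^bsub>S\<^esub> B = {\<zero>\<^bsub>S\<^esub>}))"
  unfolding S_def S\<^sub>N_def by (rule partial_action.not_prime_iff[OF assms(1,2)])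

end
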